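(* Let $\ell>0$, $0<\sigma<\tfrac12$, $0<\alpha<1<\beta$, and assume that the unique positive solution $s$ of $\tanh(\sqrt2\, s\ell)=\left(\frac{\sigma}{2-\sigma}\right)^2\sqrt2\, s\ell$ is not an integer. Let $$j_0:=\max\{j\in\mathbb{N}_+ : \nu_1(1)-\mu_j(1)>0\},$$ where $\nu_1(1)$ and $\mu_j(1)$ are the first torsional and the $j$-th longitudinal eigenvalue for the constant weight $p\equiv 1$. Then the problem $$\mathcal{R}=\sup_{p\in P_{\alpha,\beta}}\frac{\nu_1(p)}{\mu_{j_0}(p)}$$ admits a solution, i.e. there exists $\widehat p\in P_{\alpha,\beta}$ such that $\nu_1(\widehat p)/\mu_{j_0}(\widehat p)=\mathcal{R}$.
   Context: $\Omega=(0,\pi)\times(-\ell,\ell)\subset\mathbb{R}^2$. Weights: $P_{\alpha,\beta}:=\{p\in L^\infty(\Omega): \alpha\le p\le\beta \text{ a.e.},\ p(x,y)=p(x,-y)\text{ a.e. in }\Omega,\ \int_\Omega p\,dx\,dy=|\Omega|\}$. Energy space: $H^2_*=\{u\in H^2(\Omega): u=0 \text{ on } \{0,\pi\}\times(-\ell,\ell)\}$, a Hilbert space with scalar product $(u,v)_{H^2_*}=\int_\Omega[\Delta u\Delta v+(1-\sigma)(2u_{xy}v_{xy}-u_{xx}v_{yy}-u_{yy}v_{xx})]\,dx\,dy$ and norm $\|u\|_{H^2_*}^2=(u,u)_{H^2_*}$. Eigenvalue problem: for $p\in P_{\alpha,\beta}$, $\lambda$ is an eigenvalue with eigenfunction $u\in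 H^2_*\setminus\{0\}$ if $(u,v)_{H^2_*}=\lambda\int_\Omega p\,u\,v\,dx\,dy$ for all $v\in H^2_*$. (This is the weak form of $\Delta^2u=\lambda p u$ in $\Omega$ with $u=u_{xx}=0$ for $x\in\{0,\pi\}$ and $u_{yy}+\sigma u_{xx}=u_{yyy}+(2-\sigma)u_{xxy}=0$ for $y=\pm\ell$.) Let $H^2_{\mathcal E}$ and $H^2_{\mathcal O}$ be the subspaces of functions in $H^2_*$ that are even, respectively odd, in $y$; $H^2_*=H^2_{\mathcal E}\oplus H^2_{\mathcal O}$ orthogonally. Since $p$ is even in $y$, a complete system of eigenfunctions can be chosen with each eigenfunction in $H^2_{\mathcal E}$ (longitudinal) or in $H^2_{\mathcal O}$ (torsional). $\mu_1(p)\le\mu_2(p)\le\dots$ denote the eigenvalues corresponding to longitudinal eigenfunctions and $\nu_1(p)\le\nu_2(p)\le\dots$ those corresponding to torsional eigenfunctions, repeated according to multiplicity. Equivalently, $\mu_j(p)$ (resp. $\nu_j(p)$) is the minimum of $\|u\|_{H^2_*}^2/\|\sqrt p\,u\|_{L^2(\Omega)}^2$ over nonzero $u\in H^2_{\mathcal E}$ (resp. $H^2_{\mathcal O}$) that are $(\cdot,\cdot)_{H^2_*}$-orthogonal to the first $j-1$ longitudinal (resp. torsional) eigenfunctions. For $p\equiv1$ one has $\mu_1(1)<\nu_1(1)$ and $\mu_j(1)\to\infty$, so $j_0$ is well defined. *)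

theory Defs
  imports "HOL-Analysis.Analysis"
begin

text \<open>
  Elements of \<open>L\<^sup>2\<close>, \<open>L\<^sup>\<infinity>\<close> and of the Sobolev spaces are represented by Borel functions on the plate;
  every Lebesgue class contains such a function. Equality in these spaces is equality almost
  everywhere, and values outside the plate are irrelevant throughout.
\<close>

definition Omega :: "real \<Rightarrow> (real \<times> real) set" where
  "Omega l = {0<..<pi} \<times> {- l<..<l}"

definition plate :: "real \<Rightarrow> (real \<times> real) measure" where
  "plate l = restrict_space lborel (Omega l)"

definition L2 :: "real \<Rightarrow> (real \<times> real \<Rightarrow> real) set" where
  "L2 l = {u \<in> borel_measurable (plate l). integrable (plate l) (\<lambda>z. (u z)\<^sup>2)}"

definition weights :: "real \<Rightarrow> real \<Rightarrow> real \<Rightarrow> (real \<times> real \<Rightarrow> real) set" where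
  "weights l \<alpha> \<beta> = {p \<in> borel_measurable (plate l).
     (AE z in plate l. \<alpha> \<le> p z \<and> p z \<le> \<beta>) \<and>
     (AE (x, y) in plate l. p (x, y) = p (x, - y)) \<and>
     (LINT z|plate l. p z) = measure lborel (Omega l)}"


definition dx :: "(real \<times> real \<Rightarrow> real) \<Rightarrow> real \<times> real \<Rightarrow> real" where
  "dx f = (\<lambda>(x, y). deriv (\<lambda>t. f (t, y)) x)"

definition dy :: "(real \<times> real \<Rightarrow> real) \<Rightarrow> real \<times> real \<Rightarrow> real" where
  "dy f = (\<lambda>(x, y). deriv (\<lambda>t. f (x, t)) y)"

primrec Ck :: "nat \<Rightarrow> (real \<times> real \<Rightarrow> real) \<Rightarrow> bool" where
  "Ck 0 f \<longleftrightarrow> continuous_on UNIV f"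
| "Ck (Suc k) f \<longleftrightarrow> f differentiable_on UNIV \<and> Ck k (dx f) \<and> Ck k (dy f)"

definition test_functions :: "real \<Rightarrow> (real \<times> real \<Rightarrow> real) set" where
  "test_functions l = {\<phi>. (\<forall>k. Ck k \<phi>) \<and>
     compact (closure {z. \<phi> z \<noteq> 0}) \<and> closure {z. \<phi> z \<noteq> 0} \<subseteq> Omega l}"

text \<open>\<open>is_weak_deriv l m n u g\<close>: on the plate, \<open>g\<close> is the weak derivative of \<open>u\<close> of order \<open>m\<close>
  in \<open>x\<close> and \<open>n\<close> in \<open>y\<close>.\<close>

definition is_weak_deriv ::
  "real \<Rightarrow> nat \<Rightarrow> nat \<Rightarrow> (real \<times> real \<Rightarrow> real) \<Rightarrow> (real \<times> real \<Rightarrow> real) \<Rightarrow> bool" where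
  "is_weak_deriv l m n u g \<longleftrightarrow> (\<forall>\<phi>\<in>test_functions l.
     (LINT z|plate l. u z * (dx ^^ m) ((dy ^^ n) \<phi>) z) =
     (- 1) ^ (m + n) * (LINT z|plate l. g z * \<phi> z))"

definition H2 :: "real \<Rightarrow> (real \<times> real \<Rightarrow> real) set" where
  "H2 l = {u \<in> L2 l. \<forall>m n. m + n \<le> 2 \<longrightarrow> (\<exists>g\<in>L2 l. is_weak_deriv l m n u g)}"

text \<open>Weak derivatives are unique up to null sets, and \<open>wderiv\<close> is only used under integrals.\<close>

definition wderiv :: "real \<Rightarrow> nat \<Rightarrow> nat \<Rightarrow> (real \<times> real \<Rightarrow> real) \<Rightarrow> real \<times> real \<Rightarrow> real" where
  "wderiv l m n u = (SOME g. g \<in> L2 l \<and> is_weak_deriv l m n u g)"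

text \<open>The boundary condition is pointwise, for the representative given by the embedding of
  \<open>H\<^sup>2\<close> into the continuous functions on the closed rectangle.\<close>

definition H2star :: "real \<Rightarrow> (real \<times> real \<Rightarrow> real) set" where
  "H2star l = {u \<in> H2 l. \<exists>U. continuous_on (closure (Omega l)) U \<and>
     (AE z in plate l. u z = U z) \<and> (\<forall>x\<in>{0, pi}. \<forall>y\<in>{- l<..<l}. U (x, y) = 0)}"

definition H2even :: "real \<Rightarrow> (real \<times> real \<Rightarrow> real) set" where
  "H2even l = {u \<in> H2star l. AE (x, y) in plate l. u (x, - y) = u (x, y)}"

definition H2odd :: "real \<Rightarrow> (real \<times> real \<Rightarrow> real) set" where
  "H2odd l = {u \<in> H2star l. AE (x, y) in plate l. u (x, - y) = - u (x, y)}"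

definition H2star_inner ::
  "real \<Rightarrow> real \<Rightarrow> (real \<times> real \<Rightarrow> real) \<Rightarrow> (real \<times> real \<Rightarrow> real) \<Rightarrow> real" where
  "H2star_inner l \<sigma> u v =
     (let uxx = wderiv l 2 0 u; uxy = wderiv l 1 1 u; uyy = wderiv l 0 2 u;
          vxx = wderiv l 2 0 v; vxy = wderiv l 1 1 v; vyy = wderiv l 0 2 v
      in LINT z|plate l. (uxx z + uyy z) * (vxx z + vyy z) +
           (1 - \<sigma>) * (2 * uxy z * vxy z - uxx z * vyy z - uyy z * vxx z))"


text \<open>Below, \<open>V\<close> is the subspace (\<open>H2even l\<close> or \<open>H2odd l\<close>) in which the eigenfunctions are taken;
  the eigenvalue equation is tested against all of \<open>H2star l\<close>. The zero function is included.\<close>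

definition eigenspace :: "real \<Rightarrow> real \<Rightarrow> (real \<times> real \<Rightarrow> real) set \<Rightarrow> (real \<times> real \<Rightarrow> real)
    \<Rightarrow> real \<Rightarrow> (real \<times> real \<Rightarrow> real) set" where
  "eigenspace l \<sigma> V p lam = {u \<in> V. \<forall>v\<in>H2star l.
     H2star_inner l \<sigma> u v = lam * (LINT z|plate l. p z * u z * v z)}"

text \<open>\<open>has_dim l E n\<close>: modulo equality almost everywhere, \<open>E\<close> has a basis of \<open>n\<close> elements.\<close>

definition has_dim :: "real \<Rightarrow> (real \<times> real \<Rightarrow> real) set \<Rightarrow> nat \<Rightarrow> bool" where
  "has_dim l E n \<longleftrightarrow> (\<exists>b. (\<forall>i<n. b i \<in> E) \<and>
     (\<forall>c :: nat \<Rightarrow> real. (AE z in plate l. (\<Sum>i<n. c i * b i z) = 0) \<longrightarrow> (\<forall>i<n. c i = 0)) \<and>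
     (\<forall>u\<in>E. \<exists>c :: nat \<Rightarrow> real. AE z in plate l. u z = (\<Sum>i<n. c i * b i z)))"

text \<open>The nondecreasing sequence, indexed from 0, in which every real \<open>lam\<close> occurs exactly as often
  as the dimension of its eigenspace (so not at all if \<open>lam\<close> is not an eigenvalue). These conditions
  determine the sequence.\<close>

definition eigenvalue_seq :: "real \<Rightarrow> real \<Rightarrow> (real \<times> real \<Rightarrow> real) set \<Rightarrow> (real \<times> real \<Rightarrow> real)
    \<Rightarrow> nat \<Rightarrow> real" where
  "eigenvalue_seq l \<sigma> V p = (THE s. incseq s \<and>
     (\<forall>lam. finite {j. s j = lam} \<and> has_dim l (eigenspace l \<sigma> V p lam) (card {j. s j = lam})))"

text \<open>The longitudinal and torsional eigenvalues, indexed from 1.\<close>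

definition mu :: "real \<Rightarrow> real \<Rightarrow> (real \<times> real \<Rightarrow> real) \<Rightarrow> nat \<Rightarrow> real" where
  "mu l \<sigma> p j = eigenvalue_seq l \<sigma> (H2even l) p (j - 1)"

definition nu :: "real \<Rightarrow> real \<Rightarrow> (real \<times> real \<Rightarrow> real) \<Rightarrow> nat \<Rightarrow> real" where
  "nu l \<sigma> p j = eigenvalue_seq l \<sigma> (H2odd l) p (j - 1)"

definition j0 :: "real \<Rightarrow> real \<Rightarrow> nat" where
  "j0 l \<sigma> = Max {j. 1 \<le> j \<and> nu l \<sigma> (\<lambda>_. 1) 1 - mu l \<sigma> (\<lambda>_. 1) j > 0}"

end

theory Submission
  imports Defs "HOL-Library.Function_Algebras" "HOL-Complex_Analysis.Great_Picard"
begin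

text \<open>
  Write \<open>\<kappa> = 1 / \<lambda>\<close> for the reciprocal of an eigenvalue. In the even and in the odd subspace the
  \<open>\<kappa>\<close> are obtained by successively maximising \<open>\<integral> p u\<^sup>2\<close> under \<open>\<parallel>u\<parallel> = 1\<close>, and by the min-max
  principle every \<open>\<kappa>\<close> changes by at most the supremum of \<open>\<bar>\<integral> (p - q) u\<^sup>2\<bar>\<close> over the unit ball when
  \<open>p\<close> is replaced by \<open>q\<close>. The unit ball of the energy space is totally bounded in \<open>L\<^sup>2\<close>, so this
  supremum tends to 0 along a weakly convergent sequence of weights. A maximising sequence of weights
  has a weakly convergent subsequence whose limit is again a weight, hence a maximiser.

  The energy space is controlled by Fourier series in \<open>sin (m x) cos (n \<pi> (y + l) / (2 l))\<close>: two
  integrations by parts turn the coefficients of \<open>u\<^sub>x\<^sub>x\<close> and \<open>u\<^sub>x\<^sub>y\<close> into those of \<open>u\<close> times \<open>m\<^sup>2\<close> and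
  \<open>m n\<close>, and \<open>\<Sum> 1 / (m\<^sup>2 (1 + n\<^sup>2))\<close> converges. This gives uniform convergence of the series, and with
  it the embedding into the continuous functions, compactness and completeness.
\<close>

text \<open>Nothing is prescribed on the long edges, and this decides which derivatives the Fourier
  analysis may touch. Since u vanishes on the short edges the modes are sines in x; they are cosines
  in y. The coefficients of u_xx and u_xy against suitable products involve no boundary value on the
  long edges, while those of u_yy against cosines would involve u_y there. Hence u_yy is carried
  along as an L2 datum, and the multipliers of u_xx and u_xy give just enough decay for absolute
  convergence in two dimensions. Eigenvalues are specified by the dimensions of eigenspaces modulo
  null functions, so min-max values alone do not identify them: multiplicities are counted as well,
  and a nondecreasing sequence is shown to be determined by its level sets. Reciprocals of
  eigenvalues are used because they perturb additively. The quantity to be maximised is a quotient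
  of two such reciprocals, so its continuity requires only that the denominator be positive at the
  limit weight.\<close>

lemma underdetermined_kernel:
  fixes C :: "'a \<Rightarrow> nat \<Rightarrow> real"
  assumes "finite I" "m < card I"
  shows "\<exists>c. (\<exists>i\<in>I. c i \<noteq> 0) \<and> (\<forall>j<m. (\<Sum>i\<in>I. c i * C i j) = 0)"
  using assms
proof (induction m arbitrary: I C)
  case 0
  then have "I \<noteq> {}" by auto
  then show ?case by (intro exI[of _ "\<lambda>_. 1"]) auto
next
  case (Suc m)
  show ?case
  proof (cases "\<forall>i\<in>I. C i m = 0")
    case True
    from Suc.IH[of I C] Suc.prems obtain c
      where "\<exists>i\<in>I. c i \<noteq> 0" "\<forall>j<m. (\<Sum>i\<in>I. c i * C i j) = 0" by auto
    with True show ?thesis by (intro exI[of _ c]) (auto simp: less_Suc_eq)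
  next
    case False
    \<comment> \<open>Gaussian elimination: the pivot p absorbs equation m, and the induction
      hypothesis is applied to the remaining indices, which is why I is an arbitrary finite
      set.\<close>
    then obtain p where p: "p \<in> I" "C p m \<noteq> 0" by auto
    let ?I = "I - {p}"
    have card: "finite ?I" "m < card ?I" using Suc.prems p by auto
    from Suc.IH[OF card, of "\<lambda>i j. C i j - C i m / C p m * C p j"] obtain d
      where d: "\<exists>i\<in>?I. d i \<noteq> 0"
        "\<forall>j<m. (\<Sum>i\<in>?I. d i * (C i j - C i m / C p m * C p j)) = 0" by auto
    define t where "t = - (\<Sum>i\<in>?I. d i * C i m) / C p m"
    define c where "c = d(p := t)"
    have S: "(\<Sum>i\<in>I. c i * C i j) = t * C p j + (\<Sum>i\<in>?I. d i * C i j)" for j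
    proof -
      have "(\<Sum>i\<in>I. c i * C i j) = c p * C p j + (\<Sum>i\<in>?I. c i * C i j)"
        using Suc.prems p by (simp add: sum.remove)
      also have "(\<Sum>i\<in>?I. c i * C i j) = (\<Sum>i\<in>?I. d i * C i j)"
        by (intro sum.cong) (auto simp: c_def)
      finally show ?thesis by (simp add: c_def)
    qed
    have "(\<Sum>i\<in>I. c i * C i j) = 0" if "j < Suc m" for j
    proof (cases "j = m")
      case True
      then show ?thesis using S[of m] p by (simp add: t_def)
    next
      case False
      with that have "j < m" by auto
      with d have "(\<Sum>i\<in>?I. d i * C i j) = (\<Sum>i\<in>?I. d i * C i m) / C p m * C p j"
        by (simp add: algebra_simps sum_subtractf sum_divide_distrib sum_distrib_left)
      with S[of j] show ?thesis by (simp add: t_def)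
    qed
    moreover have "\<exists>i\<in>I. c i \<noteq> 0"
    proof -
      from d obtain i where "i \<in> ?I" "d i \<noteq> 0" by auto
      then show ?thesis by (intro bexI[of _ i]) (auto simp: c_def)
    qed
    ultimately show ?thesis by blast
  qed
qed

section \<open>Quadratic forms on a subspace\<close>

text \<open>Vectors will be functions, not classes modulo null sets, so a form can only be
  semidefinite. It is a parameter and not a type class operation because several forms on nested
  subspaces are compared.\<close>

locale semi_inner =
  fixes V :: "'a::real_vector set" and A :: "'a \<Rightarrow> 'a \<Rightarrow> real"
  assumes subspace: "subspace V"
    and add_left: "\<lbrakk>x \<in> V; y \<in> V; z \<in> V\<rbrakk> \<Longrightarrow> A (x + y) z = A x z + A y z"
    and scale_left: "\<lbrakk>x \<in> V; z \<in> V\<rbrakk> \<Longrightarrow> A (c *\<^sub>R x) z = c * A x z"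
    and sym: "\<lbrakk>x \<in> V; y \<in> V\<rbrakk> \<Longrightarrow> A x y = A y x"
    and nonneg: "x \<in> V \<Longrightarrow> 0 \<le> A x x"
begin

lemma zero_in: "0 \<in> V" and add_in: "x \<in> V \<Longrightarrow> y \<in> V \<Longrightarrow> x + y \<in> V"
  and scale_in: "x \<in> V \<Longrightarrow> c *\<^sub>R x \<in> V" and diff_in: "x \<in> V \<Longrightarrow> y \<in> V \<Longrightarrow> x - y \<in> V"
  and sum_in: "(\<And>i. i \<in> I \<Longrightarrow> f i \<in> V) \<Longrightarrow> sum f I \<in> V"
  using subspace by (auto simp: subspace_0 subspace_add subspace_scale subspace_diff subspace_sum)

lemmas carrier = zero_in add_in scale_in diff_in sum_in

lemma add_right: "\<lbrakk>x \<in> V; y \<in> V; z \<in> V\<rbrakk> \<Longrightarrow> A z (x + y) = A z x + A z y"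
  by (metis add_left sym add_in)

lemma scale_right: "\<lbrakk>x \<in> V; z \<in> V\<rbrakk> \<Longrightarrow> A z (c *\<^sub>R x) = c * A z x"
  by (metis scale_left sym scale_in)

lemma diff_left: "\<lbrakk>x \<in> V; y \<in> V; z \<in> V\<rbrakk> \<Longrightarrow> A (x - y) z = A x z - A y z"
  using add_left[of x "(-1) *\<^sub>R y" z] scale_left[of y z "-1"] scale_in[of y "-1"] by simp

lemma diff_right: "\<lbrakk>x \<in> V; y \<in> V; z \<in> V\<rbrakk> \<Longrightarrow> A z (x - y) = A z x - A z y"
  by (metis diff_left sym diff_in)

lemma zero_left [simp]: "z \<in> V \<Longrightarrow> A 0 z = 0"
  using scale_left[of 0 z 0] zero_in by simp

lemma sum_left: "\<lbrakk>\<And>i. i \<in> I \<Longrightarrow> f i \<in> V; z \<in> V\<rbrakk> \<Longrightarrow> A (sum f I) z = (\<Sum>i\<in>I. A (f i) z)"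
proof (induction I rule: infinite_finite_induct)
  case (insert x F)
  then show ?case using add_left[of "f x" "sum f F" z] by (simp add: sum_in)
qed auto

lemma sum_right: "\<lbrakk>\<And>i. i \<in> I \<Longrightarrow> f i \<in> V; z \<in> V\<rbrakk> \<Longrightarrow> A z (sum f I) = (\<Sum>i\<in>I. A z (f i))"
  using sum_left[of I f z] sym by (simp add: sum_in)

lemma square_add: "\<lbrakk>x \<in> V; y \<in> V\<rbrakk> \<Longrightarrow> A (x + y) (x + y) = A x x + 2 * A x y + A y y"
  using sym[of x y] by (simp add: add_left add_right add_in)

lemma square_diff: "\<lbrakk>x \<in> V; y \<in> V\<rbrakk> \<Longrightarrow> A (x - y) (x - y) = A x x - 2 * A x y + A y y"
  using sym[of x y] by (simp add: diff_left diff_right diff_in)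

lemma square_scale: "x \<in> V \<Longrightarrow> A (c *\<^sub>R x) (c *\<^sub>R x) = c\<^sup>2 * A x x"
  by (simp add: scale_left scale_right scale_in power2_eq_square)

lemma parallelogram:
  "\<lbrakk>x \<in> V; y \<in> V\<rbrakk> \<Longrightarrow> A (x - y) (x - y) = 2 * A x x + 2 * A y y - A (x + y) (x + y)"
  by (simp add: square_add square_diff)

lemma diff_commute: "\<lbrakk>x \<in> V; y \<in> V\<rbrakk> \<Longrightarrow> A (x - y) (x - y) = A (y - x) (y - x)"
  using sym[of x y] by (simp add: square_diff)

lemma Cauchy_Schwarz:
  assumes "x \<in> V" "y \<in> V"
  shows "(A x y)\<^sup>2 \<le> A x x * A y y"
proof -
  have pos: "0 \<le> A x x + 2 * t * A x y + t\<^sup>2 * A y y" for t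
    using nonneg[of "x + t *\<^sub>R y"] square_add[of x "t *\<^sub>R y"] assms
    by (simp add: scale_left scale_right carrier power2_eq_square algebra_simps)
  show ?thesis
  proof (cases "A y y = 0")
    case True
    have "A x y = 0"
    proof (rule ccontr)
      assume "A x y \<noteq> 0"
      \<comment> \<open>For a null vector y the quadratic in t is affine, and this t gives it the
        value -1.\<close>
      with pos[of "- (A x x + 1) / (2 * A x y)"] True show False by (simp add: field_simps)
    qed
    with True show ?thesis by simp
  next
    case False
    with nonneg[OF assms(2)] have "A y y > 0" by simp
    with pos[of "- A x y / A y y"] show ?thesis
      by (simp add: power2_eq_square field_simps)
  qed
qed

lemma null_left:
  assumes "x \<in> V" "y \<in> V" "A x x = 0"
  shows "A x y = 0"
  using Cauchy_Schwarz[OF assms(1,2)] assms(3) by simp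

lemma abs_le:
  assumes "x \<in> V" "y \<in> V"
  shows "\<bar>A x y\<bar> \<le> sqrt (A x x) * sqrt (A y y)"
  using Cauchy_Schwarz[OF assms] by (metis real_sqrt_abs real_sqrt_le_mono real_sqrt_mult)

lemma triangle:
  assumes "x \<in> V" "y \<in> V"
  shows "sqrt (A (x + y) (x + y)) \<le> sqrt (A x x) + sqrt (A y y)"
proof (rule real_le_lsqrt)
  show "A (x + y) (x + y) \<le> (sqrt (A x x) + sqrt (A y y))\<^sup>2"
    using abs_le[OF assms] nonneg[OF assms(1)] nonneg[OF assms(2)]
    by (simp add: square_add assms power2_sum)
qed (simp add: nonneg assms)

lemma triangle_diff:
  assumes "x \<in> V" "y \<in> V" "z \<in> V"
  shows "sqrt (A (x - z) (x - z)) \<le> sqrt (A (x - y) (x - y)) + sqrt (A (y - z) (y - z))"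
  using triangle[of "x - y" "y - z"] assms by (simp add: carrier)

lemma abs_square_diff:
  assumes "x \<in> V" "y \<in> V"
  shows "\<bar>A x x - A y y\<bar> \<le> sqrt (A (x - y) (x - y)) * (sqrt (A x x) + sqrt (A y y))"
proof -
  have "A x x - A y y = A (x - y) x + A (x - y) y"
    using sym[of x y] assms by (simp add: diff_left)
  moreover have "\<bar>A (x - y) x\<bar> \<le> sqrt (A (x - y) (x - y)) * sqrt (A x x)"
    "\<bar>A (x - y) y\<bar> \<le> sqrt (A (x - y) (x - y)) * sqrt (A y y)"
    by (intro abs_le diff_in assms)+
  ultimately show ?thesis by (simp add: algebra_simps)
qed

lemma tendsto_left:
  assumes f: "\<And>n. f n \<in> V" and x: "x \<in> V" and y: "y \<in> V"
    and lim: "(\<lambda>n. A (f n - x) (f n - x)) \<longlonglongrightarrow> 0"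
  shows "(\<lambda>n. A (f n) y) \<longlonglongrightarrow> A x y"
proof -
  have "(\<lambda>n. sqrt (A (f n - x) (f n - x)) * sqrt (A y y)) \<longlonglongrightarrow> 0"
    using tendsto_mult_right[OF tendsto_real_sqrt[OF lim]] by simp
  moreover have "\<bar>A (f n) y - A x y\<bar> \<le> sqrt (A (f n - x) (f n - x)) * sqrt (A y y)" for n
    using abs_le[of "f n - x" y] f x y by (simp add: diff_left carrier)
  ultimately have "(\<lambda>n. A (f n) y - A x y) \<longlonglongrightarrow> 0"
    by (intro Lim_null_comparison[of "\<lambda>n. A (f n) y - A x y"]) (auto simp: eventually_sequentially)
  then show ?thesis by (simp add: LIM_zero_iff)
qed

lemma tendsto_square:
  assumes f: "\<And>n. f n \<in> V" and x: "x \<in> V"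
    and lim: "(\<lambda>n. A (f n - x) (f n - x)) \<longlonglongrightarrow> 0"
  shows "(\<lambda>n. A (f n) (f n)) \<longlonglongrightarrow> A x x"
proof -
  have "A (f n) (f n) = A (f n - x) (f n - x) + 2 * A (f n) x - A x x" for n
    using f x by (simp add: square_diff)
  moreover have "(\<lambda>n. A (f n - x) (f n - x) + 2 * A (f n) x - A x x) \<longlonglongrightarrow> 0 + 2 * A x x - A x x"
    by (intro tendsto_intros lim tendsto_left f x)
  ultimately show ?thesis by simp
qed

lemma restrict:
  assumes "subspace W" "W \<subseteq> V"
  shows "semi_inner W A"
  by unfold_locales (use assms in \<open>auto simp: subsetD add_left scale_left sym nonneg\<close>)

text \<open>A single diagonal extraction replaces nested subsequences: along a subsequence the
  distances to all points of the countably many finite nets converge, and two late terms are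
  compared through a net point close to one of them.\<close>

lemma Cauchy_subseq_if_totally_bounded:
  assumes B: "B \<subseteq> V" and f: "\<And>n. f n \<in> B" and bdd: "\<And>x. x \<in> B \<Longrightarrow> A x x \<le> K"
    and tb: "\<And>e. e > 0 \<Longrightarrow> \<exists>F. finite F \<and> F \<subseteq> B \<and> (\<forall>x\<in>B. \<exists>y\<in>F. A (x - y) (x - y) < e)"
  shows "\<exists>r. strict_mono (r :: nat \<Rightarrow> nat) \<and>
    (\<forall>e>0. \<exists>n0. \<forall>n\<ge>n0. \<forall>m\<ge>n0. A (f (r n) - f (r m)) (f (r n) - f (r m)) < e)"
proof -
  define d where "d x y = sqrt (A (x - y) (x - y))" for x y
  have tri: "d x z \<le> d x y + d y z" if "x \<in> B" "y \<in> B" "z \<in> B" for x y z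
    unfolding d_def using that B by (intro triangle_diff) auto
  have d0: "0 \<le> d x y" if "x \<in> B" "y \<in> B" for x y
    unfolding d_def using that B by (auto intro!: nonneg diff_in)
  have dsym: "d x y = d y x" if "x \<in> B" "y \<in> B" for x y
    unfolding d_def using that B diff_commute[of x y] by auto
  have "\<forall>k::nat. \<exists>F. finite F \<and> F \<subseteq> B \<and> (\<forall>x\<in>B. \<exists>y\<in>F. A (x - y) (x - y) < inverse (Suc k))"
    by (intro allI tb) auto
  from choice[OF this] obtain F :: "nat \<Rightarrow> 'a set" where
    "\<forall>k. finite (F k) \<and> F k \<subseteq> B \<and> (\<forall>x\<in>B. \<exists>y\<in>F k. A (x - y) (x - y) < inverse (Suc k))" ..
  then have F: "\<And>k. finite (F k)" "\<And>k. F k \<subseteq> B"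
    "\<And>k x. x \<in> B \<Longrightarrow> \<exists>y\<in>F k. A (x - y) (x - y) < inverse (Suc k)"
    by blast+
  have bound: "norm (d (f n) y) \<le> 2 * sqrt K" if "y \<in> (\<Union>k. F k)" for n y
  proof -
    have y: "y \<in> B" using that F by auto
    have "sqrt (A (f n - y) (f n - y)) \<le> sqrt (A (f n - 0) (f n - 0)) + sqrt (A (0 - y) (0 - y))"
      using y f B zero_in by (intro triangle_diff) auto
    also have "A (0 - y) (0 - y) = A y y"
      using diff_commute[of 0 y] y B zero_in by auto
    also have "sqrt (A (f n - 0) (f n - 0)) + sqrt (A y y) \<le> sqrt K + sqrt K"
      using bdd[OF f[of n]] bdd[OF y] by (intro add_mono) auto
    finally show ?thesis using d0[OF f[of n] y] by (simp add: d_def)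
  qed
  have "countable (\<Union>k. F k)" by (simp add: countable_finite F(1))
  from function_convergent_subsequence[where f = "\<lambda>n y. d (f n) y", OF this bound] obtain r
    where r: "strict_mono (r :: nat \<Rightarrow> nat)"
      "\<And>y. y \<in> (\<Union>k. F k) \<Longrightarrow> \<exists>L. (\<lambda>n. d (f (r n)) y) \<longlonglongrightarrow> L" by blast
  have "\<exists>n0. \<forall>n\<ge>n0. \<forall>m\<ge>n0. d (f (r n)) (f (r m)) < e" if e: "e > 0" for e
  proof -
    have "(e/4)\<^sup>2 > 0" using e by simp
    then obtain k where k: "inverse (real (Suc k)) < (e/4)\<^sup>2"
      using reals_Archimedean by blast
    have "\<exists>n0. \<forall>n\<ge>n0. \<forall>m\<ge>n0. \<bar>d (f (r n)) y - d (f (r m)) y\<bar> < e / 4" if "y \<in> F k" for y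
    proof -
      have "\<exists>L. (\<lambda>n. d (f (r n)) y) \<longlonglongrightarrow> L" by (rule r(2)) (use that in auto)
      then obtain L where "(\<lambda>n. d (f (r n)) y) \<longlonglongrightarrow> L" ..
      then have "Cauchy (\<lambda>n. d (f (r n)) y)" using LIMSEQ_imp_Cauchy by blast
      then have "\<exists>n0. \<forall>m\<ge>n0. \<forall>n\<ge>n0. norm (d (f (r m)) y - d (f (r n)) y) < e / 4"
        using e by (intro CauchyD) auto
      then show ?thesis by (simp only: real_norm_def)
    qed
    then have "\<forall>y\<in>F k. \<exists>n0. \<forall>n\<ge>n0. \<forall>m\<ge>n0. \<bar>d (f (r n)) y - d (f (r m)) y\<bar> < e / 4"
      by blast
    then obtain n0 where "\<forall>y\<in>F k. \<forall>n\<ge>n0 y. \<forall>m\<ge>n0 y.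
        \<bar>d (f (r n)) y - d (f (r m)) y\<bar> < e / 4" unfolding bchoice_iff by blast
    then have n0: "\<And>y n m. \<lbrakk>y \<in> F k; n \<ge> n0 y; m \<ge> n0 y\<rbrakk> \<Longrightarrow>
        \<bar>d (f (r n)) y - d (f (r m)) y\<bar> < e / 4" by blast
    define N where "N = Max (insert 0 (n0 ` F k))"
    have N: "n0 y \<le> N" if "y \<in> F k" for y unfolding N_def using F that by auto
    show ?thesis
    proof (intro exI allI impI)
      fix n m assume nm: "N \<le> n" "N \<le> m"
      from F(3)[OF f[of "r n"]] obtain y where y: "y \<in> F k"
        "A (f (r n) - y) (f (r n) - y) < inverse (Suc k)" by blast
      have yB: "y \<in> B" using y F by auto
      have "d (f (r n)) y < e / 4"
      proof -
        have "A (f (r n) - y) (f (r n) - y) < (e/4)\<^sup>2" using y k by simp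
        then have "d (f (r n)) y < sqrt ((e/4)\<^sup>2)" unfolding d_def by (rule real_sqrt_less_mono)
        then show ?thesis using e by simp
      qed
      moreover have "\<bar>d (f (r n)) y - d (f (r m)) y\<bar> < e / 4"
        by (rule n0[OF y(1)]) (use N[OF y(1)] nm in auto)
      moreover have "d (f (r n)) (f (r m)) \<le> d (f (r n)) y + d (f (r m)) y"
        using tri[OF f yB f, of "r n" "r m"] dsym[OF yB f] by simp
      ultimately show "d (f (r n)) (f (r m)) < e" by linarith
    qed
  qed
  note * = this
  have "\<exists>n0. \<forall>n\<ge>n0. \<forall>m\<ge>n0. A (f (r n) - f (r m)) (f (r n) - f (r m)) < e" if e: "e > 0" for e
  proof -
    from *[of "sqrt e"] e obtain n0 where "\<forall>n\<ge>n0. \<forall>m\<ge>n0. d (f (r n)) (f (r m)) < sqrt e" by auto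
    then show ?thesis unfolding d_def by auto
  qed
  with r(1) show ?thesis by blast
qed

end

text \<open>\<open>complete\<close> and \<open>totally_bounded\<close> together express that the
  energy space embeds compactly for the form \<open>N\<close>. Together with \<open>N_le\<close>,
  \<open>definite\<close> says that both forms have the same null vectors.
  \<open>infinite_dim\<close> guarantees that the successive maximisation never runs out of
  vectors.\<close>

locale energy_space = A: semi_inner V A + N: semi_inner V N
  for V :: "'a::real_vector set" and A N :: "'a \<Rightarrow> 'a \<Rightarrow> real" +
  fixes C :: real
  assumes complete: "\<lbrakk>\<And>n. f n \<in> V; \<And>e. e > 0 \<Longrightarrow> \<exists>n0. \<forall>n\<ge>n0. \<forall>m\<ge>n0. A (f n - f m) (f n - f m) < e\<rbrakk>
      \<Longrightarrow> \<exists>x\<in>V. (\<lambda>n. A (f n - x) (f n - x)) \<longlonglongrightarrow> 0"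
    and totally_bounded: "e > 0 \<Longrightarrow> \<exists>F. finite F \<and> F \<subseteq> {u \<in> V. A u u \<le> 1} \<and>
      (\<forall>u\<in>{u \<in> V. A u u \<le> 1}. \<exists>y\<in>F. N (u - y) (u - y) < e)"
    and N_le: "u \<in> V \<Longrightarrow> N u u \<le> C * A u u"
    and definite: "u \<in> V \<Longrightarrow> N u u = 0 \<Longrightarrow> A u u = 0"
    and infinite_dim: "\<exists>b :: nat \<Rightarrow> 'a. (\<forall>i. b i \<in> V) \<and> (\<forall>i j. i \<noteq> j \<longrightarrow> N (b i) (b j) = 0) \<and>
      (\<forall>i. N (b i) (b i) > 0)"
begin

text \<open>The numbers \<open>\<kappa> i\<close> are the reciprocals of the eigenvalues.\<close>

definition spectral :: "('a \<Rightarrow> 'a \<Rightarrow> real) \<Rightarrow> (nat \<Rightarrow> 'a) \<Rightarrow> (nat \<Rightarrow> real) \<Rightarrow> bool" where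
  "spectral M e \<kappa> \<longleftrightarrow> (\<forall>i. e i \<in> V) \<and> (\<forall>i j. A (e i) (e j) = (if i = j then 1 else 0)) \<and>
     decseq \<kappa> \<and> (\<forall>i. \<kappa> i > 0) \<and> \<kappa> \<longlonglongrightarrow> 0 \<and> (\<forall>i. \<forall>v\<in>V. M (e i) v = \<kappa> i * A (e i) v) \<and>
     (\<forall>k. \<forall>u\<in>V. (\<forall>i<k. A u (e i) = 0) \<longrightarrow> M u u \<le> \<kappa> k * A u u)"

end

text \<open>The two-sided comparison with \<open>N\<close> transfers compactness and nondegeneracy
  to \<open>M\<close>; for a weight the constants will be its pointwise bounds.\<close>

locale weighted_energy_space = energy_space V A N C + M: semi_inner V M
  for V :: "'a::real_vector set" and A N :: "'a \<Rightarrow> 'a \<Rightarrow> real" and C :: real and M +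
  fixes a b :: real
  assumes a_pos: "a > 0" and b_pos: "b > 0"
    and lower: "u \<in> V \<Longrightarrow> a * N u u \<le> M u u" and upper: "u \<in> V \<Longrightarrow> M u u \<le> b * N u u"
begin

lemma M_le: "u \<in> V \<Longrightarrow> M u u \<le> b * C * A u u"
  using order_trans[OF upper[of u] mult_left_mono[OF N_le, of u b]] b_pos by (simp add: mult.assoc)

lemma M_pos:
  assumes "u \<in> V" "A u u > 0"
  shows "M u u > 0"
proof -
  have "N u u > 0" using definite[OF assms(1)] N.nonneg[OF assms(1)] assms by (cases "N u u = 0") auto
  then have "a * N u u > 0" using a_pos by simp
  with lower[OF assms(1)] show ?thesis by linarith
qed

lemma M_Cauchy_subseq:
  assumes "\<And>n. f n \<in> V" "\<And>n. A (f n) (f n) \<le> 1"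
  shows "\<exists>r. strict_mono (r :: nat \<Rightarrow> nat) \<and>
    (\<forall>e>0. \<exists>n0. \<forall>n\<ge>n0. \<forall>m\<ge>n0. M (f (r n) - f (r m)) (f (r n) - f (r m)) < e)"
proof -
  let ?B = "{u \<in> V. A u u \<le> 1}"
  \<comment> \<open>The sign of \<open>C\<close> is not part of the locale, hence the
    modulus.\<close>
  have bound: "N x x \<le> \<bar>C\<bar>" if "x \<in> ?B" for x
  proof -
    have "N x x \<le> C * A x x" using that by (intro N_le) auto
    also have "\<dots> \<le> \<bar>C\<bar> * A x x" using that A.nonneg[of x] by (intro mult_right_mono) auto
    also have "\<dots> \<le> \<bar>C\<bar> * 1" using that by (intro mult_left_mono) auto
    finally show ?thesis by simp
  qed
  have "\<exists>r. strict_mono (r :: nat \<Rightarrow> nat) \<and>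
    (\<forall>e>0. \<exists>n0. \<forall>n\<ge>n0. \<forall>m\<ge>n0. N (f (r n) - f (r m)) (f (r n) - f (r m)) < e)"
    by (rule N.Cauchy_subseq_if_totally_bounded[where B = ?B and K = "\<bar>C\<bar>"])
      (use assms totally_bounded bound in auto)
  then obtain r :: "nat \<Rightarrow> nat" where r: "strict_mono r"
    "\<And>e. e > 0 \<Longrightarrow> \<exists>n0. \<forall>n\<ge>n0. \<forall>m\<ge>n0. N (f (r n) - f (r m)) (f (r n) - f (r m)) < e"
    by blast
  have "\<exists>n0. \<forall>n\<ge>n0. \<forall>m\<ge>n0. M (f (r n) - f (r m)) (f (r n) - f (r m)) < e" if "e > 0" for e
  proof -
    from r(2)[of "e / b"] that b_pos obtain n0 where n0:
      "\<forall>n\<ge>n0. \<forall>m\<ge>n0. N (f (r n) - f (r m)) (f (r n) - f (r m)) < e / b" by auto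
    show ?thesis
    proof (intro exI allI impI)
      fix n m assume "n0 \<le> n" "n0 \<le> m"
      with n0 have "N (f (r n) - f (r m)) (f (r n) - f (r m)) < e / b" by blast
      then have "b * N (f (r n) - f (r m)) (f (r n) - f (r m)) < e"
        using b_pos by (simp add: field_simps)
      with upper[of "f (r n) - f (r m)"] show "M (f (r n) - f (r m)) (f (r n) - f (r m)) < e"
        using assms(1) by (simp add: A.diff_in)
    qed
  qed
  with r(1) show ?thesis by blast
qed

text \<open>By compactness a maximising sequence may be taken Cauchy for \<open>M\<close>; the parallelogram identity then
  makes it Cauchy for \<open>A\<close>.\<close>

lemma maximizer_exists:
  fixes k :: nat
  assumes f: "\<And>i. i < k \<Longrightarrow> f i \<in> V"
  shows "\<exists>x\<in>V. A x x = 1 \<and> (\<forall>i<k. A x (f i) = 0) \<and>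
    (\<forall>u\<in>V. (\<forall>i<k. A u (f i) = 0) \<longrightarrow> M u u \<le> M x x * A u u)"
proof -
  define W where "W = {u \<in> V. \<forall>i<k. A u (f i) = 0}"
  have WV: "u \<in> V" if "u \<in> W" for u using that by (simp add: W_def)
  have subW: "subspace W"
    unfolding W_def subspace_def
    by (auto simp: A.carrier A.add_left A.scale_left f)
  obtain b0 where b0: "\<And>i::nat. b0 i \<in> V" "\<And>i j. i \<noteq> j \<Longrightarrow> N (b0 i) (b0 j) = 0"
    "\<And>i. N (b0 i) (b0 i) > 0" using infinite_dim by blast
  \<comment> \<open>There are k constraints and k + 1 vectors orthogonal for \<open>N\<close>, so a
    nonzero combination survives in \<open>W\<close>; its energy is positive, which later makes the
    supremum positive.\<close>
  obtain c where c: "\<exists>i\<in>{..<Suc k}. c i \<noteq> 0" "\<forall>j<k. (\<Sum>i<Suc k. c i * A (b0 i) (f j)) = 0"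
    using underdetermined_kernel[of "{..<Suc k}" k "\<lambda>i j. A (b0 i) (f j)"] by auto
  define w where "w = (\<Sum>i<Suc k. c i *\<^sub>R b0 i)"
  have wV: "w \<in> V" unfolding w_def by (intro A.carrier b0)
  have "A w (f j) = 0" if "j < k" for j
  proof -
    have "A w (f j) = (\<Sum>i<Suc k. A (c i *\<^sub>R b0 i) (f j))"
      unfolding w_def by (intro A.sum_left A.scale_in b0 f that)
    also have "\<dots> = (\<Sum>i<Suc k. c i * A (b0 i) (f j))"
      by (intro sum.cong A.scale_left b0 f that refl)
    finally show ?thesis using c that by simp
  qed
  then have wW: "w \<in> W" using wV by (simp add: W_def)
  obtain p where p: "p < Suc k" "c p \<noteq> 0" using c by auto
  have "N w (b0 p) = (\<Sum>i<Suc k. N (c i *\<^sub>R b0 i) (b0 p))"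
    unfolding w_def by (intro N.sum_left N.scale_in b0)
  also have "\<dots> = (\<Sum>i<Suc k. if i = p then c p * N (b0 p) (b0 p) else 0)"
    by (intro sum.cong refl) (auto simp: N.scale_left b0)
  also have "\<dots> = c p * N (b0 p) (b0 p)" using p by (subst sum.delta) auto
  finally have "N w (b0 p) \<noteq> 0" using p b0(3)[of p] by simp
  then have "N w w \<noteq> 0" using N.null_left[OF wV b0(1)] by blast
  then have Aw: "A w w > 0"
    using N_le[OF wV] N.nonneg[OF wV] A.nonneg[OF wV] by (cases "A w w = 0") auto
  \<comment> \<open>Over the ball, \<open>S\<close> is nonempty because of the zero vector. That the
    maximiser has norm 1 follows at the end from \<open>\<kappa>\<close> being positive.\<close>
  define S where "S = (\<lambda>u. M u u) ` {u \<in> W. A u u \<le> 1}"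
  have bdd: "bdd_above S"
  proof (rule bdd_aboveI[of _ "\<bar>b * C\<bar>"])
    fix y assume "y \<in> S"
    then obtain u where u: "u \<in> W" "A u u \<le> 1" "y = M u u" by (auto simp: S_def)
    have "M u u \<le> b * C * A u u" using WV u by (intro M_le) auto
    also have "\<dots> \<le> \<bar>b * C\<bar> * A u u" using A.nonneg WV u by (intro mult_right_mono) auto
    also have "\<dots> \<le> \<bar>b * C\<bar> * 1" using u by (intro mult_left_mono) auto
    finally show "y \<le> \<bar>b * C\<bar>" using u by simp
  qed
  define \<kappa> where "\<kappa> = Sup S"
  have le_\<kappa>: "M u u \<le> \<kappa>" if "u \<in> W" "A u u \<le> 1" for u
    unfolding \<kappa>_def by (rule cSup_upper[OF _ bdd]) (use that in \<open>auto simp: S_def\<close>)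
  have le_A: "M u u \<le> \<kappa> * A u u" if "u \<in> W" for u
  proof (cases "A u u = 0")
    case True
    then show ?thesis using M_le[of u] WV[OF that] by simp
  next
    case False
    then have pos: "A u u > 0" using A.nonneg[OF WV[OF that]] by simp
    let ?v = "(1 / sqrt (A u u)) *\<^sub>R u"
    have "?v \<in> W" using subW that by (simp add: subspace_scale)
    moreover have "A ?v ?v = 1" using pos WV[OF that] by (simp add: A.square_scale power_divide)
    ultimately have "M ?v ?v \<le> \<kappa>" by (intro le_\<kappa>) auto
    then show ?thesis using pos WV[OF that] by (simp add: M.square_scale power_divide field_simps)
  qed
  have \<kappa>_pos: "\<kappa> > 0"
  proof -
    have "0 < \<kappa> * A w w" using le_A[OF wW] M_pos[OF wV Aw] by linarith
    then show ?thesis using Aw by (simp add: zero_less_mult_iff)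
  qed
  have "\<exists>u. u \<in> W \<and> A u u \<le> 1 \<and> \<kappa> - inverse (Suc n) < M u u" for n
  proof -
    have "S \<noteq> {}" unfolding S_def using subspace_0[OF subW] A.zero_left[OF A.zero_in] by force
    moreover have "\<kappa> - inverse (Suc n) < Sup S" by (simp add: \<kappa>_def)
    ultimately obtain y where "y \<in> S" "\<kappa> - inverse (Suc n) < y"
      using less_cSup_iff[of S] bdd by blast
    then show ?thesis by (auto simp: S_def)
  qed
  then obtain g where g: "\<And>n. g n \<in> W" "\<And>n. A (g n) (g n) \<le> 1"
    "\<And>n. \<kappa> - inverse (Suc n) < M (g n) (g n)" by metis
  obtain r where r: "strict_mono (r :: nat \<Rightarrow> nat)"
    "\<And>e. e > 0 \<Longrightarrow> \<exists>n0. \<forall>n\<ge>n0. \<forall>m\<ge>n0. M (g (r n) - g (r m)) (g (r n) - g (r m)) < e"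
    using M_Cauchy_subseq[of g] g WV by blast
  define h where "h n = g (r n)" for n
  have h: "h n \<in> W" "h n \<in> V" "A (h n) (h n) \<le> 1" "\<kappa> - inverse (Suc n) < M (h n) (h n)" for n
  proof -
    have "inverse (real (Suc (r n))) \<le> inverse (real (Suc n))"
      using seq_suble[OF r(1), of n] by (intro le_imp_inverse_le) auto
    then show "\<kappa> - inverse (Suc n) < M (h n) (h n)" using g(3)[of "r n"] unfolding h_def by linarith
  qed (use g WV in \<open>auto simp: h_def\<close>)
  \<comment> \<open>The sum of two terms lies in \<open>W\<close>, where \<open>M\<close> is at most
    \<open>\<kappa>\<close> times \<open>A\<close>. Subtracting the two parallelogram identities
    bounds the energy of the difference by the two defects and the
    \<open>M\<close>-distance.\<close>
  have par: "A (h n - h m) (h n - h m) \<le>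
      (2 * inverse (Suc n) + 2 * inverse (Suc m) + M (h n - h m) (h n - h m)) / \<kappa>" for n m
  proof -
    have "M (h n + h m) (h n + h m) \<le> \<kappa> * A (h n + h m) (h n + h m)"
      using subW h by (intro le_A) (auto intro: subspace_add)
    moreover have "M (h n - h m) (h n - h m) = 2 * M (h n) (h n) + 2 * M (h m) (h m) - M (h n + h m) (h n + h m)"
      by (intro M.parallelogram h)
    moreover have "A (h n - h m) (h n - h m) = 2 * A (h n) (h n) + 2 * A (h m) (h m) - A (h n + h m) (h n + h m)"
      by (intro A.parallelogram h)
    moreover have "\<kappa> * A (h n) (h n) \<le> \<kappa> * 1" "\<kappa> * A (h m) (h m) \<le> \<kappa> * 1"
      using h \<kappa>_pos by (intro mult_left_mono; simp)+
    ultimately have "\<kappa> * A (h n - h m) (h n - h m) \<le>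
        2 * inverse (Suc n) + 2 * inverse (Suc m) + M (h n - h m) (h n - h m)"
      using h(4)[of n] h(4)[of m] by (simp only: right_diff_distrib distrib_left mult.left_commute[of \<kappa>])
    then show ?thesis using \<kappa>_pos by (simp add: field_simps)
  qed
  have "\<exists>n0. \<forall>n\<ge>n0. \<forall>m\<ge>n0. A (h n - h m) (h n - h m) < e" if e: "e > 0" for e
  proof -
    have ek: "e * \<kappa> / 8 > 0" using e \<kappa>_pos by simp
    obtain n1 where n1: "\<forall>n\<ge>n1. \<forall>m\<ge>n1. M (h n - h m) (h n - h m) < e * \<kappa> / 8"
      using r(2)[OF ek] unfolding h_def by blast
    obtain n2 where n2: "inverse (real (Suc n2)) < e * \<kappa> / 8" using reals_Archimedean[OF ek] by blast
    show ?thesis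
    proof (intro exI[of _ "max n1 n2"] allI impI)
      fix n m assume nm: "max n1 n2 \<le> n" "max n1 n2 \<le> m"
      have "inverse (real (Suc n)) \<le> inverse (real (Suc n2))" "inverse (real (Suc m)) \<le> inverse (real (Suc n2))"
        using nm by (intro le_imp_inverse_le; simp)+
      moreover have "M (h n - h m) (h n - h m) < e * \<kappa> / 8" using n1 nm by simp
      ultimately have "2 * inverse (Suc n) + 2 * inverse (Suc m) + M (h n - h m) (h n - h m) < e * \<kappa>"
        using n2 ek by linarith
      then have "(2 * inverse (Suc n) + 2 * inverse (Suc m) + M (h n - h m) (h n - h m)) / \<kappa> < e"
        using \<kappa>_pos by (simp only: divide_less_eq if_True)
      with par[of n m] show "A (h n - h m) (h n - h m) < e" by linarith
    qed
  qed
  then obtain x where x: "x \<in> V" and lim: "(\<lambda>n. A (h n - x) (h n - x)) \<longlonglongrightarrow> 0"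
    using complete[of h] h by blast
  have limM: "(\<lambda>n. M (h n - x) (h n - x)) \<longlonglongrightarrow> 0"
  proof (rule tendsto_sandwich[of "\<lambda>_. 0" _ _ "\<lambda>n. b * C * A (h n - x) (h n - x)"])
    show "(\<lambda>n. b * C * A (h n - x) (h n - x)) \<longlonglongrightarrow> 0"
      using tendsto_mult_left[OF lim, of "b * C"] by simp
  qed (use M_le M.nonneg h x in \<open>auto simp: A.carrier\<close>)
  have orth: "A x (f i) = 0" if "i < k" for i
  proof -
    have "(\<lambda>n. A (h n) (f i)) \<longlonglongrightarrow> A x (f i)"
      by (intro A.tendsto_left h x f that lim)
    moreover have "A (h n) (f i) = 0" for n using h(1)[of n] that by (simp add: W_def)
    ultimately show ?thesis by (simp add: LIMSEQ_const_iff)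
  qed
  then have xW: "x \<in> W" using x by (simp add: W_def)
  have A_le: "A x x \<le> 1"
    by (rule LIMSEQ_le_const2[OF A.tendsto_square[OF h(2) x lim]]) (use h in auto)
  have "(\<lambda>n. M (h n) (h n)) \<longlonglongrightarrow> \<kappa>"
  proof (rule tendsto_sandwich[of "\<lambda>n. \<kappa> - inverse (Suc n)" _ _ "\<lambda>_. \<kappa>"])
    show "(\<lambda>n. \<kappa> - inverse (Suc n)) \<longlonglongrightarrow> \<kappa>"
      using tendsto_diff[OF tendsto_const LIMSEQ_inverse_real_of_nat, of \<kappa>] by simp
    show "\<forall>\<^sub>F n in sequentially. \<kappa> - inverse (Suc n) \<le> M (h n) (h n)"
      using h(4) by (intro always_eventually allI less_imp_le)
  qed (use le_\<kappa> h in auto)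
  with M.tendsto_square[OF h(2) x limM] have M_x: "M x x = \<kappa>" by (rule LIMSEQ_unique)
  with le_A[OF xW] \<kappa>_pos have "1 \<le> A x x" by simp
  with A_le have "A x x = 1" by simp
  moreover have "M u u \<le> M x x * A u u" if "u \<in> V" "\<forall>i<k. A u (f i) = 0" for u
    using le_A[of u] that M_x by (simp add: W_def)
  ultimately show ?thesis using x orth by blast
qed

text \<open>The eigenvalue equation is obtained without differentiating a quotient: where a
  nonnegative form vanishes, Cauchy-Schwarz puts the vector into its kernel. If the values stayed
  above some d > 0, the eigenvectors would form an energy-bounded sequence without an
  \<open>M\<close>-Cauchy subsequence.\<close>

lemma spectral_exists: "\<exists>e \<kappa>. spectral M e \<kappa>"
proof -
  let ?P = "\<lambda>f k x. x \<in> V \<and> A x x = 1 \<and> (\<forall>i<k. A x (f i) = 0) \<and>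
    (\<forall>u\<in>V. (\<forall>i<k. A u (f i) = 0) \<longrightarrow> M u u \<le> M x x * A u u)"
  have "\<exists>e :: nat \<Rightarrow> 'a. \<forall>k. ?P e k (e k)"
  proof (rule dependent_wellorder_choice)
    fix k :: nat and f :: "nat \<Rightarrow> 'a" assume "\<And>i. i < k \<Longrightarrow> ?P f i (f i)"
    then have "\<exists>x\<in>V. A x x = 1 \<and> (\<forall>i<k. A x (f i) = 0) \<and>
        (\<forall>u\<in>V. (\<forall>i<k. A u (f i) = 0) \<longrightarrow> M u u \<le> M x x * A u u)"
      by (intro maximizer_exists) simp
    then show "\<exists>x. ?P f k x" by (simp only: Bex_def)
  qed auto
  then obtain e :: "nat \<Rightarrow> 'a" where "\<forall>k. ?P e k (e k)" ..
  then have P: "?P e k (e k)" for k by (rule spec)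
  have eV: "e k \<in> V" for k using P by blast
  define \<kappa> where "\<kappa> k = M (e k) (e k)" for k
  have max: "M u u \<le> \<kappa> k * A u u" if "u \<in> V" "\<And>i. i < k \<Longrightarrow> A u (e i) = 0" for u k
    using P[of k] that unfolding \<kappa>_def by blast
  have orth: "A (e i) (e j) = (if i = j then 1 else 0)" for i j :: nat
  proof (cases i j rule: linorder_cases)
    case less
    then show ?thesis using P[of j] A.sym[OF eV eV, of i j] by auto
  qed (use P[of i] in auto)
  have \<kappa>_pos: "\<kappa> k > 0" for k unfolding \<kappa>_def by (intro M_pos eV) (simp add: orth)
  have "decseq \<kappa>"
    unfolding decseq_Suc_iff
  proof
    fix n
    have "M (e (Suc n)) (e (Suc n)) \<le> \<kappa> n * A (e (Suc n)) (e (Suc n))"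
      by (intro max eV) (simp add: orth)
    then show "\<kappa> (Suc n) \<le> \<kappa> n" by (simp add: \<kappa>_def orth)
  qed
  have eigen: "M (e k) v = \<kappa> k * A (e k) v" if "v \<in> V" for k v
    using that
  proof (induction k arbitrary: v rule: less_induct)
    case (less k)
    define W where "W = {u \<in> V. \<forall>i<k. A u (e i) = 0}"
    have subW: "subspace W"
      unfolding W_def subspace_def by (auto simp: A.carrier A.add_left A.scale_left eV)
    \<comment> \<open>The defect \<open>\<kappa> k * A - M\<close> is nonnegative on \<open>W\<close> and vanishes at \<open>e k\<close>.\<close>
    interpret Q: semi_inner W "\<lambda>x y. \<kappa> k * A x y - M x y"
    proof unfold_locales
      fix x assume "x \<in> W"
      then show "0 \<le> \<kappa> k * A x x - M x x" using max[of x k] by (simp add: W_def)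
    qed (rule subW, auto simp: W_def A.add_left M.add_left A.scale_left M.scale_left A.sym M.sym algebra_simps)
    have ekW: "e k \<in> W" by (auto simp: W_def eV orth)
    \<comment> \<open>Removing the components along the earlier eigenvectors leaves a vector of
      \<open>W\<close>; the removed part is orthogonal to \<open>e k\<close> for both forms.\<close>
    define w where "w = (\<Sum>i<k. A v (e i) *\<^sub>R e i)"
    have wV: "w \<in> V" unfolding w_def by (intro A.carrier eV)
    have "A w (e j) = A v (e j)" if "j < k" for j
    proof -
      have "A w (e j) = (\<Sum>i<k. A v (e i) * A (e i) (e j))"
        unfolding w_def by (subst A.sum_left) (auto intro: A.carrier eV simp: A.scale_left eV)
      then show ?thesis using that by (simp add: orth if_distrib cong: if_cong)
    qed
    then have "v - w \<in> W" using less.prems wV by (simp add: W_def A.carrier A.diff_left eV)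
    from Q.null_left[OF ekW this] have 1: "M (e k) (v - w) = \<kappa> k * A (e k) (v - w)"
      by (simp add: orth \<kappa>_def)
    have "A (e k) w = (\<Sum>i<k. A v (e i) * A (e k) (e i))"
      unfolding w_def by (subst A.sum_right) (auto intro: A.carrier eV simp: A.scale_right eV)
    then have 2: "A (e k) w = 0" by (simp add: orth)
    have "M (e k) w = (\<Sum>i<k. A v (e i) * M (e k) (e i))"
      unfolding w_def by (subst M.sum_right) (auto intro: A.carrier eV simp: M.scale_right eV)
    also have "\<dots> = 0"
    proof (intro sum.neutral ballI)
      fix i assume "i \<in> {..<k}"
      then have "M (e i) (e k) = \<kappa> i * A (e i) (e k)" by (intro less.IH eV) auto
      moreover have "A (e i) (e k) = 0" using \<open>i \<in> {..<k}\<close> by (simp add: orth)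
      ultimately show "A v (e i) * M (e k) (e i) = 0" using M.sym[OF eV eV, of i k] by simp
    qed
    finally have 3: "M (e k) w = 0" .
    from 1 2 3 show ?case using less.prems wV by (simp add: A.diff_right M.diff_right eV)
  qed
  have "\<kappa> \<longlonglongrightarrow> 0"
  proof (rule ccontr)
    assume not: "\<not> \<kappa> \<longlonglongrightarrow> 0"
    have "\<exists>d>0. \<forall>n. d \<le> \<kappa> n"
    proof (rule ccontr)
      assume no: "\<not> (\<exists>d>0. \<forall>n. d \<le> \<kappa> n)"
      have "\<exists>n0. \<forall>n\<ge>n0. norm (\<kappa> n - 0) < d" if "d > 0" for d
      proof -
        obtain n0 where "\<kappa> n0 < d" using no \<open>d > 0\<close> not_le by blast
        then have "norm (\<kappa> n - 0) < d" if "n \<ge> n0" for n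
          using decseqD[OF \<open>decseq \<kappa>\<close> that] \<kappa>_pos[of n] by simp
        then show ?thesis by blast
      qed
      then have "\<kappa> \<longlonglongrightarrow> 0" by (rule LIMSEQ_I)
      with not show False by blast
    qed
    then obtain d where d: "d > 0" "\<And>n. d \<le> \<kappa> n" by blast
    obtain r :: "nat \<Rightarrow> nat" where r: "strict_mono r"
      "\<And>\<epsilon>. \<epsilon> > 0 \<Longrightarrow> \<exists>n0. \<forall>n\<ge>n0. \<forall>m\<ge>n0. M (e (r n) - e (r m)) (e (r n) - e (r m)) < \<epsilon>"
      using M_Cauchy_subseq[of e] eV orth by auto
    from r(2)[OF d(1)] obtain n where "M (e (r n) - e (r (Suc n))) (e (r n) - e (r (Suc n))) < d"
      by (metis le_refl le_SucI)
    moreover have "r n \<noteq> r (Suc n)" using r(1) by (simp add: strict_mono_eq)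
    then have "M (e (r n)) (e (r (Suc n))) = 0" using eigen[OF eV] orth by simp
    then have "M (e (r n) - e (r (Suc n))) (e (r n) - e (r (Suc n))) = \<kappa> (r n) + \<kappa> (r (Suc n))"
      by (simp add: M.square_diff eV \<kappa>_def)
    ultimately show False using d(2)[of "r n"] \<kappa>_pos[of "r (Suc n)"] by linarith
  qed
  then have "spectral M e \<kappa>"
    unfolding spectral_def using eV orth \<open>decseq \<kappa>\<close> \<kappa>_pos eigen max by blast
  then show ?thesis by blast
qed

text \<open>By symmetry an eigenvector for lam has no component along \<open>e i\<close> unless
  \<open>1 / \<kappa> i = lam\<close>. After subtraction of the others the remainder is orthogonal
  to every \<open>e i\<close>, so \<open>M\<close> of it is at most \<open>\<kappa> k\<close> times
  its energy for all k, and it is null.\<close>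

lemma eigenvector_expansion:
  assumes sp: "spectral M e \<kappa>" and u: "u \<in> V" and lam: "\<And>v. v \<in> V \<Longrightarrow> A u v = lam * M u v"
  defines "J \<equiv> {j. 1 / \<kappa> j = lam}"
  shows "finite J" and "A (u - (\<Sum>j\<in>J. A u (e j) *\<^sub>R e j)) (u - (\<Sum>j\<in>J. A u (e j) *\<^sub>R e j)) = 0"
proof -
  have eV: "e i \<in> V" and orth: "A (e i) (e j) = (if i = j then 1 else 0)" and \<kappa>: "\<kappa> i > 0"
    and lim: "\<kappa> \<longlonglongrightarrow> 0" and eigen: "v \<in> V \<Longrightarrow> M (e i) v = \<kappa> i * A (e i) v"
    and max: "v \<in> V \<Longrightarrow> (\<And>i. i < k \<Longrightarrow> A v (e i) = 0) \<Longrightarrow> M v v \<le> \<kappa> k * A v v" for i j k v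
    using sp unfolding spectral_def by auto
  show fin: "finite J"
  proof (cases "lam > 0")
    case True
    then obtain n0 where n0: "\<And>n. n \<ge> n0 \<Longrightarrow> norm (\<kappa> n - 0) < 1 / lam"
      using LIMSEQ_D[OF lim, of "1 / lam"] by auto
    have "J \<subseteq> {..<n0}"
    proof
      fix j assume "j \<in> J"
      then have "\<kappa> j = 1 / lam" using \<kappa>[of j] by (auto simp: J_def)
      with n0[of j] \<kappa>[of j] show "j \<in> {..<n0}" by (force simp: not_less)
    qed
    then show ?thesis by (rule finite_subset) auto
  next
    case False
    then have "J = {}" using \<kappa> by (auto simp: J_def)
    then show ?thesis by simp
  qed
  define w where "w = u - (\<Sum>j\<in>J. A u (e j) *\<^sub>R e j)"
  have wV: "w \<in> V" unfolding w_def by (intro A.carrier eV u)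
  have w_e: "A w (e i) = (if i \<in> J then 0 else A u (e i))" for i
  proof -
    have "A (\<Sum>j\<in>J. A u (e j) *\<^sub>R e j) (e i) = (\<Sum>j\<in>J. A u (e j) * A (e j) (e i))"
      by (subst A.sum_left) (auto intro: A.carrier eV simp: A.scale_left eV)
    then show ?thesis using fin
      by (simp add: w_def A.diff_left A.carrier eV u orth if_distrib cong: if_cong)
  qed
  have coeff: "A u (e i) = 0" if "i \<notin> J" for i
  proof -
    have "A u (e i) = lam * (\<kappa> i * A u (e i))"
      using lam[OF eV[of i]] eigen[OF u, of i] M.sym[OF u eV, of i] A.sym[OF u eV, of i] by simp
    moreover have "lam * \<kappa> i \<noteq> 1" using that \<kappa>[of i] by (auto simp: J_def field_simps)
    ultimately show ?thesis by (simp add: algebra_simps)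
  qed
  have w0: "A w (e i) = 0" for i using w_e coeff by auto
  have "M w w \<le> \<kappa> k * A w w" for k by (rule max[OF wV w0])
  moreover have "(\<lambda>k. \<kappa> k * A w w) \<longlonglongrightarrow> 0" using tendsto_mult_right[OF lim] by simp
  ultimately have "M w w \<le> 0" by (intro LIMSEQ_le_const[of _ 0]) auto
  then show "A w w = 0" using M_pos[OF wV] A.nonneg[OF wV] by force
qed

end

text \<open>Courant--Fischer: the span of \<open>e' 0, \<dots>, e' k\<close> contains a vector orthogonal to \<open>e 0, \<dots>, e (k - 1)\<close>.\<close>

lemma (in energy_space) spectral_comparison:
  assumes sp: "spectral M e \<kappa>" and sp': "spectral M' e' \<kappa>'" and M': "semi_inner V M'"
    and le: "\<And>u. u \<in> V \<Longrightarrow> M' u u \<le> M u u + d * A u u"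
  shows "\<kappa>' k \<le> \<kappa> k + d"
proof -
  interpret M': semi_inner V M' by (rule M')
  have eV: "e i \<in> V" and max: "v \<in> V \<Longrightarrow> (\<And>i. i < k \<Longrightarrow> A v (e i) = 0) \<Longrightarrow> M v v \<le> \<kappa> k * A v v" for i v k
    using sp unfolding spectral_def by auto
  have e'V: "e' i \<in> V" and orth: "A (e' i) (e' j) = (if i = j then 1 else 0)"
    and dec: "decseq \<kappa>'" and eigen: "v \<in> V \<Longrightarrow> M' (e' i) v = \<kappa>' i * A (e' i) v" for i j v
    using sp' unfolding spectral_def by auto
  obtain c where c: "\<exists>i\<in>{..<Suc k}. c i \<noteq> 0" "\<forall>j<k. (\<Sum>i<Suc k. c i * A (e' i) (e j)) = 0"
    using underdetermined_kernel[of "{..<Suc k}" k "\<lambda>i j. A (e' i) (e j)"] by auto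
  define u where "u = (\<Sum>i<Suc k. c i *\<^sub>R e' i)"
  have uV: "u \<in> V" unfolding u_def by (intro A.carrier e'V)
  have A_u: "A u v = (\<Sum>i<Suc k. c i * A (e' i) v)" if "v \<in> V" for v
    unfolding u_def
    by (subst A.sum_left) (auto intro: A.carrier e'V that simp: A.scale_left e'V that)
  have M_u: "M' u v = (\<Sum>i<Suc k. c i * M' (e' i) v)" if "v \<in> V" for v
    unfolding u_def
    by (subst M'.sum_left) (auto intro: A.carrier e'V that simp: M'.scale_left e'V that)
  have A_e: "A (e' i) u = c i" if "i < Suc k" for i
  proof -
    have "A (e' i) u = (\<Sum>j<Suc k. c j * A (e' j) (e' i))" using A_u[OF e'V] A.sym[OF uV e'V] by simp
    also have "\<dots> = (\<Sum>j<Suc k. if j = i then c i else 0)" by (intro sum.cong) (auto simp: orth)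
    finally show ?thesis using that by (simp only: sum.delta finite_lessThan) simp
  qed
  have A_uu: "A u u = (\<Sum>i<Suc k. (c i)\<^sup>2)"
    unfolding A_u[OF uV] by (intro sum.cong) (auto simp: A_e power2_eq_square)
  have M_uu: "M' u u = (\<Sum>i<Suc k. \<kappa>' i * (c i)\<^sup>2)"
    unfolding M_u[OF uV] by (intro sum.cong) (auto simp: A_e eigen uV power2_eq_square)
  obtain p where "p < Suc k" "c p \<noteq> 0" using c by auto
  then have pos: "A u u > 0" unfolding A_uu by (intro sum_pos2[of _ p]) auto
  \<comment> \<open>On the span of the first k + 1 eigenvectors of \<open>M'\<close> the quotient of
    \<open>M'\<close> and \<open>A\<close> is at least \<open>\<kappa>' k\<close>.\<close>
  have "\<kappa>' k * A u u \<le> M' u u"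
    unfolding A_uu M_uu sum_distrib_left using decseqD[OF dec]
    by (intro sum_mono mult_right_mono) auto
  also have "\<dots> \<le> M u u + d * A u u" by (intro le uV)
  also have "M u u \<le> \<kappa> k * A u u" using A_u[OF eV] c(2) by (intro max uV) auto
  finally have "\<kappa>' k * A u u \<le> (\<kappa> k + d) * A u u" by (simp add: algebra_simps)
  with pos show ?thesis by simp
qed

section \<open>Uniqueness of eigenvalue sequences and of dimensions\<close>

text \<open>At the first index n where the sequences differ, the smaller of the two values there
  cannot occur in the other sequence from n on; so it occurs strictly more often in one sequence
  than in the other.\<close>

lemma incseq_eq_if_level_sets_eq:
  fixes s t :: "nat \<Rightarrow> real"
  assumes s: "incseq s" and t: "incseq t"
    and fin: "\<And>x. finite {j. s j = x}" "\<And>x. finite {j. t j = x}"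
    and card: "\<And>x. card {j. s j = x} = card {j. t j = x}"
  shows "s = t"
proof -
  have aux: "b n \<le> a n" if "incseq a" "incseq b" "\<And>x. finite {j. a j = x}"
      "\<And>x. card {j. a j = x} = card {j. b j = x}" "\<And>i. i < n \<Longrightarrow> a i = b i" for a b :: "nat \<Rightarrow> real" and n
  proof (rule ccontr)
    assume "\<not> b n \<le> a n"
    then have less: "a n < b j" if "n \<le> j" for j
      using incseqD[OF \<open>incseq b\<close> that] by simp
    have "{j. b j = a n} \<subset> {j. a j = a n}"
    proof
      show "{j. b j = a n} \<subseteq> {j. a j = a n}"
      proof safe
        fix j assume "b j = a n"
        then have "j < n" using less[of j] by (metis less_irrefl not_le)
        with \<open>b j = a n\<close> that(5) show "a j = a n" by simp
      qed
      show "{j. b j = a n} \<noteq> {j. a j = a n}" using less[of n] by force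
    qed
    then have "card {j. b j = a n} < card {j. a j = a n}" by (intro psubset_card_mono that)
    with that(4)[of "a n"] show False by simp
  qed
  have "s n = t n" for n
  proof (induction n rule: less_induct)
    case (less n)
    show ?case
      using aux[of s t n] aux[of t s n] assms less by (intro antisym) auto
  qed
  then show ?thesis by blast
qed

text \<open>\<open>has_dim\<close> asserts only that some basis exists; this makes the
  multiplicities prescribed in \<open>eigenvalue_seq\<close> unambiguous. The usual exchange
  argument survives the passage to almost everywhere because only finitely many null sets are
  involved.\<close>

lemma has_dim_unique:
  assumes "has_dim l E n" "has_dim l E m"
  shows "n = m"
proof -
  have aux: "m' \<ge> n'" if n': "has_dim l E n'" and m': "has_dim l E m'" for n' m'
  proof (rule ccontr)
    assume "\<not> m' \<ge> n'"
    then have less: "m' < card {..<n'}" by simp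
    obtain b where b: "\<forall>i<n'. b i \<in> E"
      "\<forall>c :: nat \<Rightarrow> real. (AE z in plate l. (\<Sum>i<n'. c i * b i z) = 0) \<longrightarrow> (\<forall>i<n'. c i = 0)"
      using n' unfolding has_dim_def by blast
    obtain b' where b': "\<forall>u\<in>E. \<exists>c :: nat \<Rightarrow> real. AE z in plate l. u z = (\<Sum>j<m'. c j * b' j z)"
      using m' unfolding has_dim_def by blast
    have "\<forall>i\<in>{..<n'}. \<exists>c :: nat \<Rightarrow> real. AE z in plate l. b i z = (\<Sum>j<m'. c j * b' j z)"
      using b b' by blast
    then obtain C :: "nat \<Rightarrow> nat \<Rightarrow> real"
      where C: "\<forall>i\<in>{..<n'}. AE z in plate l. b i z = (\<Sum>j<m'. C i j * b' j z)"
      unfolding bchoice_iff by blast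
    obtain c where c: "\<exists>i\<in>{..<n'}. c i \<noteq> 0" "\<forall>j<m'. (\<Sum>i<n'. c i * C i j) = 0"
      using underdetermined_kernel[OF finite_lessThan less] by blast
    have "AE z in plate l. \<forall>i\<in>{..<n'}. b i z = (\<Sum>j<m'. C i j * b' j z)"
      using C by (subst AE_finite_all) auto
    then have "AE z in plate l. (\<Sum>i<n'. c i * b i z) = 0"
    proof eventually_elim
      case (elim z)
      have "(\<Sum>i<n'. c i * b i z) = (\<Sum>i<n'. c i * (\<Sum>j<m'. C i j * b' j z))"
        using elim by (intro sum.cong) auto
      also have "\<dots> = (\<Sum>j<m'. (\<Sum>i<n'. c i * C i j) * b' j z)"
        unfolding sum_distrib_left sum_distrib_right by (subst sum.swap) (simp add: mult.assoc)
      also have "\<dots> = 0" using c by (intro sum.neutral) auto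
      finally show ?case .
    qed
    with b(2) c(1) show False by blast
  qed
  show ?thesis by (intro antisym aux assms)
qed

text \<open>Elements of almost minimal norm in the hulls of the tails are Cauchy by the parallelogram identity.
  This replaces the Riesz representation theorem in the proof of weak compactness.\<close>

lemma (in semi_inner) convex_combinations_Cauchy:
  assumes p: "\<And>k. p k \<in> V" and K: "\<And>k. A (p k) (p k) \<le> K"
  shows "\<exists>q. (\<forall>n::nat. q n \<in> convex hull (p ` {n..})) \<and>
    (\<forall>e>0. \<exists>n0. \<forall>n\<ge>n0. \<forall>m\<ge>n0. A (q n - q m) (q n - q m) < e)"
proof -
  define H where "H n = convex hull (p ` {n..})" for n :: nat
  have HV: "x \<in> V" if "x \<in> H n" for x n
  proof -
    have "H n \<subseteq> V" unfolding H_def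
      by (intro hull_minimal subspace_imp_convex subspace) (use p in auto)
    with that show ?thesis by blast
  qed
  have anti: "H m \<subseteq> H n" if "n \<le> m" for n m
    unfolding H_def using that by (intro hull_mono) auto
  have pH: "p n \<in> H n" for n unfolding H_def by (intro hull_inc) auto
  define a where "a n = Inf ((\<lambda>x. A x x) ` H n)" for n
  have bdd: "bdd_below ((\<lambda>x. A x x) ` H n)" for n
    by (rule bdd_belowI[of _ 0]) (use nonneg HV in auto)
  have a_le: "a n \<le> A x x" if "x \<in> H n" for x n
    unfolding a_def by (rule cInf_lower[OF _ bdd]) (use that in auto)
  have "incseq a"
  proof (rule incseq_SucI)
    fix n show "a n \<le> a (Suc n)"
      unfolding a_def using pH[of "Suc n"] anti[of n "Suc n"]
      by (intro cInf_superset_mono bdd image_mono) auto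
  qed
  moreover have "a n \<le> K" for n using a_le[OF pH] K order_trans by blast
  ultimately obtain L where "a \<longlonglongrightarrow> L" using incseq_convergent[of a K] by blast
  then have "Cauchy a" by (rule LIMSEQ_imp_Cauchy)
  have "\<exists>x\<in>H n. A x x < a n + inverse (Suc n)" for n
  proof -
    have "(\<lambda>x. A x x) ` H n \<noteq> {}" using pH by auto
    moreover have "Inf ((\<lambda>x. A x x) ` H n) < a n + inverse (Suc n)" by (simp add: a_def)
    ultimately show ?thesis using cInf_less_iff[OF _ bdd] by fastforce
  qed
  then obtain q where q: "\<And>n. q n \<in> H n" "\<And>n. A (q n) (q n) < a n + inverse (Suc n)" by metis
  have aux: "A (q n - q m) (q n - q m) \<le> 2 * a m - 2 * a n + 4 * inverse (Suc n)" if "n \<le> m" for n m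
  proof -
    have qH: "q n \<in> H n" "q m \<in> H n" using q(1)[of n] q(1)[of m] anti[OF that] by auto
    have "convex (H n)" by (simp add: H_def)
    \<comment> \<open>The midpoint stays in \<open>H n\<close>, so its square is at least the
      infimum \<open>a n\<close>; the parallelogram identity then bounds the difference.\<close>
    from convexD[OF this qH, of "1/2" "1/2"] have "(1/2) *\<^sub>R q n + (1/2) *\<^sub>R q m \<in> H n" by simp
    then have "(1/2) *\<^sub>R (q n + q m) \<in> H n" by (simp add: scaleR_add_right)
    from a_le[OF this] have "4 * a n \<le> A (q n + q m) (q n + q m)"
      using HV qH by (simp add: square_scale add_in power2_eq_square)
    moreover have "A (q n - q m) (q n - q m) =
        2 * A (q n) (q n) + 2 * A (q m) (q m) - A (q n + q m) (q n + q m)"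
      by (intro parallelogram HV[OF q(1)])
    moreover have "inverse (real (Suc m)) \<le> inverse (real (Suc n))"
      using that by (intro le_imp_inverse_le) auto
    ultimately show ?thesis using q(2)[of n] q(2)[of m] by linarith
  qed
  have "\<exists>n0. \<forall>n\<ge>n0. \<forall>m\<ge>n0. A (q n - q m) (q n - q m) < e" if e: "e > 0" for e
  proof -
    obtain n1 where n1: "\<forall>m\<ge>n1. \<forall>n\<ge>n1. norm (a m - a n) < e / 8"
      using CauchyD[OF \<open>Cauchy a\<close>, of "e / 8"] e by auto
    have "e / 8 > 0" using e by simp
    then obtain n2 where n2: "inverse (real (Suc n2)) < e / 8" using reals_Archimedean by blast
    have *: "A (q n - q m) (q n - q m) < e" if "max n1 n2 \<le> n" "n \<le> m" for n m
    proof -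
      have "inverse (real (Suc n)) \<le> inverse (real (Suc n2))"
        using that by (intro le_imp_inverse_le) auto
      moreover have "\<bar>a m - a n\<bar> < e / 8" using n1 that by simp
      ultimately show ?thesis using aux[OF that(2)] n2 e by linarith
    qed
    show ?thesis
    proof (intro exI[of _ "max n1 n2"] allI impI)
      fix n m assume "max n1 n2 \<le> n" "max n1 n2 \<le> m"
      then show "A (q n - q m) (q n - q m) < e"
        using *[of n m] *[of m n] diff_commute[of "q n" "q m"] HV[OF q(1)] by (cases "n \<le> m") auto
    qed
  qed
  with q(1) show ?thesis unfolding H_def by blast
qed

text \<open>With pointwise scaling, \<open>subspace\<close>, \<open>convex hull\<close> and the
  locales above apply to plain functions.\<close>

instantiation "fun" :: (type, real_vector) real_vector
begin

definition scaleR_fun :: "real \<Rightarrow> ('a \<Rightarrow> 'b) \<Rightarrow> 'a \<Rightarrow> 'b" where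
  "scaleR_fun c f = (\<lambda>x. c *\<^sub>R f x)"

instance
  by standard (auto simp: scaleR_fun_def fun_eq_iff scaleR_add_right scaleR_add_left)

end

lemma scaleR_apply [simp]: "(c *\<^sub>R f) x = c *\<^sub>R f x"
  by (simp add: scaleR_fun_def)

lemma sum_apply: "(sum f I) x = (\<Sum>i\<in>I. f i x)"
  for f :: "'i \<Rightarrow> 'a \<Rightarrow> 'b::comm_monoid_add"
  by (induction I rule: infinite_finite_induct) auto

section \<open>Square integrable functions on the plate\<close>

lemma open_Omega: "open (Omega l)"
  unfolding Omega_def by (intro open_Times) auto

lemma sets_Omega [measurable]: "Omega l \<in> sets borel"
  using open_Omega by (rule borel_open)

lemma space_plate [simp]: "space (plate l) = Omega l"
  by (simp add: plate_def space_restrict_space)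

lemma emeasure_lborel_Omega: "emeasure lborel (Omega l) = ennreal (pi * (2 * l))" if "l > 0"
proof -
  have "emeasure (lborel \<Otimes>\<^sub>M lborel) ({0<..<pi} \<times> {- l<..<l}) = ennreal (pi * (2 * l))"
    using that by (subst lborel.emeasure_pair_measure_Times) (auto simp: ennreal_mult)
  then show ?thesis by (simp add: Omega_def lborel_prod)
qed

lemma finite_measure_plate: "finite_measure (plate l)"
proof
  have "Omega l \<subseteq> box (0, - l) (pi, l)" by (auto simp: Omega_def box_def Basis_prod_def)
  then have "bounded (Omega l)" using bounded_box bounded_subset by blast
  then have "emeasure lborel (Omega l) < \<infinity>" by (rule emeasure_bounded_finite)
  then show "emeasure (plate l) (space (plate l)) \<noteq> \<infinity>"
    by (simp add: plate_def emeasure_restrict_space space_restrict_space)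
qed

lemma measure_plate: "measure (plate l) (Omega l) = pi * (2 * l)" if "l > 0"
proof -
  have "measure (plate l) (Omega l) = measure lborel (Omega l)"
    unfolding plate_def by (intro measure_restrict_space) auto
  then show ?thesis using emeasure_lborel_Omega[OF that] that by (simp add: measure_def)
qed

lemma borel_measurable_plate: "f \<in> borel_measurable borel \<Longrightarrow> f \<in> borel_measurable (plate l)"
  unfolding plate_def by (rule measurable_restrict_space1) simp

lemma integrable_plate_bounded:
  fixes f :: "real \<times> real \<Rightarrow> real"
  assumes "f \<in> borel_measurable (plate l)" "AE z in plate l. \<bar>f z\<bar> \<le> B"
  shows "integrable (plate l) f"
  using assms by (intro finite_measure.integrable_const_bound[OF finite_measure_plate]) auto

definition ip :: "real \<Rightarrow> (real \<times> real \<Rightarrow> real) \<Rightarrow> (real \<times> real \<Rightarrow> real) \<Rightarrow> real" where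
  "ip l u v = (LINT z|plate l. u z * v z)"

lemma L2_measurable [measurable_dest]: "u \<in> L2 l \<Longrightarrow> u \<in> borel_measurable (plate l)"
  and L2_square: "u \<in> L2 l \<Longrightarrow> integrable (plate l) (\<lambda>z. (u z)\<^sup>2)"
  by (auto simp: L2_def)

lemma L2_mult_integrable:
  assumes "u \<in> L2 l" "v \<in> L2 l"
  shows "integrable (plate l) (\<lambda>z. u z * v z)"
proof (rule Bochner_Integration.integrable_bound)
  show "integrable (plate l) (\<lambda>z. (u z)\<^sup>2 + (v z)\<^sup>2)"
    using assms by (intro Bochner_Integration.integrable_add L2_square)
  have "\<bar>u z * v z\<bar> \<le> (u z)\<^sup>2 + (v z)\<^sup>2" for z
    using sum_squares_bound[of "\<bar>u z\<bar>" "\<bar>v z\<bar>"] abs_ge_zero[of "u z * v z"]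
    unfolding abs_mult power2_abs by linarith
  then show "AE z in plate l. norm (u z * v z) \<le> norm ((u z)\<^sup>2 + (v z)\<^sup>2)"
    by (intro always_eventually) auto
qed (use assms in measurable)

lemma bounded_L2:
  assumes "u \<in> borel_measurable (plate l)" "AE z in plate l. \<bar>u z\<bar> \<le> B"
  shows "u \<in> L2 l"
proof -
  have "AE z in plate l. \<bar>(u z)\<^sup>2\<bar> \<le> B\<^sup>2"
    using assms(2) by eventually_elim (metis abs_ge_zero abs_power2 power2_abs power_mono)
  then show ?thesis using assms(1) by (auto simp: L2_def intro!: integrable_plate_bounded)
qed

lemma bounded_mult_L2:
  assumes f: "f \<in> borel_measurable (plate l)" "AE z in plate l. \<bar>f z\<bar> \<le> B" and u: "u \<in> L2 l"
  shows "(\<lambda>z. f z * u z) \<in> L2 l"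
proof -
  have "integrable (plate l) (\<lambda>z. (f z * u z)\<^sup>2)"
  proof (rule Bochner_Integration.integrable_bound)
    show "integrable (plate l) (\<lambda>z. B\<^sup>2 * (u z)\<^sup>2)" using L2_square[OF u] by simp
    show "AE z in plate l. norm ((f z * u z)\<^sup>2) \<le> norm (B\<^sup>2 * (u z)\<^sup>2)"
      using f(2)
    proof eventually_elim
      case (elim z)
      then have "(f z)\<^sup>2 \<le> B\<^sup>2" by (metis abs_ge_zero power2_abs power_mono)
      then show ?case by (simp add: power_mult_distrib mult_right_mono)
    qed
  qed (use f u in measurable)
  then show ?thesis using f u by (auto simp: L2_def)
qed

lemma subspace_L2: "subspace (L2 l)"
  unfolding subspace_def
proof (intro conjI ballI allI)
  fix u v assume uv: "u \<in> L2 l" "v \<in> L2 l"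
  have "(\<lambda>z. (u z + v z)\<^sup>2) = (\<lambda>z. (u z)\<^sup>2 + 2 * (u z * v z) + (v z)\<^sup>2)"
    by (auto simp: power2_eq_square algebra_simps)
  moreover have "integrable (plate l) (\<lambda>z. (u z)\<^sup>2 + 2 * (u z * v z) + (v z)\<^sup>2)"
    using uv by (intro Bochner_Integration.integrable_add integrable_mult_right L2_square L2_mult_integrable)
  ultimately show "u + v \<in> L2 l" using uv by (auto simp: L2_def plus_fun_def)
qed (auto simp: L2_def scaleR_fun_def zero_fun_def power_mult_distrib)

lemma const_L2: "(\<lambda>_. c) \<in> L2 l"
  by (rule bounded_L2[of _ _ "\<bar>c\<bar>"]) auto

interpretation L2: semi_inner "L2 l" "ip l" for l
proof
  fix u v w :: "real \<times> real \<Rightarrow> real"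
  assume "u \<in> L2 l" "v \<in> L2 l" "w \<in> L2 l"
  then show "ip l (u + v) w = ip l u w + ip l v w"
    by (simp add: ip_def distrib_right L2_mult_integrable)
qed (auto simp: subspace_L2 ip_def mult.assoc, simp add: mult.commute)

lemma abs_L2: "u \<in> L2 l \<Longrightarrow> (\<lambda>z. \<bar>u z\<bar>) \<in> L2 l"
  by (auto simp: L2_def)

lemma L2_integrable: "u \<in> L2 l \<Longrightarrow> integrable (plate l) u"
  using L2_mult_integrable[OF _ const_L2, of u l 1] by simp

lemma L1_le_L2:
  assumes "u \<in> L2 l"
  shows "(LINT z|plate l. \<bar>u z\<bar>) \<le> sqrt (ip l u u) * sqrt (measure (plate l) (Omega l))"
  using L2.abs_le[OF abs_L2[OF assms] const_L2[of 1]]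
  by (simp add: ip_def flip: power2_eq_square)

lemma ip_self_zero_iff:
  assumes "u \<in> L2 l"
  shows "ip l u u = 0 \<longleftrightarrow> (AE z in plate l. u z = 0)"
proof -
  have "ip l u u = 0 \<longleftrightarrow> (AE z in plate l. (u z)\<^sup>2 = 0)"
    unfolding ip_def power2_eq_square[symmetric]
    by (rule integral_nonneg_eq_0_iff_AE[OF L2_square[OF assms]]) auto
  then show ?thesis by simp
qed

text \<open>Riesz-Fischer. On a finite measure space an L2 Cauchy sequence is Cauchy in L1, which
  yields an almost everywhere convergent subsequence; Fatou transfers the square bounds to its
  limit. The subsequence is part of the conclusion because the pointwise constraints on weights pass
  to the limit through it.\<close>

lemma L2_complete:
  assumes f: "\<And>n. f n \<in> L2 l"
    and Cauchy: "\<And>e. e > 0 \<Longrightarrow> \<exists>n0. \<forall>n\<ge>n0. \<forall>m\<ge>n0. ip l (f n - f m) (f n - f m) < e"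
  shows "\<exists>g\<in>L2 l. (\<lambda>n. ip l (f n - g) (f n - g)) \<longlonglongrightarrow> 0 \<and>
    (\<exists>r. strict_mono (r :: nat \<Rightarrow> nat) \<and> (AE z in plate l. (\<lambda>n. f (r n) z) \<longlonglongrightarrow> g z))"
proof -
  note [measurable] = L2_measurable[OF f]
  \<comment> \<open>The summand 1 keeps the divisor positive even for an empty plate.\<close>
  define c where "c = sqrt (measure (plate l) (Omega l)) + 1"
  have c: "c > 0" by (simp add: c_def add_nonneg_pos)
  have L1: "\<exists>N. \<forall>i\<ge>N. \<forall>j\<ge>N. (LINT z|plate l. norm (f i z - f j z)) < e" if e: "e > 0" for e
  proof -
    have "(e / c)\<^sup>2 > 0" using e c by simp
    then obtain n0 where n0: "\<forall>n\<ge>n0. \<forall>m\<ge>n0. ip l (f n - f m) (f n - f m) < (e / c)\<^sup>2"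
      using Cauchy by blast
    show ?thesis
    proof (intro exI allI impI)
      fix i j assume "n0 \<le> i" "n0 \<le> j"
      then have "sqrt (ip l (f i - f j) (f i - f j)) < sqrt ((e / c)\<^sup>2)"
        using n0 by (intro real_sqrt_less_mono) auto
      then have less: "sqrt (ip l (f i - f j) (f i - f j)) < e / c" using e c by simp
      have "(LINT z|plate l. norm (f i z - f j z)) \<le> sqrt (ip l (f i - f j) (f i - f j)) * c"
        using order_trans[OF L1_le_L2[OF L2.diff_in[OF f f], of i j] mult_left_mono[of _ c]]
          L2.nonneg[OF L2.diff_in[OF f f], of i j] by (simp add: c_def)
      also have "\<dots> < e / c * c" using less c by (intro mult_strict_right_mono)
      finally show "(LINT z|plate l. norm (f i z - f j z)) < e" using c by simp
    qed
  qed
  obtain r where r: "strict_mono r" "AE z in plate l. Cauchy (\<lambda>i. f (r i) z)"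
    using cauchy_L1_AE_cauchy_subseq[of "plate l" f] L1 L2_integrable[OF f] by blast
  define g where "g z = lim (\<lambda>i. f (r i) z)" for z
  have [measurable]: "g \<in> borel_measurable (plate l)"
    unfolding g_def by measurable
  have lim: "AE z in plate l. (\<lambda>n. f (r n) z) \<longlonglongrightarrow> g z"
    using r(2) by eventually_elim (simp add: g_def Cauchy_convergent_iff convergent_LIMSEQ_iff)
  have bound: "integrable (plate l) (\<lambda>z. (f n z - g z)\<^sup>2) \<and> (LINT z|plate l. (f n z - g z)\<^sup>2) \<le> e"
    if n: "\<forall>m\<ge>n0. ip l (f n - f m) (f n - f m) < e" and e: "e > 0" for n n0 e
  proof -
    have "(\<integral>\<^sup>+z. ennreal ((f n z - g z)\<^sup>2) \<partial>plate l) =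
        (\<integral>\<^sup>+z. liminf (\<lambda>k. ennreal ((f n z - f (r k) z)\<^sup>2)) \<partial>plate l)"
      using lim
      by (intro nn_integral_cong_AE, eventually_elim)
        (rule lim_imp_Liminf[symmetric], simp, intro tendsto_intros)
    also have "\<dots> \<le> liminf (\<lambda>k. \<integral>\<^sup>+z. ennreal ((f n z - f (r k) z)\<^sup>2) \<partial>plate l)"
      by (intro nn_integral_liminf) measurable
    also have "\<dots> \<le> ennreal e"
    proof (rule Liminf_le)
      have "(\<integral>\<^sup>+z. ennreal ((f n z - f (r k) z)\<^sup>2) \<partial>plate l) \<le> ennreal e" if "n0 \<le> k" for k
      proof -
        have "n0 \<le> r k" using that seq_suble[OF r(1), of k] by linarith
        then have "ip l (f n - f (r k)) (f n - f (r k)) < e" using n by blast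
        moreover have "(\<integral>\<^sup>+z. ennreal ((f n z - f (r k) z)\<^sup>2) \<partial>plate l) = ennreal (ip l (f n - f (r k)) (f n - f (r k)))"
          using L2_square[OF L2.diff_in[OF f f], of n "r k"]
          by (subst nn_integral_eq_integral) (auto simp: ip_def power2_eq_square)
        ultimately show ?thesis by (simp add: ennreal_leI)
      qed
      then show "\<forall>\<^sub>F k in sequentially. (\<integral>\<^sup>+z. ennreal ((f n z - f (r k) z)\<^sup>2) \<partial>plate l) \<le> ennreal e"
        by (auto simp: eventually_sequentially)
    qed auto
    finally have le: "(\<integral>\<^sup>+z. ennreal ((f n z - g z)\<^sup>2) \<partial>plate l) \<le> ennreal e" .
    have int: "integrable (plate l) (\<lambda>z. (f n z - g z)\<^sup>2)"
      by (rule integrableI_bounded) (use le in \<open>auto simp: le_less_trans\<close>)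
    moreover have "ennreal (LINT z|plate l. (f n z - g z)\<^sup>2) \<le> ennreal e"
      using le nn_integral_eq_integral[OF int] by simp
    ultimately show ?thesis using e by simp
  qed
  have "g \<in> L2 l"
  proof -
    obtain n0 where "\<forall>n\<ge>n0. \<forall>m\<ge>n0. ip l (f n - f m) (f n - f m) < 1" using Cauchy[of 1] by auto
    then have "integrable (plate l) (\<lambda>z. (f n0 z - g z)\<^sup>2)" using bound[of n0 n0 1] by auto
    then have "f n0 - g \<in> L2 l" by (auto simp: L2_def fun_diff_def)
    from L2.diff_in[OF f[of n0] this] show ?thesis by (simp add: algebra_simps)
  qed
  moreover have "(\<lambda>n. ip l (f n - g) (f n - g)) \<longlonglongrightarrow> 0"
  proof (rule LIMSEQ_I)
    fix e :: real assume e: "e > 0"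
    then obtain n0 where n0: "\<forall>n\<ge>n0. \<forall>m\<ge>n0. ip l (f n - f m) (f n - f m) < e / 2"
      using Cauchy[of "e / 2"] by auto
    show "\<exists>n0. \<forall>n\<ge>n0. norm (ip l (f n - g) (f n - g) - 0) < e"
    proof (intro exI allI impI)
      fix n assume "n0 \<le> n"
      with n0 e bound[of n0 n "e / 2"] have "ip l (f n - g) (f n - g) \<le> e / 2"
        by (auto simp: ip_def power2_eq_square)
      moreover have "0 \<le> ip l (f n - g) (f n - g)"
        by (intro L2.nonneg L2.diff_in f \<open>g \<in> L2 l\<close>)
      ultimately show "norm (ip l (f n - g) (f n - g) - 0) < e" using e by simp
    qed
  qed
  ultimately show ?thesis using r(1) lim by blast
qed

section \<open>Reflection in the long axis\<close>

definition reflect :: "real \<times> real \<Rightarrow> real \<times> real" where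
  "reflect z = (fst z, - snd z)"

lemma reflect_simps [simp]: "reflect (x, y) = (x, - y)" "reflect (reflect z) = z"
  "fst (reflect z) = fst z" "snd (reflect z) = - snd z"
  by (auto simp: reflect_def)

lemma reflect_Omega [simp]: "reflect z \<in> Omega l \<longleftrightarrow> z \<in> Omega l"
  by (cases z) (auto simp: Omega_def)

lemma continuous_reflect: "continuous_on S reflect"
  unfolding reflect_def by (intro continuous_intros)

lemma measurable_reflect: "reflect \<in> borel_measurable borel"
  by (intro borel_measurable_continuous_onI continuous_reflect)

lemma measurable_reflect_plate [measurable]: "reflect \<in> measurable (plate l) (plate l)"
  unfolding plate_def
  by (rule measurable_restrict_space3) (use measurable_reflect in auto)

lemma distr_lborel_reflect: "distr lborel borel reflect = lborel"
proof -
  \<comment> \<open>Reflection is the affine map with factors 1 and -1 on the two basis vectors, so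
    its Jacobian has modulus 1.\<close>
  define c :: "real \<times> real \<Rightarrow> real" where "c b = (if b = (0, 1) then -1 else 1)" for b
  define T where "T x = (0, 0) + (\<Sum>j\<in>Basis. (c j * (x \<bullet> j)) *\<^sub>R j)" for x :: "real \<times> real"
  have T: "T = reflect"
    by (auto simp: T_def c_def fun_eq_iff reflect_def Basis_prod_def sum.union_disjoint sum.reindex inj_on_def)
  have "lborel = density (distr lborel borel T) (\<lambda>_. (\<Prod>j\<in>Basis. \<bar>c j\<bar>))"
    using lborel_affine_euclidean[of c "(0, 0)"] unfolding T_def by (simp add: c_def)
  moreover have "(\<Prod>j\<in>Basis. \<bar>c j\<bar>) = 1" by (intro prod.neutral) (auto simp: c_def)
  ultimately show ?thesis by (simp add: T density_1)
qed

lemma distr_plate_reflect: "distr (plate l) (plate l) reflect = plate l"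
proof (rule measure_eqI)
  fix A assume "A \<in> sets (distr (plate l) (plate l) reflect)"
  then have A: "A \<in> sets borel" "A \<subseteq> Omega l" "A \<in> sets (plate l)"
    by (auto simp: plate_def sets_restrict_space)
  have *: "reflect -` A \<inter> Omega l = reflect -` A" using A(2) reflect_Omega by blast
  have "emeasure (distr (plate l) (plate l) reflect) A = emeasure (plate l) (reflect -` A)"
    using A by (simp add: emeasure_distr *)
  also have "\<dots> = emeasure lborel (reflect -` A)"
    unfolding plate_def using A * by (intro emeasure_restrict_space) auto
  also have "\<dots> = emeasure (distr lborel borel reflect) A"
    using A measurable_reflect by (simp add: emeasure_distr)
  also have "\<dots> = emeasure (plate l) A"
    unfolding plate_def distr_lborel_reflect using A by (simp add: emeasure_restrict_space)
  finally show "emeasure (distr (plate l) (plate l) reflect) A = emeasure (plate l) A" .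
qed simp

lemma AE_reflect: "AE z in plate l. P z \<Longrightarrow> AE z in plate l. P (reflect z)"
  using AE_distrD[OF measurable_reflect_plate, of P l] unfolding distr_plate_reflect .

lemma integral_reflect:
  fixes f :: "real \<times> real \<Rightarrow> real"
  assumes "f \<in> borel_measurable (plate l)"
  shows "(LINT z|plate l. f (reflect z)) = (LINT z|plate l. f z)"
  using integral_distr[OF measurable_reflect_plate assms] by (simp add: distr_plate_reflect)

lemma integrable_reflect:
  fixes f :: "real \<times> real \<Rightarrow> real"
  assumes "integrable (plate l) f"
  shows "integrable (plate l) (\<lambda>z. f (reflect z))"
  using integrable_distr[OF measurable_reflect_plate, of l f] assms by (simp add: distr_plate_reflect)

section \<open>Compactness of the set of weights\<close>

lemma weights_measurable: "p \<in> weights l \<alpha> \<beta> \<Longrightarrow> p \<in> borel_measurable (plate l)"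
  and weights_bounds: "p \<in> weights l \<alpha> \<beta> \<Longrightarrow> AE z in plate l. \<alpha> \<le> p z \<and> p z \<le> \<beta>"
  and weights_even: "p \<in> weights l \<alpha> \<beta> \<Longrightarrow> AE z in plate l. p z = p (reflect z)"
  and weights_integral: "p \<in> weights l \<alpha> \<beta> \<Longrightarrow> (LINT z|plate l. p z) = measure lborel (Omega l)"
  by (auto simp: weights_def reflect_def case_prod_beta)

lemma weightsI:
  assumes "p \<in> borel_measurable (plate l)" "AE z in plate l. \<alpha> \<le> p z \<and> p z \<le> \<beta>"
    "AE z in plate l. p z = p (reflect z)" "(LINT z|plate l. p z) = measure lborel (Omega l)"
  shows "p \<in> weights l \<alpha> \<beta>"
  using assms by (auto simp: weights_def reflect_def case_prod_beta)

lemma weights_abs: "p \<in> weights l \<alpha> \<beta> \<Longrightarrow> AE z in plate l. \<bar>p z\<bar> \<le> \<bar>\<alpha>\<bar> + \<bar>\<beta>\<bar>"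
  by (rule eventually_mono[OF weights_bounds]) auto

lemma weights_L2: "p \<in> weights l \<alpha> \<beta> \<Longrightarrow> p \<in> L2 l"
  by (rule bounded_L2[OF weights_measurable weights_abs])

lemma weights_mult_integrable:
  assumes "p \<in> weights l \<alpha> \<beta>" "u \<in> L2 l" "v \<in> L2 l"
  shows "integrable (plate l) (\<lambda>z. p z * u z * v z)"
  using assms by (intro L2_mult_integrable bounded_mult_L2[OF weights_measurable weights_abs])

lemma convex_weights: "convex (weights l \<alpha> \<beta>)"
proof (rule convexI)
  fix p q and s t :: real
  assume p: "p \<in> weights l \<alpha> \<beta>" and q: "q \<in> weights l \<alpha> \<beta>" and st: "0 \<le> s" "0 \<le> t" "s + t = 1"
  note [measurable] = weights_measurable[OF p] weights_measurable[OF q]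
  show "s *\<^sub>R p + t *\<^sub>R q \<in> weights l \<alpha> \<beta>"
  proof (rule weightsI)
    show "s *\<^sub>R p + t *\<^sub>R q \<in> borel_measurable (plate l)"
      unfolding plus_fun_def scaleR_fun_def by measurable
    show "AE z in plate l. \<alpha> \<le> (s *\<^sub>R p + t *\<^sub>R q) z \<and> (s *\<^sub>R p + t *\<^sub>R q) z \<le> \<beta>"
      using weights_bounds[OF p] weights_bounds[OF q]
    proof eventually_elim
      case (elim z)
      then have "s * \<alpha> + t * \<alpha> \<le> s * p z + t * q z" "s * p z + t * q z \<le> s * \<beta> + t * \<beta>"
        using st by (intro add_mono mult_left_mono; auto)+
      then show ?case using st(3) by (simp flip: distrib_right)
    qed
    show "AE z in plate l. (s *\<^sub>R p + t *\<^sub>R q) z = (s *\<^sub>R p + t *\<^sub>R q) (reflect z)"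
      using weights_even[OF p] weights_even[OF q] by eventually_elim simp
    show "(LINT z|plate l. (s *\<^sub>R p + t *\<^sub>R q) z) = measure lborel (Omega l)"
      using st(3) L2_integrable[OF weights_L2[OF p]] L2_integrable[OF weights_L2[OF q]]
      by (simp add: weights_integral[OF p] weights_integral[OF q] flip: distrib_right)
  qed
qed

text \<open>Bounds and evenness pass to the limit pointwise; the mean value passes by dominated
  convergence, with the constant function 1 as \<open>f\<close>.\<close>

lemma weights_AE_limit:
  assumes q: "\<And>n. q n \<in> weights l \<alpha> \<beta>" and g: "g \<in> borel_measurable (plate l)"
    and lim: "AE z in plate l. (\<lambda>n. q n z) \<longlonglongrightarrow> g z"
  shows "g \<in> weights l \<alpha> \<beta>"
    and "integrable (plate l) f \<Longrightarrow> (\<lambda>n. LINT z|plate l. q n z * f z) \<longlonglongrightarrow> (LINT z|plate l. g z * f z)"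
proof -
  note [measurable] = weights_measurable[OF q] g
  have all: "AE z in plate l. \<forall>n. P n z" if "\<And>n. AE z in plate l. P n z" for P :: "nat \<Rightarrow> real \<times> real \<Rightarrow> bool"
    using that by (simp add: AE_all_countable)
  show conv: "(\<lambda>n. LINT z|plate l. q n z * f z) \<longlonglongrightarrow> (LINT z|plate l. g z * f z)"
    if f: "integrable (plate l) f" for f
  proof (rule integral_dominated_convergence)
    show "integrable (plate l) (\<lambda>z. (\<bar>\<alpha>\<bar> + \<bar>\<beta>\<bar>) * \<bar>f z\<bar>)" using f by simp
    show "AE z in plate l. (\<lambda>n. q n z * f z) \<longlonglongrightarrow> g z * f z"
      using lim by eventually_elim (intro tendsto_intros)
    show "AE z in plate l. norm (q n z * f z) \<le> (\<bar>\<alpha>\<bar> + \<bar>\<beta>\<bar>) * \<bar>f z\<bar>" for n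
      using weights_abs[OF q[of n]] by eventually_elim (simp add: abs_mult mult_right_mono)
  qed (use f in measurable)
  show "g \<in> weights l \<alpha> \<beta>"
  proof (rule weightsI[OF g])
    show "AE z in plate l. \<alpha> \<le> g z \<and> g z \<le> \<beta>"
      using lim all[of "\<lambda>n z. \<alpha> \<le> q n z \<and> q n z \<le> \<beta>", OF weights_bounds[OF q]]
      by eventually_elim (auto intro: LIMSEQ_le_const LIMSEQ_le_const2)
    show "AE z in plate l. g z = g (reflect z)"
      using lim AE_reflect[OF lim] all[of "\<lambda>n z. q n z = q n (reflect z)", OF weights_even[OF q]]
      by eventually_elim (auto intro: LIMSEQ_unique)
    have "integrable (plate l) (\<lambda>_. 1 :: real)" using L2_integrable[OF const_L2] .
    from conv[OF this] show "(LINT z|plate l. g z) = measure lborel (Omega l)"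
      by (simp add: weights_integral[OF q] LIMSEQ_const_iff)
  qed
qed

text \<open>Only the functionals that integrate a weight against the square of some d in
  \<open>D\<close> matter, and a diagonal extraction makes these countably many converge. The limit
  weight is found as in Mazur's theorem: convex combinations of tails converge strongly, and they
  take nearly the same values as the late terms.\<close>

lemma weights_weakly_compact:
  assumes p: "\<And>n. p n \<in> weights l \<alpha> \<beta>" and D: "countable D" "D \<subseteq> L2 l" "\<And>d. d \<in> D \<Longrightarrow> ip l d d \<le> K"
  shows "\<exists>r q. strict_mono (r :: nat \<Rightarrow> nat) \<and> q \<in> weights l \<alpha> \<beta> \<and>
    (\<forall>d\<in>D. (\<lambda>n. LINT z|plate l. p (r n) z * d z * d z) \<longlonglongrightarrow> (LINT z|plate l. q z * d z * d z))"
proof -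
  define B where "B = \<bar>\<alpha>\<bar> + \<bar>\<beta>\<bar>"
  define F where "F p d = (LINT z|plate l. p z * d z * d z)" for p d :: "real \<times> real \<Rightarrow> real"
  have F_bound: "norm (F (p n) d) \<le> B * K" if d: "d \<in> D" for n d
  proof -
    have dL: "d \<in> L2 l" using d D by blast
    have "norm (F (p n) d) \<le> (LINT z|plate l. norm (p n z * d z * d z))"
      unfolding F_def by (rule integral_norm_bound)
    also have "\<dots> \<le> (LINT z|plate l. B * (d z * d z))"
    proof (rule integral_mono_AE)
      show "AE z in plate l. norm (p n z * d z * d z) \<le> B * (d z * d z)"
        using weights_abs[OF p[of n]]
      proof eventually_elim
        case (elim z)
        have "norm (p n z * d z * d z) = \<bar>p n z\<bar> * (d z * d z)" by (simp add: abs_mult mult.assoc)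
        also have "\<dots> \<le> B * (d z * d z)" using elim by (intro mult_right_mono) (auto simp: B_def)
        finally show ?case .
      qed
    qed (use weights_mult_integrable[OF p dL dL] L2_mult_integrable[OF dL dL] in auto)
    also have "\<dots> = B * ip l d d" by (simp add: ip_def)
    also have "\<dots> \<le> B * K" using D(3)[OF d] by (intro mult_left_mono) (auto simp: B_def)
    finally show ?thesis .
  qed
  obtain r where r: "strict_mono (r :: nat \<Rightarrow> nat)" "\<And>d. d \<in> D \<Longrightarrow> \<exists>L. (\<lambda>n. F (p (r n)) d) \<longlonglongrightarrow> L"
    using function_convergent_subsequence[where f = "\<lambda>n d. F (p n) d", OF D(1) F_bound] by blast
  have pL: "p n \<in> L2 l" for n by (rule weights_L2[OF p])
  have "ip l (p (r n)) (p (r n)) \<le> B\<^sup>2 * measure (plate l) (Omega l)" for n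
  proof -
    have "ip l (p (r n)) (p (r n)) \<le> (LINT z|plate l. B\<^sup>2)"
      unfolding ip_def
    proof (rule integral_mono_AE)
      show "AE z in plate l. p (r n) z * p (r n) z \<le> B\<^sup>2"
        using weights_abs[OF p[of "r n"]]
      proof eventually_elim
        case (elim z)
        then have "\<bar>p (r n) z\<bar>\<^sup>2 \<le> B\<^sup>2" by (intro power_mono) (auto simp: B_def)
        then show ?case by (simp add: power2_eq_square)
      qed
    qed (use L2_mult_integrable[OF pL pL] L2_integrable[OF const_L2] in auto)
    then show ?thesis by (simp add: mult.commute)
  qed
  from L2.convex_combinations_Cauchy[of "\<lambda>n. p (r n)", OF pL this] obtain q
    where q: "\<And>n. q n \<in> convex hull ((\<lambda>n. p (r n)) ` {n..})"
      "\<And>e. e > 0 \<Longrightarrow> \<exists>n0. \<forall>n\<ge>n0. \<forall>m\<ge>n0. ip l (q n - q m) (q n - q m) < e" by blast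
  have qw: "q n \<in> weights l \<alpha> \<beta>" for n
  proof -
    have "convex hull ((\<lambda>n. p (r n)) ` {n..}) \<subseteq> weights l \<alpha> \<beta>"
      by (intro hull_minimal convex_weights) (use p in auto)
    with q(1)[of n] show ?thesis by blast
  qed
  obtain g t where g: "g \<in> L2 l" and t: "strict_mono (t :: nat \<Rightarrow> nat)"
    and lim: "AE z in plate l. (\<lambda>n. q (t n) z) \<longlonglongrightarrow> g z"
    using L2_complete[OF weights_L2[OF qw] q(2)] by blast
  note gw = weights_AE_limit[OF qw L2_measurable[OF g] lim]
  have "(\<lambda>n. F (p (r n)) d) \<longlonglongrightarrow> F g d" if d: "d \<in> D" for d
  proof -
    have dL: "d \<in> L2 l" using d D by blast
    obtain L where L: "(\<lambda>n. F (p (r n)) d) \<longlonglongrightarrow> L" using r(2)[OF d] by blast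
    have limF: "(\<lambda>n. F (q (t n)) d) \<longlonglongrightarrow> F g d"
      using gw(2)[OF L2_mult_integrable[OF dL dL]] by (simp add: F_def mult.assoc)
    have F_add: "F (s *\<^sub>R a + u *\<^sub>R b) d = s * F a d + u * F b d"
      if "a \<in> weights l \<alpha> \<beta>" "b \<in> weights l \<alpha> \<beta>" for a b s u
      using weights_mult_integrable[OF that(1) dL dL] weights_mult_integrable[OF that(2) dL dL]
      by (simp add: F_def distrib_right mult.assoc)
    have "F g d = L"
    proof (rule LIMSEQ_unique[OF limF], rule LIMSEQ_I)
      fix e :: real assume e: "e > 0"
      from LIMSEQ_D[OF L, of "e / 2"] e obtain n0
        where n0: "\<And>n. n \<ge> n0 \<Longrightarrow> \<bar>F (p (r n)) d - L\<bar> < e / 2" by auto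
      \<comment> \<open>\<open>S\<close> is convex because the functional is affine on weights, and
        it contains a tail of the sequence; hence it contains the convex combination
        \<open>q (t n)\<close>.\<close>
      define S where "S = {a \<in> weights l \<alpha> \<beta>. F a d \<in> {L - e / 2..L + e / 2}}"
      have "convex S"
      proof (rule convexI)
        fix a b and s u :: real
        assume ab: "a \<in> S" "b \<in> S" and su: "0 \<le> s" "0 \<le> u" "s + u = 1"
        have "s *\<^sub>R a + u *\<^sub>R b \<in> weights l \<alpha> \<beta>"
          using ab su by (intro convexD[OF convex_weights]) (auto simp: S_def)
        moreover have "s *\<^sub>R F a d + u *\<^sub>R F b d \<in> {L - e / 2..L + e / 2}"
          using ab su by (intro convexD[OF convex_real_interval(5)]) (auto simp: S_def)
        ultimately show "s *\<^sub>R a + u *\<^sub>R b \<in> S" using ab by (simp add: S_def F_add)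
      qed
      show "\<exists>n0. \<forall>n\<ge>n0. norm (F (q (t n)) d - L) < e"
      proof (intro exI[of _ n0] allI impI)
        fix n assume n: "n0 \<le> n"
        then have tn: "n0 \<le> t n" using seq_suble[OF t, of n] by linarith
        have "(\<lambda>n. p (r n)) ` {t n..} \<subseteq> S"
        proof safe
          fix k assume "t n \<le> k"
          then have "\<bar>F (p (r k)) d - L\<bar> < e / 2" using tn by (intro n0) auto
          then show "p (r k) \<in> S" using p unfolding S_def abs_less_iff by simp
        qed
        then have "convex hull ((\<lambda>n. p (r n)) ` {t n..}) \<subseteq> S"
          by (intro hull_minimal \<open>convex S\<close>)
        with q(1)[of "t n"] have "q (t n) \<in> S" by blast
        then show "norm (F (q (t n)) d - L) < e" using e by (auto simp: S_def abs_less_iff)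
      qed
    qed
    with L show ?thesis by simp
  qed
  then show ?thesis using r(1) gw(1) unfolding F_def by blast
qed

section \<open>Smooth functions of one variable and cutoffs\<close>

text \<open>Built on \<open>deriv\<close> to match the definitions of \<open>dx\<close> and
  \<open>dy\<close>: for a product of two functions of one variable, \<open>Ck\<close> then follows
  from smoothness of the factors.\<close>

primrec Dk :: "nat \<Rightarrow> (real \<Rightarrow> real) \<Rightarrow> bool" where
  "Dk 0 f \<longleftrightarrow> True"
| "Dk (Suc k) f \<longleftrightarrow> (\<forall>x. f field_differentiable at x) \<and> Dk k (deriv f)"

definition smooth :: "(real \<Rightarrow> real) \<Rightarrow> bool" where
  "smooth f \<longleftrightarrow> (\<forall>k. Dk k f)"

lemma Dk_SucI:
  assumes "\<And>x. (f has_real_derivative f' x) (at x)" "Dk k f'"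
  shows "Dk (Suc k) f"
proof -
  have "deriv f = f'" using DERIV_imp_deriv[OF assms(1)] by blast
  with assms show ?thesis by (auto simp: field_differentiable_def)
qed

lemma Dk_Suc_imp: "Dk (Suc k) f \<Longrightarrow> Dk k f"
  by (induction k arbitrary: f) auto

lemma Dk_SucD: "Dk (Suc k) f \<Longrightarrow> (f has_real_derivative deriv f x) (at x)"
  by (simp add: field_differentiable_derivI)

lemma Dk_add: "Dk k f \<Longrightarrow> Dk k g \<Longrightarrow> Dk k (\<lambda>x. f x + g x)"
proof (induction k arbitrary: f g)
  case (Suc k)
  show ?case
    by (rule Dk_SucI[of _ "\<lambda>x. deriv f x + deriv g x"])
      (use Suc.prems in \<open>auto intro!: derivative_eq_intros Dk_SucD Suc.IH simp del: Dk.simps, auto\<close>)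
qed auto

lemma Dk_cmult: "Dk k f \<Longrightarrow> Dk k (\<lambda>x. c * f x)"
proof (induction k arbitrary: f)
  case (Suc k)
  show ?case
  proof (rule Dk_SucI[of _ "\<lambda>x. c * deriv f x"])
    show "((\<lambda>x. c * f x) has_real_derivative c * deriv f x) (at x)" for x
      by (intro DERIV_cmult Dk_SucD[OF Suc.prems])
  qed (use Suc in auto)
qed auto

lemma Dk_mult: "Dk k f \<Longrightarrow> Dk k g \<Longrightarrow> Dk k (\<lambda>x. f x * g x)"
proof (induction k arbitrary: f g)
  case (Suc k)
  show ?case
  proof (rule Dk_SucI[of _ "\<lambda>x. deriv f x * g x + deriv g x * f x"])
    show "((\<lambda>x. f x * g x) has_real_derivative deriv f x * g x + deriv g x * f x) (at x)" for x
      by (intro DERIV_mult Dk_SucD[OF Suc.prems(1)] Dk_SucD[OF Suc.prems(2)])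
    show "Dk k (\<lambda>x. deriv f x * g x + deriv g x * f x)"
      using Suc.prems Dk_Suc_imp[OF Suc.prems(1)] Dk_Suc_imp[OF Suc.prems(2)]
      by (intro Dk_add Suc.IH) auto
  qed
qed auto

lemma Dk_const: "Dk k (\<lambda>_. c)"
proof (induction k arbitrary: c)
  case (Suc k)
  show ?case by (rule Dk_SucI[of _ "\<lambda>_. 0"]) (auto intro: Suc)
qed auto

lemma Dk_affine: "Dk k f \<Longrightarrow> Dk k (\<lambda>x. f (a * x + b))"
proof (induction k arbitrary: f)
  case (Suc k)
  show ?case
  proof (rule Dk_SucI[of _ "\<lambda>x. a * deriv f (a * x + b)"])
    show "((\<lambda>x. f (a * x + b)) has_real_derivative a * deriv f (a * x + b)) (at x)" for x
    proof -
      have "((\<lambda>x. a * x + b) has_real_derivative a) (at x)" by (auto intro!: derivative_eq_intros)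
      from DERIV_chain2[where f = f and g = "\<lambda>x. a * x + b", OF Dk_SucD[OF Suc.prems] this]
      show ?thesis by (simp add: mult.commute)
    qed
  qed (use Suc in \<open>auto intro!: Dk_cmult\<close>)
qed auto

lemma Dk_inverse: "Dk k f \<Longrightarrow> (\<And>x. f x \<noteq> 0) \<Longrightarrow> Dk k (\<lambda>x. inverse (f x))"
proof (induction k)
  case (Suc k)
  show ?case
  proof (rule Dk_SucI[of _ "\<lambda>x. (- 1) * (inverse (f x) * (deriv f x * inverse (f x)))"])
    show "((\<lambda>x. inverse (f x)) has_real_derivative (- 1) * (inverse (f x) * (deriv f x * inverse (f x)))) (at x)" for x
      using DERIV_inverse'[OF Dk_SucD[OF Suc.prems(1), of x] Suc.prems(2)[of x]] by (simp add: mult.assoc)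
    have "Dk k (\<lambda>x. inverse (f x))" using Suc Dk_Suc_imp by blast
    then show "Dk k (\<lambda>x. (- 1) * (inverse (f x) * (deriv f x * inverse (f x))))"
      using Suc.prems by (intro Dk_cmult Dk_mult) auto
  qed
qed auto

lemma smooth_add: "smooth f \<Longrightarrow> smooth g \<Longrightarrow> smooth (\<lambda>x. f x + g x)"
  and smooth_cmult: "smooth f \<Longrightarrow> smooth (\<lambda>x. c * f x)"
  and smooth_mult: "smooth f \<Longrightarrow> smooth g \<Longrightarrow> smooth (\<lambda>x. f x * g x)"
  and smooth_const: "smooth (\<lambda>_. c)"
  and smooth_affine: "smooth f \<Longrightarrow> smooth (\<lambda>x. f (a * x + b))"
  and smooth_inverse: "smooth f \<Longrightarrow> (\<And>x. f x \<noteq> 0) \<Longrightarrow> smooth (\<lambda>x. inverse (f x))"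
  unfolding smooth_def by (auto intro: Dk_add Dk_cmult Dk_mult Dk_const Dk_affine Dk_inverse)

lemma smooth_DERIV: "smooth f \<Longrightarrow> (f has_real_derivative deriv f x) (at x)"
  and smooth_deriv: "smooth f \<Longrightarrow> smooth (deriv f)"
  unfolding smooth_def using Dk.simps(2) Dk_SucD by blast+

lemma smooth_continuous: "smooth f \<Longrightarrow> continuous_on S f"
  by (meson DERIV_continuous_on has_field_derivative_at_within smooth_DERIV)

lemma smooth_sin: "smooth sin" and smooth_cos: "smooth cos"
proof -
  have "Dk k (\<lambda>x. c * sin x) \<and> Dk k (\<lambda>x. c * cos x)" for k and c :: real
  proof (induction k arbitrary: c)
    case (Suc k)
    have "Dk (Suc k) (\<lambda>x. c * sin x)"
      by (rule Dk_SucI[of _ "\<lambda>x. c * cos x"]) (auto intro!: derivative_eq_intros simp: Suc)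
    moreover have "Dk (Suc k) (\<lambda>x. c * cos x)"
      by (rule Dk_SucI[of _ "\<lambda>x. - c * sin x"]) (use Suc[of "- c"] in \<open>auto intro!: derivative_eq_intros\<close>)
    ultimately show ?case by blast
  qed auto
  from this[of _ 1] show "smooth sin" "smooth cos" by (auto simp: smooth_def)
qed

lemma smooth_ident: "smooth (\<lambda>x. x)"
  unfolding smooth_def
proof
  fix k show "Dk k (\<lambda>x. x)"
  proof (cases k)
    case (Suc n)
    have "Dk (Suc n) (\<lambda>x. x)"
      by (rule Dk_SucI[of _ "\<lambda>_. 1"]) (auto intro: Dk_const)
    with Suc show ?thesis by simp
  qed simp
qed

text \<open>For n = 0 this is the standard function that vanishes to infinite order at 0. The powers
  of 1 / t are included so that the family is closed under differentiation up to linear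
  combinations.\<close>

definition flat :: "nat \<Rightarrow> real \<Rightarrow> real" where
  "flat n t = (if t > 0 then inverse t ^ n * exp (- inverse t) else 0)"

lemma flat_DERIV: "(flat n has_real_derivative flat (n + 2) t - n * flat (n + 1) t) (at t)"
proof (cases t "0 :: real" rule: linorder_cases)
  case less
  have "((\<lambda>_. 0) has_real_derivative 0) (at t)" by simp
  moreover have "\<forall>\<^sub>F x in nhds t. flat n x = 0"
    using eventually_nhds_in_open[of "{..<0}" t] less
    by (auto simp: flat_def elim!: eventually_mono)
  ultimately have "(flat n has_real_derivative 0) (at t)"
    by (subst DERIV_cong_ev[OF refl _ refl]) auto
  with less show ?thesis by (simp add: flat_def)
next
  case equal
  \<comment> \<open>With x = 1 / h the difference quotient of \<open>flat n\<close> at 0 becomes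
    this expression.\<close>
  have "((\<lambda>x. x ^ Suc n / exp x) \<longlongrightarrow> 0) (at_top :: real filter)"
    by (rule tendsto_power_div_exp_0)
  from filterlim_compose[OF this filterlim_inverse_at_top_right]
  have lim: "((\<lambda>h. inverse h ^ Suc n / exp (inverse h)) \<longlongrightarrow> 0) (at_right (0::real))" .
  have "((\<lambda>h. (flat n h - flat n 0) / (h - 0)) \<longlongrightarrow> 0) (at_right 0)"
  proof (rule Lim_transform_eventually[OF lim])
    show "\<forall>\<^sub>F h in at_right 0. inverse h ^ Suc n / exp (inverse h) = (flat n h - flat n 0) / (h - 0)"
      by (rule eventually_mono[OF eventually_at_right_less])
        (auto simp: flat_def exp_minus field_simps)
  qed
  moreover have "((\<lambda>h. (flat n h - flat n 0) / (h - 0)) \<longlongrightarrow> 0) (at_left 0)"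
  proof (rule Lim_transform_eventually[OF tendsto_const])
    show "\<forall>\<^sub>F h in at_left 0. 0 = (flat n h - flat n 0) / (h - 0)"
      by (auto simp: eventually_at_left[of "-1 :: real" 0] flat_def intro!: exI[of _ "-1"])
  qed
  ultimately have "(flat n has_real_derivative 0) (at 0)"
    by (simp add: has_field_derivative_iff filterlim_at_split)
  with equal show ?thesis by (simp add: flat_def)
next
  case greater
  let ?D = "inverse t ^ (n + 2) * exp (- inverse t) - n * (inverse t ^ (n + 1) * exp (- inverse t))"
  have "((\<lambda>t. inverse t ^ n * exp (- inverse t)) has_real_derivative ?D) (at t)"
  proof -
    have "((\<lambda>t. inverse t ^ n) has_real_derivative - (n * inverse t ^ (n + 1))) (at t)"
    proof -
      have "((\<lambda>t. inverse t ^ n) has_real_derivative real n * (- (inverse t * inverse t) * inverse t ^ (n - Suc 0))) (at t)"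
        using greater DERIV_power[OF DERIV_inverse[of t UNIV], of n] by (simp add: power2_eq_square)
      then show ?thesis by (cases n) (auto simp: mult.assoc)
    qed
    moreover have "((\<lambda>t. exp (- inverse t)) has_real_derivative exp (- inverse t) * inverse t ^ 2) (at t)"
    proof -
      have "((\<lambda>t. - inverse t) has_real_derivative inverse t ^ 2) (at t)"
        using DERIV_minus[OF DERIV_inverse[of t UNIV]] greater by (simp add: power2_eq_square)
      from DERIV_chain2[OF DERIV_exp this] show ?thesis .
    qed
    ultimately show ?thesis
      by (rule DERIV_cong[OF DERIV_mult]) (simp add: power_add power2_eq_square algebra_simps)
  qed
  moreover have "\<forall>\<^sub>F x in nhds t. flat n x = inverse x ^ n * exp (- inverse x)"
    using eventually_nhds_in_open[of "{0<..}" t] greater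
    by (auto simp: flat_def elim!: eventually_mono)
  ultimately have "(flat n has_real_derivative ?D) (at t)"
    by (subst DERIV_cong_ev[OF refl _ refl]) auto
  with greater show ?thesis by (simp add: flat_def)
qed

lemma smooth_flat: "smooth (flat n)"
proof -
  have "Dk k (flat n)" for k
  proof (induction k arbitrary: n)
    case (Suc k)
    have "Dk k (\<lambda>t. flat (n + 2) t + (- real n) * flat (n + 1) t)"
      by (intro Dk_add Dk_cmult Suc)
    then show ?case by (intro Dk_SucI[OF flat_DERIV]) simp
  qed auto
  then show ?thesis by (simp add: smooth_def)
qed

text \<open>A smooth transition from 0 to 1. It takes place between 1 and 2 and not between 0 and 1,
  so that rescaled copies vanish in a whole neighbourhood of an edge, as compact support
  demands.\<close>

definition step :: "real \<Rightarrow> real" where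
  "step t = flat 0 (t - 1) * inverse (flat 0 (t - 1) + flat 0 (2 - t))"

lemma flat_nonneg: "0 \<le> flat n t"
  by (simp add: flat_def)

lemma step_denominator_pos: "flat 0 (t - 1) + flat 0 (2 - t) > 0"
  by (auto simp: flat_def add_pos_pos add_pos_nonneg add_nonneg_pos)

lemma step_bounds: "0 \<le> step t" "step t \<le> 1"
proof -
  show "0 \<le> step t" unfolding step_def using step_denominator_pos[of t]
    by (intro mult_nonneg_nonneg flat_nonneg) auto
  show "step t \<le> 1" unfolding step_def using step_denominator_pos[of t] flat_nonneg[of 0 "2 - t"]
    by (simp add: field_simps)
qed

lemma step_eq_0: "t \<le> 1 \<Longrightarrow> step t = 0"
  by (simp add: step_def flat_def)

lemma step_eq_1: "2 \<le> t \<Longrightarrow> step t = 1"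
  by (simp add: step_def flat_def)

lemma smooth_step: "smooth step"
proof -
  have 1: "smooth (\<lambda>t. flat 0 (t - 1))" using smooth_affine[OF smooth_flat, of 0 1 "-1"] by simp
  have 2: "smooth (\<lambda>t. flat 0 (2 - t))" using smooth_affine[OF smooth_flat, of 0 "-1" 2] by (simp add: algebra_simps)
  have "smooth (\<lambda>t. flat 0 (t - 1) * inverse (flat 0 (t - 1) + flat 0 (2 - t)))"
    by (intro smooth_mult smooth_inverse smooth_add 1 2) (use step_denominator_pos in \<open>force simp: less_le\<close>)
  then show ?thesis by (simp add: step_def[abs_def])
qed

lemma deriv_locally_const:
  fixes f :: "real \<Rightarrow> real"
  assumes "open S" "t \<in> S" "\<And>x. x \<in> S \<Longrightarrow> f x = c"
  shows "deriv f t = 0"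
proof -
  have "\<forall>\<^sub>F x in nhds t. f x = c"
    using eventually_nhds_in_open[OF assms(1,2)] by (auto elim!: eventually_mono simp: assms(3))
  then have "deriv f t = deriv (\<lambda>_. c) t" by (intro deriv_cong_ev) auto
  then show ?thesis by simp
qed

lemma deriv_step_eq_0: "t < 1 \<or> 2 < t \<Longrightarrow> deriv step t = 0"
  using deriv_locally_const[of "{..<1}" t step 0] deriv_locally_const[of "{2<..}" t step 1]
    step_eq_0 step_eq_1 by force

lemma deriv2_step_eq_0: "t < 1 \<or> 2 < t \<Longrightarrow> deriv (deriv step) t = 0"
  using deriv_locally_const[of "{..<1}" t "deriv step" 0] deriv_locally_const[of "{2<..}" t "deriv step" 0]
    deriv_step_eq_0 by force

lemma step_derivs_bounded: "\<exists>C\<ge>0. \<forall>t. \<bar>deriv step t\<bar> \<le> C \<and> \<bar>deriv (deriv step) t\<bar> \<le> C"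
proof -
  have bnd: "\<exists>C. \<forall>t. \<bar>f t\<bar> \<le> C" if f: "smooth f" "\<And>t. t < 1 \<or> 2 < t \<Longrightarrow> f t = 0" for f
  proof -
    have "compact (f ` {1..2})" by (intro compact_continuous_image smooth_continuous f) auto
    then obtain C where C: "\<forall>y\<in>f ` {1..2}. norm y \<le> C" using compact_imp_bounded bounded_iff by blast
    have "\<bar>f t\<bar> \<le> \<bar>C\<bar>" for t
    proof (cases "t \<in> {1..2}")
      case True
      then have "norm (f t) \<le> C" using C by blast
      then show ?thesis by simp
    qed (use f(2)[of t] in auto)
    then show ?thesis by blast
  qed
  obtain C1 where C1: "\<forall>t. \<bar>deriv step t\<bar> \<le> C1"
    using bnd[OF smooth_deriv[OF smooth_step] deriv_step_eq_0] by blast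
  obtain C2 where C2: "\<forall>t. \<bar>deriv (deriv step) t\<bar> \<le> C2"
    using bnd[OF smooth_deriv[OF smooth_deriv[OF smooth_step]] deriv2_step_eq_0] by blast
  show ?thesis
    by (rule exI[of _ "max \<bar>C1\<bar> \<bar>C2\<bar>"]) (use C1 C2 in \<open>force simp: le_max_iff_disj intro: order_trans\<close>)
qed

text \<open>Approximates the indicator of the interval from inside: it vanishes within distance 1 /
  (k + 1) of either end and equals 1 where both ends are farther than 2 / (k + 1) away.
  \<open>Suc k\<close> avoids division by zero.\<close>

definition cutoff :: "real \<Rightarrow> real \<Rightarrow> nat \<Rightarrow> real \<Rightarrow> real" where
  "cutoff a b k t = step (real (Suc k) * (t - a)) * step (real (Suc k) * (b - t))"

lemma smooth_cutoff: "smooth (cutoff a b k)"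
proof -
  have 1: "smooth (\<lambda>t. step (real (Suc k) * (t - a)))"
    using smooth_affine[OF smooth_step, of "real (Suc k)" "- real (Suc k) * a"] by (simp add: algebra_simps)
  have 2: "smooth (\<lambda>t. step (real (Suc k) * (b - t)))"
    using smooth_affine[OF smooth_step, of "- real (Suc k)" "real (Suc k) * b"] by (simp add: algebra_simps)
  show ?thesis unfolding cutoff_def[abs_def] by (intro smooth_mult 1 2)
qed

lemma cutoff_bounds: "0 \<le> cutoff a b k t" "cutoff a b k t \<le> 1"
  unfolding cutoff_def by (intro mult_nonneg_nonneg mult_le_one step_bounds)+

lemma cutoff_support:
  assumes "cutoff a b k t \<noteq> 0"
  shows "a + 1 / real (Suc k) < t" "t < b - 1 / real (Suc k)"
proof -
  have "real (Suc k) * (t - a) > 1" "real (Suc k) * (b - t) > 1"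
    using assms step_eq_0[of "real (Suc k) * (t - a)"] step_eq_0[of "real (Suc k) * (b - t)"]
    unfolding cutoff_def not_le[symmetric] by auto
  then show "a + 1 / real (Suc k) < t" "t < b - 1 / real (Suc k)" by (auto simp: field_simps)
qed

lemma deriv_cutoff:
  "deriv (cutoff a b k) = (\<lambda>t. real (Suc k) * deriv step (real (Suc k) * (t - a)) * step (real (Suc k) * (b - t))
     - real (Suc k) * step (real (Suc k) * (t - a)) * deriv step (real (Suc k) * (b - t)))"
proof (rule ext, rule DERIV_imp_deriv)
  fix t
  show "(cutoff a b k has_real_derivative real (Suc k) * deriv step (real (Suc k) * (t - a)) * step (real (Suc k) * (b - t))
     - real (Suc k) * step (real (Suc k) * (t - a)) * deriv step (real (Suc k) * (b - t))) (at t)"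
    unfolding cutoff_def[abs_def]
    by (rule derivative_eq_intros DERIV_chain2[OF smooth_DERIV[OF smooth_step]] refl)+ (simp add: algebra_simps)
qed

lemma deriv2_cutoff:
  "deriv (deriv (cutoff a b k)) = (\<lambda>t. (real (Suc k))\<^sup>2 * (deriv (deriv step) (real (Suc k) * (t - a)) * step (real (Suc k) * (b - t))
     - 2 * (deriv step (real (Suc k) * (t - a)) * deriv step (real (Suc k) * (b - t)))
     + step (real (Suc k) * (t - a)) * deriv (deriv step) (real (Suc k) * (b - t))))"
  unfolding deriv_cutoff
proof (rule ext, rule DERIV_imp_deriv)
  fix t
  show "((\<lambda>t. real (Suc k) * deriv step (real (Suc k) * (t - a)) * step (real (Suc k) * (b - t))
     - real (Suc k) * step (real (Suc k) * (t - a)) * deriv step (real (Suc k) * (b - t))) has_real_derivative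
      (real (Suc k))\<^sup>2 * (deriv (deriv step) (real (Suc k) * (t - a)) * step (real (Suc k) * (b - t))
     - 2 * (deriv step (real (Suc k) * (t - a)) * deriv step (real (Suc k) * (b - t)))
     + step (real (Suc k) * (t - a)) * deriv (deriv step) (real (Suc k) * (b - t)))) (at t)"
    by (rule derivative_eq_intros DERIV_chain2[OF smooth_DERIV[OF smooth_step]]
       DERIV_chain2[OF smooth_DERIV[OF smooth_deriv[OF smooth_step]]] refl)+
      (simp add: algebra_simps power2_eq_square)
qed

text \<open>Each derivative costs one factor k + 1 by the chain rule. For small k the transitions at
  both ends may overlap, so the product of their first derivatives is bounded by the square of C and
  not dropped.\<close>

lemma cutoff_derivs_bounded:
  "\<exists>C\<ge>0. \<forall>k t. \<bar>deriv (cutoff a b k) t\<bar> \<le> C * real (Suc k) \<and> \<bar>deriv (deriv (cutoff a b k)) t\<bar> \<le> C * (real (Suc k))\<^sup>2"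
proof -
  obtain C where C: "C \<ge> 0" "\<And>t. \<bar>deriv step t\<bar> \<le> C" "\<And>t. \<bar>deriv (deriv step) t\<bar> \<le> C"
    using step_derivs_bounded by blast
  have st: "\<bar>step t\<bar> \<le> 1" for t using step_bounds[of t] by simp
  define B where "B = 2 * C + 2 * (C * C)"
  show ?thesis
  proof (intro exI[of _ B] conjI allI)
    show "B \<ge> 0" using C by (simp add: B_def)
    fix k :: nat and t
    let ?u = "real (Suc k) * (t - a)" and ?v = "real (Suc k) * (b - t)"
    have *: "\<bar>deriv step ?u * step ?v\<bar> \<le> C * 1" "\<bar>step ?u * deriv step ?v\<bar> \<le> 1 * C"
      "\<bar>deriv step ?u * deriv step ?v\<bar> \<le> C * C"
      "\<bar>deriv (deriv step) ?u * step ?v\<bar> \<le> C * 1" "\<bar>step ?u * deriv (deriv step) ?v\<bar> \<le> 1 * C"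
      unfolding abs_mult by (intro mult_mono C st; simp add: C(1))+
    have "deriv (cutoff a b k) t = real (Suc k) * (deriv step ?u * step ?v - step ?u * deriv step ?v)"
      by (simp add: deriv_cutoff algebra_simps)
    also have "\<bar>\<dots>\<bar> = real (Suc k) * \<bar>deriv step ?u * step ?v - step ?u * deriv step ?v\<bar>" by (simp add: abs_mult)
    also have "\<dots> \<le> real (Suc k) * B" using * C(1) unfolding B_def by (intro mult_left_mono) auto
    finally show "\<bar>deriv (cutoff a b k) t\<bar> \<le> B * real (Suc k)" by (simp add: mult.commute)
    let ?X = "deriv (deriv step) ?u * step ?v - 2 * (deriv step ?u * deriv step ?v) + step ?u * deriv (deriv step) ?v"
    have "\<bar>deriv (deriv (cutoff a b k)) t\<bar> = (real (Suc k))\<^sup>2 * \<bar>?X\<bar>" by (simp add: deriv2_cutoff abs_mult)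
    also have "\<dots> \<le> (real (Suc k))\<^sup>2 * B" using * unfolding B_def by (intro mult_left_mono) auto
    finally show "\<bar>deriv (deriv (cutoff a b k)) t\<bar> \<le> B * (real (Suc k))\<^sup>2" by (simp add: mult.commute)
  qed
qed

lemma cutoff_inner:
  assumes "a + 2 / real (Suc k) < t" "t < b - 2 / real (Suc k)"
  shows "cutoff a b k t = 1" "deriv (cutoff a b k) t = 0" "deriv (deriv (cutoff a b k)) t = 0"
proof -
  have *: "real (Suc k) * (t - a) > 2" "real (Suc k) * (b - t) > 2" using assms by (auto simp: field_simps)
  show "cutoff a b k t = 1" using * by (simp add: cutoff_def step_eq_1 less_imp_le)
  show "deriv (cutoff a b k) t = 0" unfolding deriv_cutoff using * deriv_step_eq_0 by simp
  show "deriv (deriv (cutoff a b k)) t = 0" unfolding deriv2_cutoff using * deriv_step_eq_0 deriv2_step_eq_0 by simp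
qed

lemma eventually_cutoff_inner:
  assumes "t \<in> {a<..<b}"
  shows "\<forall>\<^sub>F k in sequentially. a + 2 / real (Suc k) < t \<and> t < b - 2 / real (Suc k)"
proof -
  have *: "(\<lambda>k. 2 / real (Suc k)) \<longlonglongrightarrow> 0"
    using tendsto_mult_left[OF LIMSEQ_inverse_real_of_nat, of 2] by (simp add: field_simps)
  have "(\<lambda>k. a + 2 / real (Suc k)) \<longlonglongrightarrow> a + 0" "(\<lambda>k. b - 2 / real (Suc k)) \<longlonglongrightarrow> b - 0"
    by (intro tendsto_intros *)+
  then have "\<forall>\<^sub>F k in sequentially. a + 2 / real (Suc k) < t" "\<forall>\<^sub>F k in sequentially. t < b - 2 / real (Suc k)"
    using assms order_tendstoD by force+
  then show ?thesis by eventually_elim simp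
qed

lemma cutoff_tendsto:
  "(\<lambda>k. cutoff a b k t) \<longlonglongrightarrow> indicator {a<..<b} t"
proof (cases "t \<in> {a<..<b}")
  case True
  have "\<forall>\<^sub>F k in sequentially. cutoff a b k t = 1"
    using eventually_cutoff_inner[OF True] by eventually_elim (auto intro: cutoff_inner)
  then show ?thesis using True by (simp add: tendsto_eventually)
next
  case False
  have "cutoff a b k t = 0" for k
  proof (rule ccontr)
    assume "cutoff a b k t \<noteq> 0"
    moreover have "0 < 1 / real (Suc k)" by simp
    ultimately have "a < t" "t < b" using cutoff_support[of a b k t] by linarith+
    with False show False by simp
  qed
  then show ?thesis using False by simp
qed

section \<open>Test functions\<close>

text \<open>Cutoffs and trigonometric modes are all of this form, which reduces partial derivatives
  to derivatives in one variable and plate integrals to products.\<close>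

definition tensor :: "(real \<Rightarrow> real) \<Rightarrow> (real \<Rightarrow> real) \<Rightarrow> real \<times> real \<Rightarrow> real" where
  "tensor f g z = f (fst z) * g (snd z)"

lemma dx_tensor: "smooth f \<Longrightarrow> dx (tensor f g) = tensor (deriv f) g"
  and dy_tensor: "smooth g \<Longrightarrow> dy (tensor f g) = tensor f (deriv g)"
  unfolding dx_def dy_def tensor_def
  by (auto simp: fun_eq_iff intro!: DERIV_imp_deriv DERIV_cmult_right DERIV_cmult smooth_DERIV)

lemma continuous_tensor: "smooth f \<Longrightarrow> smooth g \<Longrightarrow> continuous_on S (tensor f g)"
  unfolding tensor_def
  by (intro continuous_on_mult continuous_on_compose2[OF smooth_continuous[of f UNIV]]
      continuous_on_compose2[OF smooth_continuous[of g UNIV]] continuous_on_fst continuous_on_snd continuous_on_id) auto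

lemma tensor_differentiable:
  assumes "smooth f" "smooth g"
  shows "tensor f g differentiable_on UNIV"
proof -
  have "(\<lambda>z. f (fst z)) differentiable at z" "(\<lambda>z. g (snd z)) differentiable at z" for z :: "real \<times> real"
  proof -
    have "f differentiable at (fst z)" "g differentiable at (snd z)"
      using assms smooth_DERIV real_differentiable_def by blast+
    moreover have "fst differentiable at z" "snd differentiable at z"
      unfolding differentiable_def using has_derivative_fst[OF has_derivative_ident] has_derivative_snd[OF has_derivative_ident] by blast+
    ultimately show "(\<lambda>z. f (fst z)) differentiable at z" "(\<lambda>z. g (snd z)) differentiable at z"
      using differentiable_chain_at[of fst z f] differentiable_chain_at[of snd z g] by (auto simp: o_def)
  qed
  then show ?thesis unfolding differentiable_on_def tensor_def[abs_def]
    by (auto intro!: differentiable_mult)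
qed

lemma Ck_tensor: "smooth f \<Longrightarrow> smooth g \<Longrightarrow> Ck k (tensor f g)"
proof (induction k arbitrary: f g)
  case (Suc k)
  then show ?case by (simp add: tensor_differentiable dx_tensor dy_tensor smooth_deriv)
qed (simp add: continuous_tensor)

lemma tensor_test_function:
  assumes "smooth f" "smooth g" "e > 0"
    and f: "\<And>x. f x \<noteq> 0 \<Longrightarrow> e \<le> x \<and> x \<le> pi - e" and g: "\<And>y. g y \<noteq> 0 \<Longrightarrow> - l + e \<le> y \<and> y \<le> l - e"
  shows "tensor f g \<in> test_functions l"
proof -
  let ?K = "{e..pi - e} \<times> {- l + e..l - e}"
  have sub0: "{z. tensor f g z \<noteq> 0} \<subseteq> ?K" using f g by (auto simp: tensor_def)
  then have sub: "closure {z. tensor f g z \<noteq> 0} \<subseteq> ?K"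
    by (intro closure_minimal closed_Times) auto
  have "compact ?K" by (intro compact_Times) auto
  then have "compact (closure {z. tensor f g z \<noteq> 0})"
    by (simp add: bounded_subset[OF compact_imp_bounded sub0])
  moreover have "?K \<subseteq> Omega l" using assms(3) by (auto simp: Omega_def)
  ultimately show ?thesis using sub Ck_tensor[OF assms(1,2)] by (auto simp: test_functions_def)
qed

lemma in_support_closure: "\<phi> z \<noteq> 0 \<Longrightarrow> z \<in> closure {z. \<phi> z \<noteq> 0}"
  by (rule subsetD[OF closure_subset]) simp

lemma test_functionD:
  assumes "\<phi> \<in> test_functions l"
  shows "Ck k \<phi>" "compact (closure {z. \<phi> z \<noteq> 0})" "closure {z. \<phi> z \<noteq> 0} \<subseteq> Omega l"
    "continuous_on UNIV \<phi>" "\<phi> differentiable_on UNIV" "\<phi> z \<noteq> 0 \<Longrightarrow> z \<in> Omega l"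
proof -
  show Ck: "Ck k \<phi>" for k using assms by (simp add: test_functions_def)
  show "compact (closure {z. \<phi> z \<noteq> 0})" "closure {z. \<phi> z \<noteq> 0} \<subseteq> Omega l"
    using assms by (auto simp: test_functions_def)
  then show "\<phi> z \<noteq> 0 \<Longrightarrow> z \<in> Omega l" using in_support_closure[of \<phi> z] by blast
  show "continuous_on UNIV \<phi>" "\<phi> differentiable_on UNIV" using Ck[of 0] Ck[of "Suc 0"] by auto
qed

lemma test_function_bounded:
  assumes "\<phi> \<in> test_functions l"
  shows "\<exists>B. \<forall>z. \<bar>\<phi> z\<bar> \<le> B"
proof -
  let ?K = "closure {z. \<phi> z \<noteq> 0}"
  have "compact (\<phi> ` ?K)"
    using test_functionD[OF assms] by (intro compact_continuous_image) (auto intro: continuous_on_subset)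
  then obtain B where B: "\<forall>y\<in>\<phi> ` ?K. norm y \<le> B" using compact_imp_bounded bounded_iff by blast
  have "\<bar>\<phi> z\<bar> \<le> \<bar>B\<bar>" for z
  proof (cases "\<phi> z = 0")
    case False
    then have "z \<in> ?K" by (rule in_support_closure)
    then have "norm (\<phi> z) \<le> B" using B by blast
    then show ?thesis by simp
  qed simp
  then show ?thesis by blast
qed

lemma test_function_measurable: "\<phi> \<in> test_functions l \<Longrightarrow> \<phi> \<in> borel_measurable borel"
  using test_functionD by (intro borel_measurable_continuous_onI) blast

lemma test_function_L2:
  assumes "\<phi> \<in> test_functions l"
  shows "\<phi> \<in> L2 l'"
proof -
  obtain B where "\<forall>z. \<bar>\<phi> z\<bar> \<le> B" using test_function_bounded[OF assms] by blast
  then show ?thesis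
    by (intro bounded_L2[of _ _ B] borel_measurable_plate test_function_measurable[OF assms]) auto
qed

lemma partial_x:
  assumes "f differentiable_on UNIV"
  shows "((\<lambda>t. f (t, y)) has_real_derivative dx f (x, y)) (at x)"
proof -
  have "f differentiable (at (x, y))" using assms by (simp add: differentiable_on_def)
  moreover have "(\<lambda>t. (t, y)) differentiable (at x)" by (intro differentiable_Pair) auto
  ultimately have "(\<lambda>t. f (t, y)) differentiable (at x)"
    using differentiable_chain_at[of "\<lambda>t. (t, y)" x f] by (simp add: o_def)
  then show ?thesis unfolding dx_def
    using DERIV_deriv_iff_real_differentiable by auto
qed

lemma partial_y:
  assumes "f differentiable_on UNIV"
  shows "((\<lambda>t. f (x, t)) has_real_derivative dy f (x, y)) (at y)"
proof -
  have "f differentiable (at (x, y))" using assms by (simp add: differentiable_on_def)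
  moreover have "(\<lambda>t. (x, t)) differentiable (at y)" by (intro differentiable_Pair) auto
  ultimately have "(\<lambda>t. f (x, t)) differentiable (at y)"
    using differentiable_chain_at[of "\<lambda>t. (x, t)" y f] by (simp add: o_def)
  then show ?thesis unfolding dy_def
    using DERIV_deriv_iff_real_differentiable by auto
qed

lemma dx_mult:
  assumes "f differentiable_on UNIV" "g differentiable_on UNIV"
  shows "dx (\<lambda>z. f z * g z) = (\<lambda>z. dx f z * g z + dx g z * f z)"
    and "dy (\<lambda>z. f z * g z) = (\<lambda>z. dy f z * g z + dy g z * f z)"
proof -
  have "dx (\<lambda>z. f z * g z) (x, y) = dx f (x, y) * g (x, y) + dx g (x, y) * f (x, y)" for x y
    unfolding dx_def[of "\<lambda>z. f z * g z"]
    using DERIV_imp_deriv[OF DERIV_mult[OF partial_x[OF assms(1)] partial_x[OF assms(2)]]] by simp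
  then show "dx (\<lambda>z. f z * g z) = (\<lambda>z. dx f z * g z + dx g z * f z)" by auto
  have "dy (\<lambda>z. f z * g z) (x, y) = dy f (x, y) * g (x, y) + dy g (x, y) * f (x, y)" for x y
    unfolding dy_def[of "\<lambda>z. f z * g z"]
    using DERIV_imp_deriv[OF DERIV_mult[OF partial_y[OF assms(1)] partial_y[OF assms(2)]]] by simp
  then show "dy (\<lambda>z. f z * g z) = (\<lambda>z. dy f z * g z + dy g z * f z)" by auto
qed

lemma dx_add:
  assumes "f differentiable_on UNIV" "g differentiable_on UNIV"
  shows "dx (\<lambda>z. f z + g z) = (\<lambda>z. dx f z + dx g z)"
    and "dy (\<lambda>z. f z + g z) = (\<lambda>z. dy f z + dy g z)"
proof -
  have "dx (\<lambda>z. f z + g z) (x, y) = dx f (x, y) + dx g (x, y)" for x y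
    unfolding dx_def[of "\<lambda>z. f z + g z"]
    using DERIV_imp_deriv[OF DERIV_add[OF partial_x[OF assms(1)] partial_x[OF assms(2)]]] by simp
  then show "dx (\<lambda>z. f z + g z) = (\<lambda>z. dx f z + dx g z)" by auto
  have "dy (\<lambda>z. f z + g z) (x, y) = dy f (x, y) + dy g (x, y)" for x y
    unfolding dy_def[of "\<lambda>z. f z + g z"]
    using DERIV_imp_deriv[OF DERIV_add[OF partial_y[OF assms(1)] partial_y[OF assms(2)]]] by simp
  then show "dy (\<lambda>z. f z + g z) = (\<lambda>z. dy f z + dy g z)" by auto
qed

lemma Ck_Suc_imp: "Ck (Suc k) f \<Longrightarrow> Ck k f"
proof (induction k arbitrary: f)
  case (Suc k)
  have "f differentiable_on UNIV" "Ck (Suc k) (dx f)" "Ck (Suc k) (dy f)"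
    using Suc.prems by (simp_all only: Ck.simps(2))
  from this(1) Suc.IH[OF this(2)] Suc.IH[OF this(3)] show ?case by simp
qed (simp add: differentiable_imp_continuous_on)

lemma Ck_add: "Ck k f \<Longrightarrow> Ck k g \<Longrightarrow> Ck k (\<lambda>z. f z + g z)"
  by (induction k arbitrary: f g) (auto simp: dx_add intro: continuous_intros differentiable_on_add)

lemma Ck_mult: "Ck k f \<Longrightarrow> Ck k g \<Longrightarrow> Ck k (\<lambda>z. f z * g z)"
proof (induction k arbitrary: f g)
  case (Suc k)
  have "Ck k f" "Ck k g" using Suc.prems by (auto intro: Ck_Suc_imp simp del: Ck.simps)
  with Suc show ?case by (auto simp: dx_mult intro!: Ck_add differentiable_on_mult)
qed (auto intro: continuous_intros)

lemma Ck_const: "Ck k (\<lambda>_. c)"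
proof (induction k arbitrary: c)
  case (Suc k)
  have "dx (\<lambda>_. c) = (\<lambda>_. 0)" "dy (\<lambda>_. c) = (\<lambda>_. 0)" by (auto simp: dx_def dy_def)
  with Suc show ?case by simp
qed auto

lemma dx_reflect: "dx (\<lambda>z. f (reflect z)) = (\<lambda>z. dx f (reflect z))"
  by (auto simp: dx_def reflect_def)

lemma dy_reflect:
  assumes "f differentiable_on UNIV"
  shows "dy (\<lambda>z. f (reflect z)) = (\<lambda>z. - 1 * dy f (reflect z))"
proof -
  have "dy (\<lambda>z. f (reflect z)) (x, y) = - 1 * dy f (x, - y)" for x y
  proof -
    have "((\<lambda>t. f (x, - t)) has_real_derivative dy f (x, - y) * (- 1)) (at y)"
      by (rule DERIV_chain2[where f = "\<lambda>t. f (x, t)" and g = uminus, OF partial_y[OF assms]])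
        (auto intro!: derivative_eq_intros)
    then show ?thesis unfolding dy_def[of "\<lambda>z. f (reflect z)"] by (simp add: DERIV_imp_deriv)
  qed
  then show ?thesis by auto
qed

lemma Ck_reflect:
  assumes "Ck k f"
  shows "Ck k (\<lambda>z. f (reflect z))"
  using assms
proof (induction k arbitrary: f)
  case 0
  then show ?case by (auto intro: continuous_on_compose2[OF _ continuous_reflect])
next
  case (Suc k)
  have f: "f differentiable_on UNIV" using Suc.prems by simp
  have "linear reflect" by (rule linearI) (auto simp: reflect_def)
  then have "reflect differentiable at z" for z by (rule linear_imp_differentiable)
  moreover have "f differentiable at (reflect z)" for z
    using f unfolding differentiable_on_def by blast
  ultimately have "(\<lambda>z. f (reflect z)) differentiable at z" for z
    using differentiable_chain_at[of reflect z f] by (simp add: o_def)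
  moreover have "Ck k (dx (\<lambda>z. f (reflect z)))" "Ck k (dy (\<lambda>z. f (reflect z)))"
    unfolding dx_reflect dy_reflect[OF f]
    using Suc.IH[of "dx f"] Suc.IH[of "dy f"] Suc.prems Ck_mult[OF Ck_const, of k "\<lambda>z. dy f (reflect z)" "- 1"]
    by simp_all
  ultimately show ?case by (simp add: differentiable_on_def)
qed

lemma test_function_subsupport:
  assumes "\<And>k. Ck k \<psi>" "{z. \<psi> z \<noteq> 0} \<subseteq> closure {z. \<phi> z \<noteq> 0}" "\<phi> \<in> test_functions l"
  shows "\<psi> \<in> test_functions l"
proof -
  have sub: "closure {z. \<psi> z \<noteq> 0} \<subseteq> closure {z. \<phi> z \<noteq> 0}" using assms(2) by (intro closure_minimal) auto
  then have "closure {z. \<phi> z \<noteq> 0} \<inter> closure {z. \<psi> z \<noteq> 0} = closure {z. \<psi> z \<noteq> 0}" by blast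
  then have "compact (closure {z. \<psi> z \<noteq> 0})"
    using compact_Int_closed[OF test_functionD(2)[OF assms(3)] closed_closure] by metis
  then show ?thesis using assms(1) sub test_functionD(3)[OF assms(3)] by (auto simp: test_functions_def)
qed

lemma test_function_mult:
  assumes "\<And>k. Ck k f" "\<phi> \<in> test_functions l"
  shows "(\<lambda>z. f z * \<phi> z) \<in> test_functions l"
proof (rule test_function_subsupport[OF _ _ assms(2)])
  have "{z. f z * \<phi> z \<noteq> 0} \<subseteq> {z. \<phi> z \<noteq> 0}" by auto
  then show "{z. f z * \<phi> z \<noteq> 0} \<subseteq> closure {z. \<phi> z \<noteq> 0}" using in_support_closure[of \<phi>] by auto
qed (use assms test_functionD in \<open>auto intro: Ck_mult\<close>)

lemma eventually_zero_off_support: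
  assumes "z \<notin> closure {z. \<phi> z \<noteq> (0 :: real)}" and "isCont h t" "h t = z"
  shows "\<forall>\<^sub>F s in nhds t. \<phi> (h s) = 0"
proof -
  have "open (- closure {z. \<phi> z \<noteq> 0})" by auto
  then have "\<forall>\<^sub>F s in nhds t. h s \<in> - closure {z. \<phi> z \<noteq> 0}"
    using assms by (intro topological_tendstoD[of h "h t"]) (auto simp: isCont_def tendsto_at_iff_tendsto_nhds)
  then show ?thesis by eventually_elim (use in_support_closure in auto)
qed

lemma test_function_dx:
  assumes "\<phi> \<in> test_functions l"
  shows "dx \<phi> \<in> test_functions l" "dy \<phi> \<in> test_functions l"
proof -
  have Ck: "Ck k (dx \<phi>)" "Ck k (dy \<phi>)" for k using test_functionD(1)[OF assms, of "Suc k"] by auto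
  have "dx \<phi> (x, y) = 0" if "(x, y) \<notin> closure {z. \<phi> z \<noteq> 0}" for x y
  proof -
    have "\<forall>\<^sub>F s in nhds x. \<phi> (s, y) = 0"
      by (rule eventually_zero_off_support[OF that]) (auto intro!: continuous_intros)
    then have "deriv (\<lambda>s. \<phi> (s, y)) x = deriv (\<lambda>_. 0) x" by (intro deriv_cong_ev) auto
    then show ?thesis by (simp add: dx_def)
  qed
  then have "{z. dx \<phi> z \<noteq> 0} \<subseteq> closure {z. \<phi> z \<noteq> 0}" by auto
  from test_function_subsupport[OF Ck(1) this assms] show "dx \<phi> \<in> test_functions l" .
  have "dy \<phi> (x, y) = 0" if "(x, y) \<notin> closure {z. \<phi> z \<noteq> 0}" for x y
  proof -
    have "\<forall>\<^sub>F s in nhds y. \<phi> (x, s) = 0"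
      by (rule eventually_zero_off_support[OF that]) (auto intro!: continuous_intros)
    then have "deriv (\<lambda>s. \<phi> (x, s)) y = deriv (\<lambda>_. 0) y" by (intro deriv_cong_ev) auto
    then show ?thesis by (simp add: dy_def)
  qed
  then have "{z. dy \<phi> z \<noteq> 0} \<subseteq> closure {z. \<phi> z \<noteq> 0}" by auto
  from test_function_subsupport[OF Ck(2) this assms] show "dy \<phi> \<in> test_functions l" .
qed

lemma test_function_iterated:
  assumes "\<phi> \<in> test_functions l"
  shows "(dx ^^ m) ((dy ^^ n) \<phi>) \<in> test_functions l"
proof -
  have "(dy ^^ n) \<phi> \<in> test_functions l" by (induction n) (auto intro: test_function_dx assms)
  then show ?thesis by (induction m) (auto intro: test_function_dx)
qed

lemma test_function_reflect:
  assumes "\<phi> \<in> test_functions l"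
  shows "(\<lambda>z. \<phi> (reflect z)) \<in> test_functions l"
proof -
  let ?K = "closure {z. \<phi> z \<noteq> 0}"
  have K: "compact (reflect ` ?K)"
    by (intro compact_continuous_image continuous_reflect test_functionD(2)[OF assms])
  have "{z. \<phi> (reflect z) \<noteq> 0} \<subseteq> reflect ` ?K"
  proof
    fix z assume "z \<in> {z. \<phi> (reflect z) \<noteq> 0}"
    then have "reflect z \<in> ?K" by (simp add: in_support_closure)
    then have "reflect (reflect z) \<in> reflect ` ?K" by blast
    then show "z \<in> reflect ` ?K" by simp
  qed
  then have sub: "closure {z. \<phi> (reflect z) \<noteq> 0} \<subseteq> reflect ` ?K"
    by (intro closure_minimal compact_imp_closed K)
  then have "reflect ` ?K \<inter> closure {z. \<phi> (reflect z) \<noteq> 0} = closure {z. \<phi> (reflect z) \<noteq> 0}" by blast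
  then have "compact (closure {z. \<phi> (reflect z) \<noteq> 0})"
    using compact_Int_closed[OF K closed_closure] by metis
  moreover have "reflect ` ?K \<subseteq> Omega l"
  proof
    fix z assume "z \<in> reflect ` ?K"
    then obtain w where "w \<in> ?K" "z = reflect w" by blast
    then show "z \<in> Omega l" using test_functionD(3)[OF assms] by auto
  qed
  ultimately show ?thesis using sub Ck_reflect[OF test_functionD(1)[OF assms]]
    by (auto simp: test_functions_def)
qed

text \<open>Trigonometric products are no test functions; with cutoffs they become such, and the
  effect of the cutoffs is removed later by letting k tend to infinity.\<close>

lemma cutoff_test_function:
  assumes f: "smooth f" and g: "smooth g" and abcd: "0 \<le> a" "b \<le> pi" "- l \<le> c" "d \<le> l"
  shows "tensor (\<lambda>x. f x * cutoff a b k x) (\<lambda>y. g y * cutoff c d k y) \<in> test_functions l"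
proof (rule tensor_test_function)
  show "1 / real (Suc k) > 0" by simp
qed (use cutoff_support[of _ _ k] abcd f g in \<open>fastforce intro: smooth_mult smooth_cutoff\<close>)+

section \<open>Uniqueness of weak derivatives\<close>

lemma box_real2: "box (a, c) (b, d) = {a<..<b} \<times> {c<..<d}" for a b c d :: real
  by (auto simp: box_def Basis_prod_def)

lemma AE_plate_iff: "(AE z in plate l. P z) \<longleftrightarrow> (AE z in lborel. z \<in> Omega l \<longrightarrow> P z)"
  unfolding plate_def by (intro AE_restrict_space_iff) auto

lemma AE_plate_I: "(\<And>z. z \<in> Omega l \<Longrightarrow> P z) \<Longrightarrow> AE z in plate l. P z"
  using AE_I2[of "plate l" P] by simp

lemma integral_plate:
  fixes f :: "real \<times> real \<Rightarrow> real"
  shows "(LINT z|plate l. f z) = (LINT z|lborel. indicator (Omega l) z * f z)"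
  unfolding plate_def by (subst integral_restrict_space) auto

lemma integrable_plate_iff:
  fixes f :: "real \<times> real \<Rightarrow> real"
  shows "integrable (plate l) f \<longleftrightarrow> integrable lborel (\<lambda>z. indicator (Omega l) z * f z)"
  unfolding plate_def by (subst integrable_restrict_space) auto

text \<open>The positive and negative parts of w are densities of two measures that agree on boxes.
  Boxes generate the Borel sets and are stable under intersection, so the measures agree, and then
  so do the densities.\<close>

lemma AE_zero_if_box_integrals_zero:
  fixes w :: "real \<times> real \<Rightarrow> real"
  assumes w: "integrable lborel w" and box: "\<And>a b. (LINT z|lborel. w z * indicator (box a b) z) = 0"
  shows "AE z in lborel. w z = 0"
proof -
  define p where "p z = ennreal (max 0 (w z))" for z
  define m where "m z = ennreal (max 0 (- w z))" for z
  have [measurable]: "w \<in> borel_measurable borel" using w by (simp add: borel_measurable_integrable)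
  have [measurable]: "p \<in> borel_measurable lborel" "m \<in> borel_measurable lborel"
    unfolding p_def m_def by measurable
  have int: "integrable lborel (\<lambda>z. max 0 (w z) * indicator A z)" "integrable lborel (\<lambda>z. max 0 (- w z) * indicator A z)"
    if "A \<in> sets borel" for A
    by (rule Bochner_Integration.integrable_bound[OF w]; use that in \<open>auto simp: indicator_def\<close>)+
  have emeasure: "emeasure (density lborel p) A = ennreal (LINT z|lborel. max 0 (w z) * indicator A z)"
    "emeasure (density lborel m) A = ennreal (LINT z|lborel. max 0 (- w z) * indicator A z)"
    if "A \<in> sets borel" for A
    using that int[OF that]
    by (auto simp: emeasure_density p_def m_def nn_integral_eq_integral[symmetric] ennreal_mult' ennreal_indicator)
  have "density lborel p = density lborel m"
  proof (rule measure_eqI_generator_eq[where E = "range (\<lambda>(a, b). box a b)" and \<Omega> = UNIV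
        and A = "\<lambda>n. box (- real n, - real n) (real n, real n)"])
    show "Int_stable (range (\<lambda>(a, b). box a b :: (real \<times> real) set))"
      by (auto simp: Int_stable_def box_Int_box)
    show "emeasure (density lborel p) X = emeasure (density lborel m) X"
      if X: "X \<in> range (\<lambda>(a, b). box a b)" for X
    proof -
      from X have XB: "X \<in> sets borel" by auto
      have "(LINT z|lborel. max 0 (w z) * indicator X z) - (LINT z|lborel. max 0 (- w z) * indicator X z)
          = (LINT z|lborel. w z * indicator X z)"
        unfolding Bochner_Integration.integral_diff[OF int[OF XB], symmetric]
        by (intro Bochner_Integration.integral_cong) (auto simp: max_def indicator_def)
      also have "\<dots> = 0" using X box by auto
      finally show ?thesis by (simp add: emeasure XB)
    qed
    show "(\<Union>n. box (- real n, - real n) (real n, real n)) = (UNIV :: (real \<times> real) set)"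
    proof safe
      fix x y :: real
      obtain n where "max \<bar>x\<bar> \<bar>y\<bar> < real n" using reals_Archimedean2 by blast
      then show "(x, y) \<in> (\<Union>n. box (- real n, - real n) (real n, real n))"
        by (intro UN_I[of n]) (auto simp: box_real2)
    qed auto
    show "emeasure (density lborel p) (box (- real n, - real n) (real n, real n)) \<noteq> \<infinity>" for n
      by (simp add: emeasure)
    show "range (\<lambda>n. box (- real n, - real n) (real n, real n)) \<subseteq> range (\<lambda>(a, b). box a b :: (real \<times> real) set)"
      by auto
  qed (auto simp: borel_eq_box)
  then have "AE z in lborel. p z = m z"
    by (intro sigma_finite_measure.density_unique[OF sigma_finite_lborel]) auto
  then show ?thesis by eventually_elim (auto simp: p_def m_def max_def split: if_splits)
qed

text \<open>The fundamental lemma of the calculus of variations. Products of one-dimensional cutoffs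
  converge boundedly to indicators of boxes, so vanishing against test functions implies vanishing
  on boxes.\<close>

lemma AE_zero_if_test_integrals_zero:
  assumes w: "integrable (plate l) w" and zero: "\<And>\<phi>. \<phi> \<in> test_functions l \<Longrightarrow> (LINT z|plate l. w z * \<phi> z) = 0"
  shows "AE z in plate l. w z = 0"
proof -
  define v where "v z = indicator (Omega l) z * w z" for z
  have v: "integrable lborel v" using w unfolding v_def integrable_plate_iff .
  have "(LINT z|lborel. v z * indicator (box p q) z) = 0" for p q
  proof -
    obtain a c b d where pq: "p = (a, c)" "q = (b, d)" by (metis surj_pair)
    \<comment> \<open>The box is clipped to the plate. If nothing is left of it, the cutoff products
      and the indicator are all zero.\<close>
    define a' b' c' d' where "a' = max 0 a" "b' = min pi b" "c' = max (- l) c" "d' = min l d"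
    have ind: "indicator (Omega l) z * indicator (box p q) z = (indicator {a'<..<b'} (fst z) * indicator {c'<..<d'} (snd z) :: real)" for z
      by (cases z) (auto simp: pq box_real2 Omega_def a'_b'_c'_d'_def indicator_def)
    let ?\<phi> = "\<lambda>k. tensor (\<lambda>x. 1 * cutoff a' b' k x) (\<lambda>y. 1 * cutoff c' d' k y)"
    have test: "?\<phi> k \<in> test_functions l" for k
      by (intro cutoff_test_function smooth_const) (auto simp: a'_b'_c'_d'_def)
    have "(\<lambda>k. LINT z|plate l. w z * ?\<phi> k z) \<longlonglongrightarrow> (LINT z|plate l. w z * (indicator {a'<..<b'} (fst z) * indicator {c'<..<d'} (snd z)))"
    proof (rule integral_dominated_convergence[where w = "\<lambda>z. \<bar>w z\<bar>"])
      have [measurable]: "w \<in> borel_measurable (plate l)" using w by auto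
      have [measurable]: "?\<phi> k \<in> borel_measurable (plate l)" for k
        by (intro borel_measurable_plate borel_measurable_continuous_onI continuous_tensor smooth_mult smooth_const smooth_cutoff)
      have [measurable]: "(\<lambda>z. indicator {a'<..<b'} (fst z) * indicator {c'<..<d'} (snd z) :: real) \<in> borel_measurable (plate l)"
        by (intro borel_measurable_plate borel_measurable_times measurable_compose[OF borel_measurable_continuous_onI[OF continuous_on_fst[OF continuous_on_id]]]
            measurable_compose[OF borel_measurable_continuous_onI[OF continuous_on_snd[OF continuous_on_id]]] borel_measurable_indicator) auto
      show "(\<lambda>z. w z * ?\<phi> k z) \<in> borel_measurable (plate l)" for k by measurable
      show "(\<lambda>z. w z * (indicator {a'<..<b'} (fst z) * indicator {c'<..<d'} (snd z))) \<in> borel_measurable (plate l)" by measurable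
      show "integrable (plate l) (\<lambda>z. \<bar>w z\<bar>)" using w by simp
      show "AE z in plate l. (\<lambda>k. w z * ?\<phi> k z) \<longlonglongrightarrow> w z * (indicator {a'<..<b'} (fst z) * indicator {c'<..<d'} (snd z))"
        unfolding tensor_def mult_1 by (intro always_eventually allI tendsto_intros cutoff_tendsto)
      show "AE z in plate l. norm (w z * ?\<phi> k z) \<le> \<bar>w z\<bar>" for k
      proof (intro always_eventually allI)
        fix z
        have "\<bar>?\<phi> k z\<bar> \<le> 1 * 1" unfolding tensor_def abs_mult mult_1
          using cutoff_bounds[of a' b' k "fst z"] cutoff_bounds[of c' d' k "snd z"] by (intro mult_le_one) auto
        then show "norm (w z * ?\<phi> k z) \<le> \<bar>w z\<bar>" by (simp add: abs_mult mult_left_le)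
      qed
    qed
    then have "(LINT z|plate l. w z * (indicator {a'<..<b'} (fst z) * indicator {c'<..<d'} (snd z))) = 0"
      using zero[OF test] by (simp add: LIMSEQ_const_iff)
    moreover have "(LINT z|lborel. v z * indicator (box p q) z) =
        (LINT z|plate l. w z * (indicator {a'<..<b'} (fst z) * indicator {c'<..<d'} (snd z)))"
      unfolding integral_plate ind[symmetric] v_def
      by (intro Bochner_Integration.integral_cong) (auto simp: indicator_def)
    ultimately show ?thesis by simp
  qed
  from AE_zero_if_box_integrals_zero[OF v this] show ?thesis
    unfolding AE_plate_iff by eventually_elim (auto simp: v_def)
qed

lemma weak_deriv_unique:
  assumes "g \<in> L2 l" "h \<in> L2 l" "is_weak_deriv l m n u g" "is_weak_deriv l m n u h"
  shows "AE z in plate l. g z = h z"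
proof -
  have "AE z in plate l. g z - h z = 0"
  proof (rule AE_zero_if_test_integrals_zero)
    show "integrable (plate l) (\<lambda>z. g z - h z)"
      using L2_integrable assms by (intro Bochner_Integration.integrable_diff) auto
    fix \<phi> assume \<phi>: "\<phi> \<in> test_functions l"
    have "\<phi> \<in> L2 l" by (rule test_function_L2[OF \<phi>])
    then show "(LINT z|plate l. (g z - h z) * \<phi> z) = 0"
      using assms(3,4) \<phi> L2_mult_integrable assms(1,2)
      by (simp add: is_weak_deriv_def left_diff_distrib)
  qed
  then show ?thesis by eventually_elim simp
qed

section \<open>Integration by parts and the calculus of weak derivatives\<close>

text \<open>Fubini reduces the claim to lines, on which the integral of the derivative is a
  difference of two values outside the support.\<close>

lemma integral_dx_dy_test_function:
  assumes "\<phi> \<in> test_functions l"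
  shows "(LINT z|plate l. dx \<phi> z) = 0" "(LINT z|plate l. dy \<phi> z) = 0"
proof -
  obtain R where R: "\<And>z. \<phi> z \<noteq> 0 \<Longrightarrow> norm z \<le> R" "R \<ge> 0"
  proof -
    have "bounded {z. \<phi> z \<noteq> 0}"
      using bounded_subset[OF compact_imp_bounded[OF test_functionD(2)[OF assms]] closure_subset] .
    then obtain R where "R > 0" "\<forall>z\<in>{z. \<phi> z \<noteq> 0}. norm z \<le> R" unfolding bounded_pos by blast
    then show thesis by (intro that[of R]) auto
  qed
  have zero: "\<phi> (x, y) = 0" if "\<bar>x\<bar> > R \<or> \<bar>y\<bar> > R" for x y
    using R(1)[of "(x, y)"] norm_fst_le[of x y] norm_snd_le[of y x] that by force
  have int: "integrable lborel \<psi>" "(LINT z|plate l. \<psi> z) = (LINT z|lborel. \<psi> z)"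
    if \<psi>: "\<psi> \<in> test_functions l" for \<psi>
  proof -
    have *: "indicator (Omega l) z * \<psi> z = \<psi> z" for z
      using test_functionD(6)[OF \<psi>, of z] by (auto simp: indicator_def)
    have "integrable (plate l) \<psi>" by (intro L2_integrable test_function_L2[OF \<psi>])
    then show "integrable lborel \<psi>" "(LINT z|plate l. \<psi> z) = (LINT z|lborel. \<psi> z)"
      unfolding integrable_plate_iff integral_plate * by auto
  qed
  have line: "(LINT x|lborel. f' x) = 0"
    if "\<And>x. (f has_real_derivative f' x) (at x)" "\<And>x. isCont f' x" "\<And>x. \<bar>x\<bar> > R \<Longrightarrow> f x = 0" for f f' :: "real \<Rightarrow> real"
  proof -
    have f'0: "f' x = 0" if "\<bar>x\<bar> > R" for x
    proof -
      have "x \<in> {t. R < \<bar>t\<bar>}" using that by simp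
      moreover have "open {t::real. R < \<bar>t\<bar>}" by (intro open_Collect_less continuous_intros)
      ultimately have "deriv f x = 0" using \<open>\<And>x. \<bar>x\<bar> > R \<Longrightarrow> f x = 0\<close>
        by (intro deriv_locally_const[of "{t. R < \<bar>t\<bar>}" x f 0]) auto
      moreover have "deriv f x = f' x" by (rule DERIV_imp_deriv) fact
      ultimately show ?thesis by simp
    qed
    \<comment> \<open>The interval is wider than the support bound by 1, because \<open>f\<close> is
      known to vanish only where the modulus is strictly above \<open>R\<close>.\<close>
    have "(LINT x|lborel. f' x) = (LINT x|lborel. f' x * indicator {- R - 1..R + 1} x)"
    proof (intro Bochner_Integration.integral_cong refl)
      fix x show "f' x = f' x * indicator {- R - 1..R + 1} x"
        using f'0[of x] by (cases "\<bar>x\<bar> > R") (auto simp: indicator_def)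
    qed
    also have "\<dots> = f (R + 1) - f (- R - 1)"
      by (rule integral_FTC_Icc_real) (use that R(2) in auto)
    also have "\<dots> = 0" using that(3)[of "R + 1"] that(3)[of "- R - 1"] R(2) by simp
    finally show ?thesis .
  qed
  have cont: "isCont \<psi> z" if "\<psi> \<in> test_functions l" for \<psi> z
    using test_functionD(4)[OF that] continuous_on_eq_continuous_at[OF open_UNIV, of \<psi>] by blast
  have cx: "isCont (\<lambda>t. \<psi> (t, y)) x" and cy: "isCont (\<lambda>t. \<psi> (x, t)) y" if "\<psi> \<in> test_functions l" for \<psi> x y
    by (rule isCont_o2[where g = \<psi> and f = "\<lambda>t. (t, y)"], auto intro!: continuous_intros cont[OF that])
      (rule isCont_o2[where g = \<psi> and f = "\<lambda>t. (x, t)"], auto intro!: continuous_intros cont[OF that])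
  note d = test_function_dx[OF assms]
  have "(LINT z|lborel. dx \<phi> z) = (LINT y|lborel. LINT x|lborel. dx \<phi> (x, y))"
    using lborel_pair.integral_snd[of "\<lambda>x y. dx \<phi> (x, y)"] int(1)[OF d(1)] by (simp add: lborel_prod)
  also have "\<dots> = 0"
    using line[OF partial_x[OF test_functionD(5)[OF assms]] cx[OF d(1)]] zero by simp
  finally show "(LINT z|plate l. dx \<phi> z) = 0" using int(2)[OF d(1)] by simp
  have "(LINT z|lborel. dy \<phi> z) = (LINT x|lborel. LINT y|lborel. dy \<phi> (x, y))"
    using lborel_pair.integral_fst'[of "\<lambda>z. dy \<phi> z"] int(1)[OF d(2)] by (simp add: lborel_prod)
  also have "\<dots> = 0"
    using line[OF partial_y[OF test_functionD(5)[OF assms]] cy[OF d(2)]] zero by simp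
  finally show "(LINT z|plate l. dy \<phi> z) = 0" using int(2)[OF d(2)] by simp
qed

lemma tensor_L2:
  assumes "smooth f" "smooth g"
  shows "tensor f g \<in> L2 l"
proof -
  have "compact ({0..pi} \<times> {- l..l})" by (intro compact_Times) auto
  then have "compact (tensor f g ` ({0..pi} \<times> {- l..l}))"
    by (intro compact_continuous_image continuous_tensor assms)
  then obtain B where B: "\<forall>y\<in>tensor f g ` ({0..pi} \<times> {- l..l}). norm y \<le> B"
    using compact_imp_bounded bounded_iff by blast
  have bnd: "\<bar>tensor f g z\<bar> \<le> B" if "z \<in> Omega l" for z
  proof -
    have "z \<in> {0..pi} \<times> {- l..l}" using that by (auto simp: Omega_def)
    then show ?thesis using B by auto
  qed
  show "tensor f g \<in> L2 l"
    by (rule bounded_L2[of _ _ B])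
      (auto intro!: borel_measurable_plate borel_measurable_continuous_onI continuous_tensor assms AE_plate_I bnd)
qed

text \<open>The tensor itself has no compact support, but its product with a test function is a test
  function, and the integral of a derivative of that product vanishes.\<close>

lemma integration_by_parts_tensor:
  assumes fg: "smooth f" "smooth g" and \<phi>: "\<phi> \<in> test_functions l"
  shows "(LINT z|plate l. tensor f g z * dx \<phi> z) = - (LINT z|plate l. tensor (deriv f) g z * \<phi> z)"
    and "(LINT z|plate l. tensor f g z * dy \<phi> z) = - (LINT z|plate l. tensor f (deriv g) z * \<phi> z)"
proof -
  have test: "(\<lambda>z. tensor f g z * \<phi> z) \<in> test_functions l"
    by (intro test_function_mult Ck_tensor fg \<phi>)
  note diff = tensor_differentiable[OF fg] test_functionD(5)[OF \<phi>]
  note int = L2_mult_integrable[OF tensor_L2 test_function_L2[where l = l and l' = l]]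
  have i: "integrable (plate l) (\<lambda>z. tensor (deriv f) g z * \<phi> z)" "integrable (plate l) (\<lambda>z. tensor f g z * dx \<phi> z)"
     "integrable (plate l) (\<lambda>z. tensor f (deriv g) z * \<phi> z)" "integrable (plate l) (\<lambda>z. tensor f g z * dy \<phi> z)"
    by (intro int smooth_deriv fg test_function_dx[OF \<phi>] \<phi>)+
  have "(LINT z|plate l. tensor (deriv f) g z * \<phi> z + tensor f g z * dx \<phi> z) = 0"
    using integral_dx_dy_test_function(1)[OF test]
    unfolding dx_mult(1)[OF diff] dx_tensor[OF fg(1)] by (simp add: mult.commute)
  then show "(LINT z|plate l. tensor f g z * dx \<phi> z) = - (LINT z|plate l. tensor (deriv f) g z * \<phi> z)"
    using i by simp
  have "(LINT z|plate l. tensor f (deriv g) z * \<phi> z + tensor f g z * dy \<phi> z) = 0"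
    using integral_dx_dy_test_function(2)[OF test]
    unfolding dx_mult(2)[OF diff] dy_tensor[OF fg(2)] by (simp add: mult.commute)
  then show "(LINT z|plate l. tensor f g z * dy \<phi> z) = - (LINT z|plate l. tensor f (deriv g) z * \<phi> z)"
    using i by simp
qed

lemma smooth_iterated: "smooth f \<Longrightarrow> smooth ((deriv ^^ n) f)"
  by (induction n) (auto intro: smooth_deriv)

lemma weak_deriv_tensor:
  assumes "smooth f" "smooth g"
  shows "is_weak_deriv l m n (tensor f g) (tensor ((deriv ^^ m) f) ((deriv ^^ n) g))"
  unfolding is_weak_deriv_def
proof
  fix \<phi> assume \<phi>: "\<phi> \<in> test_functions l"
  have Y: "(LINT z|plate l. tensor f g z * (dy ^^ n) \<phi> z) = (-1) ^ n * (LINT z|plate l. tensor f ((deriv ^^ n) g) z * \<phi> z)"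
    if "smooth f" "smooth g" "\<phi> \<in> test_functions l" for f g \<phi>
    using that
  proof (induction n arbitrary: g)
    case (Suc n)
    have "(dy ^^ n) \<phi> \<in> test_functions l"
      using test_function_iterated[OF Suc.prems(3), of 0 n] by simp
    then have "(LINT z|plate l. tensor f g z * (dy ^^ Suc n) \<phi> z) = - (LINT z|plate l. tensor f (deriv g) z * (dy ^^ n) \<phi> z)"
      using integration_by_parts_tensor(2)[OF Suc.prems(1,2)] by simp
    also have "\<dots> = (-1) ^ Suc n * (LINT z|plate l. tensor f ((deriv ^^ n) (deriv g)) z * \<phi> z)"
      using Suc by (simp add: smooth_deriv)
    finally show ?case by (simp only: funpow_Suc_right o_apply)
  qed simp
  have X: "(LINT z|plate l. tensor f g z * (dx ^^ m) \<psi> z) = (-1) ^ m * (LINT z|plate l. tensor ((deriv ^^ m) f) g z * \<psi> z)"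
    if "smooth f" "smooth g" "\<psi> \<in> test_functions l" for f g \<psi>
    using that
  proof (induction m arbitrary: f)
    case (Suc m)
    have "(dx ^^ m) \<psi> \<in> test_functions l"
      using test_function_iterated[OF Suc.prems(3), of m 0] by simp
    then have "(LINT z|plate l. tensor f g z * (dx ^^ Suc m) \<psi> z) = - (LINT z|plate l. tensor (deriv f) g z * (dx ^^ m) \<psi> z)"
      using integration_by_parts_tensor(1)[OF Suc.prems(1,2)] by simp
    also have "\<dots> = (-1) ^ Suc m * (LINT z|plate l. tensor ((deriv ^^ m) (deriv f)) g z * \<psi> z)"
      using Suc by (simp add: smooth_deriv)
    finally show ?case by (simp only: funpow_Suc_right o_apply)
  qed simp
  have "(dy ^^ n) \<phi> \<in> test_functions l" using test_function_iterated[OF \<phi>, of 0 n] by simp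
  from X[OF assms this] Y[OF smooth_iterated[OF assms(1)] assms(2) \<phi>]
  show "(LINT z|plate l. tensor f g z * (dx ^^ m) ((dy ^^ n) \<phi>) z) =
      (-1) ^ (m + n) * (LINT z|plate l. tensor ((deriv ^^ m) f) ((deriv ^^ n) g) z * \<phi> z)"
    by (simp add: power_add)
qed

lemma weak_deriv_lincomb:
  assumes "u \<in> L2 l" "v \<in> L2 l" "g \<in> L2 l" "h \<in> L2 l" "is_weak_deriv l m n u g" "is_weak_deriv l m n v h"
  shows "is_weak_deriv l m n (u + v) (g + h)" "is_weak_deriv l m n (c *\<^sub>R u) (c *\<^sub>R g)"
proof -
  have int: "integrable (plate l) (\<lambda>z. w z * (dx ^^ i) ((dy ^^ j) \<phi>) z)" if "\<phi> \<in> test_functions l" "w \<in> L2 l" for w i j \<phi>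
    by (intro L2_mult_integrable that test_function_L2[OF test_function_iterated[OF that(1)]])
  have int0: "integrable (plate l) (\<lambda>z. w z * \<phi> z)" if "\<phi> \<in> test_functions l" "w \<in> L2 l" for w \<phi>
    using int[OF that, of 0 0] by simp
  show "is_weak_deriv l m n (u + v) (g + h)"
    using assms(5,6) unfolding is_weak_deriv_def
    by (simp add: distrib_right int int0 assms(1-4) distrib_left)
  show "is_weak_deriv l m n (c *\<^sub>R u) (c *\<^sub>R g)"
    unfolding is_weak_deriv_def
  proof
    fix \<phi> assume "\<phi> \<in> test_functions l"
    then have "(LINT z|plate l. u z * (dx ^^ m) ((dy ^^ n) \<phi>) z) = (- 1) ^ (m + n) * (LINT z|plate l. g z * \<phi> z)"
      using assms(5) by (simp add: is_weak_deriv_def)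
    then show "(LINT z|plate l. (c *\<^sub>R u) z * (dx ^^ m) ((dy ^^ n) \<phi>) z) =
        (- 1) ^ (m + n) * (LINT z|plate l. (c *\<^sub>R g) z * \<phi> z)"
      by (simp add: mult.assoc)
  qed
qed

lemma weak_deriv_limit:
  assumes u: "\<And>k. u k \<in> L2 l" "U \<in> L2 l" "(\<lambda>k. ip l (u k - U) (u k - U)) \<longlonglongrightarrow> 0"
    and g: "\<And>k. g k \<in> L2 l" "G \<in> L2 l" "(\<lambda>k. ip l (g k - G) (g k - G)) \<longlonglongrightarrow> 0"
    and wd: "\<And>k. is_weak_deriv l m n (u k) (g k)"
  shows "is_weak_deriv l m n U G"
  unfolding is_weak_deriv_def
proof
  fix \<phi> assume \<phi>: "\<phi> \<in> test_functions l"
  let ?D = "(dx ^^ m) ((dy ^^ n) \<phi>)"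
  have "(\<lambda>k. ip l (u k) ?D) \<longlonglongrightarrow> ip l U ?D"
    by (intro L2.tendsto_left u test_function_L2[OF test_function_iterated[OF \<phi>]])
  moreover have "(\<lambda>k. (-1) ^ (m + n) * ip l (g k) \<phi>) \<longlonglongrightarrow> (-1) ^ (m + n) * ip l G \<phi>"
    by (intro tendsto_mult_left L2.tendsto_left g test_function_L2[OF \<phi>])
  moreover have "ip l (u k) ?D = (-1) ^ (m + n) * ip l (g k) \<phi>" for k
    using wd[of k] \<phi> unfolding is_weak_deriv_def ip_def by blast
  ultimately have "ip l U ?D = (-1) ^ (m + n) * ip l G \<phi>" by (simp add: LIMSEQ_unique)
  then show "(LINT z|plate l. U z * ?D z) = (-1) ^ (m + n) * (LINT z|plate l. G z * \<phi> z)"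
    by (simp add: ip_def)
qed

lemma weak_deriv_cong:
  assumes wd: "is_weak_deriv l m n u g" and ae: "AE z in plate l. u z = v z"
    and meas: "u \<in> borel_measurable (plate l)" "v \<in> borel_measurable (plate l)"
  shows "is_weak_deriv l m n v g"
  unfolding is_weak_deriv_def
proof
  fix \<phi> assume \<phi>: "\<phi> \<in> test_functions l"
  let ?D = "(dx ^^ m) ((dy ^^ n) \<phi>)"
  have [measurable]: "?D \<in> borel_measurable (plate l)"
    by (rule L2_measurable[OF test_function_L2[OF test_function_iterated[OF \<phi>]]])
  note [measurable] = meas
  have "(LINT z|plate l. v z * ?D z) = (LINT z|plate l. u z * ?D z)"
  proof (rule integral_cong_AE)
    show "AE z in plate l. v z * ?D z = u z * ?D z" using ae by eventually_elim simp
  qed measurable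
  then show "(LINT z|plate l. v z * ?D z) = (-1) ^ (m + n) * (LINT z|plate l. g z * \<phi> z)"
    using wd \<phi> by (simp add: is_weak_deriv_def)
qed

lemma L2_reflect: "u \<in> L2 l \<Longrightarrow> (\<lambda>z. u (reflect z)) \<in> L2 l"
  using integrable_reflect[of l "\<lambda>z. (u z)\<^sup>2"]
  by (auto simp: L2_def intro: measurable_compose[OF measurable_reflect_plate])

text \<open>Reflection commutes with x-derivatives and reverses the sign of each y-derivative. Being
  a measure-preserving involution, it can be moved onto the test function.\<close>

lemma weak_deriv_reflect:
  assumes u: "u \<in> L2 l" and g: "g \<in> L2 l" and wd: "is_weak_deriv l m n u g"
  shows "is_weak_deriv l m n (\<lambda>z. u (reflect z)) (\<lambda>z. (-1) ^ n * g (reflect z))"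
  unfolding is_weak_deriv_def
proof
  fix \<phi> assume \<phi>: "\<phi> \<in> test_functions l"
  let ?\<psi> = "\<lambda>z. \<phi> (reflect z)"
  have \<psi>: "?\<psi> \<in> test_functions l" by (rule test_function_reflect[OF \<phi>])
  have Y: "(dy ^^ n) (\<lambda>z. \<phi> (reflect z)) = (\<lambda>z. (-1) ^ n * (dy ^^ n) \<phi> (reflect z))"
  proof (induction n)
    case (Suc n)
    have T: "(dy ^^ n) \<phi> \<in> test_functions l" using test_function_iterated[OF \<phi>, of 0 n] by simp
    have c: "(\<lambda>z. (-1) ^ n) differentiable_on UNIV" "dy (\<lambda>z. (-1) ^ n) = (\<lambda>_. 0)" by (auto simp: dy_def)
    note dR = test_functionD(5)[OF test_function_reflect[OF T]]
    have "dy (\<lambda>z. (-1) ^ n * (dy ^^ n) \<phi> (reflect z)) = (\<lambda>z. (-1) ^ Suc n * dy ((dy ^^ n) \<phi>) (reflect z))"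
      unfolding dx_mult(2)[OF c(1) dR] c(2) dy_reflect[OF test_functionD(5)[OF T]] by (auto simp: fun_eq_iff)
    with Suc show ?case by simp
  qed simp
  have X: "(dx ^^ m) (\<lambda>z. c * w (reflect z)) = (\<lambda>z. c * (dx ^^ m) w (reflect z))" if "w \<in> test_functions l" for c w
  proof (induction m)
    case (Suc m)
    have T: "(dx ^^ m) w \<in> test_functions l" using test_function_iterated[OF that, of m 0] by simp
    have c: "(\<lambda>z. c) differentiable_on UNIV" "dx (\<lambda>z. c) = (\<lambda>_. 0)" by (auto simp: dx_def)
    note dR = test_functionD(5)[OF test_function_reflect[OF T]]
    have "dx (\<lambda>z. c * (dx ^^ m) w (reflect z)) = (\<lambda>z. c * dx ((dx ^^ m) w) (reflect z))"
      unfolding dx_mult(1)[OF c(1) dR] c(2) dx_reflect by (auto simp: fun_eq_iff)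
    with Suc show ?case by simp
  qed simp
  let ?D = "(dx ^^ m) ((dy ^^ n) \<phi>)" and ?E = "(dx ^^ m) ((dy ^^ n) ?\<psi>)"
  have T: "(dy ^^ n) \<phi> \<in> test_functions l" using test_function_iterated[OF \<phi>, of 0 n] by simp
  have E: "?E = (\<lambda>z. (-1) ^ n * ?D (reflect z))" unfolding Y X[OF T] ..
  have refl: "(LINT z|plate l. f z * h z) = (LINT z|plate l. f (reflect z) * h (reflect z))"
    if "f \<in> L2 l" "h \<in> L2 l" for f h
    using integral_reflect[of "\<lambda>z. f z * h z" l] that L2_mult_integrable[OF that] by simp
  have "(LINT z|plate l. u (reflect z) * ?D z) = (LINT z|plate l. u z * ?D (reflect z))"
    using refl[OF L2_reflect[OF u] test_function_L2[OF test_function_iterated[OF \<phi>]]] by simp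
  also have "\<dots> = (-1) ^ n * (LINT z|plate l. u z * ?E z)"
  proof -
    have "(LINT z|plate l. u z * ?E z) = (-1) ^ n * (LINT z|plate l. u z * ?D (reflect z))"
      unfolding E by (subst integral_mult_right_zero[symmetric]) (simp only: mult.left_commute)
    then show ?thesis by (simp flip: mult.assoc power_mult_distrib)
  qed
  also have "\<dots> = (-1) ^ n * ((-1) ^ (m + n) * (LINT z|plate l. g z * \<phi> (reflect z)))"
    using wd \<psi> by (simp add: is_weak_deriv_def)
  also have "(LINT z|plate l. g z * \<phi> (reflect z)) = (LINT z|plate l. g (reflect z) * \<phi> z)"
    using refl[OF g test_function_L2[OF \<psi>]] by simp
  also have "(-1) ^ n * ((-1) ^ (m + n) * (LINT z|plate l. g (reflect z) * \<phi> z)) =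
      (-1) ^ (m + n) * (LINT z|plate l. (-1) ^ n * g (reflect z) * \<phi> z)"
  proof -
    have "(LINT z|plate l. (-1) ^ n * g (reflect z) * \<phi> z) = (-1) ^ n * (LINT z|plate l. g (reflect z) * \<phi> z)"
      unfolding mult.assoc by (rule integral_mult_right_zero)
    then show ?thesis by (simp only: mult.left_commute)
  qed
  finally show "(LINT z|plate l. u (reflect z) * ?D z) =
      (-1) ^ (m + n) * (LINT z|plate l. (-1) ^ n * g (reflect z) * \<phi> z)" .
qed

lemma (in semi_inner) square_sum_orthogonal:
  assumes e: "\<And>i. e i \<in> V" and orth: "\<And>i j. i \<noteq> j \<Longrightarrow> A (e i) (e j) = 0" and I: "finite I"
  shows "A (\<Sum>i\<in>I. c i *\<^sub>R e i) (\<Sum>i\<in>I. c i *\<^sub>R e i) = (\<Sum>i\<in>I. (c i)\<^sup>2 * A (e i) (e i))"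
proof -
  have S: "(\<Sum>i\<in>I. c i *\<^sub>R e i) \<in> V" by (intro sum_in scale_in e)
  have "A (e i) (\<Sum>j\<in>I. c j *\<^sub>R e j) = c i * A (e i) (e i)" if "i \<in> I" for i
  proof -
    have "A (e i) (\<Sum>j\<in>I. c j *\<^sub>R e j) = (\<Sum>j\<in>I. c j * A (e i) (e j))"
      by (subst sum_right) (auto intro: scale_in e simp: scale_right e)
    also have "\<dots> = (\<Sum>j\<in>I. if j = i then c i * A (e i) (e i) else 0)"
      using orth by (intro sum.cong) auto
    finally show ?thesis using that I by simp
  qed
  then show ?thesis
    by (subst sum_left) (auto intro!: sum.cong scale_in e S simp: scale_left e S power2_eq_square)
qed

text \<open>The vectors are not normalised and may be null, as sine modes of frequency 0 are, so
  only an upper bound \<open>Q\<close> on their squares is available. The combination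
  \<open>v\<close> with coefficients divided by \<open>Q\<close> satisfies
  \<open>A v v \<le> A u v\<close>, and nonnegativity of the square of \<open>u - v\<close> does the
  rest.\<close>

lemma (in semi_inner) Bessel:
  assumes e: "\<And>i. e i \<in> V" and orth: "\<And>i j. i \<noteq> j \<Longrightarrow> A (e i) (e j) = 0" and I: "finite I"
    and Q: "\<And>i. A (e i) (e i) \<le> Q" "Q > 0" and u: "u \<in> V"
  shows "(\<Sum>i\<in>I. (A u (e i))\<^sup>2) \<le> Q * A u u"
proof -
  define c where "c i = A u (e i) / Q" for i
  define v where "v = (\<Sum>i\<in>I. c i *\<^sub>R e i)"
  have v: "v \<in> V" unfolding v_def by (intro sum_in scale_in e)
  have "A u v = (\<Sum>i\<in>I. c i * A u (e i))"
    unfolding v_def by (subst sum_right) (auto intro: scale_in e u simp: scale_right e u)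
  also have "\<dots> = (\<Sum>i\<in>I. (A u (e i))\<^sup>2) / Q"
    by (simp add: c_def power2_eq_square sum_divide_distrib)
  finally have uv: "A u v = (\<Sum>i\<in>I. (A u (e i))\<^sup>2) / Q" .
  have "A v v = (\<Sum>i\<in>I. (c i)\<^sup>2 * A (e i) (e i))"
    unfolding v_def by (rule square_sum_orthogonal[OF e orth I])
  also have "\<dots> \<le> (\<Sum>i\<in>I. (c i)\<^sup>2 * Q)" by (intro sum_mono mult_left_mono Q) auto
  also have "\<dots> = (\<Sum>i\<in>I. (A u (e i))\<^sup>2) / Q"
    using Q(2) by (simp add: c_def power2_eq_square sum_divide_distrib)
  finally have "A v v \<le> A u v" by (simp add: uv)
  moreover have "0 \<le> A u u - 2 * A u v + A v v"
    using nonneg[OF diff_in[OF u v]] square_diff[OF u v] by simp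
  ultimately have "A u v \<le> A u u" by linarith
  then show ?thesis using Q(2) by (simp add: uv field_simps)
qed

section \<open>Trigonometric functions on an interval\<close>

text \<open>With \<open>w * (b - a) = pi\<close> these are the Dirichlet modes of the interval from
  a to b, and \<open>Cn\<close> gives the Neumann modes.\<close>

definition Sn :: "real \<Rightarrow> real \<Rightarrow> nat \<Rightarrow> real \<Rightarrow> real" where
  "Sn w a n t = sin (real n * (w * (t - a)))"

definition Cn :: "real \<Rightarrow> real \<Rightarrow> nat \<Rightarrow> real \<Rightarrow> real" where
  "Cn w a n t = cos (real n * (w * (t - a)))"

lemma smooth_Sn: "smooth (Sn w a n)" and smooth_Cn: "smooth (Cn w a n)"
  using smooth_affine[OF smooth_sin, of "real n * w" "- real n * w * a"]
    smooth_affine[OF smooth_cos, of "real n * w" "- real n * w * a"]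
  by (auto simp: Sn_def[abs_def] Cn_def[abs_def] algebra_simps)

lemma deriv_Sn: "deriv (Sn w a n) = (\<lambda>t. (n * w) * Cn w a n t)"
  and deriv_Cn: "deriv (Cn w a n) = (\<lambda>t. - (n * w) * Sn w a n t)"
  unfolding Sn_def Cn_def by (auto intro!: ext DERIV_imp_deriv derivative_eq_intros)

lemma Sn_abs_le: "\<bar>Sn w a n t\<bar> \<le> 1" and Cn_abs_le: "\<bar>Cn w a n t\<bar> \<le> 1"
  by (auto simp: Sn_def Cn_def)

lemma Sn_0 [simp]: "Sn w a 0 t = 0" and Cn_0 [simp]: "Cn w a 0 t = 1"
  by (auto simp: Sn_def Cn_def)

lemma Sn_times_Cn_1: "Sn w a (Suc m) t * Cn w a 1 t = (Sn w a (m + 2) t + Sn w a m t) / 2"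
proof -
  let ?x = "w * (t - a)"
  have "sin (real (Suc m) * ?x + ?x) + sin (real (Suc m) * ?x - ?x) = 2 * sin (real (Suc m) * ?x) * cos ?x"
    by (simp add: sin_add sin_diff)
  moreover have "real (Suc m) * ?x + ?x = real (m + 2) * ?x" "real (Suc m) * ?x - ?x = real m * ?x"
    by (auto simp: algebra_simps)
  ultimately show ?thesis by (simp add: Sn_def Cn_def)
qed

lemma Cn_times_Cn_1: "Cn w a (Suc n) t * Cn w a 1 t = (Cn w a (n + 2) t + Cn w a n t) / 2"
proof -
  let ?x = "w * (t - a)"
  have "cos (real (Suc n) * ?x + ?x) + cos (real (Suc n) * ?x - ?x) = 2 * cos (real (Suc n) * ?x) * cos ?x"
    by (simp add: cos_add cos_diff)
  moreover have "real (Suc n) * ?x + ?x = real (n + 2) * ?x" "real (Suc n) * ?x - ?x = real n * ?x"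
    by (auto simp: algebra_simps)
  ultimately show ?thesis by (simp add: Cn_def)
qed

text \<open>The sine is at most its frequency times the distance to the nearer end; at b this uses
  the symmetry of the sine about multiples of pi. This smallness compensates one power of k from
  differentiating a cutoff.\<close>

lemma Sn_edge:
  assumes w: "w \<ge> 0" "w * (b - a) = pi" and t: "a < t" "t < b" and k: "\<not> (a + d < t \<and> t < b - d)"
  shows "\<bar>Sn w a n t\<bar> \<le> n * w * d"
proof (cases "a + d < t")
  case False
  have "\<bar>Sn w a n t\<bar> \<le> \<bar>real n * (w * (t - a))\<bar>" unfolding Sn_def by (rule abs_sin_x_le_abs_x)
  also have "\<dots> = n * w * (t - a)" using w t by (simp add: abs_mult)
  also have "\<dots> \<le> n * w * d" using False w by (intro mult_left_mono) auto
  finally show ?thesis .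
next
  case True
  with k have "b - t \<le> d" by simp
  have "real n * (w * (t - a)) = real n * pi - real n * (w * (b - t))"
    unfolding w(2)[symmetric] by (simp add: algebra_simps)
  then have "\<bar>Sn w a n t\<bar> = \<bar>sin (real n * (w * (b - t)))\<bar>"
    by (simp add: Sn_def sin_diff abs_mult)
  also have "\<dots> \<le> \<bar>real n * (w * (b - t))\<bar>" by (rule abs_sin_x_le_abs_x)
  also have "\<dots> = n * w * (b - t)" using w t by (simp add: abs_mult)
  also have "\<dots> \<le> n * w * d" using \<open>b - t \<le> d\<close> w by (intro mult_left_mono) auto
  finally show ?thesis .
qed

lemma integral_open_interval_FTC:
  fixes f F :: "real \<Rightarrow> real"
  assumes "a \<le> b" "\<And>x. (F has_real_derivative f x) (at x)" "\<And>x. isCont f x"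
  shows "(LINT x|lborel. indicator {a<..<b} x * f x) = F b - F a"
proof -
  have [measurable]: "f \<in> borel_measurable borel"
    using assms(3) by (intro borel_measurable_continuous_onI continuous_at_imp_continuous_on) auto
  have "(LINT x|lborel. indicator {a<..<b} x * f x) = (LINT x|lborel. f x * indicator {a..b} x)"
  proof (rule integral_cong_AE)
    show "AE x in lborel. indicator {a<..<b} x * f x = f x * indicator {a..b} x"
      using AE_lborel_singleton[of a] AE_lborel_singleton[of b]
      by eventually_elim (auto simp: indicator_def)
  qed auto
  also have "\<dots> = F b - F a" by (rule integral_FTC_Icc_real) (use assms in auto)
  finally show ?thesis .
qed

lemma integral_cos_multiple:
  assumes w: "w > 0" "w * (b - a) = pi"
  shows "(LINT t|lborel. indicator {a<..<b} t * cos (of_int k * (w * (t - a)))) = (if k = 0 then b - a else 0)"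
proof -
  have ab: "a \<le> b" using w pi_gt_zero by (metis diff_ge_0_iff_ge less_imp_le zero_less_mult_pos)
  show ?thesis
  proof (cases "k = 0")
    case True
    have "(LINT t|lborel. indicator {a<..<b} t * (1 :: real)) = b - a"
      by (rule integral_open_interval_FTC[OF ab, where F = "\<lambda>t. t"]) auto
    with True show ?thesis by simp
  next
    case False
    have "(LINT t|lborel. indicator {a<..<b} t * cos (of_int k * (w * (t - a)))) =
        sin (of_int k * (w * (b - a))) / (of_int k * w) - sin (of_int k * (w * (a - a))) / (of_int k * w)"
      using False w
      by (intro integral_open_interval_FTC[OF ab, where F = "\<lambda>t. sin (of_int k * (w * (t - a))) / (of_int k * w)"])
        (auto intro!: derivative_eq_intros continuous_intros)
    then show ?thesis using False by (simp add: w(2) sin_zero_iff_int2 mult.commute)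
  qed
qed

lemma integrable_cos_multiple:
  "integrable lborel (\<lambda>t. indicator {a<..<b} t * cos (r * (w * (t - a))) :: real)"
proof -
  have "set_integrable lborel {a..b} (\<lambda>t. cos (r * (w * (t - a))))"
    by (intro borel_integrable_atLeastAtMost' continuous_intros)
  then have "set_integrable lborel {a<..<b} (\<lambda>t. cos (r * (w * (t - a))))"
    by (rule set_integrable_subset) auto
  then show ?thesis by (simp add: set_integrable_def)
qed

lemma
  assumes w: "w > 0" "w * (b - a) = pi"
  shows integral_Sn_Sn: "(LINT t|lborel. indicator {a<..<b} t * (Sn w a m t * Sn w a n t)) =
      (if m = n \<and> m \<noteq> 0 then (b - a) / 2 else 0)"
    and integral_Cn_Cn: "(LINT t|lborel. indicator {a<..<b} t * (Cn w a m t * Cn w a n t)) =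
      (if m = n then if m = 0 then b - a else (b - a) / 2 else 0)"
proof -
  let ?I = "\<lambda>k t. indicator {a<..<b} t * cos (of_int k * (w * (t - a))) :: real"
  have I: "integrable lborel (?I k)" for k by (rule integrable_cos_multiple)
  \<comment> \<open>Product-to-sum formulas; the frequency m - n is taken as an integer since it may
    be negative.\<close>
  have prod: "Sn w a m t * Sn w a n t = (cos (of_int (int m - int n) * (w * (t - a))) - cos (of_int (int m + int n) * (w * (t - a)))) / 2"
    "Cn w a m t * Cn w a n t = (cos (of_int (int m - int n) * (w * (t - a))) + cos (of_int (int m + int n) * (w * (t - a)))) / 2" for t
  proof -
    let ?x = "w * (t - a)"
    have "cos (of_int (int m - int n) * ?x) = cos (real m * ?x) * cos (real n * ?x) + sin (real m * ?x) * sin (real n * ?x)"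
      by (simp add: left_diff_distrib cos_diff)
    moreover have "cos (of_int (int m + int n) * ?x) = cos (real m * ?x) * cos (real n * ?x) - sin (real m * ?x) * sin (real n * ?x)"
      by (simp add: distrib_right cos_add)
    ultimately show "Sn w a m t * Sn w a n t = (cos (of_int (int m - int n) * ?x) - cos (of_int (int m + int n) * ?x)) / 2"
      "Cn w a m t * Cn w a n t = (cos (of_int (int m - int n) * ?x) + cos (of_int (int m + int n) * ?x)) / 2"
      by (simp_all add: Sn_def Cn_def)
  qed
  have "(LINT t|lborel. indicator {a<..<b} t * (Sn w a m t * Sn w a n t)) =
      (LINT t|lborel. (?I (int m - int n) t - ?I (int m + int n) t) / 2)"
    unfolding prod by (intro Bochner_Integration.integral_cong) (auto simp: algebra_simps)
  also have "\<dots> = ((LINT t|lborel. ?I (int m - int n) t) - (LINT t|lborel. ?I (int m + int n) t)) / 2"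
    using I[of "int m - int n"] I[of "int m + int n"] by simp
  finally show "(LINT t|lborel. indicator {a<..<b} t * (Sn w a m t * Sn w a n t)) =
      (if m = n \<and> m \<noteq> 0 then (b - a) / 2 else 0)"
    unfolding integral_cos_multiple[OF w] by auto
  have "(LINT t|lborel. indicator {a<..<b} t * (Cn w a m t * Cn w a n t)) =
      (LINT t|lborel. (?I (int m - int n) t + ?I (int m + int n) t) / 2)"
    unfolding prod by (intro Bochner_Integration.integral_cong) (auto simp: algebra_simps)
  also have "\<dots> = ((LINT t|lborel. ?I (int m - int n) t) + (LINT t|lborel. ?I (int m + int n) t)) / 2"
    using I[of "int m - int n"] I[of "int m + int n"] by simp
  finally show "(LINT t|lborel. indicator {a<..<b} t * (Cn w a m t * Cn w a n t)) =
      (if m = n then if m = 0 then b - a else (b - a) / 2 else 0)"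
    unfolding integral_cos_multiple[OF w] by auto
qed

lemma integral_plate_product:
  fixes f g :: "real \<Rightarrow> real"
  assumes f: "integrable lborel (\<lambda>x. indicator {0<..<pi} x * f x)"
    and g: "integrable lborel (\<lambda>y. indicator {- l<..<l} y * g y)"
  shows "(LINT z|plate l. f (fst z) * g (snd z)) =
    (LINT x|lborel. indicator {0<..<pi} x * f x) * (LINT y|lborel. indicator {- l<..<l} y * g y)"
proof -
  let ?f = "\<lambda>x. indicator {0<..<pi} x * f x" and ?g = "\<lambda>y. indicator {- l<..<l} y * g y"
  have eq: "indicator (Omega l) z * (f (fst z) * g (snd z)) = (case z of (x, y) \<Rightarrow> ?f x * ?g y)" for z
    by (cases z) (auto simp: Omega_def indicator_def)
  have int: "integrable (lborel \<Otimes>\<^sub>M lborel) (\<lambda>(x, y). ?f x * ?g y)"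
  proof (rule lborel_pair.Fubini_integrable)
    show "integrable lborel (\<lambda>x. LINT y|lborel. norm (case (x, y) of (x, y) \<Rightarrow> ?f x * ?g y))"
      using integrable_mult_left[OF integrable_abs[OF f], of "LINT y|lborel. \<bar>?g y\<bar>"]
      by (simp add: abs_mult)
    show "AE x in lborel. integrable lborel (\<lambda>y. case (x, y) of (x, y) \<Rightarrow> ?f x * ?g y)"
      using integrable_mult_right[OF g] by simp
  qed (use f g in \<open>measurable\<close>)
  have "(LINT z|plate l. f (fst z) * g (snd z)) = (LINT z|(lborel \<Otimes>\<^sub>M lborel). (case z of (x, y) \<Rightarrow> ?f x * ?g y))"
    unfolding integral_plate eq lborel_prod ..
  also have "\<dots> = (LINT x|lborel. LINT y|lborel. ?f x * ?g y)"
    using lborel_pair.integral_fst'[OF int] by simp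
  also have "\<dots> = (LINT x|lborel. ?f x * (LINT y|lborel. ?g y))"
    by (intro Bochner_Integration.integral_cong refl integral_mult_right_zero)
  finally show ?thesis by (simp only: integral_mult_left_zero)
qed

lemma integrable_indicator_smooth:
  assumes "smooth f"
  shows "integrable lborel (\<lambda>t. indicator {a<..<b} t * f t :: real)"
proof -
  have "set_integrable lborel {a..b} f"
    by (intro borel_integrable_atLeastAtMost' smooth_continuous assms)
  then have "set_integrable lborel {a<..<b} f" by (rule set_integrable_subset) auto
  then show ?thesis by (simp add: set_integrable_def)
qed

lemma ip_tensor:
  assumes "smooth f" "smooth g" "smooth f'" "smooth g'"
  shows "ip l (tensor f g) (tensor f' g') =
    (LINT x|lborel. indicator {0<..<pi} x * (f x * f' x)) * (LINT y|lborel. indicator {- l<..<l} y * (g y * g' y))"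
proof -
  have "ip l (tensor f g) (tensor f' g') = (LINT z|plate l. (f (fst z) * f' (fst z)) * (g (snd z) * g' (snd z)))"
    unfolding ip_def tensor_def by (intro Bochner_Integration.integral_cong) auto
  also have "\<dots> = (LINT x|lborel. indicator {0<..<pi} x * (f x * f' x)) * (LINT y|lborel. indicator {- l<..<l} y * (g y * g' y))"
    by (rule integral_plate_product[where f = "\<lambda>x. f x * f' x" and g = "\<lambda>y. g y * g' y"])
      (intro integrable_indicator_smooth smooth_mult assms)+
  finally show ?thesis .
qed

section \<open>Fourier coefficients on the plate\<close>

lemma tensor_integral_limit:
  assumes u: "u \<in> L2 l"
    and meas: "\<And>k. smooth (f k)" "\<And>k. smooth (g k)" "smooth F" "smooth G"
    and bnd: "\<And>k x. x \<in> {0<..<pi} \<Longrightarrow> \<bar>f k x\<bar> \<le> B" "\<And>k y. y \<in> {- l<..<l} \<Longrightarrow> \<bar>g k y\<bar> \<le> B"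
    and lim: "\<And>x. x \<in> {0<..<pi} \<Longrightarrow> (\<lambda>k. f k x) \<longlonglongrightarrow> F x" "\<And>y. y \<in> {- l<..<l} \<Longrightarrow> (\<lambda>k. g k y) \<longlonglongrightarrow> G y"
  shows "(\<lambda>k. LINT z|plate l. u z * tensor (f k) (g k) z) \<longlonglongrightarrow> (LINT z|plate l. u z * tensor F G z)"
proof (rule integral_dominated_convergence[where w = "\<lambda>z. \<bar>u z\<bar> * (B * B)"])
  note [measurable] = L2_measurable[OF u] L2_measurable[OF tensor_L2[OF meas(1,2)]]
    L2_measurable[OF tensor_L2[OF meas(3,4)]]
  show "(\<lambda>z. u z * tensor (f k) (g k) z) \<in> borel_measurable (plate l)" for k by measurable
  show "(\<lambda>z. u z * tensor F G z) \<in> borel_measurable (plate l)" by measurable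
  show "integrable (plate l) (\<lambda>z. \<bar>u z\<bar> * (B * B))" using L2_integrable[OF u] by simp
  have in_Omega: "fst z \<in> {0<..<pi}" "snd z \<in> {- l<..<l}" if "z \<in> Omega l" for z
    using that by (auto simp: Omega_def)
  show "AE z in plate l. (\<lambda>k. u z * tensor (f k) (g k) z) \<longlonglongrightarrow> u z * tensor F G z"
    unfolding tensor_def by (intro AE_plate_I tendsto_intros lim in_Omega)
  show "AE z in plate l. norm (u z * tensor (f k) (g k) z) \<le> \<bar>u z\<bar> * (B * B)" for k
  proof (rule AE_plate_I)
    fix z assume z: "z \<in> Omega l"
    have "\<bar>tensor (f k) (g k) z\<bar> \<le> B * B"
      unfolding tensor_def abs_mult using bnd(1)[OF in_Omega(1)[OF z], of k] bnd(2)[OF in_Omega(2)[OF z], of k]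
      by (intro mult_mono) (auto intro: order_trans[OF abs_ge_zero])
    then show "norm (u z * tensor (f k) (g k) z) \<le> \<bar>u z\<bar> * (B * B)"
      by (simp add: abs_mult mult_left_mono)
  qed
qed

text \<open>Admissible functions carry only those properties of members of \<open>H2star\<close> that survive limits in
  the energy norm by inspection; the first derivatives and the boundary values are recovered from them.\<close>

definition admissible :: "real \<Rightarrow> (real \<times> real \<Rightarrow> real) \<Rightarrow> (real \<times> real \<Rightarrow> real) \<Rightarrow> (real \<times> real \<Rightarrow> real) \<Rightarrow> bool" where
  "admissible l u gxx gxy \<longleftrightarrow> u \<in> L2 l \<and> gxx \<in> L2 l \<and> gxy \<in> L2 l \<and>
    is_weak_deriv l 2 0 u gxx \<and> is_weak_deriv l 1 1 u gxy \<and>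
    (\<exists>U. continuous_on (closure (Omega l)) U \<and> (AE z in plate l. u z = U z) \<and>
      (\<forall>x\<in>{0, pi}. \<forall>y\<in>{- l<..<l}. U (x, y) = 0))"

locale half_width =
  fixes l :: real
  assumes l_pos: "l > 0"
begin

definition c :: real where "c = pi / (2 * l)"

lemma c_pos: "c > 0" and c_length: "c * (l - - l) = pi"
  using l_pos by (auto simp: c_def)

lemma closure_Omega: "closure (Omega l) = {0..pi} \<times> {- l..l}"
  using l_pos by (simp add: Omega_def closure_Times)

lemma measure_strip:
  assumes "0 < d"
  shows "(LINT z|plate l. indicator {x. \<not> (d < x \<and> x < pi - d)} (fst z)) \<le> 4 * l * d"
proof -
  let ?S = "{x. \<not> (d < x \<and> x < pi - d)}"
  have S: "?S = {..d} \<union> {pi - d..}" by auto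
  have [measurable]: "?S \<in> sets borel" unfolding S by auto
  have I: "integrable lborel (indicator {a<..<b} :: real \<Rightarrow> real)" "integrable lborel (indicator {a..b} :: real \<Rightarrow> real)" for a b
    by (intro integrable_real_indicator; cases "a \<le> b"; simp)+
  have int: "integrable lborel (\<lambda>x. indicator {0<..<pi} x * indicator ?S x :: real)"
    by (intro integrable_real_mult_indicator) auto
  have "(LINT z|plate l. indicator ?S (fst z)) = (LINT z|plate l. indicator ?S (fst z) * (1 :: real))" by simp
  also have "\<dots> = (LINT x|lborel. indicator {0<..<pi} x * indicator ?S x) * (LINT y|lborel. indicator {- l<..<l} y * (1 :: real))"
    by (rule integral_plate_product[OF int]) (simp add: I)
  also have "(LINT y|lborel. indicator {- l<..<l} y * (1 :: real)) = 2 * l" using l_pos by simp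
  also have "(LINT x|lborel. indicator {0<..<pi} x * indicator ?S x :: real) \<le> (LINT x|lborel. indicator {0..d} x + indicator {pi - d..pi} x)"
    using assms by (intro integral_mono int Bochner_Integration.integrable_add I) (auto simp: indicator_def)
  also have "\<dots> = 2 * d" using assms by (subst Bochner_Integration.integral_add[OF I(2) I(2)]) auto
  finally show ?thesis using l_pos by (simp add: mult.commute mult_right_mono)
qed

text \<open>The factor \<open>R k\<close> has size k but lives on a layer whose measure is of order
  1 / k. So the integral is bounded by a constant times the supremum of u over the layer, which
  tends to 0 by uniform continuity of \<open>U\<close> and its zero values on the short
  edges.\<close>

lemma boundary_layer_integral_tendsto_0:
  assumes u: "u \<in> L2 l" and U: "continuous_on (closure (Omega l)) U" "AE z in plate l. u z = U z"
    "\<forall>x\<in>{0, pi}. \<forall>y\<in>{- l<..<l}. U (x, y) = 0"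
    and sm: "\<And>k. smooth (R k)" "\<And>k. smooth (G k)"
    and R: "\<And>k x. x \<in> {0<..<pi} \<Longrightarrow> \<bar>R k x\<bar> \<le> B * real (Suc k)"
      "\<And>k x. 2 / real (Suc k) < x \<Longrightarrow> x < pi - 2 / real (Suc k) \<Longrightarrow> R k x = 0"
    and G: "\<And>k y. y \<in> {- l<..<l} \<Longrightarrow> \<bar>G k y\<bar> \<le> B"
  shows "(\<lambda>k. LINT z|plate l. u z * tensor (R k) (G k) z) \<longlonglongrightarrow> 0"
proof (rule LIMSEQ_I)
  fix e :: real assume e: "e > 0"
  have B: "B \<ge> 0" using G[of 0 0] l_pos by (auto intro: order_trans[OF abs_ge_zero])
  \<comment> \<open>The estimate below ends with e' times 8 * l * B^2; the larger denominator makes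
    this strictly less than e even when B is 0.\<close>
  define e' where "e' = e / (16 * l * (B * B + 1))"
  have BB: "B * B + 1 > 0" using B by (simp add: add_nonneg_pos)
  have e': "e' > 0" unfolding e'_def using e l_pos BB by simp
  have "uniformly_continuous_on (closure (Omega l)) U"
    unfolding closure_Omega using U(1) by (intro compact_uniformly_continuous compact_Times) (auto simp: closure_Omega)
  then obtain d where d: "d > 0" "\<And>z w. z \<in> closure (Omega l) \<Longrightarrow> w \<in> closure (Omega l) \<Longrightarrow> dist w z < d \<Longrightarrow> dist (U w) (U z) < e'"
    unfolding uniformly_continuous_on_def using e' by metis
  have small: "\<bar>U z\<bar> \<le> e'" if z: "z \<in> Omega l" and s: "fst z < d \<or> pi - fst z < d" for z
  proof -
    obtain x y where xy: "z = (x, y)" by (cases z)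
    have *: "x \<in> {0<..<pi}" "y \<in> {- l<..<l}" using z xy by (auto simp: Omega_def)
    have zc: "z \<in> closure (Omega l)" using z closure_subset by blast
    have "x < d \<or> pi - x < d" using s xy by simp
    then show ?thesis
    proof
      assume "x < d"
      then have "dist (U z) (U (0, y)) < e'"
        using * xy zc by (intro d(2)) (auto simp: closure_Omega dist_Pair_Pair)
      then show ?thesis using U(3) * by (simp add: dist_real_def)
    next
      assume "pi - x < d"
      then have "dist (U z) (U (pi, y)) < e'"
        using * xy zc by (intro d(2)) (auto simp: closure_Omega dist_Pair_Pair dist_real_def)
      then show ?thesis using U(3) * by (simp add: dist_real_def)
    qed
  qed
  have "d / 2 > 0" using d by simp
  then obtain n0 where n0: "inverse (real (Suc n0)) < d / 2" using reals_Archimedean by blast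
  have "norm ((LINT z|plate l. u z * tensor (R k) (G k) z) - 0) < e" if k: "n0 \<le> k" for k
  proof -
    let ?d = "2 / real (Suc k)"
    have dk: "?d < d"
    proof -
      have "inverse (real (Suc k)) \<le> inverse (real (Suc n0))" using k by simp
      with n0 have "inverse (real (Suc k)) < d / 2" by linarith
      moreover have "?d = 2 * inverse (real (Suc k))" by (rule divide_inverse)
      ultimately show ?thesis by linarith
    qed
    let ?S = "{x. \<not> (?d < x \<and> x < pi - ?d)}"
    have S: "?S = {..?d} \<union> {pi - ?d..}" by auto
    have [measurable]: "?S \<in> sets borel" unfolding S by auto
    have ind_meas: "(\<lambda>z. indicator ?S (fst z) :: real) \<in> borel_measurable (plate l)"
      by (intro borel_measurable_plate measurable_compose[OF borel_measurable_continuous_onI[OF continuous_on_fst[OF continuous_on_id]]]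
          borel_measurable_indicator) auto
    have ind_int: "integrable (plate l) (\<lambda>z. indicator ?S (fst z) :: real)"
      by (rule integrable_plate_bounded[OF ind_meas, of 1], rule AE_plate_I, rule indicator_abs_le_1)
    let ?K = "e' * (B * real (Suc k) * B)"
    have K: "?K \<ge> 0" using e' B by simp
    have "norm (LINT z|plate l. u z * tensor (R k) (G k) z) \<le> (LINT z|plate l. norm (u z * tensor (R k) (G k) z))"
      by (rule integral_norm_bound)
    also have "\<dots> \<le> (LINT z|plate l. ?K * indicator ?S (fst z))"
    proof (rule integral_mono_AE)
      show "integrable (plate l) (\<lambda>z. norm (u z * tensor (R k) (G k) z))"
        by (intro integrable_norm L2_mult_integrable u tensor_L2 sm)
      show "integrable (plate l) (\<lambda>z. ?K * indicator ?S (fst z))" by (rule integrable_mult_right[OF ind_int])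
      have "AE z in plate l. z \<in> Omega l" by (intro AE_plate_I)
      with U(2) show "AE z in plate l. norm (u z * tensor (R k) (G k) z) \<le> ?K * indicator ?S (fst z)"
      proof eventually_elim
        case (elim z)
        have *: "fst z \<in> {0<..<pi}" "snd z \<in> {- l<..<l}" using elim(2) by (auto simp: Omega_def)
        show ?case
        proof (cases "fst z \<in> ?S")
          case True
          then have "\<bar>u z\<bar> \<le> e'" using small[OF elim(2)] dk elim(1) by auto
          then have "\<bar>u z\<bar> * (\<bar>R k (fst z)\<bar> * \<bar>G k (snd z)\<bar>) \<le> e' * (B * real (Suc k) * B)"
            using R(1)[OF *(1), of k] G[OF *(2), of k] B e' by (intro mult_mono) auto
          with True show ?thesis by (simp add: tensor_def abs_mult)
        next
          case False
          then have "R k (fst z) = 0" by (intro R(2)) auto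
          with False show ?thesis by (simp add: tensor_def)
        qed
      qed
    qed
    also have "\<dots> = ?K * (LINT z|plate l. indicator ?S (fst z))" by (rule integral_mult_right_zero)
    also have "\<dots> \<le> ?K * (4 * l * ?d)" by (intro mult_left_mono measure_strip K) auto
    also have "\<dots> = e' * (8 * l * (B * B))" by simp
    also have "\<dots> < e' * (16 * l * (B * B + 1))"
    proof (rule mult_strict_left_mono[OF _ e'])
      have "0 \<le> l * (B * B)" using l_pos by simp
      moreover have "16 * l * (B * B + 1) = 16 * (l * (B * B)) + 16 * l" by (simp add: algebra_simps)
      ultimately show "8 * l * (B * B) < 16 * l * (B * B + 1)" using l_pos by linarith
    qed
    also have "\<dots> = e" unfolding e'_def using l_pos BB by simp
    finally show ?thesis by simp
  qed
  then show "\<exists>n0. \<forall>k\<ge>n0. norm ((LINT z|plate l. u z * tensor (R k) (G k) z) - 0) < e" by blast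
qed

lemma cutoff_abs_le: "\<bar>cutoff a b k t\<bar> \<le> 1"
  using cutoff_bounds[of a b k t] by simp

lemma deriv_mult_smooth:
  assumes "smooth f" "smooth g"
  shows "deriv (\<lambda>x. f x * g x) = (\<lambda>x. deriv f x * g x + deriv g x * f x)"
  by (rule ext, rule DERIV_imp_deriv, rule DERIV_mult; rule smooth_DERIV; fact)

lemma cutoff_tendsto_1: "t \<in> {a<..<b} \<Longrightarrow> (\<lambda>k. cutoff a b k t) \<longlonglongrightarrow> 1"
  using cutoff_tendsto[of a b t] by simp

text \<open>Eigenfunctions of the Laplacian with Dirichlet conditions on the short edges and Neumann
  conditions on the long ones. \<open>Suc\<close> shifts the x-frequency because sine modes start at
  1, while cosine modes start at 0.\<close>

definition phi :: "nat \<times> nat \<Rightarrow> real \<times> real \<Rightarrow> real" where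
  "phi p = tensor (Sn 1 0 (Suc (fst p))) (Cn c (- l) (snd p))"

text \<open>Up to a constant factor the mixed derivative of \<open>phi p\<close>; it vanishes when
  the y-frequency is 0.\<close>

definition psi :: "nat \<times> nat \<Rightarrow> real \<times> real \<Rightarrow> real" where
  "psi p = tensor (Cn 1 0 (Suc (fst p))) (Sn c (- l) (snd p))"

text \<open>The cutoff near the short edges has derivatives of order \<open>k\<close> and \<open>k\<^sup>2\<close> on a layer of width \<open>1 / k\<close>;
  the second one is multiplied by a sine of size \<open>1 / k\<close>, and \<open>u\<close> tends to 0 in the layer.\<close>

lemma coefficient_xx:
  assumes adm: "admissible l u gxx gxy"
  shows "ip l gxx (phi (m, n)) = - (real (Suc m))\<^sup>2 * ip l u (phi (m, n))"
proof -
  obtain U where u: "u \<in> L2 l" and g: "gxx \<in> L2 l" and wd: "is_weak_deriv l 2 0 u gxx"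
    and U: "continuous_on (closure (Omega l)) U" "AE z in plate l. u z = U z"
      "\<forall>x\<in>{0, pi}. \<forall>y\<in>{- l<..<l}. U (x, y) = 0"
    using adm unfolding admissible_def by blast
  define f where "f = Sn 1 0 (Suc m)"
  define g' where "g' = Cn c (- l) n"
  define X where "X = cutoff 0 pi"
  define Y where "Y = cutoff (- l) l"
  have f: "smooth f" "smooth g'" "smooth (X k)" "smooth (Y k)" for k
    by (auto simp: f_def g'_def X_def Y_def smooth_Sn smooth_Cn smooth_cutoff)
  have f': "deriv f = (\<lambda>x. real (Suc m) * Cn 1 0 (Suc m) x)" by (simp add: f_def deriv_Sn)
  have f'': "deriv (deriv f) = (\<lambda>x. - (real (Suc m))\<^sup>2 * f x)"
  proof -
    have "deriv (\<lambda>x. real (Suc m) * Cn 1 0 (Suc m) x) = (\<lambda>x. real (Suc m) * deriv (Cn 1 0 (Suc m)) x)"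
      by (rule ext, rule DERIV_imp_deriv, rule DERIV_cmult, rule smooth_DERIV[OF smooth_Cn])
    then show ?thesis unfolding f' by (simp add: deriv_Cn f_def power2_eq_square algebra_simps)
  qed
  \<comment> \<open>All terms of the second derivative in which the cutoff is differentiated at
    least once.\<close>
  define R where "R k x = 2 * (deriv f x * deriv (X k) x) + f x * deriv (deriv (X k)) x" for k x
  have sR: "smooth (R k)" for k
    unfolding R_def[abs_def] by (intro smooth_add smooth_cmult smooth_mult smooth_deriv f)
  have D2: "deriv (deriv (\<lambda>x. f x * X k x)) = (\<lambda>x. - (real (Suc m))\<^sup>2 * (f x * X k x) + R k x)" for k
  proof -
    have "deriv (\<lambda>x. f x * X k x) = (\<lambda>x. deriv f x * X k x + deriv (X k) x * f x)"
      by (intro deriv_mult_smooth f)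
    moreover have "deriv (\<lambda>x. deriv f x * X k x + deriv (X k) x * f x) x =
       (deriv (deriv f) x * X k x + deriv (X k) x * deriv f x) + (deriv (deriv (X k)) x * f x + deriv f x * deriv (X k) x)" for x
      by (rule DERIV_imp_deriv, rule DERIV_add; rule DERIV_mult; rule smooth_DERIV; intro smooth_deriv f)
    ultimately show ?thesis by (auto simp: f'' R_def algebra_simps)
  qed
  let ?T = "\<lambda>k. tensor (\<lambda>x. f x * X k x) (\<lambda>y. g' y * Y k y)"
  have T: "?T k \<in> test_functions l" for k
    unfolding X_def Y_def by (intro cutoff_test_function f) auto
  have eq: "ip l gxx (?T k) = - (real (Suc m))\<^sup>2 * (LINT z|plate l. u z * ?T k z)
      + (LINT z|plate l. u z * tensor (R k) (\<lambda>y. g' y * Y k y) z)" for k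
  proof -
    have "(LINT z|plate l. u z * (dx ^^ 2) ((dy ^^ 0) (?T k)) z) = (-1) ^ (2 + 0) * (LINT z|plate l. gxx z * ?T k z)"
      using wd T unfolding is_weak_deriv_def by blast
    moreover have "(dx ^^ 2) ((dy ^^ 0) (?T k)) = tensor (deriv (deriv (\<lambda>x. f x * X k x))) (\<lambda>y. g' y * Y k y)"
      by (simp add: numeral_2_eq_2 dx_tensor smooth_mult smooth_deriv f)
    ultimately have "ip l gxx (?T k) = (LINT z|plate l. u z * tensor (\<lambda>x. - (real (Suc m))\<^sup>2 * (f x * X k x) + R k x) (\<lambda>y. g' y * Y k y) z)"
      by (simp add: ip_def D2)
    also have "\<dots> = (LINT z|plate l. - (real (Suc m))\<^sup>2 * (u z * ?T k z) + u z * tensor (R k) (\<lambda>y. g' y * Y k y) z)"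
      by (intro Bochner_Integration.integral_cong) (auto simp: tensor_def algebra_simps)
    also have "\<dots> = - (real (Suc m))\<^sup>2 * (LINT z|plate l. u z * ?T k z) + (LINT z|plate l. u z * tensor (R k) (\<lambda>y. g' y * Y k y) z)"
    proof -
      have "integrable (plate l) (\<lambda>z. u z * ?T k z)" "integrable (plate l) (\<lambda>z. u z * tensor (R k) (\<lambda>y. g' y * Y k y) z)"
        by (intro L2_mult_integrable u tensor_L2 smooth_mult f sR)+
      then show ?thesis by simp
    qed
    finally show ?thesis .
  qed
  have abs1: "\<bar>f x * X k x\<bar> \<le> 1" "\<bar>g' y * Y k y\<bar> \<le> 1" for x y k
    unfolding abs_mult X_def Y_def f_def g'_def
    by (intro mult_le_one Sn_abs_le Cn_abs_le cutoff_abs_le abs_ge_zero)+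
  have lim: "(\<lambda>k. LINT z|plate l. w z * ?T k z) \<longlonglongrightarrow> (LINT z|plate l. w z * tensor f g' z)" if "w \<in> L2 l" for w
  proof (rule tensor_integral_limit[OF that _ _ f(1,2), where B = 1])
    show "(\<lambda>k. f x * X k x) \<longlonglongrightarrow> f x" if "x \<in> {0<..<pi}" for x
      using tendsto_mult_left[OF cutoff_tendsto_1[OF that], of "f x"] by (simp add: X_def)
    show "(\<lambda>k. g' y * Y k y) \<longlonglongrightarrow> g' y" if "y \<in> {- l<..<l}" for y
      using tendsto_mult_left[OF cutoff_tendsto_1[OF that], of "g' y"] by (simp add: Y_def)
  qed (use abs1 in \<open>auto intro!: smooth_mult f\<close>)
  obtain C where C: "C \<ge> 0" "\<And>k t. \<bar>deriv (X k) t\<bar> \<le> C * real (Suc k)" "\<And>k t. \<bar>deriv (deriv (X k)) t\<bar> \<le> C * (real (Suc k))\<^sup>2"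
    using cutoff_derivs_bounded[of 0 pi] unfolding X_def by blast
  \<comment> \<open>Each of the two terms of \<open>R\<close> contributes 2 * (m + 1) * C; the
    summand 1 makes \<open>B\<close> a bound for the y-factor as well.\<close>
  define B where "B = 4 * real (Suc m) * C + 1"
  have B1: "B \<ge> 1" using C(1) by (simp add: B_def)
  have rem: "(\<lambda>k. LINT z|plate l. u z * tensor (R k) (\<lambda>y. g' y * Y k y) z) \<longlonglongrightarrow> 0"
  proof (rule boundary_layer_integral_tendsto_0[OF u U, where B = B])
    show inner: "R k x = 0" if "2 / real (Suc k) < x" "x < pi - 2 / real (Suc k)" for k x
      using cutoff_inner(2,3)[of 0 k x pi] that by (simp add: R_def X_def)
    show "\<bar>R k x\<bar> \<le> B * real (Suc k)" if x: "x \<in> {0<..<pi}" for k x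
    proof (cases "2 / real (Suc k) < x \<and> x < pi - 2 / real (Suc k)")
      case True
      then show ?thesis using inner[of k x] B1 by simp
    next
      case False
      have "\<bar>f x\<bar> \<le> real (Suc m) * 1 * (2 / real (Suc k))"
        unfolding f_def by (rule Sn_edge[where b = pi]) (use x False in auto)
      then have "\<bar>f x\<bar> * \<bar>deriv (deriv (X k)) x\<bar> \<le> (real (Suc m) * 1 * (2 / real (Suc k))) * (C * (real (Suc k))\<^sup>2)"
        by (intro mult_mono C) auto
      also have "\<dots> = 2 * real (Suc m) * C * real (Suc k)" by (simp add: power2_eq_square)
      finally have 1: "\<bar>f x * deriv (deriv (X k)) x\<bar> \<le> 2 * real (Suc m) * C * real (Suc k)" by (simp only: abs_mult)
      have "\<bar>deriv f x\<bar> * \<bar>deriv (X k) x\<bar> \<le> (real (Suc m) * 1) * (C * real (Suc k))"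
        unfolding f' abs_mult using Cn_abs_le by (intro mult_mono C mult_left_mono) auto
      then have 2: "\<bar>deriv f x * deriv (X k) x\<bar> \<le> real (Suc m) * C * real (Suc k)" by (simp add: abs_mult)
      have "\<bar>R k x\<bar> \<le> 2 * \<bar>deriv f x * deriv (X k) x\<bar> + \<bar>f x * deriv (deriv (X k)) x\<bar>"
        unfolding R_def by linarith
      also have "\<dots> \<le> 4 * real (Suc m) * C * real (Suc k)" using 1 2 by linarith
      also have "\<dots> \<le> B * real (Suc k)" by (intro mult_right_mono) (auto simp: B_def)
      finally show ?thesis .
    qed
    show "\<bar>g' y * Y k y\<bar> \<le> B" if "y \<in> {- l<..<l}" for k y using abs1(2)[of y k] B1 by linarith
  qed (intro sR smooth_mult f)+
  have "(\<lambda>k. - (real (Suc m))\<^sup>2 * (LINT z|plate l. u z * ?T k z) + (LINT z|plate l. u z * tensor (R k) (\<lambda>y. g' y * Y k y) z))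
      \<longlonglongrightarrow> - (real (Suc m))\<^sup>2 * (LINT z|plate l. u z * tensor f g' z) + 0"
    by (intro tendsto_add tendsto_mult_left lim u rem)
  moreover have "(\<lambda>k. ip l gxx (?T k)) \<longlonglongrightarrow> (LINT z|plate l. gxx z * tensor f g' z)"
    unfolding ip_def by (rule lim[OF g])
  ultimately have "(LINT z|plate l. gxx z * tensor f g' z) = - (real (Suc m))\<^sup>2 * (LINT z|plate l. u z * tensor f g' z)"
    unfolding eq using LIMSEQ_unique by force
  then show ?thesis by (simp add: ip_def phi_def f_def g'_def)
qed

text \<open>The sine in y vanishes on the long edges and compensates the derivative of the y-cutoff,
  so no information on u is used there. The cosine in x does not vanish on the short edges, but the
  x-cutoff is differentiated only once and u is small in that layer.\<close>

lemma coefficient_xy: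
  assumes adm: "admissible l u gxx gxy"
  shows "ip l gxy (psi (m, n)) = - (real (Suc m) * (real n * c)) * ip l u (phi (m, n))"
proof -
  obtain U where u: "u \<in> L2 l" and g: "gxy \<in> L2 l" and wd: "is_weak_deriv l 1 1 u gxy"
    and U: "continuous_on (closure (Omega l)) U" "AE z in plate l. u z = U z"
      "\<forall>x\<in>{0, pi}. \<forall>y\<in>{- l<..<l}. U (x, y) = 0"
    using adm unfolding admissible_def by blast
  define f where "f = Cn 1 0 (Suc m)"
  define s where "s = Sn 1 0 (Suc m)"
  define g' where "g' = Sn c (- l) n"
  define h where "h = Cn c (- l) n"
  define X where "X = cutoff 0 pi"
  define Y where "Y = cutoff (- l) l"
  have f: "smooth f" "smooth g'" "smooth (X k)" "smooth (Y k)" "smooth s" "smooth h" for k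
    by (auto simp: f_def s_def h_def g'_def X_def Y_def smooth_Sn smooth_Cn smooth_cutoff)
  have f': "deriv f = (\<lambda>x. - real (Suc m) * s x)" and g'': "deriv g' = (\<lambda>y. (real n * c) * h y)"
    by (simp_all add: f_def g'_def s_def h_def deriv_Sn deriv_Cn)
  define R where "R k x = f x * deriv (X k) x" for k x
  define G where "G k y = (real n * c) * (h y * Y k y) + g' y * deriv (Y k) y" for k y
  have sR: "smooth (R k)" "smooth (G k)" for k
    unfolding R_def[abs_def] G_def[abs_def] by (intro smooth_add smooth_cmult smooth_mult smooth_deriv f)+
  have DX: "deriv (\<lambda>x. f x * X k x) = (\<lambda>x. - real (Suc m) * (s x * X k x) + R k x)" for k
    unfolding deriv_mult_smooth[OF f(1,3)] f' R_def by (auto simp: algebra_simps)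
  have DY: "deriv (\<lambda>y. g' y * Y k y) = G k" for k
    unfolding deriv_mult_smooth[OF f(2,4)] g'' G_def by (auto simp: algebra_simps)
  let ?T = "\<lambda>k. tensor (\<lambda>x. f x * X k x) (\<lambda>y. g' y * Y k y)"
  have T: "?T k \<in> test_functions l" for k
    unfolding X_def Y_def by (intro cutoff_test_function f) auto
  have eq: "ip l gxy (?T k) = - real (Suc m) * (LINT z|plate l. u z * tensor (\<lambda>x. s x * X k x) (G k) z)
      + (LINT z|plate l. u z * tensor (R k) (G k) z)" for k
  proof -
    have "(LINT z|plate l. u z * (dx ^^ 1) ((dy ^^ 1) (?T k)) z) = (-1) ^ (1 + 1) * (LINT z|plate l. gxy z * ?T k z)"
      using wd T unfolding is_weak_deriv_def by blast
    moreover have "(dx ^^ 1) ((dy ^^ 1) (?T k)) = tensor (deriv (\<lambda>x. f x * X k x)) (deriv (\<lambda>y. g' y * Y k y))"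
      by (simp add: dx_tensor dy_tensor smooth_mult smooth_deriv f)
    ultimately have "ip l gxy (?T k) = (LINT z|plate l. u z * tensor (\<lambda>x. - real (Suc m) * (s x * X k x) + R k x) (G k) z)"
      by (simp add: ip_def DX DY)
    also have "\<dots> = (LINT z|plate l. - real (Suc m) * (u z * tensor (\<lambda>x. s x * X k x) (G k) z) + u z * tensor (R k) (G k) z)"
      by (intro Bochner_Integration.integral_cong) (auto simp: tensor_def algebra_simps)
    also have "\<dots> = - real (Suc m) * (LINT z|plate l. u z * tensor (\<lambda>x. s x * X k x) (G k) z) + (LINT z|plate l. u z * tensor (R k) (G k) z)"
    proof -
      have "integrable (plate l) (\<lambda>z. u z * tensor (\<lambda>x. s x * X k x) (G k) z)" "integrable (plate l) (\<lambda>z. u z * tensor (R k) (G k) z)"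
        by (intro L2_mult_integrable u tensor_L2 smooth_mult f sR)+
      then show ?thesis by simp
    qed
    finally show ?thesis .
  qed
  have abs1: "\<bar>f x * X k x\<bar> \<le> 1" "\<bar>g' y * Y k y\<bar> \<le> 1" "\<bar>s x * X k x\<bar> \<le> 1" "\<bar>h y * Y k y\<bar> \<le> 1" for x y k
    unfolding abs_mult X_def Y_def f_def g'_def s_def h_def
    by (intro mult_le_one Sn_abs_le Cn_abs_le cutoff_abs_le abs_ge_zero)+
  obtain C1 where C1: "C1 \<ge> 0" "\<And>k t. \<bar>deriv (X k) t\<bar> \<le> C1 * real (Suc k)"
    using cutoff_derivs_bounded[of 0 pi] unfolding X_def by blast
  obtain C2 where C2: "C2 \<ge> 0" "\<And>k t. \<bar>deriv (Y k) t\<bar> \<le> C2 * real (Suc k)"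
    using cutoff_derivs_bounded[of "- l" l] unfolding Y_def by blast
  \<comment> \<open>\<open>C1\<close> bounds the x-remainder, the next two summands bound
    \<open>G\<close>, and 1 bounds the undifferentiated x-factor.\<close>
  define B where "B = C1 + real n * c + real n * c * 2 * C2 + 1"
  have nc: "real n * c \<ge> 0" using c_pos by simp
  have ncC: "real n * c * 2 * C2 \<ge> 0" using nc C2(1) by simp
  have B: "1 \<le> B" "C1 \<le> B" "real n * c + real n * c * 2 * C2 \<le> B"
    using C1(1) nc ncC by (auto simp: B_def)
  have G_bound: "\<bar>G k y\<bar> \<le> B" if y: "y \<in> {- l<..<l}" for k y
  proof -
    have "\<bar>g' y * deriv (Y k) y\<bar> \<le> real n * c * 2 * C2"
    proof (cases "- l + 2 / real (Suc k) < y \<and> y < l - 2 / real (Suc k)")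
      case True
      then have "deriv (Y k) y = 0" unfolding Y_def by (intro cutoff_inner) auto
      then show ?thesis using ncC by simp
    next
      case False
      have "\<bar>g' y\<bar> \<le> real n * c * (2 / real (Suc k))"
        unfolding g'_def by (rule Sn_edge[where b = l]) (use y False c_pos c_length in auto)
      then have "\<bar>g' y\<bar> * \<bar>deriv (Y k) y\<bar> \<le> (real n * c * (2 / real (Suc k))) * (C2 * real (Suc k))"
        by (intro mult_mono C2) (use c_pos in auto)
      also have "\<dots> = real n * c * 2 * C2" by simp
      finally show ?thesis by (simp only: abs_mult)
    qed
    moreover have "\<bar>(real n * c) * (h y * Y k y)\<bar> \<le> real n * c * 1"
      unfolding abs_mult[of "real n * c"] using nc abs1(4)[of y k] by (intro mult_mono) auto
    ultimately show ?thesis unfolding G_def using B(3) by linarith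
  qed
  have G_lim: "(\<lambda>k. G k y) \<longlonglongrightarrow> (real n * c) * h y" if y: "y \<in> {- l<..<l}" for y
  proof -
    have "\<forall>\<^sub>F k in sequentially. g' y * deriv (Y k) y = 0"
      using eventually_cutoff_inner[OF y] by eventually_elim (auto simp: Y_def cutoff_inner)
    then have "(\<lambda>k. g' y * deriv (Y k) y) \<longlonglongrightarrow> 0" by (rule tendsto_eventually)
    moreover have "(\<lambda>k. (real n * c) * (h y * Y k y)) \<longlonglongrightarrow> (real n * c) * (h y * 1)"
      unfolding Y_def by (intro tendsto_mult_left cutoff_tendsto_1 y)
    ultimately show ?thesis unfolding G_def using tendsto_add by force
  qed
  have main: "(\<lambda>k. LINT z|plate l. u z * tensor (\<lambda>x. s x * X k x) (G k) z) \<longlonglongrightarrow> (LINT z|plate l. u z * tensor s (\<lambda>y. (real n * c) * h y) z)"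
  proof (rule tensor_integral_limit[OF u, where B = B])
    show "(\<lambda>k. s x * X k x) \<longlonglongrightarrow> s x" if "x \<in> {0<..<pi}" for x
      using tendsto_mult_left[OF cutoff_tendsto_1[OF that], of "s x"] by (simp add: X_def)
    show "\<bar>s x * X k x\<bar> \<le> B" for k x using abs1(3)[of x k] B(1) by linarith
  qed (auto intro!: smooth_mult smooth_cmult f sR G_bound G_lim)
  have rem: "(\<lambda>k. LINT z|plate l. u z * tensor (R k) (G k) z) \<longlonglongrightarrow> 0"
  proof (rule boundary_layer_integral_tendsto_0[OF u U, where B = B])
    show "R k x = 0" if "2 / real (Suc k) < x" "x < pi - 2 / real (Suc k)" for k x
      using cutoff_inner(2)[of 0 k x pi] that by (simp add: R_def X_def)
    show "\<bar>R k x\<bar> \<le> B * real (Suc k)" for k x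
    proof -
      have "\<bar>f x\<bar> * \<bar>deriv (X k) x\<bar> \<le> 1 * (C1 * real (Suc k))"
        unfolding f_def by (intro mult_mono C1 Cn_abs_le) auto
      also have "\<dots> \<le> B * real (Suc k)" using B(2) by (simp add: mult_right_mono)
      finally show ?thesis by (simp add: R_def abs_mult)
    qed
  qed (auto intro: sR G_bound)
  have lim: "(\<lambda>k. LINT z|plate l. gxy z * ?T k z) \<longlonglongrightarrow> (LINT z|plate l. gxy z * tensor f g' z)"
  proof (rule tensor_integral_limit[OF g _ _ f(1,2), where B = 1])
    show "(\<lambda>k. f x * X k x) \<longlonglongrightarrow> f x" if "x \<in> {0<..<pi}" for x
      using tendsto_mult_left[OF cutoff_tendsto_1[OF that], of "f x"] by (simp add: X_def)
    show "(\<lambda>k. g' y * Y k y) \<longlonglongrightarrow> g' y" if "y \<in> {- l<..<l}" for y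
      using tendsto_mult_left[OF cutoff_tendsto_1[OF that], of "g' y"] by (simp add: Y_def)
  qed (use abs1 in \<open>auto intro!: smooth_mult f\<close>)
  have "(\<lambda>k. - real (Suc m) * (LINT z|plate l. u z * tensor (\<lambda>x. s x * X k x) (G k) z) + (LINT z|plate l. u z * tensor (R k) (G k) z))
      \<longlonglongrightarrow> - real (Suc m) * (LINT z|plate l. u z * tensor s (\<lambda>y. (real n * c) * h y) z) + 0"
    by (intro tendsto_add tendsto_mult_left main rem)
  moreover have "(\<lambda>k. ip l gxy (?T k)) \<longlonglongrightarrow> (LINT z|plate l. gxy z * tensor f g' z)"
    unfolding ip_def by (rule lim)
  ultimately have "(LINT z|plate l. gxy z * tensor f g' z) = - real (Suc m) * (LINT z|plate l. u z * tensor s (\<lambda>y. (real n * c) * h y) z)"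
    unfolding eq using LIMSEQ_unique by force
  also have "(LINT z|plate l. u z * tensor s (\<lambda>y. (real n * c) * h y) z) = (LINT z|plate l. (real n * c) * (u z * tensor s h z))"
    by (intro Bochner_Integration.integral_cong) (auto simp: tensor_def)
  also have "\<dots> = (real n * c) * (LINT z|plate l. u z * tensor s h z)" by (rule integral_mult_right_zero)
  finally show ?thesis by (simp add: ip_def phi_def psi_def f_def g'_def s_def h_def algebra_simps)
qed

section \<open>Completeness of the sine-cosine system\<close>

lemma continuous_L2:
  assumes "continuous_on UNIV f"
  shows "f \<in> L2 l"
proof -
  have "compact (f ` closure (Omega l))"
    unfolding closure_Omega using assms
    by (intro compact_continuous_image compact_Times) (auto intro: continuous_on_subset)
  then obtain B where B: "\<forall>y\<in>f ` closure (Omega l). norm y \<le> B" using compact_imp_bounded bounded_iff by blast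
  have "\<bar>f z\<bar> \<le> B" if "z \<in> Omega l" for z
    using B that closure_subset[of "Omega l"] by (metis image_eqI real_norm_def subsetD)
  then show ?thesis
    by (intro bounded_L2[of _ _ B] borel_measurable_plate borel_measurable_continuous_onI assms AE_plate_I)
qed

lemma continuous_phi: "continuous_on UNIV (phi p)"
  unfolding phi_def by (intro continuous_tensor smooth_Sn smooth_Cn)

lemma phi_L2: "phi p \<in> L2 l" by (intro continuous_L2 continuous_phi)

lemma phi_cos_x:
  "Cn 1 0 1 (fst z) * phi (m, n) z = (phi (Suc m, n) z + (if m = 0 then 0 else phi (m - 1, n) z)) / 2"
proof -
  have "Cn 1 0 1 (fst z) * phi (m, n) z = (Sn 1 0 (Suc m) (fst z) * Cn 1 0 1 (fst z)) * Cn c (- l) n (snd z)"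
    by (simp add: phi_def tensor_def)
  then show ?thesis unfolding Sn_times_Cn_1 by (cases m) (auto simp: phi_def tensor_def algebra_simps)
qed

lemma phi_cos_y:
  "Cn c (- l) 1 (snd z) * phi (m, n) z = (if n = 0 then phi (m, 1) z else (phi (m, n + 1) z + phi (m, n - 1) z) / 2)"
proof (cases n)
  case (Suc k)
  have "Cn c (- l) 1 (snd z) * phi (m, Suc k) z = Sn 1 0 (Suc m) (fst z) * (Cn c (- l) (Suc k) (snd z) * Cn c (- l) 1 (snd z))"
    by (simp add: phi_def tensor_def)
  then show ?thesis unfolding Cn_times_Cn_1 Suc by (auto simp: phi_def tensor_def algebra_simps)
qed (simp add: phi_def tensor_def)

text \<open>The orthogonality relation is stable under multiplication by \<open>cos x\<close> and \<open>cos (c (y + l))\<close>, so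
  Stone--Weierstrass extends it from \<open>sin x\<close> to \<open>sin x\<close> times any continuous function.\<close>

lemma phi_complete:
  assumes w: "w \<in> L2 l" and zero: "\<And>p. ip l w (phi p) = 0"
  shows "AE z in plate l. w z = 0"
proof -
  define good where "good f \<longleftrightarrow> continuous_on UNIV f \<and> (\<forall>p. ip l w (\<lambda>z. f z * phi p z) = 0)" for f
  \<comment> \<open>\<open>P\<close> collects the multipliers that preserve \<open>good\<close>.
    Unlike \<open>good\<close> itself, this class is visibly closed under products, as
    Stone-Weierstrass demands.\<close>
  define P where "P f \<longleftrightarrow> continuous_on UNIV f \<and> (\<forall>g. good g \<longrightarrow> good (\<lambda>z. f z * g z))" for f
  have int: "integrable (plate l) (\<lambda>z. w z * (f z * phi p z))" if "continuous_on UNIV f" for f p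
    by (intro L2_mult_integrable w continuous_L2 continuous_on_mult that continuous_phi)
  have P_good: "good f" if "P f" for f
  proof -
    have "good (\<lambda>_. 1)" unfolding good_def using zero by simp
    with that have "good (\<lambda>z. f z * 1)" unfolding P_def by blast
    then show ?thesis by simp
  qed
  have contx: "continuous_on UNIV (\<lambda>z :: real \<times> real. Cn 1 0 1 (fst z))" "continuous_on UNIV (\<lambda>z :: real \<times> real. Cn c (- l) 1 (snd z))"
    unfolding Cn_def by (intro continuous_intros)+
  have P_x: "P (\<lambda>z. Cn 1 0 1 (fst z))"
    unfolding P_def
  proof (intro conjI allI impI contx)
    fix g assume g: "good g"
    then have cg: "continuous_on UNIV g" by (simp add: good_def)
    have "ip l w (\<lambda>z. Cn 1 0 1 (fst z) * g z * phi p z) = 0" for p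
    proof -
      obtain m n where p: "p = (m, n)" by (cases p)
      have "Cn 1 0 1 (fst z) * g z * phi p z = (1/2) * (g z * phi (Suc m, n) z) + (if m = 0 then 0 else 1/2) * (g z * phi (m - 1, n) z)" for z
      proof -
        have "Cn 1 0 1 (fst z) * g z * phi p z = g z * (Cn 1 0 1 (fst z) * phi (m, n) z)" by (simp add: p)
        then show ?thesis unfolding phi_cos_x by (cases "m = 0") (simp_all add: field_simps)
      qed
      then have "ip l w (\<lambda>z. Cn 1 0 1 (fst z) * g z * phi p z) =
          (LINT z|plate l. (1/2) * (w z * (g z * phi (Suc m, n) z)) + (if m = 0 then 0 else 1/2) * (w z * (g z * phi (m - 1, n) z)))"
        unfolding ip_def by (intro Bochner_Integration.integral_cong) (auto simp: algebra_simps)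
      also have "\<dots> = 0"
        using g int[OF cg] unfolding good_def ip_def by (subst Bochner_Integration.integral_add) auto
      finally show ?thesis .
    qed
    then show "good (\<lambda>z. Cn 1 0 1 (fst z) * g z)"
      unfolding good_def using cg contx by (auto intro: continuous_on_mult)
  qed
  have P_y: "P (\<lambda>z. Cn c (- l) 1 (snd z))"
    unfolding P_def
  proof (intro conjI allI impI contx)
    fix g assume g: "good g"
    then have cg: "continuous_on UNIV g" by (simp add: good_def)
    have "ip l w (\<lambda>z. Cn c (- l) 1 (snd z) * g z * phi p z) = 0" for p
    proof -
      obtain m n where p: "p = (m, n)" by (cases p)
      have "Cn c (- l) 1 (snd z) * g z * phi p z = (if n = 0 then 1 else 1/2) * (g z * phi (m, n + 1) z) + (if n = 0 then 0 else 1/2) * (g z * phi (m, n - 1) z)" for z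
      proof -
        have "Cn c (- l) 1 (snd z) * g z * phi p z = g z * (Cn c (- l) 1 (snd z) * phi (m, n) z)" by (simp add: p)
        then show ?thesis unfolding phi_cos_y by (cases "n = 0") (simp_all add: field_simps)
      qed
      then have "ip l w (\<lambda>z. Cn c (- l) 1 (snd z) * g z * phi p z) =
          (LINT z|plate l. (if n = 0 then 1 else 1/2) * (w z * (g z * phi (m, n + 1) z)) + (if n = 0 then 0 else 1/2) * (w z * (g z * phi (m, n - 1) z)))"
        unfolding ip_def by (intro Bochner_Integration.integral_cong) (auto simp: algebra_simps)
      also have "\<dots> = 0"
        using g int[OF cg] unfolding good_def ip_def by (subst Bochner_Integration.integral_add) auto
      finally show ?thesis .
    qed
    then show "good (\<lambda>z. Cn c (- l) 1 (snd z) * g z)"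
      unfolding good_def using cg contx by (auto intro: continuous_on_mult)
  qed
  have approx: "\<exists>g. P g \<and> (\<forall>z\<in>closure (Omega l). \<bar>f z - g z\<bar> < e)" if f: "continuous_on (closure (Omega l)) f" and e: "e > 0" for f e
  proof (rule Stone_Weierstrass_HOL[OF _ _ _ _ _ _ f e])
    show "compact (closure (Omega l))" unfolding closure_Omega by (intro compact_Times) auto
    show "P (\<lambda>_. d)" for d
      unfolding P_def good_def ip_def
      by (auto intro!: continuous_intros) (simp add: mult.assoc mult.left_commute[of _ d])
    show "continuous_on (closure (Omega l)) f" if "P f" for f
      using that unfolding P_def by (auto intro: continuous_on_subset)
    show "P (\<lambda>x. f x + g x)" if "P f \<and> P g" for f g
    proof -
      have fg: "continuous_on UNIV f" "continuous_on UNIV g" using that by (auto simp: P_def)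
      have "good (\<lambda>z. (f z + g z) * h z)" if "good h" for h
      proof -
        have "good (\<lambda>z. f z * h z)" "good (\<lambda>z. g z * h z)" using \<open>P f \<and> P g\<close> that by (auto simp: P_def)
        moreover have "continuous_on UNIV (\<lambda>z. f z * h z)" "continuous_on UNIV (\<lambda>z. g z * h z)"
          using \<open>good h\<close> fg by (auto simp: good_def intro: continuous_on_mult)
        ultimately show ?thesis using int
          unfolding good_def ip_def by (auto simp: distrib_right distrib_left intro: continuous_on_add)
      qed
      then show ?thesis unfolding P_def using fg by (auto intro: continuous_on_add)
    qed
    show "P (\<lambda>x. f x * g x)" if "P f \<and> P g" for f g
      using that unfolding P_def by (auto intro: continuous_on_mult simp: mult.assoc)
    show "\<exists>f. P f \<and> f x \<noteq> f y" if "x \<in> closure (Omega l) \<and> y \<in> closure (Omega l) \<and> x \<noteq> y" for x y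
    \<comment> \<open>Cosine is injective on the interval from 0 to pi, so the two multipliers
      separate the points of the closed plate.\<close>
    proof (cases "fst x = fst y")
      case False
      have "fst x \<in> {0..pi}" "fst y \<in> {0..pi}" using that by (auto simp: closure_Omega)
      then have "cos (fst x) \<noteq> cos (fst y)" using False cos_inj_pi by auto
      then show ?thesis using P_x by (intro exI[of _ "\<lambda>z. Cn 1 0 1 (fst z)"]) (simp add: Cn_def)
    next
      case True
      then have ne: "snd x \<noteq> snd y" using that by (simp add: prod_eq_iff)
      have xy: "snd x \<in> {- l..l}" "snd y \<in> {- l..l}" using that by (auto simp: closure_Omega)
      have range: "c * (t + l) \<in> {0..pi}" if "t \<in> {- l..l}" for t
      proof -
        have "c * (t + l) \<le> c * (l + l)" using that c_pos by (intro mult_left_mono) auto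
        moreover have "c * (l + l) = pi" using c_length by simp
        ultimately have "c * (t + l) \<le> pi" by linarith
        then show ?thesis using c_pos that by auto
      qed
      have "cos (c * (snd x + l)) \<noteq> cos (c * (snd y + l))"
        using cos_inj_pi[of "c * (snd x + l)" "c * (snd y + l)"] range[OF xy(1)] range[OF xy(2)] ne c_pos by auto
      then show ?thesis using P_y by (intro exI[of _ "\<lambda>z. Cn c (- l) 1 (snd z)"]) (simp add: Cn_def)
    qed
  qed
  \<comment> \<open>\<open>phi (0, 0)\<close> is sin x, which is positive on the open plate and can
    be divided out afterwards.\<close>
  have "AE z in plate l. w z * phi (0, 0) z = 0"
  proof (rule AE_zero_if_test_integrals_zero)
    show "integrable (plate l) (\<lambda>z. w z * phi (0, 0) z)" by (intro L2_mult_integrable w phi_L2)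
    fix f assume f: "f \<in> test_functions l"
    have cf: "continuous_on UNIV f" by (rule test_functionD(4)[OF f])
    have "\<bar>ip l w (\<lambda>z. f z * phi (0, 0) z)\<bar> \<le> e * (LINT z|plate l. \<bar>w z\<bar>)" if e: "e > 0" for e
    proof -
      obtain g where g: "P g" "\<forall>z\<in>closure (Omega l). \<bar>f z - g z\<bar> < e"
        using approx[OF continuous_on_subset[OF cf] e] by blast
      have cg: "continuous_on UNIV g" using g(1) by (simp add: P_def)
      have "ip l w (\<lambda>z. g z * phi (0, 0) z) = 0" using P_good[OF g(1)] by (simp add: good_def)
      then have "ip l w (\<lambda>z. f z * phi (0, 0) z) = (LINT z|plate l. w z * (f z * phi (0, 0) z) - w z * (g z * phi (0, 0) z))"
        using int[OF cf] int[OF cg] by (simp add: ip_def)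
      also have "\<bar>\<dots>\<bar> \<le> (LINT z|plate l. \<bar>w z * (f z * phi (0, 0) z) - w z * (g z * phi (0, 0) z)\<bar>)"
        by (rule integral_abs_bound)
      also have "\<dots> \<le> (LINT z|plate l. e * \<bar>w z\<bar>)"
      proof (rule integral_mono_AE)
        show "integrable (plate l) (\<lambda>z. \<bar>w z * (f z * phi (0, 0) z) - w z * (g z * phi (0, 0) z)\<bar>)"
          using int[OF cf] int[OF cg] by (intro integrable_abs Bochner_Integration.integrable_diff)
        show "integrable (plate l) (\<lambda>z. e * \<bar>w z\<bar>)" using L2_integrable[OF w] by simp
        show "AE z in plate l. \<bar>w z * (f z * phi (0, 0) z) - w z * (g z * phi (0, 0) z)\<bar> \<le> e * \<bar>w z\<bar>"
        proof (rule AE_plate_I)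
          fix z assume "z \<in> Omega l"
          then have "\<bar>f z - g z\<bar> \<le> e" using g(2) closure_subset[of "Omega l"] by (force intro: less_imp_le)
          moreover have "\<bar>phi (0, 0) z\<bar> \<le> 1" by (simp add: phi_def tensor_def Sn_abs_le)
          ultimately have "\<bar>f z - g z\<bar> * \<bar>phi (0, 0) z\<bar> \<le> e * 1" by (intro mult_mono) auto
          then have "\<bar>w z\<bar> * (\<bar>f z - g z\<bar> * \<bar>phi (0, 0) z\<bar>) \<le> \<bar>w z\<bar> * e" by (intro mult_left_mono) auto
          moreover have "w z * (f z * phi (0, 0) z) - w z * (g z * phi (0, 0) z) = w z * ((f z - g z) * phi (0, 0) z)"
            by (simp add: algebra_simps)
          ultimately show "\<bar>w z * (f z * phi (0, 0) z) - w z * (g z * phi (0, 0) z)\<bar> \<le> e * \<bar>w z\<bar>"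
            by (simp add: abs_mult mult.commute)
        qed
      qed
      finally show ?thesis by simp
    qed
    note bound = this
    have "ip l w (\<lambda>z. f z * phi (0, 0) z) = 0"
    proof (rule ccontr)
      define I where "I = \<bar>ip l w (\<lambda>z. f z * phi (0, 0) z)\<bar>"
      define W where "W = (LINT z|plate l. \<bar>w z\<bar>)"
      assume "ip l w (\<lambda>z. f z * phi (0, 0) z) \<noteq> 0"
      then have I: "I > 0" by (simp add: I_def)
      have W: "W \<ge> 0" by (simp add: W_def)
      \<comment> \<open>The free parameter is chosen so that the bound falls below half of
        \<open>I\<close>.\<close>
      have "I \<le> I / (2 * (W + 1)) * W" unfolding I_def[symmetric] W_def[symmetric]
        using bound[of "I / (2 * (W + 1))"] I W by (simp add: I_def[symmetric] W_def[symmetric])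
      also have "\<dots> < I" using I W by (simp add: divide_less_eq algebra_simps add_nonneg_pos)
      finally show False by simp
    qed
    then show "(LINT z|plate l. w z * phi (0, 0) z * f z) = 0"
      unfolding ip_def by (simp add: mult.assoc mult.commute[of "f _"])
  qed
  moreover have "AE z in plate l. phi (0, 0) z \<noteq> 0"
  proof (rule AE_plate_I)
    fix z assume "z \<in> Omega l"
    then have "sin (fst z) > 0" by (intro sin_gt_zero) (auto simp: Omega_def)
    then show "phi (0, 0) z \<noteq> 0" by (simp add: phi_def tensor_def Sn_def)
  qed
  ultimately show ?thesis by eventually_elim simp
qed

section \<open>Decay of the coefficients and uniform convergence of the series\<close>

lemma ip_phi: "ip l (phi p) (phi q) = (if p = q then pi / 2 * (if snd p = 0 then 2 * l else l) else 0)"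
  unfolding phi_def ip_tensor[OF smooth_Sn smooth_Cn smooth_Sn smooth_Cn]
    integral_Sn_Sn[of 1 pi 0, simplified] integral_Cn_Cn[OF c_pos c_length]
  by (auto simp: prod_eq_iff)

lemma ip_psi: "ip l (psi p) (psi q) = (if p = q \<and> snd p \<noteq> 0 then pi / 2 * l else 0)"
  unfolding psi_def ip_tensor[OF smooth_Cn smooth_Sn smooth_Cn smooth_Sn]
    integral_Cn_Cn[of 1 pi 0, simplified] integral_Sn_Sn[OF c_pos c_length]
  by (auto simp: prod_eq_iff)

definition phi_x :: "nat \<times> nat \<Rightarrow> real \<times> real \<Rightarrow> real" where
  "phi_x p = tensor (Cn 1 0 (Suc (fst p))) (Cn c (- l) (snd p))"

definition phi_y :: "nat \<times> nat \<Rightarrow> real \<times> real \<Rightarrow> real" where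
  "phi_y p = tensor (Sn 1 0 (Suc (fst p))) (Sn c (- l) (snd p))"

lemma ip_phi_x: "ip l (phi_x p) (phi_x q) = (if p = q then pi / 2 * (if snd p = 0 then 2 * l else l) else 0)"
  unfolding phi_x_def ip_tensor[OF smooth_Cn smooth_Cn smooth_Cn smooth_Cn]
    integral_Cn_Cn[of 1 pi 0, simplified] integral_Cn_Cn[OF c_pos c_length]
  by (auto simp: prod_eq_iff)

lemma ip_phi_y: "ip l (phi_y p) (phi_y q) = (if p = q \<and> snd p \<noteq> 0 then pi / 2 * l else 0)"
  unfolding phi_y_def ip_tensor[OF smooth_Sn smooth_Sn smooth_Sn smooth_Sn]
    integral_Sn_Sn[of 1 pi 0, simplified] integral_Sn_Sn[OF c_pos c_length]
  by (auto simp: prod_eq_iff)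

lemma trig_L2: "psi p \<in> L2 l" "phi_x p \<in> L2 l" "phi_y p \<in> L2 l"
  unfolding psi_def phi_x_def phi_y_def by (intro tensor_L2 smooth_Sn smooth_Cn)+

lemma phi_abs_le: "\<bar>phi p z\<bar> \<le> 1"
  unfolding phi_def tensor_def abs_mult by (intro mult_le_one Sn_abs_le Cn_abs_le abs_ge_zero)

text \<open>A lower bound for the sum of the squared multipliers of \<open>gxx\<close> and
  \<open>gxy\<close>. The fourth power of the x-frequency is weakened to the square so that the
  weight becomes a product.\<close>

definition weight :: "nat \<times> nat \<Rightarrow> real" where
  "weight p = (real (Suc (fst p)))\<^sup>2 * (1 + (real (snd p) * c)\<^sup>2)"

text \<open>The part of the second-order energy that is expressed by the coefficients of u alone;
  cosine coefficients of the second y-derivative would bring in boundary terms on the long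
  edges.\<close>

definition energy :: "(real \<times> real \<Rightarrow> real) \<Rightarrow> (real \<times> real \<Rightarrow> real) \<Rightarrow> real" where
  "energy gxx gxy = ip l gxx gxx + ip l gxy gxy"

lemma weight_pos: "weight p > 0"
  unfolding weight_def by (intro mult_pos_pos) (auto simp: add_pos_nonneg)

text \<open>Bessel's inequality for \<open>gxx\<close> against \<open>phi\<close> and for
  \<open>gxy\<close> against \<open>psi\<close>, added up. The constant pi * l is the largest square
  norm, attained by \<open>phi\<close> at y-frequency 0.\<close>

lemma weighted_Bessel:
  assumes adm: "admissible l u gxx gxy" and I: "finite I"
  shows "(\<Sum>p\<in>I. weight p * (ip l u (phi p))\<^sup>2) \<le> pi * l * energy gxx gxy"
proof -
  have L: "gxx \<in> L2 l" "gxy \<in> L2 l" using adm by (auto simp: admissible_def)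
  have "(\<Sum>p\<in>I. weight p * (ip l u (phi p))\<^sup>2) \<le> (\<Sum>p\<in>I. (ip l gxx (phi p))\<^sup>2 + (ip l gxy (psi p))\<^sup>2)"
  proof (rule sum_mono)
    fix p :: "nat \<times> nat"
    obtain m n where p: "p = (m, n)" by (cases p)
    let ?b = "ip l u (phi (m, n))"
    have "(real (Suc m))\<^sup>2 * ?b\<^sup>2 \<le> ((real (Suc m))\<^sup>2)\<^sup>2 * ?b\<^sup>2"
      by (intro mult_right_mono self_le_power) auto
    also have "\<dots> = (ip l gxx (phi p))\<^sup>2"
      unfolding p coefficient_xx[OF adm] by (simp add: power_mult_distrib)
    finally have "(real (Suc m))\<^sup>2 * ?b\<^sup>2 \<le> (ip l gxx (phi p))\<^sup>2" .
    moreover have "(real (Suc m))\<^sup>2 * (real n * c)\<^sup>2 * ?b\<^sup>2 = (ip l gxy (psi p))\<^sup>2"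
      unfolding p coefficient_xy[OF adm] by (simp add: power_mult_distrib)
    ultimately show "weight p * (ip l u (phi p))\<^sup>2 \<le> (ip l gxx (phi p))\<^sup>2 + (ip l gxy (psi p))\<^sup>2"
      unfolding weight_def p by (simp add: distrib_left distrib_right)
  qed
  also have "\<dots> \<le> pi * l * ip l gxx gxx + pi * l * ip l gxy gxy"
    unfolding sum.distrib
    by (intro add_mono L2.Bessel phi_L2 trig_L2 I L) (use l_pos in \<open>auto simp: ip_phi ip_psi\<close>)
  finally show ?thesis by (simp add: energy_def distrib_left)
qed

definition theta :: "nat \<Rightarrow> real" where
  "theta k = 1 / weight (prod_decode k)"

lemma theta_pos: "theta k > 0"
  by (simp add: theta_def weight_pos)

text \<open>Since the weight is a product, two-dimensional summability reduces to the series of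
  inverse squares. The enumeration of pairs is harmless because both components of
  \<open>prod_decode k\<close> are at most k.\<close>

lemma summable_theta: "summable theta"
proof -
  \<comment> \<open>Chosen so that (n + 1)^2 <= 2 * n^2 + 2 <= K * (1 + (n * c)^2).\<close>
  define K where "K = 2 * (1 + 1 / c\<^sup>2)"
  have K: "K > 0" unfolding K_def using c_pos by (simp add: add_pos_pos)
  define v where "v n = 1 / (real (Suc n))\<^sup>2" for n
  have v_pos: "v n > 0" for n by (simp add: v_def)
  have sv: "summable v"
    using inverse_power_summable[of 2, where 'a = real] unfolding v_def
    by (subst summable_Suc_iff) (simp add: inverse_eq_divide)
  define S where "S = suminf v"
  have bound: "theta k \<le> K * (v (fst (prod_decode k)) * v (snd (prod_decode k)))" for k
  proof -
    obtain m n where mn: "prod_decode k = (m, n)" by (cases "prod_decode k")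
    have "(real (Suc n))\<^sup>2 \<le> 2 * (real n)\<^sup>2 + 2"
      using sum_squares_bound[of "real n" 1] by (simp add: power2_sum)
    also have "\<dots> \<le> K * (1 + (real n * c)\<^sup>2)"
      using c_pos by (simp add: K_def power_mult_distrib field_simps)
    finally have "1 / (1 + (real n * c)\<^sup>2) \<le> K * v n"
      by (simp add: v_def divide_le_eq pos_le_divide_eq add_pos_nonneg mult.commute)
    then have "v m * (1 / (1 + (real n * c)\<^sup>2)) \<le> v m * (K * v n)"
      using v_pos[of m] by (intro mult_left_mono) auto
    then show ?thesis by (simp add: theta_def weight_def mn v_def)
  qed
  have "(\<Sum>k<N. theta k) \<le> K * (S * S)" for N
  proof -
    have "(\<Sum>k<N. theta k) \<le> (\<Sum>k<N. K * (v (fst (prod_decode k)) * v (snd (prod_decode k))))"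
      by (intro sum_mono bound)
    also have "\<dots> = (\<Sum>p\<in>prod_decode ` {..<N}. K * (v (fst p) * v (snd p)))"
      by (subst sum.reindex) (auto intro: inj_on_subset[OF inj_prod_decode])
    also have "\<dots> \<le> (\<Sum>p\<in>{..<N} \<times> {..<N}. K * (v (fst p) * v (snd p)))"
    proof (rule sum_mono2)
      show "prod_decode ` {..<N} \<subseteq> {..<N} \<times> {..<N}"
      proof
        fix p assume "p \<in> prod_decode ` {..<N}"
        then obtain k where "k < N" "p = prod_decode k" by auto
        moreover obtain i j where "p = (i, j)" by (cases p)
        ultimately have "prod_encode (i, j) = k" by (metis prod_decode_inverse)
        with \<open>k < N\<close> \<open>p = (i, j)\<close> show "p \<in> {..<N} \<times> {..<N}"
          using le_prod_encode_1[of i j] le_prod_encode_2[of j i] by simp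
      qed
      show "0 \<le> K * (v (fst p) * v (snd p))" for p
        using K v_pos[of "fst p"] v_pos[of "snd p"] by simp
    qed auto
    also have "\<dots> = (\<Sum>m<N. \<Sum>n<N. K * (v m * v n))"
      unfolding sum.cartesian_product by (intro sum.cong) auto
    also have "\<dots> = K * ((\<Sum>m<N. v m) * (\<Sum>n<N. v n))"
      unfolding sum_product by (simp only: sum_distrib_left)
    also have "\<dots> \<le> K * (S * S)"
      unfolding S_def using K v_pos sv
      by (intro mult_left_mono mult_mono sum_le_suminf suminf_nonneg sum_nonneg) (auto intro: less_imp_le)
    finally show ?thesis .
  qed
  then show ?thesis by (intro summableI_nonneg_bounded) (auto intro: less_imp_le theta_pos)
qed

definition coef :: "(real \<times> real \<Rightarrow> real) \<Rightarrow> nat \<Rightarrow> real" where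
  "coef u k = ip l u (phi (prod_decode k)) / ip l (phi (prod_decode k)) (phi (prod_decode k))"

definition phis :: "nat \<Rightarrow> real \<times> real \<Rightarrow> real" where
  "phis k = phi (prod_decode k)"

text \<open>The factor 2 / (pi * l) comes from dividing by square norms that are at least pi * l /
  2, and sqrt (pi * l) from Bessel's inequality.\<close>

definition rate :: real where
  "rate = 2 / (pi * l) * sqrt (pi * l)"

lemma rate_nonneg: "rate \<ge> 0"
  using l_pos by (simp add: rate_def)

lemma norm_phi_ge: "ip l (phi p) (phi p) \<ge> pi * l / 2"
  using l_pos by (simp add: ip_phi)

lemma energy_nonneg:
  assumes "admissible l u gxx gxy"
  shows "energy gxx gxy \<ge> 0"
  using assms L2.nonneg unfolding energy_def admissible_def by (intro add_nonneg_nonneg) auto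

lemma weighted_coef_bound:
  assumes adm: "admissible l u gxx gxy" and I: "finite I"
  shows "(\<Sum>k\<in>I. weight (prod_decode k) * (coef u k)\<^sup>2) \<le> rate\<^sup>2 * energy gxx gxy"
proof -
  have pl: "pi * l > 0" using l_pos by simp
  have "weight p * (ip l u (phi p) / ip l (phi p) (phi p))\<^sup>2 \<le> (2 / (pi * l))\<^sup>2 * (weight p * (ip l u (phi p))\<^sup>2)" for p
  proof -
    have "\<bar>ip l u (phi p) / ip l (phi p) (phi p)\<bar> \<le> \<bar>ip l u (phi p)\<bar> / (pi * l / 2)"
      unfolding abs_divide using norm_phi_ge[of p] pl by (intro divide_left_mono) (auto intro!: mult_pos_pos)
    then have "(ip l u (phi p) / ip l (phi p) (phi p))\<^sup>2 \<le> (\<bar>ip l u (phi p)\<bar> / (pi * l / 2))\<^sup>2"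
      using pl by (intro abs_le_square_iff[THEN iffD1]) simp
    then have "weight p * (ip l u (phi p) / ip l (phi p) (phi p))\<^sup>2 \<le> weight p * (\<bar>ip l u (phi p)\<bar> / (pi * l / 2))\<^sup>2"
      using weight_pos[of p] by (intro mult_left_mono) auto
    then show ?thesis by (simp add: power_divide power_mult_distrib mult_ac)
  qed
  then have "(\<Sum>k\<in>I. weight (prod_decode k) * (coef u k)\<^sup>2) \<le>
      (\<Sum>k\<in>I. (2 / (pi * l))\<^sup>2 * (weight (prod_decode k) * (ip l u (phi (prod_decode k)))\<^sup>2))"
    unfolding coef_def by (intro sum_mono)
  also have "\<dots> = (2 / (pi * l))\<^sup>2 * (\<Sum>p\<in>prod_decode ` I. weight p * (ip l u (phi p))\<^sup>2)"
    by (subst sum.reindex) (auto intro: inj_on_subset[OF inj_prod_decode] simp: sum_distrib_left)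
  also have "\<dots> \<le> (2 / (pi * l))\<^sup>2 * (pi * l * energy gxx gxy)"
    by (intro mult_left_mono weighted_Bessel[OF adm]) (use I in auto)
  also have "\<dots> = rate\<^sup>2 * energy gxx gxy"
    unfolding rate_def power_mult_distrib using pl by simp
  finally show ?thesis .
qed

text \<open>Cauchy-Schwarz, after splitting each coefficient into its product with the square root
  of the weight and the square root of \<open>theta\<close>.\<close>

lemma coef_sum_bound:
  assumes adm: "admissible l u gxx gxy" and I: "finite I"
  shows "(\<Sum>k\<in>I. \<bar>coef u k\<bar>) \<le> rate * sqrt (energy gxx gxy) * sqrt (\<Sum>k\<in>I. theta k)"
proof -
  have "(\<Sum>k\<in>I. \<bar>coef u k\<bar>) = (\<Sum>k\<in>I. \<bar>sqrt (weight (prod_decode k)) * coef u k\<bar> * \<bar>sqrt (theta k)\<bar>)"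
    using weight_pos by (intro sum.cong) (auto simp: theta_def real_sqrt_divide abs_mult less_imp_le less_imp_neq[symmetric])
  also have "\<dots> \<le> L2_set (\<lambda>k. sqrt (weight (prod_decode k)) * coef u k) I * L2_set (\<lambda>k. sqrt (theta k)) I"
    by (rule L2_set_mult_ineq)
  also have "L2_set (\<lambda>k. sqrt (theta k)) I = sqrt (\<Sum>k\<in>I. theta k)"
    using theta_pos by (simp add: L2_set_def less_imp_le)
  also have "L2_set (\<lambda>k. sqrt (weight (prod_decode k)) * coef u k) I \<le> rate * sqrt (energy gxx gxy)"
  proof -
    have "L2_set (\<lambda>k. sqrt (weight (prod_decode k)) * coef u k) I = sqrt (\<Sum>k\<in>I. weight (prod_decode k) * (coef u k)\<^sup>2)"
      using weight_pos by (simp add: L2_set_def power_mult_distrib less_imp_le)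
    also have "\<dots> \<le> sqrt (rate\<^sup>2 * energy gxx gxy)"
      by (intro real_sqrt_le_mono weighted_coef_bound[OF adm I])
    also have "\<dots> = rate * sqrt (energy gxx gxy)" using rate_nonneg by (simp add: real_sqrt_mult)
    finally show ?thesis .
  qed
  finally show ?thesis using theta_pos by (simp add: mult_right_mono sum_nonneg less_imp_le)
qed

text \<open>The uniform approximation error per square root of energy. It does not depend on the
  function, and this is what later gives total boundedness.\<close>

definition tail :: "nat \<Rightarrow> real" where
  "tail N = rate * sqrt (\<Sum>k. theta (k + N))"

lemma tail_nonneg: "tail N \<ge> 0"
  unfolding tail_def using theta_pos summable_theta
  by (intro mult_nonneg_nonneg rate_nonneg real_sqrt_ge_zero suminf_nonneg) (auto simp: summable_iff_shift less_imp_le)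

lemma tail_tendsto_0: "tail \<longlonglongrightarrow> 0"
proof -
  have "(\<lambda>N. \<Sum>k. theta (k + N)) \<longlonglongrightarrow> 0"
    using suminf_exist_split[OF _ summable_theta] by (auto simp: LIMSEQ_iff)
  then have "(\<lambda>N. rate * sqrt (\<Sum>k. theta (k + N))) \<longlonglongrightarrow> rate * sqrt 0"
    by (intro tendsto_mult_left tendsto_real_sqrt)
  then show ?thesis by (simp add: tail_def[abs_def])
qed

lemma coef_summable:
  assumes adm: "admissible l u gxx gxy"
  shows "summable (\<lambda>k. \<bar>coef u k\<bar>)" "(\<Sum>k. \<bar>coef u (k + N)\<bar>) \<le> tail N * sqrt (energy gxx gxy)"
proof -
  have partial: "(\<Sum>k<n. \<bar>coef u (k + N)\<bar>) \<le> tail N * sqrt (energy gxx gxy)" for n N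
  proof -
    have "(\<Sum>k<n. \<bar>coef u (k + N)\<bar>) = (\<Sum>k\<in>(\<lambda>k. k + N) ` {..<n}. \<bar>coef u k\<bar>)"
      by (subst sum.reindex) auto
    also have "\<dots> \<le> rate * sqrt (energy gxx gxy) * sqrt (\<Sum>k\<in>(\<lambda>k. k + N) ` {..<n}. theta k)"
      by (intro coef_sum_bound adm) auto
    also have "(\<Sum>k\<in>(\<lambda>k. k + N) ` {..<n}. theta k) = (\<Sum>k<n. theta (k + N))"
      by (subst sum.reindex) auto
    also have "rate * sqrt (energy gxx gxy) * sqrt (\<Sum>k<n. theta (k + N)) \<le>
        rate * sqrt (energy gxx gxy) * sqrt (\<Sum>k. theta (k + N))"
      using energy_nonneg[OF adm] theta_pos summable_theta rate_nonneg
      by (intro mult_left_mono real_sqrt_le_mono sum_le_suminf) (auto simp: summable_iff_shift less_imp_le)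
    finally show ?thesis by (simp add: tail_def mult_ac)
  qed
  show S: "summable (\<lambda>k. \<bar>coef u k\<bar>)"
    by (rule summableI_nonneg_bounded[where x = "tail 0 * sqrt (energy gxx gxy)"]) (use partial[of 0] in auto)
  have "summable (\<lambda>k. \<bar>coef u (k + N)\<bar>)" using S summable_iff_shift[of "\<lambda>k. \<bar>coef u k\<bar>" N] by simp
  then show "(\<Sum>k. \<bar>coef u (k + N)\<bar>) \<le> tail N * sqrt (energy gxx gxy)"
    by (rule suminf_le_const) (rule partial)
qed

lemma ip_le_sup_square:
  assumes u: "u \<in> L2 l" and le: "AE z in plate l. \<bar>u z\<bar> \<le> B" and B: "B \<ge> 0"
  shows "ip l u u \<le> B\<^sup>2 * (pi * (2 * l))"
proof -
  have "ip l u u \<le> (LINT z|plate l. B\<^sup>2)"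
    unfolding ip_def
  proof (rule integral_mono_AE)
    show "AE z in plate l. u z * u z \<le> B\<^sup>2"
      using le
    proof eventually_elim
      case (elim z)
      then have "\<bar>u z\<bar>\<^sup>2 \<le> B\<^sup>2" by (intro power_mono) auto
      then show ?case by (simp add: power2_eq_square)
    qed
  qed (use L2_mult_integrable[OF u u] L2_integrable[OF const_L2] in auto)
  then show ?thesis by (simp add: measure_plate[OF l_pos] mult.commute)
qed

lemma ip_tendsto_0_if_uniform:
  assumes "\<And>N. f N \<in> L2 l" "g \<in> L2 l" "t \<longlonglongrightarrow> 0" "\<And>N. t N \<ge> 0"
    and "\<And>N. AE z in plate l. \<bar>g z - f N z\<bar> \<le> t N"
  shows "(\<lambda>N. ip l (f N - g) (f N - g)) \<longlonglongrightarrow> 0"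
proof (rule tendsto_sandwich[of "\<lambda>_. 0" _ _ "\<lambda>N. (t N)\<^sup>2 * (pi * (2 * l))"])
  show "\<forall>\<^sub>F N in sequentially. 0 \<le> ip l (f N - g) (f N - g)"
    using assms by (intro always_eventually allI L2.nonneg L2.diff_in)
  have "ip l (f N - g) (f N - g) \<le> (t N)\<^sup>2 * (pi * (2 * l))" for N
  proof (rule ip_le_sup_square)
    show "AE z in plate l. \<bar>(f N - g) z\<bar> \<le> t N"
      using assms(5)[of N] by eventually_elim (simp add: abs_minus_commute)
  qed (intro L2.diff_in assms)+
  then show "\<forall>\<^sub>F N in sequentially. ip l (f N - g) (f N - g) \<le> (t N)\<^sup>2 * (pi * (2 * l))"
    by (intro always_eventually allI)
  have "(\<lambda>N. (t N)\<^sup>2 * (pi * (2 * l))) \<longlonglongrightarrow> 0\<^sup>2 * (pi * (2 * l))" by (intro tendsto_intros assms)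
  then show "(\<lambda>N. (t N)\<^sup>2 * (pi * (2 * l))) \<longlonglongrightarrow> 0" by simp
qed simp

definition partial_sum :: "(real \<times> real \<Rightarrow> real) \<Rightarrow> nat \<Rightarrow> real \<times> real \<Rightarrow> real" where
  "partial_sum u N = (\<Sum>k<N. coef u k *\<^sub>R phis k)"

lemma phis_L2: "phis k \<in> L2 l" by (simp add: phis_def phi_L2)

lemma partial_sum_L2: "partial_sum u N \<in> L2 l"
  unfolding partial_sum_def by (intro L2.sum_in L2.scale_in phis_L2)

lemma partial_sum_apply: "partial_sum u N z = (\<Sum>k<N. coef u k * phis k z)"
  by (simp add: partial_sum_def sum_apply)

text \<open>The series converges uniformly to some function \<open>P\<close>. Orthogonality gives
  \<open>P\<close> the same coefficients as u, so completeness of the system identifies the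
  two.\<close>

lemma admissible_expansion:
  assumes adm: "admissible l u gxx gxy"
  shows "AE z in plate l. \<bar>u z - partial_sum u N z\<bar> \<le> tail N * sqrt (energy gxx gxy)"
proof -
  have u: "u \<in> L2 l" using adm by (simp add: admissible_def)
  have phis_le: "\<bar>phis k z\<bar> \<le> 1" for k z by (simp add: phis_def phi_abs_le)
  have abs_le: "\<bar>coef u k * phis k z\<bar> \<le> \<bar>coef u k\<bar>" for k z
    using phis_le[of k z] by (simp add: abs_mult mult_left_le)
  have sum_abs: "summable (\<lambda>k. \<bar>coef u k * phis k z\<bar>)" for z
    by (rule summable_comparison_test'[OF coef_summable(1)[OF adm], of 0]) (use abs_le in auto)
  define P where "P z = (\<Sum>k. coef u k * phis k z)" for z
  have [measurable]: "phis k \<in> borel_measurable (plate l)" for k by (rule L2_measurable[OF phis_L2])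
  have [measurable]: "P \<in> borel_measurable (plate l)" unfolding P_def by measurable
  have rest: "\<bar>P z - partial_sum u M z\<bar> \<le> tail M * sqrt (energy gxx gxy)" for z M
  proof -
    have "P z - partial_sum u M z = (\<Sum>k. coef u (k + M) * phis (k + M) z)"
      using suminf_split_initial_segment[OF summable_rabs_cancel[OF sum_abs[of z]], of M]
      by (simp add: P_def partial_sum_apply)
    also have "\<bar>\<dots>\<bar> \<le> (\<Sum>k. \<bar>coef u (k + M) * phis (k + M) z\<bar>)"
      using sum_abs[of z] summable_iff_shift[of "\<lambda>k. \<bar>coef u k * phis k z\<bar>" M] by (intro summable_rabs) simp
    also have "\<dots> \<le> (\<Sum>k. \<bar>coef u (k + M)\<bar>)"
      using sum_abs[of z] summable_iff_shift[of "\<lambda>k. \<bar>coef u k * phis k z\<bar>" M]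
        coef_summable(1)[OF adm] summable_iff_shift[of "\<lambda>k. \<bar>coef u k\<bar>" M]
      by (intro suminf_le abs_le) auto
    also have "\<dots> \<le> tail M * sqrt (energy gxx gxy)" by (rule coef_summable(2)[OF adm])
    finally show ?thesis .
  qed
  have P: "P \<in> L2 l"
    using rest[of _ 0] by (intro bounded_L2[of _ _ "tail 0 * sqrt (energy gxx gxy)"]) (auto simp: partial_sum_def)
  have lim: "(\<lambda>M. ip l (partial_sum u M - P) (partial_sum u M - P)) \<longlonglongrightarrow> 0"
  proof (rule ip_tendsto_0_if_uniform[where t = "\<lambda>M. tail M * sqrt (energy gxx gxy)"])
    show "(\<lambda>M. tail M * sqrt (energy gxx gxy)) \<longlonglongrightarrow> 0"
      using tendsto_mult_right[OF tail_tendsto_0] by simp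
  qed (use rest energy_nonneg[OF adm] in \<open>auto intro: partial_sum_L2 P mult_nonneg_nonneg tail_nonneg\<close>)
  have "ip l (u - P) (phi p) = 0" for p
  proof -
    define j where "j = prod_encode p"
    have pj: "phi p = phis j" by (simp add: phis_def j_def)
    have "(\<lambda>M. ip l (partial_sum u M) (phis j)) \<longlonglongrightarrow> ip l P (phis j)"
      by (rule L2.tendsto_left[OF partial_sum_L2 P phis_L2 lim])
    moreover have "\<forall>\<^sub>F M in sequentially. ip l (partial_sum u M) (phis j) = ip l u (phis j)"
    proof (rule eventually_sequentiallyI[of "Suc j"])
      fix M assume M: "Suc j \<le> M"
      have "ip l (partial_sum u M) (phis j) = (\<Sum>k<M. coef u k * ip l (phis k) (phis j))"
        unfolding partial_sum_def by (subst L2.sum_left) (auto intro: L2.scale_in phis_L2 simp: L2.scale_left phis_L2)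
      also have "\<dots> = (\<Sum>k<M. if k = j then coef u j * ip l (phis j) (phis j) else 0)"
        by (intro sum.cong) (auto simp: phis_def ip_phi inj_eq[OF inj_prod_decode])
      also have "\<dots> = coef u j * ip l (phis j) (phis j)" using M by simp
      also have "\<dots> = ip l u (phis j)"
        using norm_phi_ge[of "prod_decode j"] mult_pos_pos[OF pi_gt_zero l_pos] by (simp add: coef_def phis_def)
      finally show "ip l (partial_sum u M) (phis j) = ip l u (phis j)" .
    qed
    then have "(\<lambda>M. ip l (partial_sum u M) (phis j)) \<longlonglongrightarrow> ip l u (phis j)" by (rule tendsto_eventually)
    ultimately have "ip l P (phis j) = ip l u (phis j)" by (rule LIMSEQ_unique)
    then show ?thesis by (simp add: pj L2.diff_left u P phis_L2)
  qed
  then have "AE z in plate l. (u - P) z = 0" by (intro phi_complete L2.diff_in u P)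
  then show ?thesis by eventually_elim (use rest in simp)
qed

section \<open>Recovering the first derivatives\<close>

lemma orthogonal_series_converges:
  assumes e: "\<And>k. e k \<in> L2 l" and orth: "\<And>i j :: nat. i \<noteq> j \<Longrightarrow> ip l (e i) (e j) = 0"
    and Q: "\<And>k. ip l (e k) (e k) \<le> Q" "Q > 0" and a: "\<And>N. (\<Sum>k<N. (a k)\<^sup>2) \<le> B"
  shows "\<exists>g\<in>L2 l. (\<lambda>N. ip l ((\<Sum>k<N. a k *\<^sub>R e k) - g) ((\<Sum>k<N. a k *\<^sub>R e k) - g)) \<longlonglongrightarrow> 0"
proof -
  define s where "s N = (\<Sum>k<N. a k *\<^sub>R e k)" for N
  have s: "s N \<in> L2 l" for N unfolding s_def by (intro L2.sum_in L2.scale_in e)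
  have "summable (\<lambda>k. (a k)\<^sup>2)" by (rule summableI_nonneg_bounded[where x = B]) (use a in auto)
  then have Ca: "\<exists>n0. \<forall>m\<ge>n0. \<forall>n. norm (\<Sum>k=m..<n. (a k)\<^sup>2) < d" if "d > 0" for d
    using that by (simp add: summable_Cauchy)
  have diff: "ip l (s n - s m) (s n - s m) \<le> Q * (\<Sum>k=m..<n. (a k)\<^sup>2)" if "m \<le> n" for m n
  proof -
    have "s n - s m = (\<Sum>k\<in>{m..<n}. a k *\<^sub>R e k)"
    proof -
      have "{..<n} = {..<m} \<union> {m..<n}" using that by auto
      then have "s n = s m + (\<Sum>k\<in>{m..<n}. a k *\<^sub>R e k)"
        unfolding s_def by (simp add: sum.union_disjoint ivl_disj_int)
      then show ?thesis by simp
    qed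
    then have "ip l (s n - s m) (s n - s m) = (\<Sum>k\<in>{m..<n}. (a k)\<^sup>2 * ip l (e k) (e k))"
      using L2.square_sum_orthogonal[of e l "{m..<n}" a, OF e orth] by simp
    also have "\<dots> \<le> (\<Sum>k\<in>{m..<n}. (a k)\<^sup>2 * Q)" by (intro sum_mono mult_left_mono Q) auto
    finally show ?thesis by (simp add: sum_distrib_left mult.commute)
  qed
  have "\<exists>n0. \<forall>n\<ge>n0. \<forall>m\<ge>n0. ip l (s n - s m) (s n - s m) < d" if d: "d > 0" for d
  proof -
    obtain n0 where n0: "\<forall>m\<ge>n0. \<forall>n. norm (\<Sum>k=m..<n. (a k)\<^sup>2) < d / Q" using Ca[of "d / Q"] d Q(2) by auto
    have *: "ip l (s n - s m) (s n - s m) < d" if "n0 \<le> m" "m \<le> n" for n m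
    proof -
      have "norm (\<Sum>k=m..<n. (a k)\<^sup>2) < d / Q" using n0 that by blast
      then have "(\<Sum>k=m..<n. (a k)\<^sup>2) < d / Q" by simp
      then have "Q * (\<Sum>k=m..<n. (a k)\<^sup>2) < d" using Q(2) by (simp add: field_simps)
      with diff[OF that(2)] show ?thesis by linarith
    qed
    show ?thesis
    proof (intro exI[of _ n0] allI impI)
      fix n m assume "n0 \<le> n" "n0 \<le> m"
      then show "ip l (s n - s m) (s n - s m) < d"
        using *[of n m] *[of m n] L2.diff_commute[OF s s, of n m] by (cases "n \<le> m") auto
    qed
  qed
  from L2_complete[OF s this] show ?thesis unfolding s_def by blast
qed

lemma weak_deriv_sum:
  fixes e g :: "nat \<Rightarrow> real \<times> real \<Rightarrow> real"
  assumes "\<And>k. e k \<in> L2 l" "\<And>k. g k \<in> L2 l" "\<And>k. is_weak_deriv l m n (e k) (g k)"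
  shows "is_weak_deriv l m n (\<Sum>k<N. a k *\<^sub>R e k) (\<Sum>k<N. a k *\<^sub>R g k)"
proof (induction N)
  case 0
  then show ?case by (simp add: is_weak_deriv_def)
next
  case (Suc N)
  have "is_weak_deriv l m n (a N *\<^sub>R e N) (a N *\<^sub>R g N)"
    by (rule weak_deriv_lincomb(2)[OF assms(1) assms(1) assms(2) assms(2) assms(3) assms(3)])
  then show ?case
    unfolding sum.lessThan_Suc
    by (intro weak_deriv_lincomb(1)[OF _ _ _ _ Suc] L2.sum_in L2.scale_in assms)
qed

text \<open>First derivatives are no part of \<open>admissible\<close>; they are obtained by
  differentiating the Fourier series term by term.\<close>

lemma admissible_first_derivatives:
  assumes adm: "admissible l u gxx gxy"
  shows "\<exists>g\<in>L2 l. is_weak_deriv l 1 0 u g" "\<exists>g\<in>L2 l. is_weak_deriv l 0 1 u g"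
proof -
  have u: "u \<in> L2 l" using adm by (simp add: admissible_def)
  have lim: "(\<lambda>M. ip l (partial_sum u M - u) (partial_sum u M - u)) \<longlonglongrightarrow> 0"
  proof (rule ip_tendsto_0_if_uniform[where t = "\<lambda>M. tail M * sqrt (energy gxx gxy)"])
    show "(\<lambda>M. tail M * sqrt (energy gxx gxy)) \<longlonglongrightarrow> 0"
      using tendsto_mult_right[OF tail_tendsto_0] by simp
  qed (use admissible_expansion[OF adm] energy_nonneg[OF adm] in \<open>auto intro: partial_sum_L2 u mult_nonneg_nonneg tail_nonneg\<close>)
  \<comment> \<open>\<open>e\<close> is the differentiated mode and \<open>r\<close> the factor it
    acquires. The square of the factor is dominated by the weight, so the differentiated series
    converges in L2, and weak derivatives are closed under such limits.\<close>
  have key: "\<exists>g\<in>L2 l. is_weak_deriv l m n u g"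
    if wd: "\<And>k. is_weak_deriv l m n (phis k) (r k *\<^sub>R e k)" and e: "\<And>k. e k \<in> L2 l"
      and orth: "\<And>i j :: nat. i \<noteq> j \<Longrightarrow> ip l (e i) (e j) = 0" and Q: "\<And>k. ip l (e k) (e k) \<le> pi * l"
      and r: "\<And>k. (r k)\<^sup>2 \<le> weight (prod_decode k)" for m n r and e :: "nat \<Rightarrow> real \<times> real \<Rightarrow> real"
  proof -
    have "(\<Sum>k<N. (coef u k * r k)\<^sup>2) \<le> rate\<^sup>2 * energy gxx gxy" for N
    proof -
      have "(\<Sum>k<N. (coef u k * r k)\<^sup>2) \<le> (\<Sum>k<N. weight (prod_decode k) * (coef u k)\<^sup>2)"
        using r by (intro sum_mono) (simp add: power_mult_distrib mult.commute mult_right_mono)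
      also have "\<dots> \<le> rate\<^sup>2 * energy gxx gxy" by (rule weighted_coef_bound[OF adm]) simp
      finally show ?thesis .
    qed
    from orthogonal_series_converges[of e, OF e orth Q _ this] l_pos obtain g where g: "g \<in> L2 l"
      "(\<lambda>N. ip l ((\<Sum>k<N. (coef u k * r k) *\<^sub>R e k) - g) ((\<Sum>k<N. (coef u k * r k) *\<^sub>R e k) - g)) \<longlonglongrightarrow> 0"
      by auto
    have "is_weak_deriv l m n (partial_sum u N) (\<Sum>k<N. (coef u k * r k) *\<^sub>R e k)" for N
      using weak_deriv_sum[where e = phis and g = "\<lambda>k. r k *\<^sub>R e k" and N = N and a = "coef u", OF phis_L2 L2.scale_in[OF e] wd]
      by (simp only: partial_sum_def scaleR_scaleR)
    from weak_deriv_limit[OF partial_sum_L2 u lim _ g this] have "is_weak_deriv l m n u g"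
      by (simp add: L2.sum_in L2.scale_in e)
    with g(1) show ?thesis by blast
  qed
  show "\<exists>g\<in>L2 l. is_weak_deriv l 1 0 u g"
  proof (rule key[where r = "\<lambda>k. real (Suc (fst (prod_decode k)))" and e = "\<lambda>k. phi_x (prod_decode k)"])
    show "is_weak_deriv l 1 0 (phis k) (real (Suc (fst (prod_decode k))) *\<^sub>R phi_x (prod_decode k))" for k
    proof -
      have "is_weak_deriv l 1 0 (phis k) (tensor ((deriv ^^ 1) (Sn 1 0 (Suc (fst (prod_decode k))))) ((deriv ^^ 0) (Cn c (- l) (snd (prod_decode k)))))"
        unfolding phis_def phi_def by (intro weak_deriv_tensor smooth_Sn smooth_Cn)
      also have "tensor ((deriv ^^ 1) (Sn 1 0 (Suc (fst (prod_decode k))))) ((deriv ^^ 0) (Cn c (- l) (snd (prod_decode k)))) =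
          real (Suc (fst (prod_decode k))) *\<^sub>R phi_x (prod_decode k)"
        by (simp add: deriv_Sn fun_eq_iff tensor_def phi_x_def)
      finally show ?thesis .
    qed
    show "(real (Suc (fst (prod_decode k))))\<^sup>2 \<le> weight (prod_decode k)" for k
      by (simp add: weight_def mult_le_cancel_left1)
  qed (use l_pos in \<open>auto simp: trig_L2 ip_phi_x inj_eq[OF inj_prod_decode]\<close>)
  show "\<exists>g\<in>L2 l. is_weak_deriv l 0 1 u g"
  proof (rule key[where r = "\<lambda>k. - (real (snd (prod_decode k)) * c)" and e = "\<lambda>k. phi_y (prod_decode k)"])
    show "is_weak_deriv l 0 1 (phis k) (- (real (snd (prod_decode k)) * c) *\<^sub>R phi_y (prod_decode k))" for k
    proof -
      have "is_weak_deriv l 0 1 (phis k) (tensor ((deriv ^^ 0) (Sn 1 0 (Suc (fst (prod_decode k))))) ((deriv ^^ 1) (Cn c (- l) (snd (prod_decode k)))))"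
        unfolding phis_def phi_def by (intro weak_deriv_tensor smooth_Sn smooth_Cn)
      also have "tensor ((deriv ^^ 0) (Sn 1 0 (Suc (fst (prod_decode k))))) ((deriv ^^ 1) (Cn c (- l) (snd (prod_decode k)))) =
          - (real (snd (prod_decode k)) * c) *\<^sub>R phi_y (prod_decode k)"
        by (simp add: deriv_Cn fun_eq_iff tensor_def phi_y_def)
      finally show ?thesis .
    qed
    show "(- (real (snd (prod_decode k)) * c))\<^sup>2 \<le> weight (prod_decode k)" for k
    proof -
      have "(real (snd (prod_decode k)) * c)\<^sup>2 \<le> 1 * (1 + (real (snd (prod_decode k)) * c)\<^sup>2)" by simp
      also have "\<dots> \<le> weight (prod_decode k)" unfolding weight_def by (intro mult_right_mono) auto
      finally show ?thesis by simp
    qed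
  qed (use l_pos in \<open>auto simp: trig_L2 ip_phi_y inj_eq[OF inj_prod_decode]\<close>)
qed

end

section \<open>The energy space\<close>

text \<open>The choice made by \<open>wderiv\<close> need not be linear, nor respect reflection.
  Calculations therefore run with arbitrary representatives of the second derivatives.\<close>

definition derivs :: "real \<Rightarrow> (real \<times> real \<Rightarrow> real) \<Rightarrow> (real \<times> real \<Rightarrow> real) \<Rightarrow> (real \<times> real \<Rightarrow> real)
    \<Rightarrow> (real \<times> real \<Rightarrow> real) \<Rightarrow> bool" where
  "derivs l u a b d \<longleftrightarrow> a \<in> L2 l \<and> b \<in> L2 l \<and> d \<in> L2 l \<and>
     is_weak_deriv l 2 0 u a \<and> is_weak_deriv l 1 1 u b \<and> is_weak_deriv l 0 2 u d"

lemma derivs_L2: "derivs l u a b d \<Longrightarrow> a \<in> L2 l" "derivs l u a b d \<Longrightarrow> b \<in> L2 l" "derivs l u a b d \<Longrightarrow> d \<in> L2 l"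
  by (auto simp: derivs_def)

lemma H2_L2: "u \<in> H2 l \<Longrightarrow> u \<in> L2 l"
  by (simp add: H2_def)

lemma H2star_H2: "u \<in> H2star l \<Longrightarrow> u \<in> H2 l"
  by (simp add: H2star_def)

lemma wderiv:
  assumes "u \<in> H2 l" "m + n \<le> 2"
  shows "wderiv l m n u \<in> L2 l" "is_weak_deriv l m n u (wderiv l m n u)"
proof -
  have "\<exists>g. g \<in> L2 l \<and> is_weak_deriv l m n u g" using assms by (auto simp: H2_def)
  from someI_ex[OF this] show "wderiv l m n u \<in> L2 l" "is_weak_deriv l m n u (wderiv l m n u)"
    unfolding wderiv_def by blast+
qed

lemma derivs_wderiv: "u \<in> H2 l \<Longrightarrow> derivs l u (wderiv l 2 0 u) (wderiv l 1 1 u) (wderiv l 0 2 u)"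
  unfolding derivs_def by (intro conjI wderiv) auto

lemma derivs_lincomb:
  assumes "u \<in> L2 l" "v \<in> L2 l" "derivs l u a b d" "derivs l v a' b' d'"
  shows "derivs l (u + v) (a + a') (b + b') (d + d')"
    and "derivs l (r *\<^sub>R u) (r *\<^sub>R a) (r *\<^sub>R b) (r *\<^sub>R d)"
proof -
  show "derivs l (u + v) (a + a') (b + b') (d + d')"
    using assms unfolding derivs_def by (auto intro!: weak_deriv_lincomb(1) L2.add_in)
  show "derivs l (r *\<^sub>R u) (r *\<^sub>R a) (r *\<^sub>R b) (r *\<^sub>R d)"
    using assms(1,3) unfolding derivs_def
    by (auto intro!: L2.scale_in intro: weak_deriv_lincomb(2)[of u l u _ _ _ _])
qed

lemma derivs_diff:
  assumes "u \<in> L2 l" "v \<in> L2 l" "derivs l u a b d" "derivs l v a' b' d'"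
  shows "derivs l (u - v) (a - a') (b - b') (d - d')"
proof -
  have "derivs l ((-1) *\<^sub>R v) ((-1) *\<^sub>R a') ((-1) *\<^sub>R b') ((-1) *\<^sub>R d')"
    by (rule derivs_lincomb(2)[OF assms(2,2,4,4)])
  from derivs_lincomb(1)[OF assms(1) L2.scale_in[OF assms(2)] assms(3) this] show ?thesis by simp
qed

lemma derivs_cong:
  assumes "derivs l u a b d" "AE z in plate l. u z = v z" "u \<in> L2 l" "v \<in> L2 l"
  shows "derivs l v a b d"
  using assms weak_deriv_cong[OF _ assms(2) L2_measurable[OF assms(3)] L2_measurable[OF assms(4)]]
  unfolding derivs_def by blast

lemma derivs_reflect:
  assumes "derivs l u a b d" "u \<in> L2 l"
  shows "derivs l (\<lambda>z. u (reflect z)) (\<lambda>z. a (reflect z)) (\<lambda>z. - b (reflect z)) (\<lambda>z. d (reflect z))"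
proof -
  have "is_weak_deriv l 2 0 (\<lambda>z. u (reflect z)) (\<lambda>z. a (reflect z))"
    using weak_deriv_reflect[of u l a 2 0] assms by (simp add: derivs_def)
  moreover have "is_weak_deriv l 1 1 (\<lambda>z. u (reflect z)) (\<lambda>z. - b (reflect z))"
    using weak_deriv_reflect[of u l b 1 1] assms by (simp add: derivs_def)
  moreover have "is_weak_deriv l 0 2 (\<lambda>z. u (reflect z)) (\<lambda>z. d (reflect z))"
    using weak_deriv_reflect[of u l d 0 2] assms by (simp add: derivs_def)
  moreover have "(\<lambda>z. - b (reflect z)) \<in> L2 l"
    using L2.scale_in[OF L2_reflect[of b l], of "-1"] assms by (simp add: derivs_def scaleR_fun_def)
  ultimately show ?thesis using assms L2_reflect by (simp add: derivs_def)
qed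

lemma ip_cong:
  assumes "AE z in plate l. u z = u' z" "AE z in plate l. v z = v' z" "u \<in> L2 l" "u' \<in> L2 l" "v \<in> L2 l" "v' \<in> L2 l"
  shows "ip l u v = ip l u' v'"
  unfolding ip_def
proof (rule integral_cong_AE)
  show "AE z in plate l. u z * v z = u' z * v' z" using assms(1,2) by eventually_elim simp
qed (use L2_mult_integrable assms in blast)+

lemma ip_reflect: "u \<in> L2 l \<Longrightarrow> v \<in> L2 l \<Longrightarrow> ip l (\<lambda>z. u (reflect z)) (\<lambda>z. v (reflect z)) = ip l u v"
  unfolding ip_def using integral_reflect[of "\<lambda>z. u z * v z" l] L2_mult_integrable by blast

text \<open>Expanding the product of Laplacians against the correction term leaves the factor
  \<sigma> on the mixed products of the xx and yy derivatives. Weak derivatives are unique up to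
  null sets, so any representatives may replace the chosen ones.\<close>

lemma inner_eq:
  assumes u: "u \<in> H2 l" "derivs l u a b d" and v: "v \<in> H2 l" "derivs l v a' b' d'"
  shows "H2star_inner l \<sigma> u v = ip l a a' + ip l d d' + \<sigma> * (ip l a d' + ip l d a') + 2 * (1 - \<sigma>) * ip l b b'"
proof -
  have eq: "H2star_inner l \<sigma> u v = ip l a a' + ip l d d' + \<sigma> * (ip l a d' + ip l d a') + 2 * (1 - \<sigma>) * ip l b b'"
    if "derivs l u a b d" "derivs l v a' b' d'" "a = wderiv l 2 0 u" "b = wderiv l 1 1 u" "d = wderiv l 0 2 u"
      "a' = wderiv l 2 0 v" "b' = wderiv l 1 1 v" "d' = wderiv l 0 2 v" for a b d a' b' d'
  proof -
    note L = derivs_L2[OF that(1)] derivs_L2[OF that(2)]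
    note int = L2_mult_integrable
    have "H2star_inner l \<sigma> u v = (LINT z|plate l. (a z * a' z + d z * d' z) + \<sigma> * (a z * d' z + d z * a' z) + 2 * (1 - \<sigma>) * (b z * b' z))"
      unfolding H2star_inner_def Let_def that(3-8)[symmetric]
      by (intro Bochner_Integration.integral_cong) (auto simp: algebra_simps)
    also have "\<dots> = (ip l a a' + ip l d d') + \<sigma> * (ip l a d' + ip l d a') + 2 * (1 - \<sigma>) * ip l b b'"
      unfolding ip_def using L by (simp add: int)
    finally show ?thesis .
  qed
  let ?a = "wderiv l 2 0 u" and ?b = "wderiv l 1 1 u" and ?d = "wderiv l 0 2 u"
  let ?a' = "wderiv l 2 0 v" and ?b' = "wderiv l 1 1 v" and ?d' = "wderiv l 0 2 v"
  note wu = derivs_wderiv[OF u(1)] and wv = derivs_wderiv[OF v(1)]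
  have U: "AE z in plate l. ?a z = a z" "AE z in plate l. ?b z = b z" "AE z in plate l. ?d z = d z"
    using wu u(2) weak_deriv_unique unfolding derivs_def by blast+
  have V: "AE z in plate l. ?a' z = a' z" "AE z in plate l. ?b' z = b' z" "AE z in plate l. ?d' z = d' z"
    using wv v(2) weak_deriv_unique unfolding derivs_def by blast+
  note L = derivs_L2[OF wu] derivs_L2[OF wv] derivs_L2[OF u(2)] derivs_L2[OF v(2)]
  have "ip l ?a ?a' = ip l a a'" "ip l ?d ?d' = ip l d d'" "ip l ?a ?d' = ip l a d'" "ip l ?d ?a' = ip l d a'" "ip l ?b ?b' = ip l b b'"
    by (intro ip_cong U V L)+
  with eq[OF wu wv] show ?thesis by simp
qed

lemma inner_cong:
  assumes "u \<in> H2 l" "v \<in> H2 l" "u' \<in> H2 l" "v' \<in> H2 l"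
    "AE z in plate l. u z = u' z" "AE z in plate l. v z = v' z"
  shows "H2star_inner l \<sigma> u v = H2star_inner l \<sigma> u' v'"
proof -
  note wu = derivs_wderiv[OF assms(1)] and wv = derivs_wderiv[OF assms(2)]
  show ?thesis
    unfolding inner_eq[OF assms(1) wu assms(2) wv]
      inner_eq[OF assms(3) derivs_cong[OF wu assms(5) H2_L2 H2_L2] assms(4) derivs_cong[OF wv assms(6) H2_L2 H2_L2], OF assms(1,3,2,4)] ..
qed

text \<open>The mixed derivative changes sign under reflection, but it occurs in both
  factors.\<close>

lemma inner_reflect:
  assumes u: "u \<in> H2 l" and v: "v \<in> H2 l" and ru: "(\<lambda>z. u (reflect z)) \<in> H2 l" and rv: "(\<lambda>z. v (reflect z)) \<in> H2 l"
  shows "H2star_inner l \<sigma> (\<lambda>z. u (reflect z)) (\<lambda>z. v (reflect z)) = H2star_inner l \<sigma> u v"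
proof -
  note wu = derivs_wderiv[OF u] and wv = derivs_wderiv[OF v]
  note L = derivs_L2[OF wu] derivs_L2[OF wv]
  have neg: "ip l (\<lambda>z. - f (reflect z)) (\<lambda>z. - g (reflect z)) = ip l (\<lambda>z. f (reflect z)) (\<lambda>z. g (reflect z))" for f g
    by (simp add: ip_def)
  show ?thesis
    unfolding inner_eq[OF u wu v wv] inner_eq[OF ru derivs_reflect[OF wu H2_L2[OF u]] rv derivs_reflect[OF wv H2_L2[OF v]]]
    by (simp add: neg ip_reflect L del: One_nat_def)
qed

lemma H2star_admissible:
  assumes "u \<in> H2star l" "derivs l u a b d"
  shows "admissible l u a b"
  using assms H2_L2[OF H2star_H2[OF assms(1)]] unfolding admissible_def derivs_def H2star_def by blast

lemma H2star_derivs: "u \<in> H2star l \<Longrightarrow> \<exists>a b d. derivs l u a b d"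
  using derivs_wderiv[OF H2star_H2] by blast

locale plate_energy = half_width l for l :: real +
  fixes \<sigma> :: real
  assumes \<sigma>: "0 < \<sigma>" "\<sigma> < 1"
begin

text \<open>Membership in \<open>H2\<close> demands all derivatives up to order 2. The first-order
  ones come from the Fourier series, so the second-order ones and the boundary values remain to be
  supplied.\<close>

lemma H2starI:
  assumes adm: "admissible l u a b" and d: "derivs l u a b d"
  shows "u \<in> H2star l"
proof -
  have u: "u \<in> L2 l" using adm by (simp add: admissible_def)
  have "\<exists>g\<in>L2 l. is_weak_deriv l m n u g" if "m + n \<le> 2" for m n
  proof -
    have "(m, n) \<in> {(0,0), (1,0), (0,1), (2,0), (1,1), (0,2)}" using that by auto
    moreover have "is_weak_deriv l 0 0 u u" by (simp add: is_weak_deriv_def)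
    ultimately show ?thesis
      using u admissible_first_derivatives[OF adm] d unfolding derivs_def by auto
  qed
  with u adm show ?thesis unfolding H2star_def H2_def admissible_def by blast
qed

lemma subspace_H2star: "subspace (H2star l)"
  unfolding subspace_def
proof (intro conjI ballI allI)
  have "is_weak_deriv l m n 0 0" for m n by (simp add: is_weak_deriv_def)
  then have "derivs l 0 0 0 0" using L2.zero_in by (simp add: derivs_def)
  moreover from this have "admissible l 0 0 0"
    using L2.zero_in unfolding admissible_def derivs_def by (intro conjI exI[of _ "\<lambda>_. 0"]) auto
  ultimately show "0 \<in> H2star l" by (intro H2starI)
next
  fix u v assume uv: "u \<in> H2star l" "v \<in> H2star l"
  obtain a b d where u: "derivs l u a b d" using H2star_derivs[OF uv(1)] by blast
  obtain a' b' d' where v: "derivs l v a' b' d'" using H2star_derivs[OF uv(2)] by blast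
  note au = H2star_admissible[OF uv(1) u] and av = H2star_admissible[OF uv(2) v]
  have L: "u \<in> L2 l" "v \<in> L2 l" using au av by (auto simp: admissible_def)
  note uvd = derivs_lincomb(1)[OF L u v]
  obtain U where U: "continuous_on (closure (Omega l)) U" "AE z in plate l. u z = U z" "\<forall>x\<in>{0, pi}. \<forall>y\<in>{- l<..<l}. U (x, y) = 0"
    using au by (auto simp: admissible_def)
  obtain V where V: "continuous_on (closure (Omega l)) V" "AE z in plate l. v z = V z" "\<forall>x\<in>{0, pi}. \<forall>y\<in>{- l<..<l}. V (x, y) = 0"
    using av by (auto simp: admissible_def)
  have "AE z in plate l. (u + v) z = U z + V z" using U(2) V(2) by eventually_elim simp
  then have "admissible l (u + v) (a + a') (b + b')"
    using uvd L U V unfolding admissible_def derivs_def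
    by (intro conjI exI[of _ "\<lambda>z. U z + V z"]) (auto intro: continuous_on_add L2.add_in)
  with uvd show "u + v \<in> H2star l" by (intro H2starI)
next
  fix r :: real and u assume u: "u \<in> H2star l"
  obtain a b d where d: "derivs l u a b d" using H2star_derivs[OF u] by blast
  note au = H2star_admissible[OF u d]
  have L: "u \<in> L2 l" using au by (auto simp: admissible_def)
  note ud = derivs_lincomb(2)[OF L L d d]
  obtain U where U: "continuous_on (closure (Omega l)) U" "AE z in plate l. u z = U z" "\<forall>x\<in>{0, pi}. \<forall>y\<in>{- l<..<l}. U (x, y) = 0"
    using au by (auto simp: admissible_def)
  have "AE z in plate l. (r *\<^sub>R u) z = r * U z" using U(2) by eventually_elim simp
  then have "admissible l (r *\<^sub>R u) (r *\<^sub>R a) (r *\<^sub>R b)"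
    using ud L U unfolding admissible_def derivs_def
    by (intro conjI exI[of _ "\<lambda>z. r * U z"]) (auto intro: continuous_on_mult_left L2.scale_in)
  with ud show "r *\<^sub>R u \<in> H2star l" by (intro H2starI)
qed

text \<open>For the lower bound, the difference of the two sides is \<sigma> times the square of
  \<open>a + d\<close> plus 1 - \<sigma> times the square of \<open>b\<close>. For the upper bound
  the square of \<open>a - d\<close> plays the same role.\<close>

lemma inner_coercive:
  assumes u: "u \<in> H2 l" and d: "derivs l u a b d"
  shows "(1 - \<sigma>) * (ip l a a + ip l b b + ip l d d) \<le> H2star_inner l \<sigma> u u"
    and "H2star_inner l \<sigma> u u \<le> 2 * (ip l a a + ip l b b + ip l d d)"
proof -
  note L = derivs_L2[OF d]
  have s: "ip l d a = ip l a d" by (rule L2.sym[OF L(3,1)])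
  have pos: "0 \<le> ip l a a + 2 * ip l a d + ip l d d" "0 \<le> ip l a a - 2 * ip l a d + ip l d d"
    using L2.nonneg[OF L2.add_in[OF L(1,3)]] L2.nonneg[OF L2.diff_in[OF L(1,3)]]
    by (simp_all add: L2.square_add L2.square_diff L)
  have b: "0 \<le> ip l b b" by (rule L2.nonneg[OF L(2)])
  have A: "H2star_inner l \<sigma> u u = ip l a a + ip l d d + 2 * \<sigma> * ip l a d + 2 * (1 - \<sigma>) * ip l b b"
    unfolding inner_eq[OF u d u d] s by simp
  have "0 \<le> \<sigma> * (ip l a a + 2 * ip l a d + ip l d d) + (1 - \<sigma>) * ip l b b"
    using \<sigma> pos(1) b by simp
  then show "(1 - \<sigma>) * (ip l a a + ip l b b + ip l d d) \<le> H2star_inner l \<sigma> u u"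
    unfolding A by (simp add: algebra_simps)
  have "0 \<le> \<sigma> * (ip l a a - 2 * ip l a d + ip l d d) + (1 - \<sigma>) * (ip l a a + ip l d d) + 2 * \<sigma> * ip l b b"
    using \<sigma> pos(2) b L2.nonneg[OF L(1)] L2.nonneg[OF L(3)] by simp
  then show "H2star_inner l \<sigma> u u \<le> 2 * (ip l a a + ip l b b + ip l d d)"
    unfolding A by (simp add: algebra_simps)
qed

sublocale H: semi_inner "H2star l" "H2star_inner l \<sigma>"
proof
  show "subspace (H2star l)" by (rule subspace_H2star)
next
  fix u v w assume uvw: "u \<in> H2star l" "v \<in> H2star l" "w \<in> H2star l"
  note H = H2star_H2[OF uvw(1)] H2star_H2[OF uvw(2)] H2star_H2[OF uvw(3)]
  note d = derivs_wderiv[OF H(1)] derivs_wderiv[OF H(2)] derivs_wderiv[OF H(3)]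
  have uv: "u + v \<in> H2 l" using subspace_add[OF subspace_H2star uvw(1,2)] by (rule H2star_H2)
  note L = derivs_L2[OF d(1)] derivs_L2[OF d(2)] derivs_L2[OF d(3)]
  show "H2star_inner l \<sigma> (u + v) w = H2star_inner l \<sigma> u w + H2star_inner l \<sigma> v w"
    unfolding inner_eq[OF uv derivs_lincomb(1)[OF H2_L2[OF H(1)] H2_L2[OF H(2)] d(1,2)] H(3) d(3)]
      inner_eq[OF H(1) d(1) H(3) d(3)] inner_eq[OF H(2) d(2) H(3) d(3)]
    by (simp add: L2.add_left L algebra_simps del: One_nat_def)
next
  fix u w r assume uw: "u \<in> H2star l" "w \<in> H2star l"
  note H = H2star_H2[OF uw(1)] H2star_H2[OF uw(2)]
  note d = derivs_wderiv[OF H(1)] derivs_wderiv[OF H(2)]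
  have ru: "r *\<^sub>R u \<in> H2 l" using subspace_scale[OF subspace_H2star uw(1)] by (rule H2star_H2)
  note L = derivs_L2[OF d(1)] derivs_L2[OF d(2)]
  show "H2star_inner l \<sigma> (r *\<^sub>R u) w = r * H2star_inner l \<sigma> u w"
    unfolding inner_eq[OF ru derivs_lincomb(2)[OF H2_L2[OF H(1)] H2_L2[OF H(1)] d(1,1)] H(2) d(2)]
      inner_eq[OF H(1) d(1) H(2) d(2)]
    by (simp add: L2.scale_left L algebra_simps del: One_nat_def)
next
  fix u w assume uw: "u \<in> H2star l" "w \<in> H2star l"
  note H = H2star_H2[OF uw(1)] H2star_H2[OF uw(2)]
  note d = derivs_wderiv[OF H(1)] derivs_wderiv[OF H(2)]
  note L = derivs_L2[OF d(1)] derivs_L2[OF d(2)]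
  show "H2star_inner l \<sigma> u w = H2star_inner l \<sigma> w u"
    unfolding inner_eq[OF H(1) d(1) H(2) d(2)] inner_eq[OF H(2) d(2) H(1) d(1)]
      L2.sym[OF L(4,1)] L2.sym[OF L(6,3)] L2.sym[OF L(4,3)] L2.sym[OF L(6,1)] L2.sym[OF L(5,2)]
    by simp
next
  fix u assume u: "u \<in> H2star l"
  note d = derivs_wderiv[OF H2star_H2[OF u]]
  have "0 \<le> (1 - \<sigma>) * (ip l (wderiv l 2 0 u) (wderiv l 2 0 u) + ip l (wderiv l 1 1 u) (wderiv l 1 1 u) + ip l (wderiv l 0 2 u) (wderiv l 0 2 u))"
    using \<sigma> derivs_L2[OF d] by (simp add: L2.nonneg)
  then show "0 \<le> H2star_inner l \<sigma> u u" using inner_coercive(1)[OF H2star_H2[OF u] d] by linarith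
qed

definition sup_const :: real where
  "sup_const = inverse (sqrt (1 - \<sigma>))"

lemma sup_const_nonneg: "sup_const \<ge> 0"
  using \<sigma> by (simp add: sup_const_def)

lemma energy_le_inner:
  assumes u: "u \<in> H2star l" and d: "derivs l u a b d"
  shows "sqrt (energy a b) \<le> sup_const * sqrt (H2star_inner l \<sigma> u u)"
proof -
  have "(1 - \<sigma>) * energy a b \<le> (1 - \<sigma>) * (ip l a a + ip l b b + ip l d d)"
    using \<sigma> L2.nonneg[OF derivs_L2(3)[OF d]] by (simp add: energy_def)
  also have "\<dots> \<le> H2star_inner l \<sigma> u u" by (rule inner_coercive(1)[OF H2star_H2[OF u] d])
  finally have "energy a b \<le> inverse (1 - \<sigma>) * H2star_inner l \<sigma> u u" using \<sigma> by (simp add: field_simps)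
  then have "sqrt (energy a b) \<le> sqrt (inverse (1 - \<sigma>) * H2star_inner l \<sigma> u u)" by (rule real_sqrt_le_mono)
  then show ?thesis by (simp add: sup_const_def real_sqrt_mult real_sqrt_inverse)
qed

lemma H2star_expansion:
  assumes u: "u \<in> H2star l"
  shows "AE z in plate l. \<bar>u z - partial_sum u N z\<bar> \<le> tail N * (sup_const * sqrt (H2star_inner l \<sigma> u u))"
proof -
  obtain a b d where d: "derivs l u a b d" using H2star_derivs[OF u] by blast
  have "tail N * sqrt (energy a b) \<le> tail N * (sup_const * sqrt (H2star_inner l \<sigma> u u))"
    by (intro mult_left_mono energy_le_inner[OF u d] tail_nonneg)
  with admissible_expansion[OF H2star_admissible[OF u d], of N] show ?thesis by (auto elim: eventually_mono)
qed

lemma H2star_sup_bound: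
  assumes u: "u \<in> H2star l"
  shows "AE z in plate l. \<bar>u z\<bar> \<le> tail 0 * (sup_const * sqrt (H2star_inner l \<sigma> u u))"
  using H2star_expansion[OF u, of 0] by (simp add: partial_sum_def)

lemma H2star_L2: "u \<in> H2star l \<Longrightarrow> u \<in> L2 l"
  using H2_L2 H2star_H2 by blast

definition embed_const :: real where
  "embed_const = (tail 0 * sup_const)\<^sup>2 * (pi * (2 * l))"

lemma embed_const_nonneg: "embed_const \<ge> 0"
  using l_pos by (simp add: embed_const_def)

lemma H2star_embedding:
  assumes u: "u \<in> H2star l"
  shows "ip l u u \<le> embed_const * H2star_inner l \<sigma> u u"
proof -
  have "ip l u u \<le> (tail 0 * (sup_const * sqrt (H2star_inner l \<sigma> u u)))\<^sup>2 * (pi * (2 * l))"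
    using H.nonneg[OF u] by (intro ip_le_sup_square H2star_L2 u H2star_sup_bound mult_nonneg_nonneg tail_nonneg sup_const_nonneg) auto
  then show ?thesis using H.nonneg[OF u] by (simp add: embed_const_def power_mult_distrib mult_ac)
qed

lemma H2star_null:
  assumes u: "u \<in> H2star l" and "ip l u u = 0"
  shows "H2star_inner l \<sigma> u u = 0"
proof -
  have "AE z in plate l. u z = 0 z" using assms ip_self_zero_iff[OF H2star_L2[OF u]] by simp
  then have "H2star_inner l \<sigma> u u = H2star_inner l \<sigma> 0 0"
    by (intro inner_cong H2star_H2 u H.zero_in)
  then show ?thesis using H.zero_in by simp
qed

text \<open>The set where the bound fails is open in the plate and null, hence empty; continuity
  carries the bound to the edges.\<close>

lemma AE_le_imp_le_closure:
  fixes g :: "real \<times> real \<Rightarrow> real"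
  assumes g: "continuous_on (closure (Omega l)) g" and ae: "AE z in plate l. \<bar>g z\<bar> \<le> B" and z: "z \<in> closure (Omega l)"
  shows "\<bar>g z\<bar> \<le> B"
proof -
  let ?S = "{z \<in> Omega l. \<bar>g z\<bar> > B}"
  have gO: "continuous_on (Omega l) (\<lambda>z. \<bar>g z\<bar>)"
    by (intro continuous_intros continuous_on_subset[OF g closure_subset])
  have "open ?S"
    using continuous_open_preimage[OF gO open_Omega open_greaterThan[of B]] by (simp add: vimage_def Int_def conj_commute)
  moreover have "AE z in lborel. z \<notin> ?S"
    using ae unfolding AE_plate_iff by eventually_elim auto
  then have "?S \<in> null_sets lborel"
    using \<open>open ?S\<close> by (subst AE_iff_null_sets) auto
  then have "negligible ?S" by (simp add: negligible_iff_null_sets null_sets_completionI)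
  ultimately have "?S = {}" using open_not_negligible by blast
  then have "\<bar>g w\<bar> \<le> B" if "w \<in> Omega l" for w using \<open>?S = {}\<close> that not_le by blast
  then show ?thesis
    using continuous_le_on_closure[of "Omega l" "\<lambda>z. \<bar>g z\<bar>" z B] g z by (auto intro: continuous_on_rabs)
qed

lemma continuous_closure_measurable:
  assumes "continuous_on (closure (Omega l)) U"
  shows "U \<in> borel_measurable (plate l)"
proof -
  have "continuous_on (Omega l) U" using assms closure_subset by (rule continuous_on_subset)
  then have "U \<in> borel_measurable (restrict_space borel (Omega l))"
    by (rule borel_measurable_continuous_on_restrict)
  then show ?thesis by (simp add: plate_def measurable_def space_restrict_space sets_restrict_space)
qed

text \<open>Convergence of the second derivatives in \<open>L2\<close> forces uniform convergence of the continuous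
  representatives, so the limit again has a continuous representative vanishing on the short edges.\<close>

lemma H2star_complete:
  assumes f: "\<And>n. f n \<in> H2star l"
    and Cauchy: "\<And>e. e > 0 \<Longrightarrow> \<exists>n0. \<forall>n\<ge>n0. \<forall>m\<ge>n0. H2star_inner l \<sigma> (f n - f m) (f n - f m) < e"
  shows "\<exists>u\<in>H2star l. (\<lambda>n. H2star_inner l \<sigma> (f n - u) (f n - u)) \<longlonglongrightarrow> 0"
proof -
  have "\<forall>n. \<exists>g. derivs l (f n) (fst g) (fst (snd g)) (snd (snd g))"
    using H2star_derivs[OF f] by auto
  from choice[OF this] obtain G where G: "\<And>n. derivs l (f n) (fst (G n)) (fst (snd (G n))) (snd (snd (G n)))" by blast
  define a b d where "a n = fst (G n)" and "b n = fst (snd (G n))" and "d n = snd (snd (G n))" for n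
  have D: "derivs l (f n) (a n) (b n) (d n)" for n using G by (simp add: a_def b_def d_def)
  note L = derivs_L2[OF D]
  have fL: "f n \<in> L2 l" for n by (rule H2star_L2[OF f])
  have Ddiff: "derivs l (f n - f m) (a n - a m) (b n - b m) (d n - d m)" for n m
    by (rule derivs_diff[OF fL fL D D])
  have fd: "f n - f m \<in> H2star l" for n m by (intro H.diff_in f)
  have L2C: "\<exists>n0. \<forall>n\<ge>n0. \<forall>m\<ge>n0. ip l (g n - g m) (g n - g m) < e"
    if le: "\<And>n m. (1 - \<sigma>) * ip l (g n - g m) (g n - g m) \<le> H2star_inner l \<sigma> (f n - f m) (f n - f m)" and e: "e > 0" for g e
  proof -
    have "(1 - \<sigma>) * e > 0" using \<sigma> e by simp
    from Cauchy[OF this] obtain n0 where n0: "\<forall>n\<ge>n0. \<forall>m\<ge>n0. H2star_inner l \<sigma> (f n - f m) (f n - f m) < (1 - \<sigma>) * e" by blast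
    show ?thesis
    proof (intro exI[of _ n0] allI impI)
      fix n m assume "n0 \<le> n" "n0 \<le> m"
      then have "(1 - \<sigma>) * ip l (g n - g m) (g n - g m) < (1 - \<sigma>) * e" using n0 le[of n m] by force
      then show "ip l (g n - g m) (g n - g m) < e" using \<sigma> by simp
    qed
  qed
  have comp: "(1 - \<sigma>) * ip l (a n - a m) (a n - a m) \<le> H2star_inner l \<sigma> (f n - f m) (f n - f m)"
    "(1 - \<sigma>) * ip l (b n - b m) (b n - b m) \<le> H2star_inner l \<sigma> (f n - f m) (f n - f m)"
    "(1 - \<sigma>) * ip l (d n - d m) (d n - d m) \<le> H2star_inner l \<sigma> (f n - f m) (f n - f m)" for n m
  proof -
    have "0 \<le> (1 - \<sigma>) * ip l (a n - a m) (a n - a m)" "0 \<le> (1 - \<sigma>) * ip l (b n - b m) (b n - b m)" "0 \<le> (1 - \<sigma>) * ip l (d n - d m) (d n - d m)"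
      using \<sigma> L2.nonneg[OF L2.diff_in[OF L(1) L(1)]] L2.nonneg[OF L2.diff_in[OF L(2) L(2)]] L2.nonneg[OF L2.diff_in[OF L(3) L(3)]] by auto
    with inner_coercive(1)[OF H2star_H2[OF fd] Ddiff, of n m]
    show "(1 - \<sigma>) * ip l (a n - a m) (a n - a m) \<le> H2star_inner l \<sigma> (f n - f m) (f n - f m)"
      "(1 - \<sigma>) * ip l (b n - b m) (b n - b m) \<le> H2star_inner l \<sigma> (f n - f m) (f n - f m)"
      "(1 - \<sigma>) * ip l (d n - d m) (d n - d m) \<le> H2star_inner l \<sigma> (f n - f m) (f n - f m)"
      unfolding distrib_left by linarith+
  qed
  obtain a' where a': "a' \<in> L2 l" "(\<lambda>n. ip l (a n - a') (a n - a')) \<longlonglongrightarrow> 0"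
    using L2_complete[OF L(1) L2C[OF comp(1)]] by blast
  obtain b' where b': "b' \<in> L2 l" "(\<lambda>n. ip l (b n - b') (b n - b')) \<longlonglongrightarrow> 0"
    using L2_complete[OF L(2) L2C[OF comp(2)]] by blast
  obtain d' where d': "d' \<in> L2 l" "(\<lambda>n. ip l (d n - d') (d n - d')) \<longlonglongrightarrow> 0"
    using L2_complete[OF L(3) L2C[OF comp(3)]] by blast
  have "\<forall>n. \<exists>U. continuous_on (closure (Omega l)) U \<and> (AE z in plate l. f n z = U z) \<and> (\<forall>x\<in>{0, pi}. \<forall>y\<in>{- l<..<l}. U (x, y) = 0)"
    using f by (simp add: H2star_def)
  from choice[OF this] obtain U where U: "\<And>n. continuous_on (closure (Omega l)) (U n)" "\<And>n. AE z in plate l. f n z = U n z"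
    "\<And>n. \<forall>x\<in>{0, pi}. \<forall>y\<in>{- l<..<l}. U n (x, y) = 0" by blast
  define K where "K = tail 0 * sup_const"
  have K: "K \<ge> 0" by (simp add: K_def tail_nonneg sup_const_nonneg)
  \<comment> \<open>The sup bound holds only almost everywhere, but the representatives are
    continuous, so it holds at every point of the closed plate, edges included.\<close>
  have U_le: "\<bar>U n z - U m z\<bar> \<le> K * sqrt (H2star_inner l \<sigma> (f n - f m) (f n - f m))" if z: "z \<in> closure (Omega l)" for n m z
  proof (rule AE_le_imp_le_closure[OF _ _ z])
    show "continuous_on (closure (Omega l)) (\<lambda>z. U n z - U m z)" by (intro continuous_on_diff U)
    show "AE z in plate l. \<bar>U n z - U m z\<bar> \<le> K * sqrt (H2star_inner l \<sigma> (f n - f m) (f n - f m))"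
      using H2star_sup_bound[OF fd[of n m]] U(2)[of n] U(2)[of m] by eventually_elim (simp add: K_def mult.assoc)
  qed
  have "uniformly_Cauchy_on (closure (Omega l)) U"
    unfolding uniformly_Cauchy_on_def
  proof (intro allI impI)
    fix e :: real assume e: "e > 0"
    have K1: "K + 1 > 0" using K by simp
    then have "(e / (K + 1))\<^sup>2 > 0" using e by simp
    from Cauchy[OF this] obtain n0 where n0: "\<forall>n\<ge>n0. \<forall>m\<ge>n0. H2star_inner l \<sigma> (f n - f m) (f n - f m) < (e / (K + 1))\<^sup>2" by blast
    show "\<exists>M. \<forall>x\<in>closure (Omega l). \<forall>m\<ge>M. \<forall>n\<ge>M. dist (U m x) (U n x) < e"
    proof (intro exI[of _ n0] ballI allI impI)
      fix z m n assume z: "z \<in> closure (Omega l)" and mn: "n0 \<le> m" "n0 \<le> n"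
      have "sqrt (H2star_inner l \<sigma> (f m - f n) (f m - f n)) < sqrt ((e / (K + 1))\<^sup>2)"
        using n0 mn by (intro real_sqrt_less_mono) auto
      then have s: "sqrt (H2star_inner l \<sigma> (f m - f n) (f m - f n)) < e / (K + 1)" using e K1 by simp
      have "dist (U m z) (U n z) \<le> K * sqrt (H2star_inner l \<sigma> (f m - f n) (f m - f n))"
        using U_le[OF z] by (simp add: dist_real_def)
      also have "\<dots> \<le> K * (e / (K + 1))" using s K by (intro mult_left_mono) auto
      also have "\<dots> < e" using e K K1 by (simp add: divide_less_eq algebra_simps)
      finally show "dist (U m z) (U n z) < e" .
    qed
  qed
  then obtain u where unif: "uniform_limit (closure (Omega l)) U u sequentially"
    using Cauchy_uniformly_convergent unfolding uniformly_convergent_on_def by blast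
  have cont_u: "continuous_on (closure (Omega l)) u"
    by (rule uniform_limit_theorem[OF _ unif]) (use U in auto)
  have u_zero: "\<forall>x\<in>{0, pi}. \<forall>y\<in>{- l<..<l}. u (x, y) = 0"
  proof (intro ballI)
    fix x y assume xy: "x \<in> {0, pi}" "y \<in> {- l<..<l}"
    then have "(x, y) \<in> closure (Omega l)" by (auto simp: closure_Omega)
    then have "(\<lambda>n. U n (x, y)) \<longlonglongrightarrow> u (x, y)" using tendsto_uniform_limitI[OF unif] by blast
    moreover have "U n (x, y) = 0" for n using U(3)[of n] xy by blast
    ultimately show "u (x, y) = 0" by (simp add: LIMSEQ_const_iff)
  qed
  have "compact (u ` closure (Omega l))"
    using cont_u unfolding closure_Omega by (intro compact_continuous_image compact_Times) auto
  then obtain Bu where Bu: "\<forall>y\<in>u ` closure (Omega l). norm y \<le> Bu" using compact_imp_bounded bounded_iff by blast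
  have uL: "u \<in> L2 l"
  proof (rule bounded_L2[OF continuous_closure_measurable[OF cont_u]])
    show "AE z in plate l. \<bar>u z\<bar> \<le> Bu"
      by (rule AE_plate_I) (use Bu closure_subset[of "Omega l"] in force)
  qed
  have "(\<lambda>n. ip l (f n - u) (f n - u)) \<longlonglongrightarrow> 0"
  proof (rule LIMSEQ_I)
    fix e :: real assume e: "e > 0"
    define \<eta> where "\<eta> = sqrt (e / (pi * (2 * l) + 1))"
    have pl: "pi * (2 * l) + 1 > 0" using l_pos by (simp add: add_pos_pos)
    have \<eta>: "\<eta> > 0" using e pl by (simp add: \<eta>_def)
    obtain n0 where n0: "\<forall>n\<ge>n0. \<forall>z\<in>closure (Omega l). dist (U n z) (u z) < \<eta>"
      using unif \<eta> unfolding uniform_limit_sequentially_iff by blast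
    show "\<exists>n0. \<forall>n\<ge>n0. norm (ip l (f n - u) (f n - u) - 0) < e"
    proof (intro exI[of _ n0] allI impI)
      fix n assume n: "n0 \<le> n"
      have "AE z in plate l. z \<in> Omega l" by (intro AE_plate_I)
      with U(2)[of n] have "AE z in plate l. \<bar>(f n - u) z\<bar> \<le> \<eta>"
      proof eventually_elim
        case (elim z)
        then have "dist (U n z) (u z) < \<eta>" using n0 n closure_subset[of "Omega l"] by blast
        with elim show ?case by (simp add: dist_real_def)
      qed
      then have "ip l (f n - u) (f n - u) \<le> \<eta>\<^sup>2 * (pi * (2 * l))"
        using \<eta> by (intro ip_le_sup_square L2.diff_in fL uL) auto
      also have "\<dots> < \<eta>\<^sup>2 * (pi * (2 * l) + 1)" using \<eta> by simp
      also have "\<dots> = e" using e pl by (simp add: \<eta>_def)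
      finally show "norm (ip l (f n - u) (f n - u) - 0) < e"
        using L2.nonneg[OF L2.diff_in[OF fL uL], of n] by simp
    qed
  qed
  note limu = this
  have Du: "derivs l u a' b' d'"
    using weak_deriv_limit[OF fL uL limu L(1) a'] weak_deriv_limit[OF fL uL limu L(2) b'] weak_deriv_limit[OF fL uL limu L(3) d'] D a' b' d'
    unfolding derivs_def by blast
  have adm: "admissible l u a' b'"
    unfolding admissible_def using uL a' b' Du cont_u u_zero
    by (auto simp: derivs_def simp del: One_nat_def intro!: exI[of _ u])
  have uH: "u \<in> H2star l" by (rule H2starI[OF adm Du])
  have "(\<lambda>n. H2star_inner l \<sigma> (f n - u) (f n - u)) \<longlonglongrightarrow> 0"
  proof (rule tendsto_sandwich[of "\<lambda>_. 0" _ _ "\<lambda>n. 2 * (ip l (a n - a') (a n - a') + ip l (b n - b') (b n - b') + ip l (d n - d') (d n - d'))"])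
    show "\<forall>\<^sub>F n in sequentially. 0 \<le> H2star_inner l \<sigma> (f n - u) (f n - u)"
      by (intro always_eventually allI H.nonneg H.diff_in f uH)
    show "\<forall>\<^sub>F n in sequentially. H2star_inner l \<sigma> (f n - u) (f n - u) \<le> 2 * (ip l (a n - a') (a n - a') + ip l (b n - b') (b n - b') + ip l (d n - d') (d n - d'))"
      by (intro always_eventually allI inner_coercive(2) H2star_H2 H.diff_in f uH derivs_diff fL uL D Du)
    have "(\<lambda>n. 2 * (ip l (a n - a') (a n - a') + ip l (b n - b') (b n - b') + ip l (d n - d') (d n - d'))) \<longlonglongrightarrow> 2 * (0 + 0 + 0)"
      by (intro tendsto_intros a' b' d')
    then show "(\<lambda>n. 2 * (ip l (a n - a') (a n - a') + ip l (b n - b') (b n - b') + ip l (d n - d') (d n - d'))) \<longlonglongrightarrow> 0" by simp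
  qed simp
  with uH show ?thesis by blast
qed

lemma coef_bound:
  assumes u: "u \<in> H2star l" and A: "H2star_inner l \<sigma> u u \<le> 1"
  shows "\<bar>coef u k\<bar> \<le> tail 0 * sup_const"
proof -
  obtain a b d where d: "derivs l u a b d" using H2star_derivs[OF u] by blast
  note adm = H2star_admissible[OF u d]
  have "\<bar>coef u k\<bar> \<le> (\<Sum>k. \<bar>coef u k\<bar>)"
    using sum_le_suminf[OF coef_summable(1)[OF adm], of "{k}"] by simp
  also have "\<dots> \<le> tail 0 * sqrt (energy a b)" using coef_summable(2)[OF adm, of 0] by simp
  also have "\<dots> \<le> tail 0 * (sup_const * sqrt (H2star_inner l \<sigma> u u))"
    by (intro mult_left_mono energy_le_inner[OF u d] tail_nonneg)
  also have "\<dots> \<le> tail 0 * (sup_const * 1)"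
    using A by (intro mult_left_mono tail_nonneg sup_const_nonneg) auto
  finally show ?thesis by simp
qed

text \<open>Up to an error that is uniform on the unit ball, a function is determined by its first
  \<open>N\<close> Fourier coefficients. These are bounded, so rounding them to a grid leaves
  finitely many codes, and one function is kept per code.\<close>

lemma H2star_totally_bounded:
  assumes V: "V \<subseteq> H2star l" and e: "e > 0"
  shows "\<exists>F. finite F \<and> F \<subseteq> {u \<in> V. H2star_inner l \<sigma> u u \<le> 1} \<and>
    (\<forall>u\<in>{u \<in> V. H2star_inner l \<sigma> u u \<le> 1}. \<exists>y\<in>F. ip l (u - y) (u - y) < e)"
proof -
  let ?B = "{u \<in> V. H2star_inner l \<sigma> u u \<le> 1}"
  \<comment> \<open>Three errors of size \<delta> will be added: two tails and the difference of the
    partial sums. The square of their sum times the area of the plate must stay below e.\<close>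
  define \<delta> where "\<delta> = sqrt (e / (pi * (2 * l) + 1)) / 3"
  have pl: "pi * (2 * l) + 1 > 0" using l_pos by (simp add: add_pos_pos)
  have \<delta>: "\<delta> > 0" using e pl by (simp add: \<delta>_def)
  have "\<delta> / (sup_const + 1) > 0" using \<delta> sup_const_nonneg by simp
  from LIMSEQ_D[OF tail_tendsto_0 this] obtain N where "norm (tail N - 0) < \<delta> / (sup_const + 1)" by blast
  then have "tail N < \<delta> / (sup_const + 1)" by simp
  then have "tail N * (sup_const + 1) < \<delta>" using sup_const_nonneg by (simp add: pos_less_divide_eq add_nonneg_pos)
  then have tN: "tail N * sup_const \<le> \<delta>" using tail_nonneg[of N] by (simp add: algebra_simps)
  define \<eta> where "\<eta> = \<delta> / (real N + 1)"
  have \<eta>: "\<eta> > 0" using \<delta> by (simp add: \<eta>_def)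
  define K where "K = tail 0 * sup_const"
  define code where "code u = restrict (\<lambda>k. \<lfloor>coef u k / \<eta>\<rfloor>) {..<N}" for u
  define M where "M = \<lceil>K / \<eta>\<rceil> + 1"
  have "code ` ?B \<subseteq> ({..<N} \<rightarrow>\<^sub>E {- M..M})"
  proof (rule image_subsetI)
    fix u assume "u \<in> ?B"
    then have u: "u \<in> V" "H2star_inner l \<sigma> u u \<le> 1" by auto
    have "\<lfloor>coef u k / \<eta>\<rfloor> \<in> {- M..M}" for k
    proof -
      have "\<bar>coef u k\<bar> \<le> K" unfolding K_def using V u by (intro coef_bound) auto
      then have "\<bar>coef u k / \<eta>\<bar> \<le> K / \<eta>" using \<eta> by (simp add: abs_divide divide_right_mono)
      then have "coef u k / \<eta> \<le> K / \<eta>" "- (K / \<eta>) \<le> coef u k / \<eta>" by linarith+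
      then have "\<lfloor>coef u k / \<eta>\<rfloor> \<le> M" "- M \<le> \<lfloor>coef u k / \<eta>\<rfloor>" unfolding M_def by linarith+
      then show ?thesis by simp
    qed
    then show "code u \<in> {..<N} \<rightarrow>\<^sub>E {- M..M}" by (auto simp: code_def PiE_def)
  qed
  moreover have "finite ({..<N} \<rightarrow>\<^sub>E {- M..M})" by (intro finite_PiE) auto
  ultimately have fin: "finite (code ` ?B)" by (rule finite_subset)
  \<comment> \<open>The representative of a code is taken from the ball itself, so that the net lies
    in the ball.\<close>
  define pick where "pick r = (SOME y. y \<in> ?B \<and> code y = r)" for r
  have pick: "pick (code u) \<in> ?B" "code (pick (code u)) = code u" if "u \<in> ?B" for u
  proof -
    have "\<exists>y. y \<in> ?B \<and> code y = code u" using that by blast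
    from someI_ex[OF this] show "pick (code u) \<in> ?B" "code (pick (code u)) = code u" unfolding pick_def by blast+
  qed
  have close: "ip l (u - pick (code u)) (u - pick (code u)) < e" if u: "u \<in> ?B" for u
  proof -
    define y where "y = pick (code u)"
    have y: "y \<in> ?B" "code y = code u" using pick[OF u] by (auto simp: y_def)
    have uH: "u \<in> H2star l" and yH: "y \<in> H2star l" using u y V by auto
    have tail_le: "tail N * (sup_const * sqrt (H2star_inner l \<sigma> v v)) \<le> \<delta>" if "v \<in> ?B" for v
    proof -
      have "tail N * (sup_const * sqrt (H2star_inner l \<sigma> v v)) \<le> tail N * (sup_const * 1)"
        using that by (intro mult_left_mono tail_nonneg sup_const_nonneg) auto
      with tN show ?thesis by simp
    qed
    have coef_le: "\<bar>coef u k - coef y k\<bar> \<le> \<eta>" if "k < N" for k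
    proof -
      have "code u k = code y k" using y(2) by simp
      then have "\<lfloor>coef u k / \<eta>\<rfloor> = \<lfloor>coef y k / \<eta>\<rfloor>" using that by (simp add: code_def)
      then have "\<bar>coef u k / \<eta> - coef y k / \<eta>\<bar> \<le> 1" by linarith
      then have "\<bar>coef u k - coef y k\<bar> / \<eta> \<le> 1" using \<eta> by (simp add: abs_divide flip: diff_divide_distrib)
      then show ?thesis using \<eta> by simp
    qed
    have ps: "\<bar>partial_sum u N z - partial_sum y N z\<bar> \<le> \<delta>" for z
    proof -
      have "\<bar>partial_sum u N z - partial_sum y N z\<bar> = \<bar>\<Sum>k<N. (coef u k - coef y k) * phis k z\<bar>"
        by (simp add: partial_sum_apply sum_subtractf left_diff_distrib)
      also have "\<dots> \<le> (\<Sum>k<N. \<bar>(coef u k - coef y k) * phis k z\<bar>)" by (rule sum_abs)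
      also have "\<dots> \<le> (\<Sum>k<N. \<eta>)"
      proof (rule sum_mono)
        fix k assume "k \<in> {..<N}"
        then have "\<bar>coef u k - coef y k\<bar> * \<bar>phis k z\<bar> \<le> \<eta> * 1"
          by (intro mult_mono coef_le) (auto simp: phis_def phi_abs_le less_imp_le[OF \<eta>])
        then show "\<bar>(coef u k - coef y k) * phis k z\<bar> \<le> \<eta>" by (simp add: abs_mult)
      qed
      also have "\<dots> \<le> \<delta>" using \<delta> by (simp add: \<eta>_def field_simps)
      finally show ?thesis .
    qed
    have "AE z in plate l. \<bar>(u - y) z\<bar> \<le> 3 * \<delta>"
      using H2star_expansion[OF uH, of N] H2star_expansion[OF yH, of N]
    proof eventually_elim
      case (elim z)
      have "(u - y) z = (u z - partial_sum u N z) + (partial_sum u N z - partial_sum y N z) - (y z - partial_sum y N z)"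
        by simp
      then show ?case using elim tail_le[OF u] tail_le[OF y(1)] ps[of z] by linarith
    qed
    then have "ip l (u - y) (u - y) \<le> (3 * \<delta>)\<^sup>2 * (pi * (2 * l))"
      using \<delta> by (intro ip_le_sup_square L2.diff_in H2star_L2 uH yH) auto
    also have "\<dots> < (3 * \<delta>)\<^sup>2 * (pi * (2 * l) + 1)" using \<delta> by simp
    also have "\<dots> = e" using e pl by (simp add: \<delta>_def)
    finally show ?thesis by (simp add: y_def)
  qed
  show ?thesis
  proof (intro exI[of _ "pick ` code ` ?B"] conjI ballI)
    show "finite (pick ` code ` ?B)" using fin by (rule finite_imageI)
    show "pick ` code ` ?B \<subseteq> ?B" using pick by blast
    fix u assume "u \<in> ?B"
    then show "\<exists>y\<in>pick ` code ` ?B. ip l (u - y) (u - y) < e" using close by blast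
  qed
qed

end

section \<open>Even and odd functions\<close>

definition wform :: "real \<Rightarrow> (real \<times> real \<Rightarrow> real) \<Rightarrow> (real \<times> real \<Rightarrow> real) \<Rightarrow> (real \<times> real \<Rightarrow> real) \<Rightarrow> real" where
  "wform l p u v = (LINT z|plate l. p z * u z * v z)"

lemma semi_inner_wform:
  assumes p: "p \<in> weights l \<alpha> \<beta>" and \<alpha>: "0 \<le> \<alpha>"
  shows "semi_inner (L2 l) (wform l p)"
proof
  fix u v w assume "u \<in> L2 l" "v \<in> L2 l" "w \<in> L2 l"
  then show "wform l p (u + v) w = wform l p u w + wform l p v w"
    using weights_mult_integrable[OF p, of u w] weights_mult_integrable[OF p, of v w]
    by (simp add: wform_def distrib_right distrib_left)
next
  fix u v r assume uv: "u \<in> L2 l" "v \<in> L2 l"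
  have "wform l p (r *\<^sub>R u) v = (LINT z|plate l. r * (p z * u z * v z))"
    unfolding wform_def by (intro Bochner_Integration.integral_cong) auto
  then show "wform l p (r *\<^sub>R u) v = r * wform l p u v" by (simp add: wform_def)
next
  fix u v assume "u \<in> L2 l" "v \<in> L2 l"
  show "wform l p u v = wform l p v u"
    unfolding wform_def by (intro Bochner_Integration.integral_cong) auto
next
  fix u assume "u \<in> L2 l"
  show "0 \<le> wform l p u u"
    unfolding wform_def
  proof (rule integral_nonneg_AE)
    show "AE z in plate l. 0 \<le> p z * u z * u z"
      using weights_bounds[OF p] by eventually_elim (use \<alpha> in \<open>auto simp: mult.assoc\<close>)
  qed
qed (rule subspace_L2)

lemma wform_bounds:
  assumes p: "p \<in> weights l \<alpha> \<beta>" and u: "u \<in> L2 l"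
  shows "\<alpha> * ip l u u \<le> wform l p u u" "wform l p u u \<le> \<beta> * ip l u u"
proof -
  have b: "AE z in plate l. \<alpha> * (u z * u z) \<le> p z * u z * u z \<and> p z * u z * u z \<le> \<beta> * (u z * u z)"
    using weights_bounds[OF p]
    by eventually_elim (auto simp: mult.assoc intro: mult_right_mono)
  have int: "integrable (plate l) (\<lambda>z. p z * u z * u z)" "integrable (plate l) (\<lambda>z. r * (u z * u z))" for r
    using weights_mult_integrable[OF p u u] L2_mult_integrable[OF u u] by auto
  have "(LINT z|plate l. \<alpha> * (u z * u z)) \<le> (LINT z|plate l. p z * u z * u z)"
    by (intro integral_mono_AE int) (use b in \<open>auto elim: eventually_mono\<close>)
  then show "\<alpha> * ip l u u \<le> wform l p u u" by (simp add: ip_def wform_def)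
  have "(LINT z|plate l. p z * u z * u z) \<le> (LINT z|plate l. \<beta> * (u z * u z))"
    by (intro integral_mono_AE int) (use b in \<open>auto elim: eventually_mono\<close>)
  then show "wform l p u u \<le> \<beta> * ip l u u" by (simp add: ip_def wform_def)
qed

text \<open>With s = 1 and s = -1 the longitudinal and the torsional functions are treated at
  once.\<close>

definition parity :: "real \<Rightarrow> real \<Rightarrow> (real \<times> real \<Rightarrow> real) set" where
  "parity l s = {u \<in> H2star l. AE z in plate l. u (reflect z) = s * u z}"

lemma H2even_parity: "H2even l = parity l 1" and H2odd_parity: "H2odd l = parity l (-1)"
  by (auto simp: H2even_def H2odd_def parity_def reflect_def case_prod_beta)

context plate_energy
begin

lemma H2star_reflect:
  assumes u: "u \<in> H2star l"
  shows "(\<lambda>z. u (reflect z)) \<in> H2star l"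
proof -
  obtain a b d where d: "derivs l u a b d" using H2star_derivs[OF u] by blast
  have L: "u \<in> L2 l" by (rule H2star_L2[OF u])
  note dr = derivs_reflect[OF d L]
  obtain U where U: "continuous_on (closure (Omega l)) U" "AE z in plate l. u z = U z" "\<forall>x\<in>{0, pi}. \<forall>y\<in>{- l<..<l}. U (x, y) = 0"
    using u by (auto simp: H2star_def)
  have "continuous_on (closure (Omega l)) (\<lambda>z. U (reflect z))"
    by (rule continuous_on_compose2[OF U(1) continuous_reflect]) (auto simp: closure_Omega)
  moreover have "AE z in plate l. u (reflect z) = U (reflect z)" using AE_reflect[OF U(2)] .
  moreover have "\<forall>x\<in>{0, pi}. \<forall>y\<in>{- l<..<l}. U (reflect (x, y)) = 0" using U(3) by auto
  ultimately have "admissible l (\<lambda>z. u (reflect z)) (\<lambda>z. a (reflect z)) (\<lambda>z. - b (reflect z))"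
    unfolding admissible_def using dr L2_reflect[OF L] unfolding derivs_def by blast
  then show ?thesis using dr by (rule H2starI)
qed

lemma parity_H2star: "parity l s \<subseteq> H2star l"
  by (auto simp: parity_def)

lemma subspace_parity: "subspace (parity l s)"
  unfolding subspace_def
proof (intro conjI ballI allI)
  show "0 \<in> parity l s" using H.zero_in by (simp add: parity_def)
next
  fix u v assume uv: "u \<in> parity l s" "v \<in> parity l s"
  have ae: "AE z in plate l. u (reflect z) = s * u z" "AE z in plate l. v (reflect z) = s * v z"
    using uv by (auto simp: parity_def)
  then have "AE z in plate l. (u + v) (reflect z) = s * (u + v) z"
    by eventually_elim (simp add: distrib_left)
  then show "u + v \<in> parity l s" using uv H.add_in unfolding parity_def by blast
next
  fix r :: real and u assume u: "u \<in> parity l s"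
  have "AE z in plate l. u (reflect z) = s * u z" using u by (simp add: parity_def)
  then have "AE z in plate l. (r *\<^sub>R u) (reflect z) = s * (r *\<^sub>R u) z"
    by eventually_elim simp
  then show "r *\<^sub>R u \<in> parity l s" using u H.scale_in unfolding parity_def by blast
qed

text \<open>The defect \<open>D\<close> of the limit serves as its own test function: the parity
  relation passes to the limit in the product with \<open>D\<close> and shows that \<open>D\<close>
  has norm 0.\<close>

lemma parity_closed:
  assumes f: "\<And>n. f n \<in> parity l s" and u: "u \<in> H2star l" and lim: "(\<lambda>n. ip l (f n - u) (f n - u)) \<longlonglongrightarrow> 0"
  shows "u \<in> parity l s"
proof -
  let ?R = "\<lambda>u z. u (reflect z)"
  have fL: "f n \<in> L2 l" for n using f parity_H2star H2star_L2 by blast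
  have uL: "u \<in> L2 l" by (rule H2star_L2[OF u])
  define D where "D = ?R u - s *\<^sub>R u"
  have D: "D \<in> L2 l" unfolding D_def by (intro L2.diff_in L2.scale_in L2_reflect uL)
  have "ip l (?R (f n) - ?R u) (?R (f n) - ?R u) = ip l (f n - u) (f n - u)" for n
    using ip_reflect[OF L2.diff_in[OF fL uL] L2.diff_in[OF fL uL], of n n] by (simp add: fun_diff_def)
  then have limR: "(\<lambda>n. ip l (?R (f n) - ?R u) (?R (f n) - ?R u)) \<longlonglongrightarrow> 0" using lim by simp
  have "(\<lambda>n. ip l (?R (f n)) D) \<longlonglongrightarrow> ip l (?R u) D"
    by (intro L2.tendsto_left L2_reflect fL uL D limR)
  moreover have "(\<lambda>n. s * ip l (f n) D) \<longlonglongrightarrow> s * ip l u D"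
    by (intro tendsto_mult_left L2.tendsto_left fL uL D lim)
  moreover have "ip l (?R (f n)) D = s * ip l (f n) D" for n
  proof -
    have "ip l (?R (f n)) D = ip l (s *\<^sub>R f n) D"
      using f[of n] by (intro ip_cong L2_reflect L2.scale_in fL D) (auto simp: parity_def)
    then show ?thesis by (simp add: L2.scale_left fL D)
  qed
  ultimately have "ip l (?R u) D = s * ip l u D" by (simp add: LIMSEQ_unique)
  then have "ip l D D = 0"
    using L2.diff_left[OF L2_reflect[OF uL] L2.scale_in[OF uL] D, of s] by (simp add: D_def[symmetric] L2.scale_left uL D)
  then have "AE z in plate l. D z = 0" using ip_self_zero_iff[OF D] by simp
  then show ?thesis using u by (simp add: parity_def D_def)
qed

text \<open>Both forms are invariant under simultaneous reflection of the arguments, which for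
  opposite parities multiplies their value by -1. For the weighted form this uses evenness of the
  weight.\<close>

lemma parity_orthogonal:
  assumes s: "s * s = 1" and u: "u \<in> parity l s" and v: "v \<in> parity l (- s)"
  shows "H2star_inner l \<sigma> u v = 0"
    and "p \<in> weights l \<alpha> \<beta> \<Longrightarrow> wform l p u v = 0"
proof -
  let ?R = "\<lambda>u z. u (reflect z)"
  have H: "u \<in> H2star l" "v \<in> H2star l" using u v by (auto simp: parity_def)
  have "H2star_inner l \<sigma> u v = H2star_inner l \<sigma> (?R u) (?R v)"
    by (intro inner_reflect[symmetric] H2star_H2 H2star_reflect H)
  also have "\<dots> = H2star_inner l \<sigma> (s *\<^sub>R u) ((- s) *\<^sub>R v)"
    using u v by (intro inner_cong H2star_H2 H2star_reflect H.scale_in H) (auto simp: parity_def)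
  also have "\<dots> = - (s * s) * H2star_inner l \<sigma> u v"
    using H by (simp only: H.scale_left H.scale_right H.scale_in) simp
  finally show "H2star_inner l \<sigma> u v = 0" using s by simp
  assume p: "p \<in> weights l \<alpha> \<beta>"
  have "wform l p u v = (LINT z|plate l. p (reflect z) * u (reflect z) * v (reflect z))"
    unfolding wform_def using weights_mult_integrable[OF p H2star_L2[OF H(1)] H2star_L2[OF H(2)]]
    by (intro integral_reflect[symmetric]) auto
  also have "\<dots> = (LINT z|plate l. - (p z * u z * v z))"
  proof (rule integral_cong_AE)
    have ae: "AE z in plate l. u (reflect z) = s * u z" "AE z in plate l. v (reflect z) = - s * v z"
      using u v by (auto simp: parity_def)
    show "AE z in plate l. p (reflect z) * u (reflect z) * v (reflect z) = - (p z * u z * v z)"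
      using ae weights_even[OF p]
    proof eventually_elim
      case (elim z)
      have "p (reflect z) * u (reflect z) * v (reflect z) = - (s * s) * (p z * u z * v z)"
        unfolding elim(1,2) elim(3)[symmetric] by simp
      then show ?case using s by simp
    qed
    have int: "integrable (plate l) (\<lambda>z. p z * u z * v z)"
      by (intro weights_mult_integrable[OF p] H2star_L2 H)
    show "(\<lambda>z. p (reflect z) * u (reflect z) * v (reflect z)) \<in> borel_measurable (plate l)"
      using integrable_reflect[OF int] by auto
    show "(\<lambda>z. - (p z * u z * v z)) \<in> borel_measurable (plate l)" using int by auto
  qed
  also have "\<dots> = - wform l p u v" by (simp add: wform_def)
  finally show "wform l p u v = 0" by simp
qed

lemma parity_decomposition:
  assumes s: "s * s = 1" and v: "v \<in> H2star l"
  shows "\<exists>v1\<in>parity l s. \<exists>v2\<in>parity l (- s). v = v1 + v2"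
proof -
  let ?R = "\<lambda>u z. u (reflect z)"
  define v1 where "v1 = (1/2) *\<^sub>R (v + s *\<^sub>R ?R v)"
  define v2 where "v2 = (1/2) *\<^sub>R (v - s *\<^sub>R ?R v)"
  have "v1 \<in> H2star l" "v2 \<in> H2star l"
    unfolding v1_def v2_def by (intro H.scale_in H.add_in H.diff_in v H2star_reflect)+
  moreover have "v1 (reflect z) = s * v1 z" "v2 (reflect z) = - s * v2 z" for z
    using s by (simp_all add: v1_def v2_def algebra_simps flip: mult.assoc)
  ultimately have "v1 \<in> parity l s" "v2 \<in> parity l (- s)" by (auto simp: parity_def)
  moreover have "v = v1 + v2" by (simp add: v1_def v2_def fun_eq_iff field_simps)
  ultimately show ?thesis by blast
qed

lemma tensor_H2star:
  assumes g: "smooth g"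
  shows "tensor (Sn 1 0 i) g \<in> H2star l"
proof -
  let ?u = "tensor (Sn 1 0 i) g"
  have d: "derivs l ?u (tensor ((deriv ^^ 2) (Sn 1 0 i)) ((deriv ^^ 0) g)) (tensor ((deriv ^^ 1) (Sn 1 0 i)) ((deriv ^^ 1) g))
      (tensor ((deriv ^^ 0) (Sn 1 0 i)) ((deriv ^^ 2) g))"
    unfolding derivs_def
    by (intro conjI tensor_L2 weak_deriv_tensor smooth_iterated smooth_Sn g)
  have "\<forall>x\<in>{0, pi}. \<forall>y\<in>{- l<..<l}. ?u (x, y) = 0" by (auto simp: tensor_def Sn_def)
  then have "admissible l ?u (tensor ((deriv ^^ 2) (Sn 1 0 i)) ((deriv ^^ 0) g)) (tensor ((deriv ^^ 1) (Sn 1 0 i)) ((deriv ^^ 1) g))"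
    unfolding admissible_def using d tensor_L2[OF smooth_Sn g] continuous_tensor[OF smooth_Sn g]
    unfolding derivs_def by blast
  then show ?thesis using d by (rule H2starI)
qed

lemma parity_infinite_dim:
  assumes s: "s = 1 \<or> s = - 1"
  shows "\<exists>b :: nat \<Rightarrow> real \<times> real \<Rightarrow> real. (\<forall>i. b i \<in> parity l s) \<and> (\<forall>i j. i \<noteq> j \<longrightarrow> ip l (b i) (b j) = 0) \<and>
      (\<forall>i. ip l (b i) (b i) > 0)"
proof -
  \<comment> \<open>A function of y with the required parity; orthogonality of the family comes from
    the sines in x alone.\<close>
  define g where "g y = (if s = 1 then 1 else y)" for y :: real
  have g: "smooth g" using smooth_const[of 1] smooth_ident by (cases "s = 1") (auto simp: g_def[abs_def])
  have pos: "(LINT y|lborel. indicator {- l<..<l} y * (g y * g y)) > 0"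
  proof (cases "s = 1")
    case True
    have "(LINT y|lborel. indicator {- l<..<l} y * (1 :: real)) = l - - l"
      using l_pos by (intro integral_open_interval_FTC[where F = "\<lambda>y. y"]) auto
    with True l_pos show ?thesis by (simp add: g_def)
  next
    case False
    have "(LINT y|lborel. indicator {- l<..<l} y * (y * y)) = l ^ 3 / 3 - (- l) ^ 3 / 3"
      using l_pos by (intro integral_open_interval_FTC[where F = "\<lambda>y. y ^ 3 / 3"])
        (auto intro!: derivative_eq_intros continuous_intros simp: power2_eq_square)
    moreover have "l ^ 3 / 3 - (- l) ^ 3 / 3 > 0" using l_pos by simp
    ultimately show ?thesis using False by (simp only: g_def if_False)
  qed
  define b where "b i = tensor (Sn 1 0 (Suc i)) g" for i
  have "b i \<in> parity l s" for i
  proof -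
    have "b i (reflect z) = s * b i z" for z using s by (auto simp: b_def tensor_def g_def)
    then show ?thesis using tensor_H2star[OF g] by (simp add: parity_def b_def)
  qed
  moreover have "ip l (b i) (b j) = (if i = j then pi / 2 * (LINT y|lborel. indicator {- l<..<l} y * (g y * g y)) else 0)" for i j
    unfolding b_def ip_tensor[OF smooth_Sn g smooth_Sn g] integral_Sn_Sn[of 1 pi 0, simplified] by auto
  ultimately show ?thesis using pos by (intro exI[of _ b]) auto
qed

lemma energy_space_parity:
  assumes s: "s = 1 \<or> s = - 1"
  shows "energy_space (parity l s) (H2star_inner l \<sigma>) (ip l) embed_const"
proof -
  have sub: "parity l s \<subseteq> L2 l" using parity_H2star H2star_L2 by blast
  interpret A: semi_inner "parity l s" "H2star_inner l \<sigma>" by (rule H.restrict[OF subspace_parity parity_H2star])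
  interpret N: semi_inner "parity l s" "ip l" by (rule L2.restrict[OF subspace_parity sub])
  show ?thesis
  proof
    fix f :: "nat \<Rightarrow> real \<times> real \<Rightarrow> real"
    assume f: "\<And>n. f n \<in> parity l s"
      and C: "\<And>e. e > 0 \<Longrightarrow> \<exists>n0. \<forall>n\<ge>n0. \<forall>m\<ge>n0. H2star_inner l \<sigma> (f n - f m) (f n - f m) < e"
    have fH: "f n \<in> H2star l" for n using f parity_H2star by blast
    obtain u where u: "u \<in> H2star l" and lim: "(\<lambda>n. H2star_inner l \<sigma> (f n - u) (f n - u)) \<longlonglongrightarrow> 0"
      using H2star_complete[OF fH C] by blast
    have "(\<lambda>n. ip l (f n - u) (f n - u)) \<longlonglongrightarrow> 0"
    proof (rule tendsto_sandwich[of "\<lambda>_. 0" _ _ "\<lambda>n. embed_const * H2star_inner l \<sigma> (f n - u) (f n - u)"])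
      show "(\<lambda>n. embed_const * H2star_inner l \<sigma> (f n - u) (f n - u)) \<longlonglongrightarrow> 0"
        using tendsto_mult_left[OF lim, of embed_const] by simp
    qed (auto intro!: always_eventually L2.nonneg L2.diff_in H2star_L2 fH u H2star_embedding H.diff_in)
    then have "u \<in> parity l s" by (intro parity_closed[OF f u])
    with lim show "\<exists>x\<in>parity l s. (\<lambda>n. H2star_inner l \<sigma> (f n - x) (f n - x)) \<longlonglongrightarrow> 0" by blast
  next
    fix e :: real assume "e > 0"
    then show "\<exists>F. finite F \<and> F \<subseteq> {u \<in> parity l s. H2star_inner l \<sigma> u u \<le> 1} \<and>
      (\<forall>u\<in>{u \<in> parity l s. H2star_inner l \<sigma> u u \<le> 1}. \<exists>y\<in>F. ip l (u - y) (u - y) < e)"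
      by (rule H2star_totally_bounded[OF parity_H2star])
  next
    fix u assume "u \<in> parity l s"
    then have "u \<in> H2star l" using parity_H2star by blast
    then show "ip l u u \<le> embed_const * H2star_inner l \<sigma> u u" "ip l u u = 0 \<Longrightarrow> H2star_inner l \<sigma> u u = 0"
      by (simp_all add: H2star_embedding H2star_null)
  next
    show "\<exists>b. (\<forall>i::nat. b i \<in> parity l s) \<and> (\<forall>i j. i \<noteq> j \<longrightarrow> ip l (b i) (b j) = 0) \<and> (\<forall>i. 0 < ip l (b i) (b i))"
      by (rule parity_infinite_dim[OF s])
  qed
qed

lemma weighted_energy_space_parity:
  assumes s: "s = 1 \<or> s = - 1" and p: "p \<in> weights l \<alpha> \<beta>" and \<alpha>: "0 < \<alpha>" "0 < \<beta>"
  shows "weighted_energy_space (parity l s) (H2star_inner l \<sigma>) (ip l) embed_const (wform l p) \<alpha> \<beta>"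
proof -
  interpret energy_space "parity l s" "H2star_inner l \<sigma>" "ip l" embed_const by (rule energy_space_parity[OF s])
  have sub: "parity l s \<subseteq> L2 l" using parity_H2star H2star_L2 by blast
  interpret M: semi_inner "parity l s" "wform l p"
    using semi_inner.restrict[OF semi_inner_wform[OF p] subspace_parity sub] \<alpha> by simp
  show ?thesis
    by unfold_locales (use \<alpha> wform_bounds[OF p] sub in auto)
qed

section \<open>The eigenvalue sequences\<close>

text \<open>The orthonormal eigenvectors with \<open>1 / \<kappa> j = lam\<close> form a basis of
  the eigenspace modulo null functions: independence follows from orthonormality and spanning from
  the expansion of eigenvectors. So the reciprocals have the required multiplicities, and level sets
  determine a nondecreasing sequence.\<close>

lemma eigenvalue_seq_eq:
  assumes s: "s = 1 \<or> s = - 1" and p: "p \<in> weights l \<alpha> \<beta>" and \<alpha>: "0 < \<alpha>" "0 < \<beta>"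
    and sp: "energy_space.spectral (parity l s) (H2star_inner l \<sigma>) (wform l p) e \<kappa>"
  shows "eigenvalue_seq l \<sigma> (parity l s) p = (\<lambda>j. 1 / \<kappa> j)"
proof -
  interpret weighted_energy_space "parity l s" "H2star_inner l \<sigma>" "ip l" embed_const "wform l p" \<alpha> \<beta>
    by (rule weighted_energy_space_parity[OF s p \<alpha>])
  have eV: "e i \<in> parity l s" and orth: "H2star_inner l \<sigma> (e i) (e j) = (if i = j then 1 else 0)" and \<kappa>: "\<kappa> i > 0"
    and dec: "decseq \<kappa>" and eigen: "v \<in> parity l s \<Longrightarrow> wform l p (e i) v = \<kappa> i * H2star_inner l \<sigma> (e i) v" for i j v
    using sp unfolding spectral_def by auto
  have ss: "s * s = 1" using s by auto
  \<comment> \<open>Eigenfunctions are tested against all of \<open>H2star\<close>; the component of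
    opposite parity contributes 0 to both sides, so testing within the parity class is
    equivalent.\<close>
  have eigenspace: "u \<in> eigenspace l \<sigma> (parity l s) p lam \<longleftrightarrow>
      u \<in> parity l s \<and> (\<forall>v\<in>parity l s. H2star_inner l \<sigma> u v = lam * wform l p u v)" for u lam
  proof
    assume "u \<in> eigenspace l \<sigma> (parity l s) p lam"
    then show "u \<in> parity l s \<and> (\<forall>v\<in>parity l s. H2star_inner l \<sigma> u v = lam * wform l p u v)"
      using parity_H2star unfolding eigenspace_def wform_def by blast
  next
    assume u: "u \<in> parity l s \<and> (\<forall>v\<in>parity l s. H2star_inner l \<sigma> u v = lam * wform l p u v)"
    have uH: "u \<in> H2star l" using u parity_H2star by blast
    have "H2star_inner l \<sigma> u v = lam * wform l p u v" if v: "v \<in> H2star l" for v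
    proof -
      obtain v1 v2 where v12: "v1 \<in> parity l s" "v2 \<in> parity l (- s)" "v = v1 + v2"
        using parity_decomposition[OF ss v] by blast
      have H: "v1 \<in> H2star l" "v2 \<in> H2star l" using v12 parity_H2star by blast+
      interpret W: semi_inner "L2 l" "wform l p" by (rule semi_inner_wform[OF p]) (use \<alpha> in simp)
      have "H2star_inner l \<sigma> u v = H2star_inner l \<sigma> u v1" "wform l p u v = wform l p u v1"
        using parity_orthogonal(1)[OF ss _ v12(2), of u] parity_orthogonal(2)[OF ss _ v12(2) p, of u] u
        by (simp_all add: v12(3) H.add_right W.add_right uH H H2star_L2)
      with u v12(1) show ?thesis by simp
    qed
    with u show "u \<in> eigenspace l \<sigma> (parity l s) p lam" by (simp add: eigenspace_def wform_def)
  qed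
  have null_iff: "H2star_inner l \<sigma> u u = 0 \<longleftrightarrow> (AE z in plate l. u z = 0)" if "u \<in> parity l s" for u
  proof -
    have u: "u \<in> H2star l" using that parity_H2star by blast
    have "ip l u u = 0 \<longleftrightarrow> H2star_inner l \<sigma> u u = 0"
      using H2star_null[OF u] H2star_embedding[OF u] L2.nonneg[OF H2star_L2[OF u]] by auto
    then show ?thesis using ip_self_zero_iff[OF H2star_L2[OF u]] by simp
  qed
  have dims: "finite {j. 1 / \<kappa> j = lam} \<and> has_dim l (eigenspace l \<sigma> (parity l s) p lam) (card {j. 1 / \<kappa> j = lam})" for lam
  proof
    let ?J = "{j. 1 / \<kappa> j = lam}"
    \<comment> \<open>The zero function satisfies the equation for every lam, which yields
      finiteness of the level set even when lam is not an eigenvalue.\<close>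
    have "H2star_inner l \<sigma> 0 v = lam * wform l p 0 v" if "v \<in> parity l s" for v
      using that by (simp add: M.zero_left)
    from eigenvector_expansion(1)[OF sp A.zero_in this] show fin: "finite ?J" .
    then obtain h where h: "bij_betw h {0..<card ?J} ?J" using ex_bij_betw_nat_finite by blast
    then have h': "bij_betw h {..<card ?J} ?J" by (simp add: atLeast0LessThan)
    show "has_dim l (eigenspace l \<sigma> (parity l s) p lam) (card ?J)"
      unfolding has_dim_def
    proof (intro exI[of _ "\<lambda>i. e (h i)"] conjI allI impI ballI)
      fix i assume "i < card ?J"
      then have "h i \<in> ?J" using h' by (auto simp: bij_betw_def)
      then show "e (h i) \<in> eigenspace l \<sigma> (parity l s) p lam"
        unfolding eigenspace using eV eigen \<kappa>[of "h i"] by (auto simp: field_simps)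
    next
      fix c :: "nat \<Rightarrow> real" and i
      assume c: "AE z in plate l. (\<Sum>i<card ?J. c i * e (h i) z) = 0" and i: "i < card ?J"
      define w where "w = (\<Sum>i<card ?J. c i *\<^sub>R e (h i))"
      have w: "w \<in> parity l s" unfolding w_def by (intro A.carrier eV)
      have "AE z in plate l. w z = 0" using c by (simp add: w_def sum_apply)
      then have "H2star_inner l \<sigma> w (e (h i)) = 0" using null_iff[OF w] A.null_left[OF w eV] by blast
      moreover have "H2star_inner l \<sigma> w (e (h i)) = (\<Sum>j<card ?J. c j * H2star_inner l \<sigma> (e (h j)) (e (h i)))"
        unfolding w_def by (subst A.sum_left) (auto intro: A.carrier eV simp: A.scale_left eV)
      moreover have "\<dots> = (\<Sum>j<card ?J. if j = i then c i else 0)"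
      proof (intro sum.cong refl)
        fix j assume "j \<in> {..<card ?J}"
        then have "h j = h i \<longleftrightarrow> j = i" using h' i by (auto simp: bij_betw_def inj_on_def)
        then show "c j * H2star_inner l \<sigma> (e (h j)) (e (h i)) = (if j = i then c i else 0)" by (simp add: orth)
      qed
      ultimately show "c i = 0" using i by simp
    next
      fix u assume "u \<in> eigenspace l \<sigma> (parity l s) p lam"
      then have u: "u \<in> parity l s" "\<And>v. v \<in> parity l s \<Longrightarrow> H2star_inner l \<sigma> u v = lam * wform l p u v"
        unfolding eigenspace by auto
      define w where "w = u - (\<Sum>j\<in>?J. H2star_inner l \<sigma> u (e j) *\<^sub>R e j)"
      have w: "w \<in> parity l s" unfolding w_def by (intro A.carrier eV u)
      have "H2star_inner l \<sigma> w w = 0" unfolding w_def by (rule eigenvector_expansion(2)[OF sp u])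
      then have "AE z in plate l. w z = 0" using null_iff[OF w] by blast
      moreover have "w z = u z - (\<Sum>i<card ?J. H2star_inner l \<sigma> u (e (h i)) * e (h i) z)" for z
        using sum.reindex_bij_betw[OF h', of "\<lambda>j. H2star_inner l \<sigma> u (e j) * e j z"]
        by (simp add: w_def sum_apply)
      ultimately have "AE z in plate l. u z = (\<Sum>i<card ?J. H2star_inner l \<sigma> u (e (h i)) * e (h i) z)" by simp
      then show "\<exists>c :: nat \<Rightarrow> real. AE z in plate l. u z = (\<Sum>i<card ?J. c i * e (h i) z)"
        by (intro exI[of _ "\<lambda>i. H2star_inner l \<sigma> u (e (h i))"])
    qed
  qed
  have inc: "incseq (\<lambda>j. 1 / \<kappa> j)"
    unfolding incseq_def using decseqD[OF dec] \<kappa> by (auto intro!: divide_left_mono)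
  show ?thesis
    unfolding eigenvalue_seq_def
  proof (rule the_equality)
    show "incseq (\<lambda>j. 1 / \<kappa> j) \<and> (\<forall>lam. finite {j. 1 / \<kappa> j = lam} \<and>
        has_dim l (eigenspace l \<sigma> (parity l s) p lam) (card {j. 1 / \<kappa> j = lam}))"
      using inc dims by blast
    fix t assume t: "incseq t \<and> (\<forall>lam. finite {j. t j = lam} \<and> has_dim l (eigenspace l \<sigma> (parity l s) p lam) (card {j. t j = lam}))"
    show "t = (\<lambda>j. 1 / \<kappa> j)"
      by (rule incseq_eq_if_level_sets_eq) (use t inc dims has_dim_unique in blast)+
  qed
qed

text \<open>Homogeneity turns closeness on the unit ball into a bound by d times the energy,
  functions of zero energy being null for both weights. The comparison of spectra is then applied in
  both directions.\<close>

lemma eigenvalue_seq_perturbation: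
  assumes s: "s = 1 \<or> s = - 1" and p: "p \<in> weights l \<alpha> \<beta>" and q: "q \<in> weights l \<alpha> \<beta>" and \<alpha>: "0 < \<alpha>" "0 < \<beta>"
    and close: "\<And>u. u \<in> H2star l \<Longrightarrow> H2star_inner l \<sigma> u u \<le> 1 \<Longrightarrow> \<bar>wform l p u u - wform l q u u\<bar> \<le> d"
  shows "eigenvalue_seq l \<sigma> (parity l s) p k > 0"
    and "\<bar>1 / eigenvalue_seq l \<sigma> (parity l s) p k - 1 / eigenvalue_seq l \<sigma> (parity l s) q k\<bar> \<le> d"
proof -
  interpret P: weighted_energy_space "parity l s" "H2star_inner l \<sigma>" "ip l" embed_const "wform l p" \<alpha> \<beta>
    by (rule weighted_energy_space_parity[OF s p \<alpha>])
  interpret Q: weighted_energy_space "parity l s" "H2star_inner l \<sigma>" "ip l" embed_const "wform l q" \<alpha> \<beta>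
    by (rule weighted_energy_space_parity[OF s q \<alpha>])
  obtain e \<kappa> where sp: "P.spectral (wform l p) e \<kappa>" using P.spectral_exists by blast
  obtain e' \<kappa>' where sq: "P.spectral (wform l q) e' \<kappa>'" using Q.spectral_exists by blast
  note ep = eigenvalue_seq_eq[OF s p \<alpha> sp] and eq = eigenvalue_seq_eq[OF s q \<alpha> sq]
  have pos: "\<kappa> k > 0" using sp by (simp add: P.spectral_def)
  then show "eigenvalue_seq l \<sigma> (parity l s) p k > 0" by (simp add: ep)
  have le: "\<bar>wform l p u u - wform l q u u\<bar> \<le> d * H2star_inner l \<sigma> u u" if u: "u \<in> parity l s" for u
  proof (cases "H2star_inner l \<sigma> u u = 0")
    case True
    then have "wform l p u u = 0" "wform l q u u = 0"
      using P.M_le[OF u] Q.M_le[OF u] P.M.nonneg[OF u] Q.M.nonneg[OF u] by auto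
    with True show ?thesis by simp
  next
    case False
    then have A: "H2star_inner l \<sigma> u u > 0" using P.A.nonneg[OF u] by simp
    let ?t = "1 / sqrt (H2star_inner l \<sigma> u u)"
    have "\<bar>wform l p (?t *\<^sub>R u) (?t *\<^sub>R u) - wform l q (?t *\<^sub>R u) (?t *\<^sub>R u)\<bar> \<le> d"
    proof (rule close)
      show "?t *\<^sub>R u \<in> H2star l" using P.A.scale_in[OF u] parity_H2star by blast
      show "H2star_inner l \<sigma> (?t *\<^sub>R u) (?t *\<^sub>R u) \<le> 1" using A u by (simp add: P.A.square_scale power_divide)
    qed
    then have "\<bar>wform l p u u / H2star_inner l \<sigma> u u - wform l q u u / H2star_inner l \<sigma> u u\<bar> \<le> d"
      using A u by (simp add: P.M.square_scale Q.M.square_scale power_divide)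
    then show ?thesis using A by (simp add: divide_le_eq abs_divide flip: diff_divide_distrib)
  qed
  have "\<kappa>' k \<le> \<kappa> k + d"
    by (rule P.spectral_comparison[OF sp sq Q.M.semi_inner_axioms]) (use le in \<open>force simp: abs_le_iff\<close>)
  moreover have "\<kappa> k \<le> \<kappa>' k + d"
    by (rule P.spectral_comparison[OF sq sp P.M.semi_inner_axioms]) (use le in \<open>force simp: abs_le_iff\<close>)
  ultimately show "\<bar>1 / eigenvalue_seq l \<sigma> (parity l s) p k - 1 / eigenvalue_seq l \<sigma> (parity l s) q k\<bar> \<le> d"
    by (simp add: ep eq abs_le_iff)
qed

text \<open>Weak compactness controls the quadratic functionals only at the countably many net
  points. On the unit ball these functionals are Lipschitz for the L2 distance with a constant
  common to all weights, so the convergence is uniform there, as the perturbation bound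
  demands.\<close>

lemma weights_subsequence:
  assumes p: "\<And>n. p n \<in> weights l \<alpha> \<beta>" and \<alpha>: "0 < \<alpha>" "0 < \<beta>"
  shows "\<exists>r q. strict_mono (r :: nat \<Rightarrow> nat) \<and> q \<in> weights l \<alpha> \<beta> \<and>
    (\<forall>d>0. \<exists>n0. \<forall>n\<ge>n0. \<forall>u\<in>H2star l. H2star_inner l \<sigma> u u \<le> 1 \<longrightarrow> \<bar>wform l (p (r n)) u u - wform l q u u\<bar> \<le> d)"
proof -
  let ?B = "{u \<in> H2star l. H2star_inner l \<sigma> u u \<le> 1}"
  have "\<forall>k::nat. \<exists>F. finite F \<and> F \<subseteq> ?B \<and> (\<forall>u\<in>?B. \<exists>y\<in>F. ip l (u - y) (u - y) < inverse (real (Suc k)))"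
    by (intro allI H2star_totally_bounded) auto
  from choice[OF this] obtain F where
    "\<forall>k. finite (F k) \<and> F k \<subseteq> ?B \<and> (\<forall>u\<in>?B. \<exists>y\<in>F k. ip l (u - y) (u - y) < inverse (real (Suc k)))" by blast
  then have F: "\<And>k. finite (F k)" "\<And>k. F k \<subseteq> ?B" "\<And>k u. u \<in> ?B \<Longrightarrow> \<exists>y\<in>F k. ip l (u - y) (u - y) < inverse (real (Suc k))"
    by blast+
  define D where "D = (\<Union>k. F k)"
  have D: "countable D" "D \<subseteq> L2 l" unfolding D_def using F(1,2) H2star_L2 by (auto intro: countable_finite)
  have ip_B: "ip l u u \<le> embed_const" if "u \<in> ?B" for u
  proof -
    have "ip l u u \<le> embed_const * H2star_inner l \<sigma> u u" using that by (intro H2star_embedding) auto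
    also have "\<dots> \<le> embed_const * 1" using that embed_const_nonneg by (intro mult_left_mono) auto
    finally show ?thesis by simp
  qed
  have ip_D: "ip l d d \<le> embed_const" if "d \<in> D" for d using that F(2) ip_B unfolding D_def by blast
  from weights_weakly_compact[where p = p and K = embed_const, OF p D ip_D] obtain r q where r: "strict_mono (r :: nat \<Rightarrow> nat)" and q: "q \<in> weights l \<alpha> \<beta>"
    and lim: "\<And>d. d \<in> D \<Longrightarrow> (\<lambda>n. wform l (p (r n)) d d) \<longlonglongrightarrow> wform l q d d"
    unfolding wform_def by blast
  \<comment> \<open>A difference of squares for the weighted form: one factor sqrt \<beta> comes
    from the distance of u and y, the other from the sizes of u and y.\<close>
  have lip: "\<bar>wform l w u u - wform l w y y\<bar> \<le> 2 * \<beta> * sqrt embed_const * sqrt h"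
    if w: "w \<in> weights l \<alpha> \<beta>" and uy: "u \<in> ?B" "y \<in> ?B" and h: "ip l (u - y) (u - y) < h" for w u y h
  proof -
    interpret W: semi_inner "L2 l" "wform l w" by (rule semi_inner_wform[OF w]) (use \<alpha> in simp)
    have L: "u \<in> L2 l" "y \<in> L2 l" "u - y \<in> L2 l" using uy H2star_L2 L2.diff_in by blast+
    have bound: "sqrt (wform l w v v) \<le> sqrt \<beta> * sqrt embed_const" if "v \<in> ?B" for v
    proof -
      have "wform l w v v \<le> \<beta> * ip l v v" using that by (intro wform_bounds[OF w] H2star_L2) auto
      also have "\<dots> \<le> \<beta> * embed_const" using ip_B[OF that] \<alpha> by (intro mult_left_mono) auto
      finally show ?thesis by (simp flip: real_sqrt_mult)
    qed
    have "wform l w (u - y) (u - y) \<le> \<beta> * ip l (u - y) (u - y)" by (rule wform_bounds(2)[OF w L(3)])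
    also have "\<dots> \<le> \<beta> * h" using h \<alpha> by (intro mult_left_mono) auto
    finally have diff: "sqrt (wform l w (u - y) (u - y)) \<le> sqrt \<beta> * sqrt h" by (simp flip: real_sqrt_mult)
    have "\<bar>wform l w u u - wform l w y y\<bar> \<le> sqrt (wform l w (u - y) (u - y)) * (sqrt (wform l w u u) + sqrt (wform l w y y))"
      by (rule W.abs_square_diff[OF L(1,2)])
    also have "\<dots> \<le> (sqrt \<beta> * sqrt h) * (sqrt \<beta> * sqrt embed_const + sqrt \<beta> * sqrt embed_const)"
      using L2.nonneg[OF L(3)] h \<alpha> W.nonneg[OF L(1)] W.nonneg[OF L(2)]
      by (intro mult_mono diff add_mono bound uy) auto
    also have "\<dots> = 2 * \<beta> * sqrt embed_const * sqrt h"
    proof -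
      have "(sqrt \<beta> * sqrt h) * (sqrt \<beta> * sqrt embed_const + sqrt \<beta> * sqrt embed_const) =
          2 * (sqrt \<beta> * sqrt \<beta>) * sqrt embed_const * sqrt h" by simp
      then show ?thesis using \<alpha> by simp
    qed
    finally show ?thesis .
  qed
  have "\<exists>n0. \<forall>n\<ge>n0. \<forall>u\<in>H2star l. H2star_inner l \<sigma> u u \<le> 1 \<longrightarrow> \<bar>wform l (p (r n)) u u - wform l q u u\<bar> \<le> d" if d: "d > 0" for d
  proof -
    \<comment> \<open>The summand 1 keeps the divisor positive. The net is then so fine that each of
      the two Lipschitz errors is at most d / 3, which leaves d / 3 for the error at the net
      point.\<close>
    define K where "K = 2 * \<beta> * sqrt embed_const + 1"
    have K: "K > 0" unfolding K_def using \<alpha> embed_const_nonneg by (simp add: add_nonneg_pos)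
    have "(d / (3 * K))\<^sup>2 > 0" using d K by simp
    then obtain k where k: "inverse (real (Suc k)) < (d / (3 * K))\<^sup>2" using reals_Archimedean by blast
    have "sqrt (inverse (real (Suc k))) \<le> sqrt ((d / (3 * K))\<^sup>2)" using k by (intro real_sqrt_le_mono) simp
    also have "\<dots> = d / (3 * K)" using d K by simp
    finally have sk: "sqrt (inverse (real (Suc k))) \<le> d / (3 * K)" .
    have "2 * \<beta> * sqrt embed_const * sqrt (inverse (real (Suc k))) \<le> K * (d / (3 * K))"
      using sk \<alpha> embed_const_nonneg by (intro mult_mono) (auto simp: K_def)
    then have small: "2 * \<beta> * sqrt embed_const * sqrt (inverse (real (Suc k))) \<le> d / 3" using K by simp
    have "\<forall>y\<in>F k. \<exists>n0. \<forall>n\<ge>n0. \<bar>wform l (p (r n)) y y - wform l q y y\<bar> < d / 3"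
    proof
      fix y assume "y \<in> F k"
      then have "y \<in> D" by (auto simp: D_def)
      from LIMSEQ_D[OF lim[OF this], of "d / 3"] d
      show "\<exists>n0. \<forall>n\<ge>n0. \<bar>wform l (p (r n)) y y - wform l q y y\<bar> < d / 3" by auto
    qed
    then obtain n0 where n0: "\<forall>y\<in>F k. \<forall>n\<ge>n0 y. \<bar>wform l (p (r n)) y y - wform l q y y\<bar> < d / 3"
      unfolding bchoice_iff by blast
    define N where "N = Max (insert 0 (n0 ` F k))"
    have N: "n0 y \<le> N" if "y \<in> F k" for y unfolding N_def using F(1) that by auto
    show ?thesis
    proof (intro exI[of _ N] allI impI ballI)
      fix n u assume n: "N \<le> n" and u: "u \<in> H2star l" "H2star_inner l \<sigma> u u \<le> 1"
      then have uB: "u \<in> ?B" by simp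
      obtain y where y: "y \<in> F k" "ip l (u - y) (u - y) < inverse (real (Suc k))" using F(3)[OF uB] by blast
      have yB: "y \<in> ?B" using y F(2) by blast
      have "\<bar>wform l (p (r n)) u u - wform l (p (r n)) y y\<bar> \<le> d / 3" "\<bar>wform l q u u - wform l q y y\<bar> \<le> d / 3"
        using lip[OF p uB yB y(2)] lip[OF q uB yB y(2)] small order_trans by blast+
      moreover have "\<bar>wform l (p (r n)) y y - wform l q y y\<bar> < d / 3" using n0 y(1) N[OF y(1)] n by auto
      ultimately show "\<bar>wform l (p (r n)) u u - wform l q u u\<bar> \<le> d" by linarith
    qed
  qed
  with r q show ?thesis by blast
qed

end

section \<open>Existence of an optimal weight\<close>

theorem theorem3p1:
  fixes l \<sigma> \<alpha> \<beta> s :: real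
  assumes "l > 0" and "0 < \<sigma>" and "\<sigma> < 1 / 2"
    and "0 < \<alpha>" and "\<alpha> < 1" and "1 < \<beta>"
    and "s > 0" and "tanh (sqrt 2 * s * l) = (\<sigma> / (2 - \<sigma>))\<^sup>2 * sqrt 2 * s * l"
    and "s \<notin> \<int>"
  shows "\<exists>q\<in>weights l \<alpha> \<beta>.
    ereal (nu l \<sigma> q 1 / mu l \<sigma> q (j0 l \<sigma>)) =
    (SUP p\<in>weights l \<alpha> \<beta>. ereal (nu l \<sigma> p 1 / mu l \<sigma> p (j0 l \<sigma>)))"
proof -
  interpret plate_energy l \<sigma> by unfold_locales (use assms in auto)
  have \<beta>: "0 < \<beta>" using assms by simp
  note \<alpha> = assms(4) \<beta>
  \<comment> \<open>The sequences are indexed from 0. The index is determined by the constant weight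
    1, so it stays fixed while the weight varies.\<close>
  define k where "k = j0 l \<sigma> - 1"
  define E where "E t p j = eigenvalue_seq l \<sigma> (parity l t) p j" for t p j
  define R where "R p = ereal (nu l \<sigma> p 1 / mu l \<sigma> p (j0 l \<sigma>))" for p
  \<comment> \<open>Written with reciprocals, which are the quantities controlled by the
    perturbation bound.\<close>
  have R: "R p = ereal ((1 / E 1 p k) / (1 / E (-1) p 0))" for p
    by (simp add: R_def nu_def mu_def H2even_parity H2odd_parity E_def k_def)
  have "(\<lambda>_. 1) \<in> weights l \<alpha> \<beta>"
    using assms measure_plate[OF l_pos] emeasure_lborel_Omega[OF l_pos]
    by (intro weightsI) (auto simp: measure_def)
  then have "R ` weights l \<alpha> \<beta> \<noteq> {}" by blast
  from Sup_countable_SUP[OF this] obtain f where f: "incseq f" "range f \<subseteq> R ` weights l \<alpha> \<beta>"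
    "Sup (R ` weights l \<alpha> \<beta>) = (SUP n. f n)" by blast
  then have "\<forall>n. \<exists>p. p \<in> weights l \<alpha> \<beta> \<and> f n = R p" by blast
  from choice[OF this] obtain p where p: "\<And>n. p n \<in> weights l \<alpha> \<beta>" "\<And>n. f n = R (p n)" by blast
  \<comment> \<open>In \<open>ereal\<close> the supremum is a limit of values even before it is
    known to be finite; finiteness follows from its being attained.\<close>
  have lim_f: "(\<lambda>n. R (p n)) \<longlonglongrightarrow> Sup (R ` weights l \<alpha> \<beta>)"

  proof -
    have "f = (\<lambda>n. R (p n))" using p(2) by (rule ext)
    with LIMSEQ_SUP[OF f(1)] f(3) show ?thesis by simp
  qed
  obtain r q where r: "strict_mono (r :: nat \<Rightarrow> nat)" and q: "q \<in> weights l \<alpha> \<beta>"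
    and conv: "\<forall>d>0. \<exists>n0. \<forall>n\<ge>n0. \<forall>u\<in>H2star l. H2star_inner l \<sigma> u u \<le> 1 \<longrightarrow> \<bar>wform l (p (r n)) u u - wform l q u u\<bar> \<le> d"
    using weights_subsequence[where p = p, OF p(1) \<alpha>] by blast
  have lim_E: "(\<lambda>n. 1 / E t (p (r n)) j) \<longlonglongrightarrow> 1 / E t q j" if t: "t = 1 \<or> t = -1" for t j
  proof (rule LIMSEQ_I)
    fix d :: real assume d: "d > 0"
    then obtain n0 where n0: "\<forall>n\<ge>n0. \<forall>u\<in>H2star l. H2star_inner l \<sigma> u u \<le> 1 \<longrightarrow> \<bar>wform l (p (r n)) u u - wform l q u u\<bar> \<le> d / 2"
      using conv[rule_format, of "d / 2"] by auto
    show "\<exists>n0. \<forall>n\<ge>n0. norm (1 / E t (p (r n)) j - 1 / E t q j) < d"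
    proof (intro exI[of _ n0] allI impI)
      fix n assume "n0 \<le> n"
      then have "\<bar>1 / E t (p (r n)) j - 1 / E t q j\<bar> \<le> d / 2"
        unfolding E_def using n0 by (intro eigenvalue_seq_perturbation(2)[OF t p(1) q \<alpha>]) blast
      with d show "norm (1 / E t (p (r n)) j - 1 / E t q j) < d" by simp
    qed
  qed
  \<comment> \<open>The perturbation lemma with equal weights and d = 0 supplies positivity, so the
    denominator has a nonzero limit.\<close>
  have "E (-1) q 0 > 0"
    unfolding E_def by (rule eigenvalue_seq_perturbation(1)[OF _ q q \<alpha>, where d = 0]) auto
  then have "(\<lambda>n. (1 / E 1 (p (r n)) k) / (1 / E (-1) (p (r n)) 0)) \<longlonglongrightarrow> (1 / E 1 q k) / (1 / E (-1) q 0)"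
    by (intro tendsto_divide lim_E) auto
  then have "(\<lambda>n. R (p (r n))) \<longlonglongrightarrow> R q" unfolding R by (rule tendsto_ereal)
  moreover have "(\<lambda>n. R (p (r n))) \<longlonglongrightarrow> Sup (R ` weights l \<alpha> \<beta>)"
    using LIMSEQ_subseq_LIMSEQ[OF lim_f r] by (simp add: o_def)
  ultimately have "R q = Sup (R ` weights l \<alpha> \<beta>)" by (rule LIMSEQ_unique)
  with q show ?thesis unfolding R_def by blast
qed

end
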